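(* Let $n\ge2$, $\gamma>1$, $\Omega\subset\mathbb{R}^n$ open. Let $(\rho^\varepsilon,u^\varepsilon,p^\varepsilon)$, $\rho^\varepsilon,p^\varepsilon>0$, be a sequence of functions on $\Omega$ with $q^\varepsilon=|u^\varepsilon|$, $c^\varepsilon=\sqrt{\gamma p^\varepsilon/\rho^\varepsilon}$, $M^\varepsilon=q^\varepsilon/c^\varepsilon$, $B^\varepsilon=\frac{(q^\varepsilon)^2}{2}+\frac{\gamma p^\varepsilon}{(\gamma-1)\rho^\varepsilon}$, $S^\varepsilon=\frac{\gamma p^\varepsilon}{(\gamma-1)(\rho^\varepsilon)^\gamma}$, $E^\varepsilon=\frac{(q^\varepsilon)^2}{2}+\frac{p^\varepsilon}{(\gamma-1)\rho^\varepsilon}$, and $$e_1(\varepsilon)=\operatorname{div}(\rho^\varepsilon u^\varepsilon),\quad e_2(\varepsilon)=\operatorname{div}(\rho^\varepsilon u^\varepsilon\otimes u^\varepsilon+p^\varepsilon I),\quad e_3(\varepsilon)=\operatorname{div}(\rho^\varepsilon u^\varepsilon E^\varepsilon+u^\varepsilon p^\varepsilon).$$ Assume: (A.1) $M^\varepsilon\le1$ a.e. in $\Omega$; (A.2) $S^\varepsilon,B^\varepsilon$ are uniformly bounded, for every compact $K\subset\Omega$ there is $c(K)>0$ independent of $\varepsilon$ with $\inf_K S^\varepsilon\ge c(K)$, and $(S^\varepsilon,B^\varepsilon)\to(\overline S,\overline B)$ a.e. in $\Omega$; (A.3) $\operatorname{curl}u^\varepsilon$ and $e_1(\varepsilon)$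 lie in a compact subset of $W^{-1,p}_{loc}(\Omega)$ for some $1<p\le2$. Assume moreover that $e_j(\varepsilon)\to0$ in the sense of distributions as $\varepsilon\to0$, $j=1,2,3$. Then a subsequence converges a.e. in $\Omega$ as $\varepsilon\to0$ to a weak solution $(\rho,u,p)$ of the steady full Euler equations $$\operatorname{div}(\rho u)=0,\quad \operatorname{div}(\rho u\otimes u+pI)=0,\quad \operatorname{div}(\rho uE+up)=0\quad (E=\tfrac{|u|^2}{2}+\tfrac{p}{(\gamma-1)\rho}),$$ holding in the sense of distributions in $\Omega$, and $M(x)=|u(x)|/\sqrt{\gamma p(x)/\rho(x)}\le1$ for a.e. $x\in\Omega$. *)

theory Defs
  imports "HOL-Analysis.Analysis"
begin

definition pd :: "'n::finite \<Rightarrow> (real^'n \<Rightarrow> real) \<Rightarrow> real^'n \<Rightarrow> real" where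
  "pd i f x = frechet_derivative f (at x) (axis i 1)"

definition grad :: "(real^'n::finite \<Rightarrow> real) \<Rightarrow> real^'n \<Rightarrow> real^'n" where
  "grad f x = (\<chi> i. pd i f x)"

fun Ck :: "nat \<Rightarrow> (real^'n::finite \<Rightarrow> real) \<Rightarrow> bool" where
  "Ck 0 f = continuous_on UNIV f"
| "Ck (Suc k) f = (f differentiable_on UNIV \<and> (\<forall>i. Ck k (pd i f)))"

definition smooth :: "(real^'n::finite \<Rightarrow> real) \<Rightarrow> bool" where
  "smooth f \<longleftrightarrow> (\<forall>k. Ck k f)"

definition test_fun :: "(real^'n::finite) set \<Rightarrow> (real^'n \<Rightarrow> real) \<Rightarrow> bool" where
  "test_fun U \<phi> \<longleftrightarrow> smooth \<phi> \<and> compact (closure {x. \<phi> x \<noteq> 0})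
                        \<and> closure {x. \<phi> x \<noteq> 0} \<subseteq> U"

text \<open>A distribution is represented by its action on test functions.\<close>
type_synonym 'n distr = "(real^'n \<Rightarrow> real) \<Rightarrow> real"

definition div_distr :: "(real^'n::finite \<Rightarrow> real^'n) \<Rightarrow> 'n distr" where
  "div_distr F \<phi> = - (\<integral>x. F x \<bullet> grad \<phi> x \<partial>lebesgue)"

text \<open>Component (i,j) of curl u = (d_i u_j - d_j u_i), as a distribution.\<close>
definition curl_distr :: "(real^'n::finite \<Rightarrow> real^'n) \<Rightarrow> 'n \<Rightarrow> 'n \<Rightarrow> 'n distr" where
  "curl_distr u i j \<phi> = (\<integral>x. u x $ i * pd j \<phi> x - u x $ j * pd i \<phi> x \<partial>lebesgue)"

definition locally_integrable :: "(real^'n::finite) set \<Rightarrow> (real^'n \<Rightarrow> 'b::{banach,second_countable_topology}) \<Rightarrow> bool" where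
  "locally_integrable \<Omega> F \<longleftrightarrow> (\<forall>K. compact K \<and> K \<subseteq> \<Omega> \<longrightarrow> set_integrable lebesgue K F)"

definition weak_div_free :: "(real^'n::finite) set \<Rightarrow> (real^'n \<Rightarrow> real^'n) \<Rightarrow> bool" where
  "weak_div_free \<Omega> F \<longleftrightarrow> locally_integrable \<Omega> F \<and> (\<forall>\<phi>. test_fun \<Omega> \<phi> \<longrightarrow> div_distr F \<phi> = 0)"

definition W1_norm :: "real \<Rightarrow> (real^'n::finite \<Rightarrow> real) \<Rightarrow> real" where
  "W1_norm q \<phi> = ((\<integral>x. \<bar>\<phi> x\<bar> powr q \<partial>lebesgue) + (\<integral>x. norm (grad \<phi> x) powr q \<partial>lebesgue)) powr (1/q)"

text \<open>W^{-1,s}(U) norm of a distribution T: the dual norm with respect to W^{1,s'}_0(U),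
  s' = s/(s-1), computed on the dense subspace C_c^infinity(U) (possibly infinite).\<close>
definition Wneg_norm :: "real \<Rightarrow> (real^'n::finite) set \<Rightarrow> 'n distr \<Rightarrow> ereal" where
  "Wneg_norm s U T = (SUP \<phi>\<in>{\<phi>. test_fun U \<phi> \<and> W1_norm (s / (s - 1)) \<phi> \<le> 1}. ereal \<bar>T \<phi>\<bar>)"

definition cc_open :: "(real^'n::finite) set \<Rightarrow> (real^'n) set \<Rightarrow> bool" where
  "cc_open U \<Omega> \<longleftrightarrow> open U \<and> compact (closure U) \<and> closure U \<subseteq> \<Omega>"

text \<open>The sequence T lies in W^{-1,s}_loc(Omega) and in a compact subset of it
  (the Frechet space W^{-1,s}_loc is metrizable and complete, so relative compactness of
  a sequence means: every subsequence has a further subsequence which is Cauchy in every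
  local seminorm).\<close>
definition Wneg_loc_precompact :: "real \<Rightarrow> (real^'n::finite) set \<Rightarrow> (nat \<Rightarrow> 'n distr) \<Rightarrow> bool" where
  "Wneg_loc_precompact s \<Omega> T \<longleftrightarrow>
     (\<forall>k U. cc_open U \<Omega> \<longrightarrow> Wneg_norm s U (T k) < \<infinity>) \<and>
     (\<forall>r::nat\<Rightarrow>nat. strict_mono r \<longrightarrow> (\<exists>r'::nat\<Rightarrow>nat. strict_mono r' \<and>
        (\<forall>U. cc_open U \<Omega> \<longrightarrow> (\<forall>e>0. \<exists>N. \<forall>m\<ge>N. \<forall>k\<ge>N.
            Wneg_norm s U (\<lambda>\<phi>. T (r (r' m)) \<phi> - T (r (r' k)) \<phi>) < ereal e))))"

definition sound_speed :: "real \<Rightarrow> real \<Rightarrow> real \<Rightarrow> real" where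
  "sound_speed \<gamma> rho P = sqrt (\<gamma> * P / rho)"

definition mach :: "real \<Rightarrow> real \<Rightarrow> real^'n::finite \<Rightarrow> real \<Rightarrow> real" where
  "mach \<gamma> rho u P = norm u / sound_speed \<gamma> rho P"

definition bernoulli :: "real \<Rightarrow> real \<Rightarrow> real^'n::finite \<Rightarrow> real \<Rightarrow> real" where
  "bernoulli \<gamma> rho u P = (norm u)\<^sup>2 / 2 + \<gamma> * P / ((\<gamma> - 1) * rho)"

definition entropy :: "real \<Rightarrow> real \<Rightarrow> real \<Rightarrow> real" where
  "entropy \<gamma> rho P = \<gamma> * P / ((\<gamma> - 1) * rho powr \<gamma>)"

definition energy :: "real \<Rightarrow> real \<Rightarrow> real^'n::finite \<Rightarrow> real \<Rightarrow> real" where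
  "energy \<gamma> rho u P = (norm u)\<^sup>2 / 2 + P / ((\<gamma> - 1) * rho)"

text \<open>Fluxes: mass flux rho u; j-th row of the momentum flux rho u (x) u + P I; energy flux.\<close>
definition mass_flux :: "real \<Rightarrow> real^'n::finite \<Rightarrow> real^'n" where
  "mass_flux rho u = rho *\<^sub>R u"

definition mom_flux :: "'n::finite \<Rightarrow> real \<Rightarrow> real^'n \<Rightarrow> real \<Rightarrow> real^'n" where
  "mom_flux j rho u P = (rho * u $ j) *\<^sub>R u + P *\<^sub>R axis j 1"

definition energy_flux :: "real \<Rightarrow> real \<Rightarrow> real^'n::finite \<Rightarrow> real \<Rightarrow> real^'n" where
  "energy_flux \<gamma> rho u P = (rho * energy \<gamma> rho u P) *\<^sub>R u + P *\<^sub>R u"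

definition weak_full_euler :: "real \<Rightarrow> (real^'n::finite) set \<Rightarrow> (real^'n \<Rightarrow> real) \<Rightarrow> (real^'n \<Rightarrow> real^'n) \<Rightarrow> (real^'n \<Rightarrow> real) \<Rightarrow> bool" where
  "weak_full_euler \<gamma> \<Omega> rho u P \<longleftrightarrow>
     weak_div_free \<Omega> (\<lambda>x. mass_flux (rho x) (u x)) \<and>
     (\<forall>j. weak_div_free \<Omega> (\<lambda>x. mom_flux j (rho x) (u x) (P x))) \<and>
     weak_div_free \<Omega> (\<lambda>x. energy_flux \<gamma> (rho x) (u x) (P x))"

end

theory Submission
  imports Defs "HOL-Library.Diagonal_Subsequence"
begin

text \<open>
  The Bernoulli function and the entropy determine the density as a function of the velocity, and
  the mass flux \<open>a \<mapsto> dens \<gamma> b \<sigma> a *\<^sub>R a\<close> is strictly monotone on subsonic velocities \<open>a\<close>. Since \<open>b\<close> and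
  \<open>\<sigma>\<close> converge almost everywhere, the product of \<open>u\<^sub>m - u\<^sub>k\<close> with the difference of the mass fluxes is
  nonnegative up to a vanishing error, while the div-curl lemma, applied to these differences, sends its
  local integrals to 0. So the velocities are Cauchy in \<open>L\<^sup>1\<close> locally and a subsequence
  converges almost everywhere; density, pressure and all fluxes follow by continuity. Comparing two
  members of the sequence avoids both weak limits and Young measures.

  The div-curl lemma is proved by writing the difference of two mollifications of a field, at scales
  \<open>\<eta>\<close> and \<open>T\<close>, as the Laplacian of its convolution with a truncated Newtonian kernel, which
  expresses the pairing through the curl of one field and the divergence of the other, tested against
  functions that have only bounded energy. As the norm of \<open>W^{-1,s}\<close> with \<open>s < 2\<close> does not control
  such pairings, these functions are replaced by Lipschitz truncations, with an error estimated
  through the maximal function of the squared gradient.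
\<close>

section \<open>Smooth functions and test functions\<close>

text \<open>The pairings involve the Hessian of a potential. For bounded data it is estimated only
  in \<open>L^2\<close>, which integration by parts alone provides, while \<open>W^{-1,s}\<close>
  with s < 2 asks for test functions with gradients in \<open>L^{s'}\<close>, s' > 2. This gap is
  the obstacle. Classically one interpolates to reach \<open>W^{-1,2}\<close>; here the boundedness
  of the fields enters directly, as a factor in front of the small set on which truncation changes
  the test function.

  The condition M \<le> 1 is exactly what monotonicity needs: at fixed b and \<sigma> the mass flux
  has derivative \<rho> (1 - M^2) in the speed. Between two admissible speeds this can vanish only
  at an endpoint, so the closed condition still gives strict monotonicity, and being closed it also
  survives the limit. The limit may contain vacuum; the formulas used there are therefore arranged
  to be free of quotients by the density.\<close>

lemma pd_eqI:
  assumes "(f has_derivative f') (at x)"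
  shows "pd i f x = f' (axis i 1)"
  using frechet_derivative_at[OF assms] by (simp add: pd_def)

lemma has_derivative_grad:
  fixes f :: "real^'n::finite \<Rightarrow> real"
  assumes "f differentiable at x"
  shows "(f has_derivative (\<lambda>h. grad f x \<bullet> h)) (at x)"
proof -
  let ?D = "frechet_derivative f (at x)"
  have D: "(f has_derivative ?D) (at x)"
    using assms by (simp add: frechet_derivative_works)
  then have lin: "linear ?D"
    by (rule has_derivative_linear)
  have "?D h = grad f x \<bullet> h" for h
  proof -
    have "?D h = ?D (\<Sum>i\<in>UNIV. h $ i *\<^sub>R axis i 1)"
      by (simp add: basis_expansion scalar_mult_eq_scaleR [symmetric])
    also have "\<dots> = (\<Sum>i\<in>UNIV. h $ i * pd i f x)"
      by (simp add: linear_sum[OF lin] linear_cmul[OF lin] pd_def)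
    finally show ?thesis
      by (simp add: grad_def inner_vec_def mult.commute)
  qed
  then have "?D = (\<lambda>h. grad f x \<bullet> h)" by auto
  with D show ?thesis by simp
qed

lemma grad_nth [simp]: "grad f x $ i = pd i f x"
  by (simp add: grad_def)

lemma differentiable_on_UNIV: "f differentiable_on UNIV \<longleftrightarrow> (\<forall>x. f differentiable at x)"
  by (simp add: differentiable_on_def)

lemma pd_const [simp]: "pd i (\<lambda>x. c) x = 0"
  by (subst pd_eqI[where f'="\<lambda>_. 0"]) auto

lemma pd_nth: "pd i (\<lambda>x. x $ j) x = (if i = j then 1 else 0)"
proof -
  have "((\<lambda>x. x $ j) has_derivative (\<lambda>h. h $ j)) (at x)"
    by (intro bounded_linear_imp_has_derivative bounded_linear_vec_nth)
  then have "pd i (\<lambda>x. x $ j) x = axis i 1 $ j" by (rule pd_eqI)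
  then show ?thesis by (simp add: axis_def)
qed

lemma pd_add:
  assumes "f differentiable at x" "g differentiable at x"
  shows "pd i (\<lambda>x. f x + g x) x = pd i f x + pd i g x"
  by (subst pd_eqI[OF has_derivative_add[OF has_derivative_grad has_derivative_grad]])
     (auto simp: assms inner_axis)

lemma pd_mult:
  fixes f g :: "real^'n::finite \<Rightarrow> real"
  assumes "f differentiable at x" "g differentiable at x"
  shows "pd i (\<lambda>x. f x * g x) x = f x * pd i g x + pd i f x * g x"
  by (subst pd_eqI[OF has_derivative_mult[OF has_derivative_grad has_derivative_grad]])
     (auto simp: assms inner_axis)

lemma pd_affine:
  fixes f :: "real^'n::finite \<Rightarrow> real"
  assumes "f differentiable at (c *\<^sub>R x + y)"
  shows "pd i (\<lambda>x. f (c *\<^sub>R x + y)) x = c * pd i f (c *\<^sub>R x + y)"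
proof -
  have "((\<lambda>x. f (c *\<^sub>R x + y)) has_derivative (\<lambda>h. grad f (c *\<^sub>R x + y) \<bullet> (c *\<^sub>R h))) (at x)"
    by (rule has_derivative_compose[where g=f and f="\<lambda>x. c *\<^sub>R x + y", OF _ has_derivative_grad[OF assms]])
       (auto intro!: derivative_eq_intros)
  then show ?thesis by (simp add: pd_eqI inner_axis)
qed

lemma Ck_continuous: "Ck k f \<Longrightarrow> continuous_on UNIV f"
  by (cases k) (auto intro: differentiable_imp_continuous_on)

lemma Ck_Suc_D: "Ck (Suc k) f \<Longrightarrow> Ck k f"
proof (induction k arbitrary: f)
  case 0
  then show ?case by (simp add: differentiable_imp_continuous_on)
next
  case (Suc k)
  then show ?case by (metis Ck.simps(2))
qed

lemma Ck_const [simp]: "Ck k (\<lambda>x. c)"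
proof (induction k arbitrary: c)
  case (Suc k)
  have "pd i (\<lambda>x. c) = (\<lambda>x. 0)" for i :: 'a by auto
  with Suc show ?case by simp
qed auto

lemma Ck_nth [simp]: "Ck k (\<lambda>x. x $ j)"
proof (cases k)
  case 0
  then show ?thesis by (simp add: continuous_on_component)
next
  case (Suc l)
  have "(\<lambda>x. x $ j) differentiable_on UNIV"
    by (simp add: bounded_linear_imp_differentiable_on bounded_linear_vec_nth)
  moreover have "pd i (\<lambda>x. x $ j) = (\<lambda>x. if i = j then 1 else 0)" for i
    by (auto simp: pd_nth)
  ultimately show ?thesis using Suc by simp
qed

lemma Ck_add: "Ck k f \<Longrightarrow> Ck k g \<Longrightarrow> Ck k (\<lambda>x. f x + g x)"
proof (induction k arbitrary: f g)
  case 0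
  then show ?case by (simp add: continuous_on_add)
next
  case (Suc k)
  then have "pd i (\<lambda>x. f x + g x) = (\<lambda>x. pd i f x + pd i g x)" for i
    by (auto simp: pd_add differentiable_on_UNIV)
  with Suc show ?case by (simp add: differentiable_on_UNIV)
qed

lemma Ck_mult: "Ck k f \<Longrightarrow> Ck k g \<Longrightarrow> Ck k (\<lambda>x. f x * g x)"
proof (induction k arbitrary: f g)
  case 0
  then show ?case by (simp add: continuous_on_mult)
next
  case (Suc k)
  then have *: "pd i (\<lambda>x. f x * g x) = (\<lambda>x. f x * pd i g x + pd i f x * g x)" for i
    by (auto simp: pd_mult differentiable_on_UNIV)
  have "Ck k f" "Ck k g" using Suc.prems Ck_Suc_D by blast+
  with Suc show ?case by (simp add: differentiable_on_UNIV * Ck_add)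
qed

lemma smoothI: "(\<And>k. Ck k f) \<Longrightarrow> smooth f"
  by (simp add: smooth_def)

lemma smooth_differentiable: "smooth f \<Longrightarrow> f differentiable at x"
  using Ck.simps(2)[of 0 f] by (auto simp: smooth_def differentiable_on_UNIV simp del: Ck.simps)

lemma smooth_pd [intro]: "smooth f \<Longrightarrow> smooth (pd i f)"
  unfolding smooth_def by (metis Ck.simps(2))

lemma smooth_continuous: "smooth f \<Longrightarrow> continuous_on S f"
  using Ck_continuous continuous_on_subset unfolding smooth_def by blast

lemma smooth_const [simp, intro]: "smooth (\<lambda>x. c)"
  by (simp add: smooth_def)

lemma smooth_nth [simp, intro]: "smooth (\<lambda>x. x $ i)"
  by (simp add: smooth_def)

lemma smooth_add [intro]: "smooth f \<Longrightarrow> smooth g \<Longrightarrow> smooth (\<lambda>x. f x + g x)"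
  by (simp add: smooth_def Ck_add)

lemma smooth_mult [intro]: "smooth f \<Longrightarrow> smooth g \<Longrightarrow> smooth (\<lambda>x. f x * g x)"
  by (simp add: smooth_def Ck_mult)

lemma smooth_sum [intro]: "(\<And>i. i \<in> I \<Longrightarrow> smooth (f i)) \<Longrightarrow> smooth (\<lambda>x. \<Sum>i\<in>I. f i x)"
  by (induction I rule: infinite_finite_induct) auto

lemma smooth_minus [intro]: "smooth f \<Longrightarrow> smooth (\<lambda>x. - f x)"
  using smooth_mult[of "\<lambda>x. -1" f] by simp

lemma smooth_diff [intro]: "smooth f \<Longrightarrow> smooth g \<Longrightarrow> smooth (\<lambda>x. f x - g x)"
  using smooth_add[of f "\<lambda>x. - g x"] smooth_minus[of g] by simp

lemma pd_sum:
  assumes "finite I" "\<And>j. j \<in> I \<Longrightarrow> smooth (f j)"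
  shows "pd i (\<lambda>x. \<Sum>j\<in>I. f j x) x = (\<Sum>j\<in>I. pd i (f j) x)"
  using assms
proof (induction I rule: finite_induct)
  case (insert j I)
  then have "smooth (f j)" "smooth (\<lambda>x. \<Sum>j\<in>I. f j x)" by auto
  with insert show ?case by (simp add: pd_add smooth_differentiable)
qed auto

lemma pd_cmult: "smooth f \<Longrightarrow> pd i (\<lambda>x. c * f x) x = c * pd i f x"
  by (subst pd_mult) (auto simp: smooth_differentiable)

lemma pd_minus: "smooth f \<Longrightarrow> pd i (\<lambda>x. - f x) x = - pd i f x"
  using pd_cmult[of f i "-1" x] by simp

lemma pd_diff: "smooth f \<Longrightarrow> smooth g \<Longrightarrow> pd i (\<lambda>x. f x - g x) x = pd i f x - pd i g x"
  using pd_add[of f x "\<lambda>x. - g x" i] smooth_minus[of g]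
  by (simp add: smooth_differentiable pd_minus)

lemma continuous_on_grad: "smooth f \<Longrightarrow> continuous_on S (grad f)"
  unfolding grad_def by (intro continuous_on_vec_lambda smooth_continuous smooth_pd)

lemma smooth_affine [intro]:
  fixes f :: "real^'n::finite \<Rightarrow> real"
  assumes "smooth f"
  shows "smooth (\<lambda>x. f (c *\<^sub>R x + y))"
proof (rule smoothI)
  fix k
  show "Ck k (\<lambda>x. f (c *\<^sub>R x + y))" using assms
  proof (induction k arbitrary: f)
    case 0
    then show ?case
      by (auto intro!: continuous_on_compose2[OF smooth_continuous[of f UNIV]] continuous_intros)
  next
    case (Suc k)
    have "pd i (\<lambda>x. f (c *\<^sub>R x + y)) = (\<lambda>x. c * pd i f (c *\<^sub>R x + y))" for i
      using Suc.prems by (auto simp: pd_affine smooth_differentiable)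
    moreover have "(\<lambda>x. f (c *\<^sub>R x + y)) differentiable at x" for x
      using Suc.prems
      by (intro differentiable_compose[where f=f and g="\<lambda>x. c *\<^sub>R x + y"] smooth_differentiable
          differentiable_add differentiable_scaleR) (auto intro: derivative_intros)
    ultimately show ?case
      using Suc.IH[OF smooth_pd[OF Suc.prems]] by (auto simp: differentiable_on_UNIV intro!: Ck_mult)
  qed
qed

lemma pd_zero_outside:
  assumes "closed S" "\<And>x. x \<notin> S \<Longrightarrow> f x = 0" "x \<notin> S"
  shows "pd i f x = 0"
proof -
  have "(f has_derivative (\<lambda>h. 0)) (at x)"
    by (rule has_derivative_transform_within_open[where f="\<lambda>_. 0" and s="- S"]) (use assms in auto)
  then show ?thesis by (simp add: pd_eqI)
qed

lemma grad_zero_outside: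
  assumes "closed S" "\<And>x. x \<notin> S \<Longrightarrow> f x = 0" "x \<notin> S"
  shows "grad f x = 0"
  by (simp add: vec_eq_iff pd_zero_outside[OF assms])

section \<open>Test functions and integrability from compact support\<close>

lemma test_funI:
  assumes "smooth f" "compact S" "S \<subseteq> U" "\<And>x. x \<notin> S \<Longrightarrow> f x = 0"
  shows "test_fun U f"
proof -
  have "{x. f x \<noteq> 0} \<subseteq> S" using assms by auto
  then have "closure {x. f x \<noteq> 0} \<subseteq> S"
    using assms(2) by (simp add: closure_minimal compact_imp_closed)
  moreover have "compact (closure {x. f x \<noteq> 0})"
    using bounded_subset[OF compact_imp_bounded[OF assms(2)] \<open>{x. f x \<noteq> 0} \<subseteq> S\<close>] by (simp add: compact_closure)
  ultimately show ?thesis using assms by (auto simp: test_fun_def)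
qed

lemma test_funE:
  assumes "test_fun U f"
  obtains S where "smooth f" "compact S" "S \<subseteq> U" "\<And>x. x \<notin> S \<Longrightarrow> f x = 0"
proof (rule that[of "closure {x. f x \<noteq> 0}"])
  show "f x = 0" if "x \<notin> closure {x. f x \<noteq> 0}" for x
    using that closure_subset[of "{x. f x \<noteq> 0}"] by auto
qed (use assms in \<open>auto simp: test_fun_def\<close>)

lemma bounded_of_compact_support:
  fixes f :: "'a::euclidean_space \<Rightarrow> 'b::real_normed_vector"
  assumes "continuous_on UNIV f" "compact S" "\<And>x. x \<notin> S \<Longrightarrow> f x = 0"
  obtains b where "b > 0" "\<And>x. norm (f x) \<le> b"
proof -
  have "compact (f ` S)"
    using assms by (intro compact_continuous_image) (auto intro: continuous_on_subset)
  then obtain b where "\<And>x. x \<in> S \<Longrightarrow> norm (f x) \<le> b"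
    by (metis compact_imp_bounded bounded_iff imageI)
  then have "norm (f x) \<le> max b 1" for x
    by (cases "x \<in> S") (use assms in fastforce)+
  then show ?thesis using that[of "max b 1"] by auto
qed

lemma integrable_compact_support:
  fixes f :: "'a::euclidean_space \<Rightarrow> 'b::{banach,second_countable_topology}"
  assumes "f \<in> borel_measurable borel" "compact S" "\<And>x. x \<notin> S \<Longrightarrow> f x = 0" "\<And>x. norm (f x) \<le> b"
  shows "integrable lborel f"
proof (rule Bochner_Integration.integrable_bound)
  show "integrable lborel (\<lambda>x. indicat_real S x * b)"
    using assms(2) borel_compact[OF assms(2)] emeasure_compact_finite[OF assms(2)]
    by (intro integrable_mult_left integrable_real_indicator) auto
  have "norm (f x) \<le> norm (indicat_real S x * b)" for x
    using assms(3)[of x] assms(4)[of x] by (cases "x \<in> S") auto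
  then show "AE x in lborel. norm (f x) \<le> norm (indicat_real S x * b)" by simp
qed (use assms in auto)

lemma integrable_continuous_compact_support:
  fixes f :: "'a::euclidean_space \<Rightarrow> 'b::{banach,second_countable_topology}"
  assumes "continuous_on UNIV f" "compact S" "\<And>x. x \<notin> S \<Longrightarrow> f x = 0"
  shows "integrable lborel f"
proof -
  obtain b where "\<And>x. norm (f x) \<le> b"
    using bounded_of_compact_support[OF assms] by metis
  then show ?thesis
    using assms by (intro integrable_compact_support[of f S b] borel_measurable_continuous_onI) auto
qed

text \<open>A non-integrable function has integral 0, so a pointwise majorant suffices and
  integrability of \<open>f\<close> does not have to be shown for an estimate.\<close>

lemma norm_integral_le:
  fixes f :: "'a \<Rightarrow> 'b::{banach,second_countable_topology}"
  assumes "integrable M g" "\<And>x. x \<in> space M \<Longrightarrow> norm (f x) \<le> g x"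
  shows "norm (\<integral>x. f x \<partial>M) \<le> (\<integral>x. g x \<partial>M)"
proof (cases "integrable M f")
  case True
  then show ?thesis
    by (intro order_trans[OF integral_norm_bound integral_mono[OF integrable_norm[OF True]]] assms)
next
  case False
  have "0 \<le> (\<integral>x. g x \<partial>M)"
    using assms(2) norm_ge_zero order_trans by (intro Bochner_Integration.integral_nonneg) blast
  with False show ?thesis by (simp add: not_integrable_integral_eq)
qed

section \<open>Mean value and Taylor estimates\<close>

lemma smooth_mvt:
  fixes f :: "real^'n::finite \<Rightarrow> real"
  assumes "smooth f"
  shows "\<exists>t\<in>{0<..<1}. f (x + h) - f x = grad f (x + t *\<^sub>R h) \<bullet> h"
proof -
  have "\<exists>z>0. z < 1 \<and> f (x + 1 *\<^sub>R h) - f (x + 0 *\<^sub>R h) = (1 - 0) * (grad f (x + z *\<^sub>R h) \<bullet> h)"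
  proof (rule MVT2)
    fix t :: real
    have "((\<lambda>t. f (x + t *\<^sub>R h)) has_derivative (\<lambda>s. grad f (x + t *\<^sub>R h) \<bullet> (s *\<^sub>R h))) (at t)"
      by (rule has_derivative_compose[where g=f and f="\<lambda>t. x + t *\<^sub>R h", OF _ has_derivative_grad[OF smooth_differentiable[OF assms]]])
         (auto intro!: derivative_eq_intros)
    then show "DERIV (\<lambda>t. f (x + t *\<^sub>R h)) t :> grad f (x + t *\<^sub>R h) \<bullet> h"
      by (simp add: has_field_derivative_def mult.commute[of _ "grad f _ \<bullet> h"])
  qed simp
  then show ?thesis by auto
qed

lemma smooth_lipschitz:
  fixes f :: "real^'n::finite \<Rightarrow> real"
  assumes "smooth f" "\<And>x. norm (grad f x) \<le> L"
  shows "\<bar>f x - f y\<bar> \<le> L * norm (x - y)"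
proof -
  obtain t where "f (y + (x - y)) - f y = grad f (y + t *\<^sub>R (x - y)) \<bullet> (x - y)"
    using smooth_mvt[OF assms(1)] by blast
  then have "\<bar>f x - f y\<bar> \<le> norm (grad f (y + t *\<^sub>R (x - y))) * norm (x - y)"
    using Cauchy_Schwarz_ineq2 by auto
  also have "\<dots> \<le> L * norm (x - y)"
    by (intro mult_right_mono assms) auto
  finally show ?thesis .
qed

lemma norm_le_vec_bound:
  fixes x :: "real^'n::finite"
  assumes "\<And>i. \<bar>x $ i\<bar> \<le> b"
  shows "norm x \<le> real CARD('n) * b"
proof -
  have "norm x \<le> (\<Sum>i\<in>UNIV. \<bar>x $ i\<bar>)"
    using norm_le_l1_cart by blast
  also have "\<dots> \<le> (\<Sum>i\<in>(UNIV::'n set). b)"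
    by (intro sum_mono assms)
  finally show ?thesis by simp
qed

text \<open>Compact support makes the remainder quadratic with one constant for all base points.
  This uniformity lets a derivative pass under an integral by a direct estimate.\<close>

lemma smooth_taylor2:
  fixes f :: "real^'n::finite \<Rightarrow> real"
  assumes f: "smooth f" and S: "compact S" "\<And>x. x \<notin> S \<Longrightarrow> f x = 0"
  obtains L where "L \<ge> 0" "\<And>x h. \<bar>f (x + h) - f x - grad f x \<bullet> h\<bar> \<le> L * (norm h)\<^sup>2"
proof -
  have "\<exists>b. \<forall>i x. norm (grad (pd i f) x) \<le> b"
  proof -
    have "\<exists>b. \<forall>x. norm (grad (pd i f) x) \<le> b" for i
      using f S compact_imp_closed[OF S(1)]
      by (metis bounded_of_compact_support[of "grad (pd i f)" S] continuous_on_grad smooth_pd grad_zero_outside pd_zero_outside)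
    then obtain b where "\<And>i x. norm (grad (pd i f) x) \<le> b i" by metis
    moreover have "b i \<le> Max (range b)" for i by simp
    ultimately have "norm (grad (pd i f) x) \<le> Max (range b)" for i x
      using order_trans by blast
    then show ?thesis by blast
  qed
  then obtain b where b: "\<And>i x. norm (grad (pd i f) x) \<le> b" by blast
  have b0: "b \<ge> 0" using b[of undefined 0] norm_ge_zero order_trans by blast
  have lip: "norm (grad f x - grad f y) \<le> real CARD('n) * (b * norm (x - y))" for x y
    by (rule norm_le_vec_bound) (simp add: smooth_lipschitz[OF smooth_pd[OF f] b])
  show ?thesis
  proof
    show "0 \<le> real CARD('n) * b" using b0 by simp
    fix x h
    obtain t where t: "t \<in> {0<..<1}" "f (x + h) - f x = grad f (x + t *\<^sub>R h) \<bullet> h"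
      using smooth_mvt[OF f] by blast
    then have "\<bar>f (x + h) - f x - grad f x \<bullet> h\<bar> = \<bar>(grad f (x + t *\<^sub>R h) - grad f x) \<bullet> h\<bar>"
      by (simp add: inner_diff_left)
    also have "\<dots> \<le> norm (grad f (x + t *\<^sub>R h) - grad f x) * norm h"
      by (rule Cauchy_Schwarz_ineq2)
    also have "\<dots> \<le> (real CARD('n) * (b * norm (t *\<^sub>R h))) * norm h"
      using lip[of "x + t *\<^sub>R h" x] by (intro mult_right_mono) auto
    also have "\<dots> \<le> (real CARD('n) * (b * norm h)) * norm h"
      using t b0 by (intro mult_right_mono mult_left_mono) (auto simp: mult_left_le_one_le)
    finally show "\<bar>f (x + h) - f x - grad f x \<bullet> h\<bar> \<le> real CARD('n) * b * (norm h)\<^sup>2"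
      by (simp add: power2_eq_square mult_ac)
  qed
qed

lemma has_derivative_quadraticI:
  fixes f :: "'a::real_normed_vector \<Rightarrow> 'b::real_normed_vector"
  assumes "bounded_linear D" "\<And>h. norm (f (x + h) - f x - D h) \<le> L * (norm h)\<^sup>2"
  shows "(f has_derivative D) (at x)"
  unfolding has_derivative_at
proof
  show "(\<lambda>h. norm (f (x + h) - f x - D h) / norm h) \<midarrow>0\<rightarrow> 0"
  proof (rule Lim_null_comparison)
    show "\<forall>\<^sub>F h in at 0. norm (norm (f (x + h) - f x - D h) / norm h) \<le> L * norm h"
      using assms(2)
      by (intro always_eventually allI) (auto simp: divide_simps power2_eq_square mult_ac)
    show "((\<lambda>h. L * norm h) \<longlongrightarrow> 0) (at 0)"
      by (intro tendsto_eq_intros) auto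
  qed
qed (rule assms)

text \<open>Convolutions and averages over dilations are both of the form treated here.\<close>

lemma superposition:
  fixes f :: "real^'n::finite \<Rightarrow> real" and a c :: "'a \<Rightarrow> real" and y :: "'a \<Rightarrow> real^'n"
  assumes f: "smooth f" and S: "compact S" "\<And>x. x \<notin> S \<Longrightarrow> f x = 0"
    and a: "integrable M a" and c[measurable]: "c \<in> borel_measurable M" and y[measurable]: "y \<in> borel_measurable M"
    and C: "\<And>w. \<bar>c w\<bar> \<le> C"
  shows superposition_integrable: "integrable M (\<lambda>w. a w * f (c w *\<^sub>R x + y w))"
    and superposition_smooth: "smooth (\<lambda>x. \<integral>w. a w * f (c w *\<^sub>R x + y w) \<partial>M)"
    and superposition_pd: "pd i (\<lambda>x. \<integral>w. a w * f (c w *\<^sub>R x + y w) \<partial>M) x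
          = (\<integral>w. a w * c w * pd i f (c w *\<^sub>R x + y w) \<partial>M)"
proof -
  \<comment> \<open>Stated for arbitrary \<open>g\<close> and \<open>a\<close>: each derivative
    replaces \<open>f\<close> by \<open>pd i f\<close> and the weight \<open>a\<close> by
    \<open>a * c\<close>, and the induction for smoothness needs the claims for all of
    these.\<close>
  have int: "integrable M (\<lambda>w. a w * g (c w *\<^sub>R x + y w))"
    if g: "smooth g" "\<And>x. x \<notin> S \<Longrightarrow> g x = 0" and a: "integrable M a" for g :: "real^'n \<Rightarrow> real" and a x
  proof -
    obtain b where b: "b > 0" "\<And>x. norm (g x) \<le> b"
      using bounded_of_compact_support[OF smooth_continuous[OF g(1)] S(1) g(2)] by metis
    have [measurable]: "g \<in> borel_measurable borel"
      using g(1) by (intro borel_measurable_continuous_onI smooth_continuous)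
    have [measurable]: "a \<in> borel_measurable M" using a by auto
    show ?thesis
    proof (rule Bochner_Integration.integrable_bound)
      show "integrable M (\<lambda>w. b * a w)" using a by simp
      show "AE w in M. norm (a w * g (c w *\<^sub>R x + y w)) \<le> norm (b * a w)"
      proof (rule AE_I2)
        fix w
        have "\<bar>a w\<bar> * \<bar>g (c w *\<^sub>R x + y w)\<bar> \<le> \<bar>a w\<bar> * b"
          using b(2) by (intro mult_left_mono) auto
        then show "norm (a w * g (c w *\<^sub>R x + y w)) \<le> norm (b * a w)"
          using b(1) by (simp add: abs_mult mult.commute)
      qed
    qed measurable
  qed
  show "integrable M (\<lambda>w. a w * f (c w *\<^sub>R x + y w))" for x
    by (rule int[OF f S(2) a])
  have ac: "integrable M (\<lambda>w. a w * c w)" if a: "integrable M a" for a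
  proof (rule Bochner_Integration.integrable_bound)
    have [measurable]: "a \<in> borel_measurable M" using a by auto
    show "(\<lambda>w. a w * c w) \<in> borel_measurable M" by measurable
    show "integrable M (\<lambda>w. C * a w)" using a by simp
    show "AE w in M. norm (a w * c w) \<le> norm (C * a w)"
    proof (rule AE_I2)
      fix w
      have "\<bar>a w\<bar> * \<bar>c w\<bar> \<le> \<bar>a w\<bar> * \<bar>C\<bar>"
        using C[of w] by (intro mult_left_mono) auto
      then show "norm (a w * c w) \<le> norm (C * a w)"
        by (simp add: abs_mult mult.commute)
    qed
  qed
  have der: "((\<lambda>x. \<integral>w. a w * g (c w *\<^sub>R x + y w) \<partial>M) has_derivative
       (\<lambda>h. (\<chi> i. \<integral>w. a w * c w * pd i g (c w *\<^sub>R x + y w) \<partial>M) \<bullet> h)) (at x)"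
    if g: "smooth g" "\<And>x. x \<notin> S \<Longrightarrow> g x = 0" and a: "integrable M a" for g :: "real^'n \<Rightarrow> real" and a x
  proof -
    obtain L where L: "L \<ge> 0" "\<And>x h. \<bar>g (x + h) - g x - grad g x \<bullet> h\<bar> \<le> L * (norm h)\<^sup>2"
      using smooth_taylor2[OF g(1) S(1) g(2)] by metis
    have I: "integrable M (\<lambda>w. a w * g (c w *\<^sub>R x + y w))" for x
      by (rule int[OF g a])
    have J: "integrable M (\<lambda>w. a w * c w * pd i g (c w *\<^sub>R x + y w))" for x i
      by (rule int[OF smooth_pd[OF g(1)] pd_zero_outside[OF compact_imp_closed[OF S(1)] g(2)] ac[OF a]])
    have [measurable]: "a \<in> borel_measurable M" using a by auto
    show ?thesis
    proof (rule has_derivative_quadraticI)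
      show "bounded_linear ((\<bullet>) (\<chi> i. \<integral>w. a w * c w * pd i g (c w *\<^sub>R x + y w) \<partial>M))"
        by (rule bounded_linear_inner_right)
      fix h
      have K: "integrable M (\<lambda>w. a w * (grad g (c w *\<^sub>R x + y w) \<bullet> (c w *\<^sub>R h)))"
        and K': "(\<chi> i. \<integral>w. a w * c w * pd i g (c w *\<^sub>R x + y w) \<partial>M) \<bullet> h
            = (\<integral>w. a w * (grad g (c w *\<^sub>R x + y w) \<bullet> (c w *\<^sub>R h)) \<partial>M)"
      proof -
        have eq: "(\<lambda>w. a w * (grad g (c w *\<^sub>R x + y w) \<bullet> (c w *\<^sub>R h)))
          = (\<lambda>w. \<Sum>i\<in>UNIV. a w * c w * pd i g (c w *\<^sub>R x + y w) * h $ i)"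
          by (auto simp: inner_vec_def sum_distrib_left mult_ac)
        show "integrable M (\<lambda>w. a w * (grad g (c w *\<^sub>R x + y w) \<bullet> (c w *\<^sub>R h)))"
          unfolding eq using J by (intro Bochner_Integration.integrable_sum integrable_mult_left) auto
        show "(\<chi> i. \<integral>w. a w * c w * pd i g (c w *\<^sub>R x + y w) \<partial>M) \<bullet> h
            = (\<integral>w. a w * (grad g (c w *\<^sub>R x + y w) \<bullet> (c w *\<^sub>R h)) \<partial>M)"
          unfolding eq using J
          by (subst Bochner_Integration.integral_sum) (auto simp: inner_vec_def intro!: integrable_mult_left)
      qed
      have "norm ((\<integral>w. a w * g (c w *\<^sub>R (x + h) + y w) \<partial>M) - (\<integral>w. a w * g (c w *\<^sub>R x + y w) \<partial>M) -
           (\<chi> i. \<integral>w. a w * c w * pd i g (c w *\<^sub>R x + y w) \<partial>M) \<bullet> h)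
        = norm (\<integral>w. a w * g (c w *\<^sub>R (x + h) + y w) - a w * g (c w *\<^sub>R x + y w)
             - a w * (grad g (c w *\<^sub>R x + y w) \<bullet> (c w *\<^sub>R h)) \<partial>M)"
        unfolding K' using I K by simp
      also have "\<dots> \<le> (\<integral>w. \<bar>a w\<bar> * (L * (C\<^sup>2 * (norm h)\<^sup>2)) \<partial>M)"
      proof (rule norm_integral_le)
        show "integrable M (\<lambda>w. \<bar>a w\<bar> * (L * (C\<^sup>2 * (norm h)\<^sup>2)))" using a by auto
        fix w
        have "\<bar>g (c w *\<^sub>R x + y w + c w *\<^sub>R h) - g (c w *\<^sub>R x + y w) - grad g (c w *\<^sub>R x + y w) \<bullet> (c w *\<^sub>R h)\<bar>
            \<le> L * (norm (c w *\<^sub>R h))\<^sup>2" by (rule L)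
        also have "\<dots> \<le> L * (C\<^sup>2 * (norm h)\<^sup>2)"
        proof -
          have "\<bar>c w\<bar>\<^sup>2 \<le> C\<^sup>2" using C[of w] by (intro power_mono) auto
          then show ?thesis using L(1)
            by (simp only: norm_scaleR power_mult_distrib) (intro mult_left_mono mult_right_mono; simp)
        qed
        finally have "\<bar>g (c w *\<^sub>R (x + h) + y w) - g (c w *\<^sub>R x + y w) - grad g (c w *\<^sub>R x + y w) \<bullet> (c w *\<^sub>R h)\<bar>
            \<le> L * (C\<^sup>2 * (norm h)\<^sup>2)"
          by (simp add: algebra_simps)
        then have "\<bar>a w\<bar> * \<bar>g (c w *\<^sub>R (x + h) + y w) - g (c w *\<^sub>R x + y w) - grad g (c w *\<^sub>R x + y w) \<bullet> (c w *\<^sub>R h)\<bar>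
            \<le> \<bar>a w\<bar> * (L * (C\<^sup>2 * (norm h)\<^sup>2))" by (intro mult_left_mono) auto
        then show "norm (a w * g (c w *\<^sub>R (x + h) + y w) - a w * g (c w *\<^sub>R x + y w)
             - a w * (grad g (c w *\<^sub>R x + y w) \<bullet> (c w *\<^sub>R h))) \<le> \<bar>a w\<bar> * (L * (C\<^sup>2 * (norm h)\<^sup>2))"
          by (simp add: abs_mult[symmetric] right_diff_distrib)
      qed
      also have "\<dots> = ((\<integral>w. \<bar>a w\<bar> \<partial>M) * L * C\<^sup>2) * (norm h)\<^sup>2"
        by simp
      finally show "norm ((\<integral>w. a w * g (c w *\<^sub>R (x + h) + y w) \<partial>M) - (\<integral>w. a w * g (c w *\<^sub>R x + y w) \<partial>M) -
           (\<chi> i. \<integral>w. a w * c w * pd i g (c w *\<^sub>R x + y w) \<partial>M) \<bullet> h) \<le> ((\<integral>w. \<bar>a w\<bar> \<partial>M) * L * C\<^sup>2) * (norm h)\<^sup>2" .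
    qed
  qed
  have pd: "pd i (\<lambda>x. \<integral>w. a w * g (c w *\<^sub>R x + y w) \<partial>M) x
          = (\<integral>w. a w * c w * pd i g (c w *\<^sub>R x + y w) \<partial>M)"
    if g: "smooth g" "\<And>x. x \<notin> S \<Longrightarrow> g x = 0" and a: "integrable M a" for g :: "real^'n \<Rightarrow> real" and a x i
    using pd_eqI[OF der[OF that]] by (simp add: inner_axis)
  show "pd i (\<lambda>x. \<integral>w. a w * f (c w *\<^sub>R x + y w) \<partial>M) x
          = (\<integral>w. a w * c w * pd i f (c w *\<^sub>R x + y w) \<partial>M)" for x i
    by (rule pd[OF f S(2) a])
  show "smooth (\<lambda>x. \<integral>w. a w * f (c w *\<^sub>R x + y w) \<partial>M)"
  proof (rule smoothI)
    fix k show "Ck k (\<lambda>x. \<integral>w. a w * f (c w *\<^sub>R x + y w) \<partial>M)"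
      using f S(2) a
    proof (induction k arbitrary: f a)
      case 0
      then show ?case
        using has_derivative_continuous[OF der[OF 0]] by (simp add: continuous_at_imp_continuous_on)
    next
      case (Suc k)
      have "(\<lambda>x. \<integral>w. a w * f (c w *\<^sub>R x + y w) \<partial>M) differentiable_on UNIV"
        using der[OF Suc.prems] by (auto simp: differentiable_on_UNIV differentiable_def)
      moreover have "pd i (\<lambda>x. \<integral>w. a w * f (c w *\<^sub>R x + y w) \<partial>M)
         = (\<lambda>x. \<integral>w. a w * c w * pd i f (c w *\<^sub>R x + y w) \<partial>M)" for i
        using pd[OF Suc.prems] by blast
      moreover have "Ck k (\<lambda>x. \<integral>w. a w * c w * pd i f (c w *\<^sub>R x + y w) \<partial>M)" for i
        by (rule Suc.IH[OF smooth_pd[OF Suc.prems(1)] pd_zero_outside[OF compact_imp_closed[OF S(1)] Suc.prems(2)]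
              ac[OF Suc.prems(3)]])
      ultimately show ?case by simp
    qed
  qed
qed

section \<open>Mollifiers and truncated Newtonian kernels\<close>

text \<open>The negative powers of y make the family closed under differentiation: the derivative of
  \<open>flat m\<close> combines \<open>flat (m + 2)\<close> and \<open>flat (m + 1)\<close>.
  Smoothness of the bumps is then an induction over the order with m arbitrary.\<close>

definition flat :: "nat \<Rightarrow> real \<Rightarrow> real" where
  "flat m y = (if y > 0 then exp (- inverse y) * inverse y ^ m else 0)"

lemma flat_nonneg: "flat m y \<ge> 0"
  by (simp add: flat_def)

text \<open>From \<open>exp z \<ge> (1 + z / k)^k \<ge> (z / k)^k\<close> with z = 1/y and k = m +
  2. The two powers beyond m leave the quadratic decay that gives derivative 0 at the
  origin.\<close>

lemma flat_le_square: "flat m y \<le> (real (m + 2)) ^ (m + 2) * y\<^sup>2"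
proof (cases "y > 0")
  case True
  define k where "k = m + 2"
  have "(1 + inverse y / real k) ^ k \<le> exp (inverse y)"
    using True by (intro exp_ge_one_plus_x_over_n_power_n) (auto simp: k_def intro: order_trans[of _ 0])
  moreover have "(inverse y / real k) ^ k \<le> (1 + inverse y / real k) ^ k"
    using True by (intro power_mono) auto
  ultimately have "inverse y ^ k / real k ^ k \<le> exp (inverse y)"
    by (simp add: power_divide)
  moreover have "real k ^ k > 0" by (simp add: k_def)
  ultimately have "inverse y ^ k \<le> exp (inverse y) * real k ^ k"
    by (simp only: pos_divide_le_eq)
  then have "inverse y ^ k * exp (- inverse y) \<le> real k ^ k"
    using mult_right_mono[of "inverse y ^ k" "exp (inverse y) * real k ^ k" "exp (- inverse y)"]
    by (simp add: exp_minus field_simps)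
  then have "y\<^sup>2 * (inverse y ^ k * exp (- inverse y)) \<le> y\<^sup>2 * real k ^ k"
    by (intro mult_left_mono) auto
  moreover have "y\<^sup>2 * (inverse y ^ k * exp (- inverse y)) = flat m y"
    using True by (simp add: flat_def k_def power_add power2_eq_square field_simps)
  ultimately show ?thesis by (simp add: k_def mult.commute)
next
  case False
  then show ?thesis by (simp add: flat_def)
qed

lemma DERIV_flat: "(flat m has_real_derivative flat (m + 2) y - real m * flat (m + 1) y) (at y)"
proof (cases "y > 0")
  case True
  have "((\<lambda>y. exp (- inverse y) * inverse y ^ m) has_real_derivative
      exp (- inverse y) * inverse y ^ (m + 2) - real m * (exp (- inverse y) * inverse y ^ (m + 1))) (at y)"
  proof -
    have "((\<lambda>y. exp (- inverse y)) has_real_derivative exp (- inverse y) * inverse y ^ 2) (at y)"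
      using True by (auto intro!: derivative_eq_intros simp: power2_eq_square)
    moreover have "((\<lambda>y. inverse y ^ m) has_real_derivative - real m * inverse y ^ (m + 1)) (at y)"
    proof (cases m)
      case (Suc l)
      have "(inverse has_real_derivative - (inverse y * inverse y)) (at y)"
        using True DERIV_inverse[of y UNIV] by (simp add: power2_eq_square)
      from DERIV_power_Suc[OF this, of l] show ?thesis
        unfolding Suc by (rule DERIV_cong) (simp add: algebra_simps)
    qed simp
    ultimately have "((\<lambda>y. exp (- inverse y) * inverse y ^ m) has_real_derivative
      exp (- inverse y) * (- real m * inverse y ^ (m + 1)) + exp (- inverse y) * inverse y ^ 2 * inverse y ^ m) (at y)"
      by (rule DERIV_mult')
    then show ?thesis by (rule DERIV_cong) (simp add: power_add power2_eq_square algebra_simps)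
  qed
  then have "((\<lambda>y. exp (- inverse y) * inverse y ^ m) has_real_derivative
      flat (m + 2) y - real m * flat (m + 1) y) (at y)"
    using True by (simp add: flat_def)
  then show ?thesis
    by (rule has_field_derivative_transform_within_open[where S="{0<..}"]) (use True in \<open>auto simp: flat_def\<close>)
next
  case False
  then have 0: "flat k y = 0" for k by (simp add: flat_def)
  \<comment> \<open>For y \<le> 0 the whole family vanishes at y, so the claimed derivative is 0. An
    increment reaches the positive side only with y + h \<le> h, where the quadratic bound
    applies.\<close>
  have "(flat m has_derivative (\<lambda>h. 0)) (at y)"
  proof (rule has_derivative_quadraticI)
    fix h
    have "flat m (y + h) \<le> (real (m + 2)) ^ (m + 2) * h\<^sup>2"
    proof (cases "y + h > 0")
      case True
      have "flat m (y + h) \<le> (real (m + 2)) ^ (m + 2) * (y + h)\<^sup>2" by (rule flat_le_square)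
      also have "\<dots> \<le> (real (m + 2)) ^ (m + 2) * h\<^sup>2"
        using True False by (intro mult_left_mono power_mono) auto
      finally show ?thesis .
    qed (simp add: flat_def)
    then show "norm (flat m (y + h) - flat m y - 0) \<le> (real (m + 2)) ^ (m + 2) * (norm h)\<^sup>2"
      by (simp add: 0 flat_nonneg)
  qed auto
  moreover have "(*) 0 = (\<lambda>h::real. 0)" by auto
  ultimately show ?thesis by (simp add: 0 has_field_derivative_def)
qed

definition bump :: "nat \<Rightarrow> real^'n::finite \<Rightarrow> real" where
  "bump m x = flat m (1 - x \<bullet> x)"

lemma bump_nonneg: "bump m x \<ge> 0"
  by (simp add: bump_def flat_nonneg)

lemma bump_zero: "x \<notin> cball 0 1 \<Longrightarrow> bump m x = 0"
  by (auto simp: bump_def flat_def power2_norm_eq_inner[symmetric])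
     (smt (verit) one_less_power zero_less_numeral)

lemma bump_pos: "norm x < 1 \<Longrightarrow> bump m x > 0"
  by (simp add: bump_def flat_def power2_norm_eq_inner[symmetric] power_less_one_iff)

lemma bump_minus [simp]: "bump m (- x) = bump m x"
  by (simp add: bump_def)

lemma has_derivative_bump:
  "(bump m has_derivative (\<lambda>h. (- 2 * (bump (m + 2) x - real m * bump (m + 1) x)) *\<^sub>R x \<bullet> h)) (at x)"
proof -
  have "((\<lambda>x. 1 - x \<bullet> x) has_derivative (\<lambda>h. - (2 * (x \<bullet> h)))) (at x)"
    by (auto intro!: derivative_eq_intros simp: inner_commute)
  then have "((\<lambda>x. flat m (1 - x \<bullet> x)) has_derivative
     (\<lambda>h. - (2 * (x \<bullet> h)) * (flat (m + 2) (1 - x \<bullet> x) - real m * flat (m + 1) (1 - x \<bullet> x)))) (at x)"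
    by (rule has_derivative_compose[where g="flat m" and f="\<lambda>x. 1 - x \<bullet> x"])
       (use DERIV_flat[of m "1 - x \<bullet> x", THEN DERIV_cong, OF refl, unfolded has_field_derivative_def]
         in \<open>simp only: mult_commute_abs\<close>)
  then show ?thesis by (simp add: bump_def[abs_def] algebra_simps)
qed

lemma pd_bump: "pd i (bump m) x = - 2 * x $ i * (bump (m + 2) x - real m * bump (m + 1) x)"
  by (simp add: pd_eqI[OF has_derivative_bump] inner_axis algebra_simps)

lemma smooth_bump [simp, intro]: "smooth (bump m)"
proof (rule smoothI)
  fix k show "Ck k (bump m :: real^'n \<Rightarrow> real)"
  proof (induction k arbitrary: m)
    case 0
    then show ?case
      using has_derivative_continuous[OF has_derivative_bump] by (auto intro: continuous_at_imp_continuous_on)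
  next
    case (Suc k)
    have "pd i (bump m) = (\<lambda>x. (-2 * x $ i) * (bump (m + 2) x + (- real m) * bump (m + 1) x))" for i :: 'n
      by (auto simp: pd_bump)
    moreover have "Ck k (\<lambda>x. (-2 * x $ i) * (bump (m + 2) x + (- real m) * bump (m + 1) x))" for i :: 'n
      by (intro Ck_mult Ck_add Ck_const Ck_nth Suc)
    ultimately show ?case
      using differentiableI[OF has_derivative_bump[of m, where 'a='n]] by (simp add: differentiable_on_UNIV)
  qed
qed

lemma continuous_bump: "continuous_on S (bump m)"
  by (intro smooth_continuous smooth_bump)

lemma integrable_bump: "integrable lborel (bump m)"
  by (rule integrable_continuous_compact_support[of _ "cball 0 1"]) (auto simp: continuous_bump bump_zero)

lemma integral_bump_pos: "(\<integral>x. bump m (x::real^'n::finite) \<partial>lborel) > 0"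
proof -
  have "(\<integral>x. bump m (x::real^'n) \<partial>lborel) \<noteq> 0"
  proof
    assume "(\<integral>x. bump m (x::real^'n) \<partial>lborel) = 0"
    then have "AE x::real^'n in lborel. bump m x = 0"
      using integral_nonneg_eq_0_iff_AE[OF integrable_bump[of m, where 'a='n]] bump_nonneg by blast
    then have "AE x::real^'n in lborel. x \<notin> ball 0 1"
      by eventually_elim (metis bump_pos mem_ball_0 less_irrefl)
    then have "emeasure lborel (ball (0::real^'n) 1) = 0"
      by (subst (asm) AE_iff_measurable[OF _ refl]) (auto simp: ball_def)
    then show False
      using content_ball_eq_0_iff[of "0::real^'n" 1] by (simp add: measure_def)
  qed
  then show ?thesis
    using Bochner_Integration.integral_nonneg[of lborel "bump m :: real^'n \<Rightarrow> real", OF bump_nonneg]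
    by linarith
qed

section \<open>Affine substitution and the mollifier\<close>

lemma lborel_integral_affine:
  fixes f :: "'a::euclidean_space \<Rightarrow> 'b::{banach,second_countable_topology}"
  assumes "c \<noteq> 0" and [measurable]: "f \<in> borel_measurable borel"
  shows "(\<integral>x. f (y + c *\<^sub>R x) \<partial>lborel) = (1 / \<bar>c\<bar> ^ DIM('a)) *\<^sub>R (\<integral>x. f x \<partial>lborel)"
proof -
  have "(\<integral>x. f x \<partial>lborel) = \<bar>c\<bar> ^ DIM('a) *\<^sub>R (\<integral>x. f (y + c *\<^sub>R x) \<partial>lborel)"
    by (subst lborel_affine[OF assms(1), of y]) (simp add: integral_density integral_distr)
  then show ?thesis using assms(1) by simp
qed

lemma lborel_nn_integral_affine:
  fixes f :: "'a::euclidean_space \<Rightarrow> ennreal"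
  assumes "c \<noteq> 0" and [measurable]: "f \<in> borel_measurable borel"
  shows "(\<integral>\<^sup>+x. f x \<partial>lborel) = ennreal (\<bar>c\<bar> ^ DIM('a)) * (\<integral>\<^sup>+x. f (y + c *\<^sub>R x) \<partial>lborel)"
  by (subst lborel_affine[OF assms(1), of y])
     (simp add: nn_integral_density nn_integral_distr nn_integral_cmult ennreal_power)

definition bump_mass :: "'n::finite itself \<Rightarrow> real" where
  "bump_mass _ = (\<integral>x. bump 2 (x::real^'n) \<partial>lborel)"

lemma bump_mass_pos: "bump_mass TYPE('n::finite) > 0"
  by (simp add: bump_mass_def integral_bump_pos)

text \<open>The profile is \<open>bump 2\<close> because the gradient of \<open>bump 0\<close> is -2
  x times \<open>bump 2\<close>: x times the profile is then a gradient, and the derivative of the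
  mollifier in its scale is the Laplacian of a rescaled \<open>bump 0\<close>.\<close>

definition mol :: "real \<Rightarrow> real^'n::finite \<Rightarrow> real" where
  "mol t x = (1 / (bump_mass TYPE('n) * t ^ CARD('n))) * bump 2 ((1 / t) *\<^sub>R x)"

lemma mol_nonneg: "t > 0 \<Longrightarrow> mol t x \<ge> 0"
  using bump_mass_pos[where 'n='a] by (simp add: mol_def bump_nonneg less_imp_le)

lemma mol_zero: "t > 0 \<Longrightarrow> norm x > t \<Longrightarrow> mol t x = 0"
  by (simp add: mol_def bump_zero)

lemma mol_minus [simp]: "mol t (- x) = mol t x"
  by (simp add: mol_def)

lemma smooth_mol [simp, intro]: "smooth (mol t)"
  unfolding mol_def using smooth_affine[where f="bump 2" and c="1/t" and y=0] by (intro smooth_mult) auto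

lemma continuous_mol: "continuous_on S (mol t)"
  by (intro smooth_continuous smooth_mol)

lemma measurable_mol [measurable]: "mol t \<in> borel_measurable borel"
  by (intro borel_measurable_continuous_onI continuous_mol)

lemma integrable_mol: "t > 0 \<Longrightarrow> integrable lborel (mol t)"
  by (rule integrable_continuous_compact_support[of _ "cball 0 t"]) (auto simp: continuous_mol mol_zero)

lemma integral_mol: "t > 0 \<Longrightarrow> (\<integral>x. mol t (x::real^'n::finite) \<partial>lborel) = 1"
  using lborel_integral_affine[of "1/t" "bump 2" "0::real^'n"] integral_bump_pos[of 2, where 'n='n]
  by (simp add: mol_def[abs_def] bump_mass_def borel_measurable_continuous_onI continuous_bump power_divide)

lemma laplace_bump:
  fixes x :: "real^'n::finite"
  shows "(\<Sum>i\<in>UNIV. pd i (pd i (bump 0)) x)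
     = - 2 * real CARD('n) * bump 2 x + 4 * (x \<bullet> x) * (bump 4 x - 2 * bump 3 x)"
proof -
  have 1: "pd i (bump 0) = (\<lambda>x::real^'n. -2 * (x $ i * bump 2 x))" for i
    by (intro ext) (simp add: pd_bump numeral_2_eq_2)
  have 2: "pd i (\<lambda>x::real^'n. -2 * (x $ i * bump 2 x)) x
      = -2 * (x $ i * pd i (bump 2) x + pd i (\<lambda>x. x $ i) x * bump 2 x)" for i
    by (subst pd_cmult[OF smooth_mult[OF smooth_nth smooth_bump]], subst pd_mult)
       (simp_all only: smooth_differentiable[OF smooth_nth] smooth_differentiable[OF smooth_bump])
  have "pd i (pd i (bump 0)) x
      = -2 * bump 2 x + 4 * (x $ i * x $ i) * (bump 4 x - 2 * bump 3 x)" for i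
    unfolding 1 2 by (simp add: pd_nth pd_bump algebra_simps eval_nat_numeral)
  then have "(\<Sum>i\<in>UNIV. pd i (pd i (bump 0)) x)
      = (\<Sum>i\<in>UNIV. -2 * bump 2 x + 4 * (bump 4 x - 2 * bump 3 x) * (x $ i * x $ i))"
    by (intro sum.cong) simp_all
  then show ?thesis
    by (simp add: sum.distrib sum_subtractf sum_distrib_left[symmetric] inner_vec_def)
qed

text \<open>In dimension n the derivative of \<open>t^{-n} f (x / t)\<close> in t is
  \<open>- t^{-n-1}\<close> times the divergence of \<open>y f y\<close> at y = x / t, and for
  \<open>f = bump 2\<close> this divergence is minus half the Laplacian of \<open>bump 0\<close>.
  The powers are grouped as \<open>t (1/t)^n\<close> and \<open>(1/t)^2\<close> because the second
  arises from differentiating \<open>bump 0 (x / t)\<close> twice, while the first is the weight of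
  the kernel.\<close>

lemma DERIV_mol:
  fixes x :: "real^'n::finite" and t :: real
  assumes "t > 0"
  shows "((\<lambda>t. mol t x) has_real_derivative
     1 / (2 * bump_mass TYPE('n)) * t * (1/t) ^ CARD('n) * (1/t)\<^sup>2 * (\<Sum>i\<in>UNIV. pd i (pd i (bump 0)) ((1 / t) *\<^sub>R x))) (at t)"
proof -
  let ?N = "CARD('n)"
  define q where "q = x \<bullet> x"
  define F where "F = (\<lambda>t. 1 / bump_mass TYPE('n) * ((1/t) ^ ?N * flat 2 (1 - q / t\<^sup>2)))"
  have F: "mol t x = F t" for t
    by (simp add: mol_def F_def bump_def q_def power2_eq_square power_divide)
  have f: "((\<lambda>t. flat 2 (1 - q / t\<^sup>2)) has_real_derivative
      (flat 4 (1 - q / t\<^sup>2) - 2 * flat 3 (1 - q / t\<^sup>2)) * (2 * q / t ^ 3)) (at t)"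
    using DERIV_flat[of 2 "1 - q / t\<^sup>2"] assms
    by (intro DERIV_chain2[where f="flat 2"])
       (auto intro!: derivative_eq_intros simp: eval_nat_numeral field_simps)
  have p: "((\<lambda>t. (1/t) ^ ?N) has_real_derivative - real ?N * (1/t) ^ ?N * (1/t)) (at t)"
  proof -
    obtain m where m: "?N = Suc m" using zero_less_card_finite[where 'a='n] by (metis gr0_implies_Suc)
    have "((\<lambda>t. (1/t) ^ Suc m) has_real_derivative of_nat (Suc m) * (- (1 / t * (1 / t)) * (1/t) ^ m)) (at t)"
    proof (rule DERIV_power_Suc[where f="\<lambda>t. 1/t", THEN DERIV_cong])
      show "((\<lambda>t. 1 / t) has_real_derivative - (1 / t * (1 / t))) (at t)"
        using assms by (auto intro!: derivative_eq_intros)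
    qed simp
    then show ?thesis unfolding m by (rule DERIV_cong) (simp add: algebra_simps add_divide_distrib diff_divide_distrib)
  qed
  have "(F has_real_derivative 1 / bump_mass TYPE('n) * ((1/t) ^ ?N * ((flat 4 (1 - q / t\<^sup>2) - 2 * flat 3 (1 - q / t\<^sup>2)) * (2 * q / t ^ 3))
      + (- real ?N * (1/t) ^ ?N * (1/t)) * flat 2 (1 - q / t\<^sup>2))) (at t)"
    unfolding F_def by (intro DERIV_cmult DERIV_mult' p f)
  also have "1 / bump_mass TYPE('n) * ((1/t) ^ ?N * ((flat 4 (1 - q / t\<^sup>2) - 2 * flat 3 (1 - q / t\<^sup>2)) * (2 * q / t ^ 3))
      + (- real ?N * (1/t) ^ ?N * (1/t)) * flat 2 (1 - q / t\<^sup>2))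
     = 1 / (2 * bump_mass TYPE('n)) * t * (1/t) ^ ?N * (1/t)\<^sup>2 *
         (- 2 * real ?N * flat 2 (1 - q / t\<^sup>2) + 4 * (q / t\<^sup>2) * (flat 4 (1 - q / t\<^sup>2) - 2 * flat 3 (1 - q / t\<^sup>2)))"
  proof -
    \<comment> \<open>With the power of symbolic exponent hidden behind a name, the remaining
      identity is rational in t.\<close>
    define X where "X = (1/t) ^ ?N"
    show ?thesis unfolding X_def[symmetric]
      using assms bump_mass_pos[where 'n='n] by (simp add: field_simps eval_nat_numeral)
  qed
  also have "(- 2 * real ?N * flat 2 (1 - q / t\<^sup>2) + 4 * (q / t\<^sup>2) * (flat 4 (1 - q / t\<^sup>2) - 2 * flat 3 (1 - q / t\<^sup>2)))
     = (\<Sum>i\<in>UNIV. pd i (pd i (bump 0)) ((1 / t) *\<^sub>R x))"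
    unfolding laplace_bump by (simp add: bump_def q_def power2_eq_square)
  finally show ?thesis by (simp add: F[abs_def])
qed


text \<open>Set on \<open>lborel\<close>, where affine substitution and Fubini are at hand; Lebesgue
  measurable fields enter only through Borel versions.\<close>

definition conv :: "(real^'n::finite \<Rightarrow> real) \<Rightarrow> (real^'n \<Rightarrow> real) \<Rightarrow> real^'n \<Rightarrow> real" where
  "conv K V x = (\<integral>y. V y * K (x - y) \<partial>lborel)"

context
  fixes K V :: "real^'n::finite \<Rightarrow> real" and S :: "(real^'n) set"
  assumes K: "smooth K" "compact S" "\<And>x. x \<notin> S \<Longrightarrow> K x = 0"
    and V: "integrable lborel V"
begin

lemma conv_integrable: "integrable lborel (\<lambda>y. V y * K (x - y))"
  using superposition_integrable[OF K V, of "\<lambda>_. 1" uminus 1 x] by simp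

lemma conv_smooth: "smooth (conv K V)"
  using superposition_smooth[OF K V, of "\<lambda>_. 1" uminus 1] by (simp add: conv_def[abs_def])

lemma conv_pd: "pd i (conv K V) = conv (pd i K) V"
  using superposition_pd[OF K V, of "\<lambda>_. 1" uminus 1 i] by (auto simp: conv_def[abs_def])

end

lemma conv_abs_le:
  fixes K V :: "real^'n::finite \<Rightarrow> real"
  assumes "integrable lborel K" "\<And>x. \<bar>V x\<bar> \<le> A"
  shows "\<bar>conv K V x\<bar> \<le> A * (\<integral>x. \<bar>K x\<bar> \<partial>lborel)"
proof -
  have m: "(\<lambda>x. \<bar>K x\<bar>) \<in> borel_measurable borel"
    using borel_measurable_integrable[OF assms(1)] by simp
  have eq: "(\<integral>y. \<bar>K (x - y)\<bar> \<partial>lborel) = (\<integral>x. \<bar>K x\<bar> \<partial>lborel)"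
    using lborel_integral_affine[of "-1" "\<lambda>x. \<bar>K x\<bar>" x] m by simp
  have int: "integrable lborel (\<lambda>y. \<bar>K (x - y)\<bar>)"
  proof (rule ccontr)
    assume n: "\<not> ?thesis"
    have "(\<integral>\<^sup>+y. ennreal \<bar>K (x - y)\<bar> \<partial>lborel) = (\<integral>\<^sup>+y. ennreal \<bar>K y\<bar> \<partial>lborel)"
      using lborel_nn_integral_affine[of "-1" "\<lambda>y. ennreal \<bar>K y\<bar>" x] m by simp
    also have "\<dots> < \<infinity>"
      using assms(1) by (simp add: integrable_iff_bounded)
    finally have "integrable lborel (\<lambda>y. \<bar>K (x - y)\<bar>)"
      using m by (subst integrable_iff_bounded) auto
    with n show False by simp
  qed
  have "norm (conv K V x) \<le> (\<integral>y. A * \<bar>K (x - y)\<bar> \<partial>lborel)"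
    unfolding conv_def
    by (rule norm_integral_le) (use int assms(2) in \<open>auto simp: abs_mult intro!: mult_right_mono\<close>)
  then show ?thesis using eq by simp
qed

lemma conv_zero:
  assumes "\<And>y. V y \<noteq> 0 \<Longrightarrow> K (x - y) = 0"
  shows "conv K V x = 0"
proof -
  have "V y * K (x - y) = 0" for y using assms[of y] by auto
  then show ?thesis unfolding conv_def by (simp only: integral_zero)
qed

text \<open>\<open>mol t\<close> is a probability density supported in the ball of radius t, so the
  convolution averages values of \<open>g\<close> that all lie within \<open>e\<close> of
  \<open>b\<close>.\<close>

lemma conv_mol_close:
  fixes g :: "real^'n::finite \<Rightarrow> real"
  assumes "t > 0" "integrable lborel g" "\<And>y. dist y x \<le> t \<Longrightarrow> \<bar>g y - b\<bar> \<le> e"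
  shows "\<bar>conv (mol t) g x - b\<bar> \<le> e"
proof -
  have e: "e \<ge> 0" using assms(3)[of x] assms(1) by fastforce
  have int: "integrable lborel (\<lambda>y. g y * mol t (x - y))"
    by (rule conv_integrable[where S="cball 0 t"]) (use assms in \<open>auto simp: mol_zero\<close>)
  have int2: "integrable lborel (\<lambda>y. mol t (x - y))"
    by (rule integrable_continuous_compact_support[of _ "cball x t"])
      (use assms(1) in \<open>auto simp: dist_norm mol_zero intro!: continuous_on_compose2[OF continuous_mol[of UNIV]] continuous_intros\<close>)
  have one: "(\<integral>y. mol t (x - y) \<partial>lborel) = 1"
    using lborel_integral_affine[of "-1" "mol t" x] integral_mol[OF assms(1), where 'n='n] by simp
  have "norm (\<integral>y. (g y - b) * mol t (x - y) \<partial>lborel) \<le> (\<integral>y. e * mol t (x - y) \<partial>lborel)"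
  proof (rule norm_integral_le)
    fix y
    show "norm ((g y - b) * mol t (x - y)) \<le> e * mol t (x - y)"
    proof (cases "dist y x \<le> t")
      case True
      then show ?thesis using assms(3)[OF True] mol_nonneg[OF assms(1), of "x - y"]
        by (auto simp: abs_mult intro!: mult_right_mono)
    next
      case False
      then show ?thesis using assms(1) by (simp add: mol_zero dist_norm norm_minus_commute)
    qed
  qed (use int2 in auto)
  also have "\<dots> = e" using one by simp
  also have "(\<integral>y. (g y - b) * mol t (x - y) \<partial>lborel) = conv (mol t) g x - b"
    using int int2 one by (simp add: conv_def left_diff_distrib)
  finally show ?thesis by simp
qed

text \<open>The weight is what remains of the scale derivative of \<open>mol t\<close> once the
  factor \<open>(1/t)^2\<close> is left to the two spatial derivatives.\<close>

definition ker_w :: "'n::finite itself \<Rightarrow> real \<Rightarrow> real \<Rightarrow> real \<Rightarrow> real" where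
  "ker_w _ \<eta> T t = indicator {\<eta>..T} t * (1 / (2 * bump_mass TYPE('n)) * t * (1/t) ^ CARD('n))"

text \<open>The indicator keeps the dilation factor below \<open>1 / \<eta>\<close> on the whole
  line, as differentiation under the integral requires.\<close>

definition ker_c :: "real \<Rightarrow> real \<Rightarrow> real \<Rightarrow> real" where
  "ker_c \<eta> T t = indicator {\<eta>..T} t * (1/t)"

text \<open>The truncated Newtonian kernel: since the derivative of \<open>mol t\<close> in \<open>t\<close> is a Laplacian,
  integrating in \<open>t\<close> solves a Poisson equation with compactly supported smooth data.\<close>

definition ker :: "real \<Rightarrow> real \<Rightarrow> real^'n::finite \<Rightarrow> real" where
  "ker \<eta> T x = (\<integral>t. ker_w TYPE('n) \<eta> T t * bump 0 (ker_c \<eta> T t *\<^sub>R x) \<partial>lborel)"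

lemma ker_c_measurable [measurable]: "ker_c \<eta> T \<in> borel_measurable borel"
  unfolding ker_c_def[abs_def] by measurable

lemma ker_w_measurable [measurable]: "ker_w TYPE('n::finite) \<eta> T \<in> borel_measurable borel"
  unfolding ker_w_def[abs_def] by measurable

context
  fixes \<eta> T :: real
  assumes \<eta>: "0 < \<eta>" "\<eta> < T"
begin

lemma ker_c_bound: "\<bar>ker_c \<eta> T t\<bar> \<le> 1 / \<eta>"
  using \<eta> by (auto simp: ker_c_def indicator_def divide_simps)

lemma ker_w_integrable: "integrable lborel (ker_w TYPE('n::finite) \<eta> T)"
proof -
  have "set_integrable lborel {\<eta>..T} (\<lambda>t. 1 / (2 * bump_mass TYPE('n)) * t * (1/t) ^ CARD('n))"
    using \<eta> bump_mass_pos[where 'n='n] by (intro borel_integrable_atLeastAtMost') (auto intro!: continuous_intros)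
  then show ?thesis by (simp add: set_integrable_def ker_w_def[abs_def])
qed

lemma ker_wc_integrable: "integrable lborel (\<lambda>t. ker_w TYPE('n::finite) \<eta> T t * ker_c \<eta> T t)"
proof -
  have "integrable lborel (\<lambda>t. ker_c \<eta> T t * ker_w TYPE('n) \<eta> T t)"
  proof (rule Bochner_Integration.integrable_bound)
    show "integrable lborel (\<lambda>t. 1 / \<eta> * ker_w TYPE('n) \<eta> T t)"
      by (intro integrable_mult_right ker_w_integrable)
    show "AE t in lborel. norm (ker_c \<eta> T t * ker_w TYPE('n) \<eta> T t) \<le> norm (1 / \<eta> * ker_w TYPE('n) \<eta> T t)"
    proof (rule AE_I2)
      fix t
      have "\<bar>ker_c \<eta> T t\<bar> * \<bar>ker_w TYPE('n) \<eta> T t\<bar> \<le> (1 / \<eta>) * \<bar>ker_w TYPE('n) \<eta> T t\<bar>"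
        by (intro mult_right_mono ker_c_bound) auto
      then show "norm (ker_c \<eta> T t * ker_w TYPE('n) \<eta> T t) \<le> norm (1 / \<eta> * ker_w TYPE('n) \<eta> T t)"
        using \<eta> by (simp add: abs_mult)
    qed
  qed measurable
  then show ?thesis by (simp add: mult.commute)
qed

lemma smooth_ker: "smooth (ker \<eta> T :: real^'n::finite \<Rightarrow> real)"
  using superposition_smooth[where f="bump 0 :: real^'n \<Rightarrow> real" and S="cball 0 1" and M=lborel
      and a="ker_w TYPE('n) \<eta> T" and c="ker_c \<eta> T" and y="\<lambda>_. 0" and C="1/\<eta>"]
  by (simp add: bump_zero ker_w_integrable ker_c_bound ker_def[abs_def])

lemma pd_ker: "pd i (ker \<eta> T) = (\<lambda>x::real^'n::finite. \<integral>t. ker_w TYPE('n) \<eta> T t * ker_c \<eta> T t * pd i (bump 0) (ker_c \<eta> T t *\<^sub>R x) \<partial>lborel)"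
  using superposition_pd[where f="bump 0 :: real^'n \<Rightarrow> real" and S="cball 0 1" and M=lborel
      and a="ker_w TYPE('n) \<eta> T" and c="ker_c \<eta> T" and y="\<lambda>_. 0" and C="1/\<eta>" and i=i]
  by (auto simp: bump_zero ker_w_integrable ker_c_bound ker_def[abs_def])

lemma pd_bump_zero: "x \<notin> cball 0 1 \<Longrightarrow> pd i (bump m) x = 0"
  by (rule pd_zero_outside[of "cball 0 1"]) (auto simp: bump_zero)

lemma pd_pd_ker: "pd j (pd i (ker \<eta> T)) x = (\<integral>t. ker_w TYPE('n) \<eta> T t * ker_c \<eta> T t * ker_c \<eta> T t
      * pd j (pd i (bump 0)) (ker_c \<eta> T t *\<^sub>R x) \<partial>lborel)" for x :: "real^'n::finite"
  unfolding pd_ker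
  using superposition_pd[where f="pd i (bump 0) :: real^'n \<Rightarrow> real" and S="cball 0 1" and M=lborel
      and a="\<lambda>t. ker_w TYPE('n) \<eta> T t * ker_c \<eta> T t" and c="ker_c \<eta> T" and y="\<lambda>_. 0" and C="1/\<eta>" and i=j]
  by (auto simp: pd_bump_zero smooth_pd ker_wc_integrable ker_c_bound)

lemma ker_minus: "ker \<eta> T (- x) = ker \<eta> T x"
  by (simp add: ker_def)

lemma ker_zero: "norm x > T \<Longrightarrow> ker \<eta> T (x::real^'n::finite) = 0"
proof -
  assume x: "norm x > T"
  have "ker_w TYPE('n) \<eta> T t * bump 0 (ker_c \<eta> T t *\<^sub>R x) = 0" for t
  proof (cases "t \<in> {\<eta>..T}")
    case True
    then have "t > 0" "norm x > t" using \<eta> x by auto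
    then show ?thesis using True by (subst bump_zero) (auto simp: ker_c_def)
  qed (simp add: ker_w_def)
  then show ?thesis unfolding ker_def by (simp only: integral_zero)
qed

text \<open>Two spatial derivatives restore the factor \<open>(1/t)^2\<close>, so the integrand is
  the scale derivative of \<open>mol t\<close>, and the fundamental theorem of calculus leaves the
  mollifiers at the two end scales.\<close>

lemma laplace_ker: "(\<Sum>i\<in>UNIV. pd i (pd i (ker \<eta> T)) x) = mol T x - mol \<eta> (x::real^'n::finite)"
proof -
  let ?D = "\<lambda>t. 1 / (2 * bump_mass TYPE('n)) * t * (1/t) ^ CARD('n) * (1/t)\<^sup>2 *
       (\<Sum>i\<in>UNIV. pd i (pd i (bump 0)) ((1 / t) *\<^sub>R x))"
  have int: "integrable lborel (\<lambda>t. ker_w TYPE('n) \<eta> T t * ker_c \<eta> T t * ker_c \<eta> T t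
      * pd i (pd i (bump 0)) (ker_c \<eta> T t *\<^sub>R x))" for i
  proof -
    have "continuous_on {\<eta>..T} (\<lambda>t. pd i (pd i (bump 0)) ((1/t) *\<^sub>R x))"
      using \<eta> by (intro continuous_on_compose2[OF smooth_continuous[of _ UNIV]] smooth_pd smooth_bump) 
        (auto intro!: continuous_intros)
    then have "set_integrable lborel {\<eta>..T} (\<lambda>t. (1 / (2 * bump_mass TYPE('n)) * t * (1/t) ^ CARD('n)) * (1/t) * (1/t)
        * pd i (pd i (bump 0)) ((1/t) *\<^sub>R x))"
      using \<eta> by (intro borel_integrable_atLeastAtMost' continuous_on_mult) (auto intro!: continuous_intros)
    then show ?thesis
      unfolding set_integrable_def
      by (rule Bochner_Integration.integrable_cong[THEN iffD1, rotated -1])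
         (auto simp: ker_w_def ker_c_def indicator_def)
  qed
  have "(\<Sum>i\<in>UNIV. pd i (pd i (ker \<eta> T)) x)
     = (\<integral>t. (\<Sum>i\<in>UNIV. ker_w TYPE('n) \<eta> T t * ker_c \<eta> T t * ker_c \<eta> T t
      * pd i (pd i (bump 0)) (ker_c \<eta> T t *\<^sub>R x)) \<partial>lborel)"
    unfolding pd_pd_ker using int by (subst Bochner_Integration.integral_sum) auto
  also have "\<dots> = (\<integral>t. indicator {\<eta>..T} t *\<^sub>R ?D t \<partial>lborel)"
    by (rule Bochner_Integration.integral_cong)
       (auto simp: ker_w_def ker_c_def indicator_def sum_distrib_left power2_eq_square mult.assoc)
  also have "\<dots> = mol T x - mol \<eta> x"
  proof (rule integral_FTC_Icc)
    show "((\<lambda>t. mol t x) has_vector_derivative ?D t) (at t within {\<eta>..T})" if "\<eta> \<le> t" "t \<le> T" for t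
      using DERIV_mol[of t x] \<eta> that
      by (auto simp: has_real_derivative_iff_has_vector_derivative[symmetric] intro: has_field_derivative_at_within)
    have "continuous_on {\<eta>..T} (\<lambda>t. pd i (pd i (bump 0)) ((1/t) *\<^sub>R x))" for i
      using \<eta> by (intro continuous_on_compose2[OF smooth_continuous[of _ UNIV]] smooth_pd smooth_bump) 
        (auto intro!: continuous_intros)
    then show "continuous_on {\<eta>..T} ?D"
      using \<eta> by (intro continuous_on_mult continuous_on_sum) (auto intro!: continuous_intros)
  qed (use \<eta> in auto)
  finally show ?thesis .
qed

lemma integrable_pd_ker: "integrable lborel (pd i (ker \<eta> T) :: real^'n::finite \<Rightarrow> real)"
  by (rule integrable_continuous_compact_support[of _ "cball 0 T"])
     (auto intro!: smooth_continuous smooth_pd smooth_ker pd_zero_outside[of "cball 0 T"] simp: ker_zero)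

text \<open>At each scale the weight times \<open>ker_c\<close> is proportional to
  \<open>t^{-n}\<close>, which rescaling the integral cancels exactly. Every scale contributes the
  same constant and the scales fill an interval shorter than T: the bound is linear in T and uniform
  in \<eta>.\<close>

lemma integral_pd_ker_le:
  "(\<integral>x. \<bar>pd i (ker \<eta> T) (x::real^'n::finite)\<bar> \<partial>lborel)
    \<le> T * ((\<integral>x. \<bar>pd i (bump 0) (x::real^'n)\<bar> \<partial>lborel) / (2 * bump_mass TYPE('n)))"
proof -
  let ?B = "\<integral>x. \<bar>pd i (bump 0) (x::real^'n)\<bar> \<partial>lborel"
  let ?g = "\<lambda>t x::real^'n. ker_w TYPE('n) \<eta> T t * ker_c \<eta> T t * pd i (bump 0) (ker_c \<eta> T t *\<^sub>R x)"
  have [measurable]: "pd i (bump 0) \<in> borel_measurable (borel :: (real^'n) measure)"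
    by (intro borel_measurable_continuous_onI smooth_continuous smooth_pd smooth_bump)
  have "(\<integral>\<^sup>+x. ennreal \<bar>pd i (ker \<eta> T) (x::real^'n)\<bar> \<partial>lborel) \<le> (\<integral>\<^sup>+x. \<integral>\<^sup>+t. ennreal \<bar>?g t x\<bar> \<partial>lborel \<partial>lborel)"
  proof (rule nn_integral_mono)
    fix x :: "real^'n"
    have "integrable lborel (\<lambda>t. ?g t x)"
      using superposition_integrable[where f="pd i (bump 0) :: real^'n \<Rightarrow> real" and S="cball 0 1" and M=lborel
        and a="\<lambda>t. ker_w TYPE('n) \<eta> T t * ker_c \<eta> T t" and c="ker_c \<eta> T" and y="\<lambda>_. 0" and C="1/\<eta>"]
      by (simp add: pd_bump_zero smooth_pd ker_wc_integrable ker_c_bound)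
    from integral_norm_bound_ennreal[OF this]
    show "ennreal \<bar>pd i (ker \<eta> T) x\<bar> \<le> (\<integral>\<^sup>+t. ennreal \<bar>?g t x\<bar> \<partial>lborel)"
      unfolding pd_ker by simp
  qed
  also have "\<dots> = (\<integral>\<^sup>+t. \<integral>\<^sup>+x. ennreal \<bar>?g t x\<bar> \<partial>lborel \<partial>lborel)"
    by (rule lborel_pair.Fubini') measurable
  also have "\<dots> = (\<integral>\<^sup>+t. indicator {\<eta>..T} t * ennreal (?B / (2 * bump_mass TYPE('n))) \<partial>lborel)"
  proof (rule nn_integral_cong)
    fix t
    show "(\<integral>\<^sup>+x. ennreal \<bar>?g t x\<bar> \<partial>lborel) = indicator {\<eta>..T} t * ennreal (?B / (2 * bump_mass TYPE('n)))"
    proof (cases "t \<in> {\<eta>..T}")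
      case True
      then have t: "t > 0" using \<eta> by auto
      have "(\<integral>\<^sup>+x. ennreal \<bar>?g t x\<bar> \<partial>lborel)
        = (\<integral>\<^sup>+x. ennreal ((1/t) ^ CARD('n) / (2 * bump_mass TYPE('n)) * \<bar>pd i (bump 0) ((1/t) *\<^sub>R (x::real^'n))\<bar>) \<partial>lborel)"
        using True t bump_mass_pos[where 'n='n]
        by (intro nn_integral_cong) (simp add: ker_w_def ker_c_def abs_mult power_divide)
      also have "\<dots> = ennreal (\<integral>x. (1/t) ^ CARD('n) / (2 * bump_mass TYPE('n)) * \<bar>pd i (bump 0) ((1/t) *\<^sub>R (x::real^'n))\<bar> \<partial>lborel)"
      proof (rule nn_integral_eq_integral)
        have "integrable lborel (\<lambda>x::real^'n. \<bar>pd i (bump 0) ((1/t) *\<^sub>R x)\<bar>)"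
          using t by (intro integrable_continuous_compact_support[of _ "cball 0 t"])
            (auto intro!: continuous_on_rabs continuous_on_compose2[OF smooth_continuous[of "pd i (bump 0)" UNIV]] continuous_intros smooth_pd pd_bump_zero)
        then show "integrable lborel (\<lambda>x::real^'n. (1/t) ^ CARD('n) / (2 * bump_mass TYPE('n)) * \<bar>pd i (bump 0) ((1/t) *\<^sub>R (x::real^'n))\<bar>)"
          by simp
      qed (use t bump_mass_pos[where 'n='n] in auto)
      also have "(\<integral>x. (1/t) ^ CARD('n) / (2 * bump_mass TYPE('n)) * \<bar>pd i (bump 0) ((1/t) *\<^sub>R (x::real^'n))\<bar> \<partial>lborel)
         = ?B / (2 * bump_mass TYPE('n))"
        using lborel_integral_affine[of "1/t" "\<lambda>x. \<bar>pd i (bump 0) x\<bar>" "0::real^'n"] t by (simp add: power_divide)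
      finally show ?thesis using True by simp
    qed (simp add: ker_w_def)
  qed
  also have "\<dots> = ennreal ((T - \<eta>) * (?B / (2 * bump_mass TYPE('n))))"
    using \<eta> bump_mass_pos[where 'n='n] by (simp add: nn_integral_multc ennreal_mult'[symmetric] less_imp_le)
  also have "\<dots> \<le> ennreal (T * (?B / (2 * bump_mass TYPE('n))))"
    using \<eta> bump_mass_pos[where 'n='n] by (intro ennreal_leI mult_right_mono) (auto intro!: divide_nonneg_pos)
  finally have "ennreal (\<integral>x. \<bar>pd i (ker \<eta> T) (x::real^'n)\<bar> \<partial>lborel) \<le> ennreal (T * (?B / (2 * bump_mass TYPE('n))))"
    using nn_integral_eq_integral[OF integrable_abs[OF integrable_pd_ker[of i]]] by simp
  then show ?thesis
    using \<eta> bump_mass_pos[where 'n='n] by (subst (asm) ennreal_le_iff) (auto intro!: mult_nonneg_nonneg divide_nonneg_pos)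
qed

end

section \<open>Integration by parts and energy bounds for convolutions\<close>

text \<open>Translation invariance takes the place of iterated integrals: \<open>H x\<close>
  integrates a translate of \<open>h\<close> over a fixed ball and is constant for |x| < 1, so
  differentiating it under the integral at 0 gives the claim. The radius R + 1 leaves room for these
  translations.\<close>

lemma integral_pd_eq_0:
  fixes h :: "real^'n::finite \<Rightarrow> real"
  assumes h: "smooth h" and S: "compact S" "\<And>x. x \<notin> S \<Longrightarrow> h x = 0"
  shows "(\<integral>x. pd i h x \<partial>lborel) = 0"
proof -
  obtain R where R: "\<And>x. x \<in> S \<Longrightarrow> norm x \<le> R"
    using compact_imp_bounded[OF S(1)] by (auto simp: bounded_iff)
  define a where "a = (indicat_real (cball (0::real^'n) (R + 1)))"
  define H where "H = (\<lambda>x. \<integral>y. a y * h (1 *\<^sub>R x + y) \<partial>lborel)"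
  have a: "integrable lborel a"
    unfolding a_def using emeasure_compact_finite[OF compact_cball]
    by (intro integrable_real_indicator) auto
  have [measurable]: "h \<in> borel_measurable borel"
    using h by (intro borel_measurable_continuous_onI smooth_continuous)
  have H: "H x = (\<integral>y. h y \<partial>lborel)" if "x \<in> ball 0 1" for x
  proof -
    have "a y * h (1 *\<^sub>R x + y) = h (x + 1 *\<^sub>R y)" for y
    proof (cases "x + y \<in> S")
      case True
      have "norm y \<le> norm (x + y) + norm x" using norm_triangle_ineq4[of "x + y" x] by simp
      then have "norm y \<le> R + 1" using R[OF True] that by simp
      then show ?thesis by (simp add: a_def)
    qed (simp add: S)
    then have "H x = (\<integral>y. h (x + 1 *\<^sub>R y) \<partial>lborel)"
      unfolding H_def by (intro Bochner_Integration.integral_cong refl)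
    also have "\<dots> = (\<integral>y. h y \<partial>lborel)"
      by (subst lborel_integral_affine) auto
    finally show ?thesis .
  qed
  have "(H has_derivative (\<lambda>h. 0)) (at 0)"
    by (rule has_derivative_transform_within_open[where f="\<lambda>_. (\<integral>y. h y \<partial>lborel)" and s="ball 0 1"])
       (simp_all add: H)
  then have "0 = pd i H 0" by (simp add: pd_eqI)
  also have "\<dots> = (\<integral>y. a y * 1 * pd i h (1 *\<^sub>R 0 + y) \<partial>lborel)"
    unfolding H_def by (rule superposition_pd[OF h S a, of "\<lambda>_. 1" "\<lambda>y. y" 1]) auto
  also have "\<dots> = (\<integral>y. pd i h y \<partial>lborel)"
  proof (rule Bochner_Integration.integral_cong)
    fix y
    show "a y * 1 * pd i h (1 *\<^sub>R 0 + y) = pd i h y"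
    proof (cases "y \<in> S")
      case True
      then show ?thesis using R[OF True] by (simp add: a_def)
    qed (simp add: pd_zero_outside[OF compact_imp_closed[OF S(1)] S(2)])
  qed simp
  finally show ?thesis by simp
qed

lemma integral_pd_mult:
  fixes f g :: "real^'n::finite \<Rightarrow> real"
  assumes f: "smooth f" and g: "smooth g" and S: "compact S" "\<And>x. x \<notin> S \<Longrightarrow> g x = 0"
  shows "(\<integral>x. f x * pd i g x \<partial>lborel) = - (\<integral>x. pd i f x * g x \<partial>lborel)"
proof -
  have z: "x \<notin> S \<Longrightarrow> pd i g x = 0" for x
    by (rule pd_zero_outside[OF compact_imp_closed[OF S(1)] S(2)])
  have 1: "integrable lborel (\<lambda>x. f x * pd i g x)" "integrable lborel (\<lambda>x. pd i f x * g x)"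
    by (rule integrable_continuous_compact_support[OF smooth_continuous[OF smooth_mult[OF f smooth_pd[OF g]]] S(1)],
        simp add: z,
        rule integrable_continuous_compact_support[OF smooth_continuous[OF smooth_mult[OF smooth_pd[OF f] g]] S(1)],
        simp add: S)
  have "x \<notin> S \<Longrightarrow> f x * g x = 0" for x by (simp add: S)
  from integral_pd_eq_0[OF smooth_mult[OF f g] S(1) this]
  have "0 = (\<integral>x. pd i (\<lambda>x. f x * g x) x \<partial>lborel)" by simp
  also have "\<dots> = (\<integral>x. f x * pd i g x + pd i f x * g x \<partial>lborel)"
    by (simp add: pd_mult smooth_differentiable f g)
  finally show ?thesis using 1 by simp
qed

section \<open>Symmetry of mixed partial derivatives\<close>

lemma conv_commute:
  assumes [measurable]: "K \<in> borel_measurable borel" "V \<in> borel_measurable borel"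
  shows "conv K V x = conv V K x"
  using lborel_integral_affine[of "-1" "\<lambda>y. V y * K (x - y)" x]
  by (simp add: conv_def mult.commute)

text \<open>As for any radial function, the second derivative has the form
  \<open>4 x_i x_j q - 2 \<delta>_ij g\<close>, which is visibly symmetric.\<close>

lemma pd_pd_bump_sym: "pd i (pd j (bump m)) x = pd j (pd i (bump m)) (x :: real^'a::finite)"
proof -
  define g where "g = (\<lambda>x::real^'a. bump (m + 2) x - real m * bump (m + 1) x)"
  define q where "q = bump (m + 4) x - real (m + 2) * bump (m + 3) x - real m * (bump (m + 3) x - real (m + 1) * bump (m + 2) x)"
  have g: "smooth g" unfolding g_def by (intro smooth_diff smooth_mult smooth_const smooth_bump)
  have 1: "pd j (bump m) = (\<lambda>x. -2 * (x $ j * g x))" for j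
    by (intro ext) (simp add: pd_bump g_def)
  have 2: "pd i g x = -2 * x $ i * q" for i
    unfolding g_def pd_diff[OF smooth_bump smooth_mult[OF smooth_const smooth_bump]] pd_cmult[OF smooth_bump] pd_bump q_def
    by (simp add: algebra_simps eval_nat_numeral)
  have 3: "pd i (\<lambda>x. -2 * (x $ j * g x)) x = -2 * (x $ j * pd i g x + pd i (\<lambda>x. x $ j) x * g x)" for i j
    by (subst pd_cmult[OF smooth_mult[OF smooth_nth g]], subst pd_mult)
       (simp_all only: smooth_differentiable[OF smooth_nth] smooth_differentiable[OF g])
  show ?thesis unfolding 1 3 2 pd_nth by (cases "i = j") (simp_all add: mult_ac)
qed

lemma pd_pd_affine:
  fixes f :: "real^'n::finite \<Rightarrow> real"
  assumes "smooth f"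
  shows "pd i (pd j (\<lambda>x. b * f (c *\<^sub>R x))) x = b * c * c * pd i (pd j f) (c *\<^sub>R x)"
proof -
  have 1: "pd j (\<lambda>x. b * g (c *\<^sub>R x)) x = b * c * pd j g (c *\<^sub>R x)"
    if "smooth g" for g :: "real^'n \<Rightarrow> real" and b j x
    using pd_affine[of g c x 0 j] that smooth_affine[OF that, of c 0]
    by (simp add: pd_cmult smooth_differentiable)
  have "pd j (\<lambda>x. b * f (c *\<^sub>R x)) = (\<lambda>x. b * c * pd j f (c *\<^sub>R x))"
    using 1[OF assms] by auto
  then show ?thesis using 1[OF smooth_pd[OF assms]] by simp
qed

text \<open>Mixed partials of the mollifier commute by an explicit computation, and the derivatives
  in a convolution can be moved to either factor.\<close>

lemma pd_commute:
  fixes f :: "real^'n::finite \<Rightarrow> real"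
  assumes f: "smooth f" and S: "compact S" "\<And>x. x \<notin> S \<Longrightarrow> f x = 0"
  shows "pd i (pd j f) = pd j (pd i f)"
proof
  fix x
  have cl: "closed S" using S(1) by (rule compact_imp_closed)
  have z1: "x \<notin> S \<Longrightarrow> pd j f x = 0" for x j by (rule pd_zero_outside[OF cl S(2)])
  have z2: "x \<notin> S \<Longrightarrow> pd i (pd j f) x = 0" for x i j by (rule pd_zero_outside[OF cl z1])
  have m: "g \<in> borel_measurable borel" if "smooth g" for g :: "real^'n \<Rightarrow> real"
    by (rule borel_measurable_continuous_onI[OF smooth_continuous[OF that]])
  have int: "integrable lborel f"
    by (rule integrable_continuous_compact_support[OF smooth_continuous[OF f] S])
  have eq: "conv (mol t) (pd i (pd j f)) x = conv (pd i (pd j (mol t))) f x" if t: "t > 0" for t x i j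
  proof -
    have mz: "x \<notin> cball 0 t \<Longrightarrow> mol t x = 0" for x :: "real^'n" using t by (simp add: mol_zero)
    have mz1: "x \<notin> cball 0 t \<Longrightarrow> pd j (mol t) x = 0" for x :: "real^'n" and j
      by (rule pd_zero_outside[OF closed_cball mz])
    have "conv (mol t) (pd i (pd j f)) x = conv (pd i (pd j f)) (mol t) x"
      by (rule conv_commute[OF m[OF smooth_mol] m[OF smooth_pd[OF smooth_pd[OF f]]]])
    also have "conv (pd i (pd j f)) (mol t) = pd i (conv (pd j f) (mol t))"
      by (rule conv_pd[symmetric, OF smooth_pd[OF f] S(1) z1 integrable_mol[OF t]])
    also have "conv (pd j f) (mol t) = pd j (conv f (mol t))"
      by (rule conv_pd[symmetric, OF f S integrable_mol[OF t]])
    also have "conv f (mol t) = conv (mol t) f"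
      by (rule ext) (rule conv_commute[OF m[OF f] m[OF smooth_mol]])
    also have "pd j (conv (mol t) f) = conv (pd j (mol t)) f"
      by (rule conv_pd[OF smooth_mol compact_cball mz int])
    also have "pd i (conv (pd j (mol t)) f) = conv (pd i (pd j (mol t))) f"
      by (rule conv_pd[OF smooth_pd[OF smooth_mol] compact_cball mz1 int])
    finally show ?thesis .
  qed
  have sym: "pd i (pd j (mol t)) = pd j (pd i (mol t :: real^'n \<Rightarrow> real))" for t
    unfolding mol_def[abs_def] by (intro ext) (simp only: pd_pd_affine[OF smooth_bump], subst pd_pd_bump_sym, rule refl)
  \<comment> \<open>Both orders agree after mollification at every scale; a small scale brings each
    within \<open>e / 2\<close> of its pointwise value.\<close>
  have "\<bar>pd i (pd j f) x - pd j (pd i f) x\<bar> \<le> e" if e: "e > 0" for e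
  proof -
    have "\<exists>d>0. \<forall>y. dist y x < d \<longrightarrow> \<bar>pd i (pd j f) y - pd i (pd j f) x\<bar> < e/2" for i j
      using smooth_continuous[OF smooth_pd[OF smooth_pd[OF f]], of UNIV i j, unfolded continuous_on_iff, THEN bspec[of _ _ x], OF UNIV_I, THEN spec[of _ "e/2"]] e
      by (simp add: dist_real_def)
    then obtain d1 d2 where d: "d1 > 0" "\<And>y. dist y x < d1 \<Longrightarrow> \<bar>pd i (pd j f) y - pd i (pd j f) x\<bar> < e/2"
      "d2 > 0" "\<And>y. dist y x < d2 \<Longrightarrow> \<bar>pd j (pd i f) y - pd j (pd i f) x\<bar> < e/2" by metis
    define t where "t = min d1 d2 / 2"
    have t: "t > 0" "t < d1" "t < d2" using d by (auto simp: t_def)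
    have I: "integrable lborel (pd i (pd j f))" for i j
      by (rule integrable_continuous_compact_support[OF smooth_continuous[OF smooth_pd[OF smooth_pd[OF f]]] S(1) z2])
    have "\<bar>conv (mol t) (pd i (pd j f)) x - pd i (pd j f) x\<bar> \<le> e/2"
      by (rule conv_mol_close[OF t(1) I]) (rule less_imp_le, rule d(2), use t in linarith)
    moreover have "\<bar>conv (mol t) (pd j (pd i f)) x - pd j (pd i f) x\<bar> \<le> e/2"
      by (rule conv_mol_close[OF t(1) I]) (rule less_imp_le, rule d(4), use t in linarith)
    ultimately show ?thesis unfolding eq[OF t(1)] sym by linarith
  qed
  then have "\<bar>pd i (pd j f) x - pd j (pd i f) x\<bar> \<le> 0"
    using field_le_epsilon[of "\<bar>pd i (pd j f) x - pd j (pd i f) x\<bar>" 0] by simp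
  then show "pd i (pd j f) x = pd j (pd i f) x" by simp
qed

lemma norm_grad_square: "(norm (grad f x))\<^sup>2 = (\<Sum>i\<in>UNIV. (pd i f x)\<^sup>2)"
  by (simp only: power2_norm_eq_inner inner_vec_def grad_nth) (simp add: power2_eq_square)

text \<open>Two integrations by parts and the symmetry of mixed derivatives turn the square of
  \<open>pd i (pd j H)\<close> into the product of \<open>pd i (pd i H)\<close> and
  \<open>pd j (pd j H)\<close>. Summed over i and j this equates the \<open>L^2\<close> norms of
  Hessian and Laplacian; the left side is one row of the Hessian.\<close>

lemma integral_grad_pd_le_laplace:
  fixes H :: "real^'n::finite \<Rightarrow> real"
  assumes H: "smooth H" and S: "compact S" "\<And>x. x \<notin> S \<Longrightarrow> H x = 0"
  shows "(\<integral>x. (norm (grad (pd j H) x))\<^sup>2 \<partial>lborel) \<le> (\<integral>x. (\<Sum>i\<in>UNIV. pd i (pd i H) x)\<^sup>2 \<partial>lborel)"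
proof -
  have cl: "closed S" using S(1) by (rule compact_imp_closed)
  have z1: "x \<notin> S \<Longrightarrow> pd j H x = 0" for x j by (rule pd_zero_outside[OF cl S(2)])
  have z2: "x \<notin> S \<Longrightarrow> pd i (pd j H) x = 0" for x i j by (rule pd_zero_outside[OF cl z1])
  have I: "integrable lborel (\<lambda>x. pd i (pd j H) x * pd k (pd l H) x)" for i j k l
    by (rule integrable_continuous_compact_support[OF smooth_continuous[OF smooth_mult[OF smooth_pd[OF smooth_pd[OF H]]
          smooth_pd[OF smooth_pd[OF H]]]] S(1)]) (simp add: z2)
  have key: "(\<integral>x. (pd i (pd j H) x)\<^sup>2 \<partial>lborel) = (\<integral>x. pd i (pd i H) x * pd j (pd j H) x \<partial>lborel)" for i j
  proof -
    have "(\<integral>x. (pd i (pd j H) x)\<^sup>2 \<partial>lborel) = - (\<integral>x. pd i (pd i (pd j H)) x * pd j H x \<partial>lborel)"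
      unfolding power2_eq_square by (rule integral_pd_mult[OF smooth_pd[OF smooth_pd[OF H]] smooth_pd[OF H] S(1) z1])
    also have "pd i (pd i (pd j H)) = pd j (pd i (pd i H))"
      using pd_commute[OF H S, of i j] pd_commute[OF smooth_pd[OF H] S(1) z1, of i j i] by simp
    also have "- (\<integral>x. pd j (pd i (pd i H)) x * pd j H x \<partial>lborel) = (\<integral>x. pd i (pd i H) x * pd j (pd j H) x \<partial>lborel)"
      using integral_pd_mult[OF smooth_pd[OF H] smooth_pd[OF smooth_pd[OF H]] S(1) z2, of j j i i]
      by (simp add: mult.commute)
    finally show ?thesis .
  qed
  have "(\<integral>x. (norm (grad (pd j H) x))\<^sup>2 \<partial>lborel) = (\<Sum>i\<in>UNIV. (\<integral>x. (pd i (pd j H) x)\<^sup>2 \<partial>lborel))"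
    unfolding norm_grad_square using I by (subst Bochner_Integration.integral_sum) (auto simp: power2_eq_square)
  also have "\<dots> \<le> (\<Sum>k\<in>UNIV. \<Sum>i\<in>UNIV. (\<integral>x. (pd i (pd k H) x)\<^sup>2 \<partial>lborel))"
    using member_le_sum[of j UNIV "\<lambda>k. \<Sum>i\<in>UNIV. (\<integral>x. (pd i (pd k H) x)\<^sup>2 \<partial>lborel)"]
    by (simp add: sum_nonneg)
  also have "\<dots> = (\<integral>x. (\<Sum>k\<in>UNIV. \<Sum>i\<in>UNIV. pd i (pd i H) x * pd k (pd k H) x) \<partial>lborel)"
    unfolding key using I by (subst Bochner_Integration.integral_sum, simp)+ simp
  also have "\<dots> = (\<integral>x. (\<Sum>i\<in>UNIV. pd i (pd i H) x)\<^sup>2 \<partial>lborel)"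
    by (simp add: power2_eq_square sum_product mult.commute)
  finally show ?thesis .
qed

lemma conv_mol_abs_le:
  assumes "t > 0" "\<And>x. \<bar>W x\<bar> \<le> A"
  shows "\<bar>conv (mol t) W x\<bar> \<le> A"
  using conv_abs_le[where K="mol t" and V=W, OF integrable_mol[OF assms(1)] assms(2)]
    integral_mol[OF assms(1), where 'n='a] mol_nonneg[OF assms(1), where 'a='a]
  by simp

context
  fixes \<eta> T :: real and W :: "real^'n::finite \<Rightarrow> real" and A R :: real
  assumes \<eta>: "0 < \<eta>" "\<eta> < T"
    and W [measurable]: "W \<in> borel_measurable borel" and A: "\<And>x. \<bar>W x\<bar> \<le> A"
    and R: "\<And>x. norm x > R \<Longrightarrow> W x = 0"
begin

lemma W_integrable: "integrable lborel W"
  by (rule integrable_compact_support[of _ "cball 0 R" A]) (use A R in auto)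

lemma conv_ker_smooth: "smooth (conv (ker \<eta> T) W)"
  by (rule conv_smooth[OF smooth_ker[OF \<eta>] compact_cball[of 0 T] _ W_integrable]) (auto simp: ker_zero[OF \<eta>])

lemma conv_ker_pd: "pd i (conv (ker \<eta> T) W) = conv (pd i (ker \<eta> T)) W"
  by (rule conv_pd[OF smooth_ker[OF \<eta>] compact_cball[of 0 T] _ W_integrable]) (auto simp: ker_zero[OF \<eta>])

lemma pd_ker_zero: "norm x > T \<Longrightarrow> pd i (ker \<eta> T) x = 0"
  by (rule pd_zero_outside[of "cball 0 T"]) (auto simp: ker_zero[OF \<eta>])

lemma conv_ker_pd_pd: "pd j (pd i (conv (ker \<eta> T) W)) = conv (pd j (pd i (ker \<eta> T))) W"
  unfolding conv_ker_pd
  by (rule conv_pd[OF smooth_pd[OF smooth_ker[OF \<eta>]] compact_cball[of 0 T] _ W_integrable]) (auto simp: pd_ker_zero)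

lemma conv_ker_laplace:
  "(\<Sum>i\<in>UNIV. pd i (pd i (conv (ker \<eta> T) W)) x) = conv (mol T) W x - conv (mol \<eta>) W x"
proof -
  have I: "integrable lborel (\<lambda>y. W y * pd i (pd i (ker \<eta> T)) (x - y))" for i
    by (rule conv_integrable[OF smooth_pd[OF smooth_pd[OF smooth_ker[OF \<eta>]]] compact_cball[of 0 T] _ W_integrable])
       (auto intro: pd_zero_outside[of "cball 0 T"] simp: pd_ker_zero)
  have J: "integrable lborel (\<lambda>y. W y * mol t (x - y))" if "t > 0" for t
    by (rule conv_integrable[OF smooth_mol compact_cball[of 0 t] _ W_integrable]) (auto simp: mol_zero that)
  have "(\<Sum>i\<in>UNIV. pd i (pd i (conv (ker \<eta> T) W)) x) = (\<integral>y. (\<Sum>i\<in>UNIV. W y * pd i (pd i (ker \<eta> T)) (x - y)) \<partial>lborel)"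
    unfolding conv_ker_pd_pd conv_def using I by (subst Bochner_Integration.integral_sum) auto
  also have "\<dots> = (\<integral>y. W y * mol T (x - y) - W y * mol \<eta> (x - y) \<partial>lborel)"
    by (simp add: sum_distrib_left[symmetric] laplace_ker[OF \<eta>] right_diff_distrib)
  also have "\<dots> = conv (mol T) W x - conv (mol \<eta>) W x"
    unfolding conv_def using J \<eta> by (subst Bochner_Integration.integral_diff) auto
  finally show ?thesis .
qed

lemma conv_ker_zero: "norm x > R + T \<Longrightarrow> conv (ker \<eta> T) W x = 0"
proof (rule conv_zero)
  fix y assume "norm x > R + T" "W y \<noteq> 0"
  then have "norm y \<le> R" using R[of y] by fastforce
  with \<open>norm x > R + T\<close> have "norm (x - y) > T"
    using norm_triangle_ineq2[of x y] by linarith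
  then show "ker \<eta> T (x - y) = 0" by (rule ker_zero[OF \<eta>])
qed

text \<open>The Laplacian of the potential is a difference of two averages of \<open>W\<close>,
  hence at most 2 A and supported in the ball of radius R + T. The Hessian inherits an
  \<open>L^2\<close> bound in which \<eta> does not occur.\<close>

lemma conv_ker_L2:
  "(\<integral>x. (norm (grad (conv (pd j (ker \<eta> T)) W) x))\<^sup>2 \<partial>lborel) \<le> 4 * A\<^sup>2 * measure lborel (cball (0::real^'n) (R + T))"
proof -
  let ?L = "\<lambda>x. \<Sum>i\<in>UNIV. pd i (pd i (conv (ker \<eta> T) W)) x"
  have L: "\<bar>?L x\<bar> \<le> 2 * A" for x
    using conv_mol_abs_le[of \<eta> W A x] conv_mol_abs_le[of T W A x] \<eta> A
    unfolding conv_ker_laplace by fastforce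
  have z: "?L x = 0" if "x \<notin> cball 0 (R + T)" for x
  proof -
    have z: "x \<notin> cball 0 (R + T) \<Longrightarrow> conv (ker \<eta> T) W x = 0" for x
      using conv_ker_zero[of x] by simp
    have "x \<notin> cball 0 (R + T) \<Longrightarrow> pd i (conv (ker \<eta> T) W) x = 0" for x i
      by (rule pd_zero_outside[OF closed_cball z])
    from pd_zero_outside[OF closed_cball this that] have "pd i (pd i (conv (ker \<eta> T) W)) x = 0" for i .
    then show ?thesis by simp
  qed
  have "(\<integral>x. (norm (grad (conv (pd j (ker \<eta> T)) W) x))\<^sup>2 \<partial>lborel) \<le> (\<integral>x. (?L x)\<^sup>2 \<partial>lborel)"
    unfolding conv_ker_pd[symmetric]
    by (rule integral_grad_pd_le_laplace[OF conv_ker_smooth compact_cball[of 0 "R + T"]])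
       (auto simp: conv_ker_zero)
  also have "\<dots> \<le> norm (\<integral>x. (?L x)\<^sup>2 \<partial>lborel)" by simp
  also have "\<dots> \<le> (\<integral>x. 4 * A\<^sup>2 * indicator (cball (0::real^'n) (R + T)) x \<partial>lborel)"
  proof (rule norm_integral_le)
    show "integrable lborel (\<lambda>x::real^'n. 4 * A\<^sup>2 * indicator (cball 0 (R + T)) x)"
      using emeasure_compact_finite[OF compact_cball, of "0::real^'n" "R + T"]
      by (intro integrable_mult_right integrable_real_indicator) auto
    fix x
    have "(?L x)\<^sup>2 \<le> (2 * A)\<^sup>2" using L[of x] power_mono[of "\<bar>?L x\<bar>" "2 * A" 2] by simp
    then show "norm ((?L x)\<^sup>2) \<le> 4 * A\<^sup>2 * indicator (cball 0 (R + T)) x"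
      using z[of x] by (cases "x \<in> cball 0 (R + T)") (auto simp: power_mult_distrib)
  qed
  finally show ?thesis by simp
qed

end

section \<open>Maximal functions and Lipschitz extension\<close>

lemma measure_ball_cart:
  "r \<ge> 0 \<Longrightarrow> measure lborel (ball (x::real^'n::finite) r) = unit_ball_vol (real CARD('n)) * r ^ CARD('n)"
  by (simp add: content_ball)

lemma ball_borel [measurable]: "ball (x::'a::metric_space) r \<in> sets borel"
  by simp

text \<open>Cauchy-Schwarz for the derivative along the segment from x to z, stated in
  \<open>ennreal\<close> so that Tonelli can be applied to it.\<close>

lemma square_increment_le:
  fixes G :: "real^'n::finite \<Rightarrow> real"
  assumes G: "smooth G"
  shows "ennreal ((G z - G x)\<^sup>2)
    \<le> (\<integral>\<^sup>+t. indicator {0..1} t * ennreal ((norm (grad G (x + t *\<^sub>R (z - x))))\<^sup>2 * (norm (z - x))\<^sup>2) \<partial>lborel)"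
proof -
  define h where "h = (\<lambda>t. G (x + t *\<^sub>R (z - x)))"
  define h' where "h' = (\<lambda>t. grad G (x + t *\<^sub>R (z - x)) \<bullet> (z - x))"
  define e where "e = (\<lambda>t. (norm (grad G (x + t *\<^sub>R (z - x))))\<^sup>2 * (norm (z - x))\<^sup>2)"
  define c where "c = G z - G x"
  have cg: "continuous_on UNIV (\<lambda>t. grad G (x + t *\<^sub>R (z - x)))"
    by (rule continuous_on_compose2[OF continuous_on_grad[OF G, of UNIV]]) (auto intro!: continuous_intros)
  have ch': "continuous_on S h'" and ce: "continuous_on S e" for S
    unfolding h'_def e_def
    by (intro continuous_intros continuous_on_subset[OF cg]; simp)+
  have d: "(h has_vector_derivative h' t) (at t within {0..1})" for t
  proof -
    have "(h has_derivative (\<lambda>s. grad G (x + t *\<^sub>R (z - x)) \<bullet> (s *\<^sub>R (z - x)))) (at t)"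
      unfolding h_def
      by (rule has_derivative_compose[where g=G and f="\<lambda>t. x + t *\<^sub>R (z - x)", OF _ has_derivative_grad[OF smooth_differentiable[OF G]]])
         (auto intro!: derivative_eq_intros)
    then show ?thesis
      unfolding has_vector_derivative_def h'_def by (auto intro: has_derivative_at_withinI)
  qed
  have 1: "(\<integral>t. indicator {0..1} t *\<^sub>R h' t \<partial>lborel) = c"
    using integral_FTC_Icc[of 0 1 h h'] d ch' by (simp add: h_def c_def)
  have i1: "integrable lborel (\<lambda>t. indicator {0..1} t *\<^sub>R h' t)"
    and i2: "integrable lborel (\<lambda>t. indicator {0..1} t *\<^sub>R (h' t * h' t))"
    and i3: "integrable lborel (\<lambda>t. indicator {0..1} t *\<^sub>R e t)"
    using borel_integrable_atLeastAtMost'[of 0 1 h'] borel_integrable_atLeastAtMost'[of 0 1 "\<lambda>t. h' t * h' t"]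
      borel_integrable_atLeastAtMost'[of 0 1 e] ch' ce
    by (auto simp: set_integrable_def intro!: continuous_on_mult)
  \<comment> \<open>Expanding the variance of \<open>h'\<close> about its mean \<open>c\<close>
    bounds the square of the mean by the mean of the square.\<close>
  have "0 \<le> (\<integral>t. indicator {0..1} t *\<^sub>R (h' t - c)\<^sup>2 \<partial>lborel)"
    by (rule Bochner_Integration.integral_nonneg) (simp add: indicator_def)
  also have "\<dots> = (\<integral>t. indicator {0..1} t *\<^sub>R (h' t * h' t) - (2 * c) * (indicator {0..1} t *\<^sub>R h' t) + c\<^sup>2 * indicat_real {0..1} t \<partial>lborel)"
    by (rule Bochner_Integration.integral_cong) (auto simp: indicator_def power2_eq_square algebra_simps)
  also have "\<dots> = (\<integral>t. indicator {0..1} t *\<^sub>R (h' t * h' t) \<partial>lborel) - (2 * c) * c + c\<^sup>2"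
  proof -
    have iC: "integrable lborel (\<lambda>t::real. c\<^sup>2 * indicat_real {0..1} t)"
      by (intro integrable_mult_right integrable_real_indicator) auto
    have iB: "integrable lborel (\<lambda>t. (2 * c) * (indicator {0..1} t *\<^sub>R h' t))"
      by (intro integrable_mult_right i1)
    have C: "(\<integral>t. c\<^sup>2 * indicat_real {0..1} (t::real) \<partial>lborel) = c\<^sup>2" by simp
    have B: "(\<integral>t. (2 * c) * (indicator {0..1} t *\<^sub>R h' t) \<partial>lborel) = (2 * c) * c"
      by (simp only: integral_mult_right_zero 1)
    show ?thesis
      by (simp only: Bochner_Integration.integral_add[OF Bochner_Integration.integrable_diff[OF i2 iB] iC]
          Bochner_Integration.integral_diff[OF i2 iB] B C)
  qed
  finally have "c\<^sup>2 \<le> (\<integral>t. indicator {0..1} t *\<^sub>R (h' t * h' t) \<partial>lborel)"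
    by (simp add: power2_eq_square)
  also have "\<dots> \<le> (\<integral>t. indicator {0..1} t *\<^sub>R e t \<partial>lborel)"
  proof (rule integral_mono[OF i2 i3])
    fix t
    have "\<bar>h' t\<bar>\<^sup>2 \<le> (norm (grad G (x + t *\<^sub>R (z - x))) * norm (z - x))\<^sup>2"
      unfolding h'_def by (intro power_mono Cauchy_Schwarz_ineq2) simp
    then have "h' t * h' t \<le> e t" by (simp add: e_def power_mult_distrib power2_eq_square mult_ac)
    then show "indicat_real {0..1} t *\<^sub>R (h' t * h' t) \<le> indicat_real {0..1} t *\<^sub>R e t"
      by (simp add: indicator_def)
  qed
  finally have "ennreal (c\<^sup>2) \<le> ennreal (\<integral>t. indicator {0..1} t *\<^sub>R e t \<partial>lborel)" by (rule ennreal_leI)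
  also have "\<dots> = (\<integral>\<^sup>+t. ennreal (indicator {0..1} t *\<^sub>R e t) \<partial>lborel)"
    by (rule nn_integral_eq_integral[symmetric, OF i3]) (simp add: e_def indicator_def)
  also have "\<dots> = (\<integral>\<^sup>+t. indicator {0..1} t * ennreal (e t) \<partial>lborel)"
    by (rule nn_integral_cong) (simp add: indicator_def)
  finally show ?thesis by (simp add: c_def e_def)
qed

definition energy_on :: "(real^'n::finite \<Rightarrow> real) \<Rightarrow> (real^'n) set \<Rightarrow> ennreal" where
  "energy_on G S = (\<integral>\<^sup>+y. indicator S y * ennreal ((norm (grad G y))\<^sup>2) \<partial>lborel)"

text \<open>The set where the Hardy-Littlewood maximal function of the squared gradient exceeds \<open>l\<^sup>2\<close>.\<close>

definition bad :: "(real^'n::finite \<Rightarrow> real) \<Rightarrow> real \<Rightarrow> (real^'n) set" where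
  "bad G l = {x. \<exists>r>0. ennreal (l\<^sup>2 * measure lborel (ball x r)) < energy_on G (ball x r)}"

lemma energy_on_mono: "S \<subseteq> T \<Longrightarrow> energy_on G S \<le> energy_on G T"
  unfolding energy_on_def by (intro nn_integral_mono) (auto simp: indicator_def)

lemma measurable_grad: "smooth G \<Longrightarrow> grad G \<in> borel_measurable borel"
  by (rule borel_measurable_continuous_onI[OF continuous_on_grad])

text \<open>A Poincare inequality centred at x. When the segment bound is integrated over z, the
  dilation by t maps the ball of radius r to that of radius t r, and its Jacobian \<open>t^n\<close>
  cancels against the volume in the maximal bound, which is used at every radius t r.\<close>

lemma good_ball_oscillation:
  fixes G :: "real^'n::finite \<Rightarrow> real"
  assumes G: "smooth G" and x: "x \<notin> bad G l" and r: "r > 0"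
  shows "(\<integral>\<^sup>+z. indicator (ball x r) z * ennreal ((G z - G x)\<^sup>2) \<partial>lborel)
     \<le> ennreal (r\<^sup>2 * l\<^sup>2 * measure lborel (ball x r))"
proof -
  note [measurable] = measurable_grad[OF G]
  have [measurable]: "ball x s \<in> sets borel" for s by simp
  let ?N = "CARD('n)"
  let ?e = "\<lambda>y. ennreal ((norm (grad G y))\<^sup>2)"
  have "(\<integral>\<^sup>+z. indicator (ball x r) z * ennreal ((G z - G x)\<^sup>2) \<partial>lborel)
     \<le> (\<integral>\<^sup>+z. \<integral>\<^sup>+t. ennreal (r\<^sup>2) * (indicator {0..1} t * (indicator (ball x r) z * ?e (x + t *\<^sub>R (z - x)))) \<partial>lborel \<partial>lborel)"
  proof (rule nn_integral_mono)
    fix z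
    show "indicator (ball x r) z * ennreal ((G z - G x)\<^sup>2)
      \<le> (\<integral>\<^sup>+t. ennreal (r\<^sup>2) * (indicator {0..1} t * (indicator (ball x r) z * ?e (x + t *\<^sub>R (z - x)))) \<partial>lborel)"
    proof (cases "z \<in> ball x r")
      case True
      have "ennreal ((G z - G x)\<^sup>2)
         \<le> (\<integral>\<^sup>+t. indicator {0..1} t * ennreal ((norm (grad G (x + t *\<^sub>R (z - x))))\<^sup>2 * (norm (z - x))\<^sup>2) \<partial>lborel)"
        by (rule square_increment_le[OF G])
      also have "\<dots> \<le> (\<integral>\<^sup>+t. ennreal (r\<^sup>2) * (indicator {0..1} t * ?e (x + t *\<^sub>R (z - x))) \<partial>lborel)"
      proof (rule nn_integral_mono)
        fix t
        have "(norm (z - x))\<^sup>2 \<le> r\<^sup>2"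
          using True by (intro power_mono) (auto simp: dist_norm norm_minus_commute)
        then have "(norm (grad G (x + t *\<^sub>R (z - x))))\<^sup>2 * (norm (z - x))\<^sup>2 \<le> r\<^sup>2 * (norm (grad G (x + t *\<^sub>R (z - x))))\<^sup>2"
          by (subst mult.commute) (intro mult_right_mono, auto)
        then have "ennreal ((norm (grad G (x + t *\<^sub>R (z - x))))\<^sup>2 * (norm (z - x))\<^sup>2) \<le> ennreal (r\<^sup>2) * ?e (x + t *\<^sub>R (z - x))"
          by (simp add: ennreal_mult[symmetric] ennreal_leI)
        then show "indicator {0..1} t * ennreal ((norm (grad G (x + t *\<^sub>R (z - x))))\<^sup>2 * (norm (z - x))\<^sup>2)
          \<le> ennreal (r\<^sup>2) * (indicator {0..1} t * ?e (x + t *\<^sub>R (z - x)))"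
          by (simp add: indicator_def)
      qed
      finally show ?thesis using True by simp
    qed simp
  qed
  also have "\<dots> = (\<integral>\<^sup>+t. \<integral>\<^sup>+z. ennreal (r\<^sup>2) * (indicator {0..1} t * (indicator (ball x r) z * ?e (x + t *\<^sub>R (z - x)))) \<partial>lborel \<partial>lborel)"
    by (rule lborel_pair.Fubini') measurable
  also have "\<dots> \<le> (\<integral>\<^sup>+t. indicator {0..1} (t::real) * ennreal (r\<^sup>2 * l\<^sup>2 * measure lborel (ball x r)) \<partial>lborel)"
  proof (rule nn_integral_mono_AE)
    have main: "(\<integral>\<^sup>+z. ennreal (r\<^sup>2) * (indicator {0..1} t * (indicator (ball x r) z * ?e (x + t *\<^sub>R (z - x)))) \<partial>lborel)
       \<le> indicator {0..1} t * ennreal (r\<^sup>2 * l\<^sup>2 * measure lborel (ball x r))" if "t \<noteq> 0" for t :: real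
    proof (cases "t \<in> {0..1}")
      case True
      with that have t: "t > 0" by auto
      have "energy_on G (ball x (t * r)) = ennreal (\<bar>t\<bar> ^ ?N) *
          (\<integral>\<^sup>+z. indicator (ball x (t * r)) ((x - t *\<^sub>R x) + t *\<^sub>R z) * ?e ((x - t *\<^sub>R x) + t *\<^sub>R z) \<partial>lborel)"
        unfolding energy_on_def
        by (subst lborel_nn_integral_affine[where c=t and y="x - t *\<^sub>R x"]) (use t in \<open>simp_all\<close>, measurable)
      also have "(\<lambda>z. indicator (ball x (t * r)) ((x - t *\<^sub>R x) + t *\<^sub>R z) * ?e ((x - t *\<^sub>R x) + t *\<^sub>R z))
         = (\<lambda>z. indicator (ball x r) z * ?e (x + t *\<^sub>R (z - x)))"
      proof
        fix z
        have *: "(x - t *\<^sub>R x) + t *\<^sub>R z = x + t *\<^sub>R (z - x)" by (simp add: algebra_simps)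
        have "x + t *\<^sub>R (z - x) \<in> ball x (t * r) \<longleftrightarrow> z \<in> ball x r"
          using t by (simp add: dist_norm norm_minus_commute)
        then show "indicator (ball x (t * r)) ((x - t *\<^sub>R x) + t *\<^sub>R z) * ?e ((x - t *\<^sub>R x) + t *\<^sub>R z)
           = indicator (ball x r) z * ?e (x + t *\<^sub>R (z - x))"
          unfolding * by (simp add: indicator_def)
      qed
      finally have E: "energy_on G (ball x (t * r)) = ennreal (t ^ ?N) * (\<integral>\<^sup>+z. indicator (ball x r) z * ?e (x + t *\<^sub>R (z - x)) \<partial>lborel)"
        using t by simp
      have "energy_on G (ball x (t * r)) \<le> ennreal (l\<^sup>2 * measure lborel (ball x (t * r)))"
      proof -
        have "\<not> ennreal (l\<^sup>2 * measure lborel (ball x (t * r))) < energy_on G (ball x (t * r))"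
          using x t r unfolding bad_def mem_Collect_eq by (meson mult_pos_pos)
        then show ?thesis by (simp add: not_less)
      qed
      also have "\<dots> = ennreal (t ^ ?N) * ennreal (l\<^sup>2 * measure lborel (ball x r))"
        using t r by (simp add: measure_ball_cart power_mult_distrib ennreal_mult[symmetric] mult_ac del: ennreal_mult')
      finally have le: "(\<integral>\<^sup>+z. indicator (ball x r) z * ?e (x + t *\<^sub>R (z - x)) \<partial>lborel) \<le> ennreal (l\<^sup>2 * measure lborel (ball x r))"
        unfolding E using t by (subst (asm) ennreal_mult_le_mult_iff) auto
      have "(\<integral>\<^sup>+z. ennreal (r\<^sup>2) * (indicator {0..1} t * (indicator (ball x r) z * ?e (x + t *\<^sub>R (z - x)))) \<partial>lborel)
          = (\<integral>\<^sup>+z. ennreal (r\<^sup>2) * (indicator (ball x r) z * ?e (x + t *\<^sub>R (z - x))) \<partial>lborel)"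
        using True by (intro nn_integral_cong) simp
      also have "\<dots> = ennreal (r\<^sup>2) * (\<integral>\<^sup>+z. indicator (ball x r) z * ?e (x + t *\<^sub>R (z - x)) \<partial>lborel)"
        by (rule nn_integral_cmult) measurable
      also have "ennreal (r\<^sup>2) * (\<integral>\<^sup>+z. indicator (ball x r) z * ?e (x + t *\<^sub>R (z - x)) \<partial>lborel)
         \<le> ennreal (r\<^sup>2) * ennreal (l\<^sup>2 * measure lborel (ball x r))"
        by (rule mult_left_mono[OF le]) simp
      also have "\<dots> = ennreal (r\<^sup>2 * l\<^sup>2 * measure lborel (ball x r))"
        by (simp add: ennreal_mult[symmetric] mult_ac)
      finally show ?thesis using True by simp
    qed simp
    \<comment> \<open>The dilation degenerates at t = 0, which is a null set.\<close>
    show "AE t in lborel. (\<integral>\<^sup>+z. ennreal (r\<^sup>2) * (indicator {0..1} t * (indicator (ball x r) z * ?e (x + t *\<^sub>R (z - x)))) \<partial>lborel)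
       \<le> indicator {0..1} t * ennreal (r\<^sup>2 * l\<^sup>2 * measure lborel (ball x r))"
      using AE_lborel_singleton[of "0::real"] by eventually_elim (rule main)
  qed
  also have "\<dots> = ennreal (r\<^sup>2 * l\<^sup>2 * measure lborel (ball x r))"
    by (simp add: nn_integral_multc)
  finally show ?thesis .
qed

text \<open>Both points are compared with a variable z in the ball about their midpoint of radius
  half their distance, which lies inside the ball of radius that distance about either point.
  Averaging over z costs the volume ratio \<open>2^n\<close>.\<close>

lemma good_lipschitz:
  fixes G :: "real^'n::finite \<Rightarrow> real"
  assumes G: "smooth G" and x: "x \<notin> bad G l" and y: "y \<notin> bad G l" and l: "l \<ge> 0"
  shows "\<bar>G x - G y\<bar> \<le> 2 ^ (CARD('n) + 1) * l * dist x y"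
proof (cases "x = y")
  case False
  let ?N = "CARD('n)"
  note [measurable] = borel_measurable_continuous_onI[OF smooth_continuous[OF G, of UNIV]]
  define r where "r = dist x y"
  define m where "m = midpoint x y"
  define w where "w = unit_ball_vol (real ?N)"
  have w: "w > 0" by (simp add: w_def)
  have r: "r > 0" using False by (simp add: r_def)
  have sub: "ball m (r/2) \<subseteq> ball x r" "ball m (r/2) \<subseteq> ball y r"
  proof -
    have "dist x m = r / 2" "dist y m = r / 2"
      by (simp_all add: m_def r_def dist_midpoint)
    then have "dist x z < r" "dist y z < r" if "dist m z < r / 2" for z
      using that dist_triangle[of x z m] dist_triangle[of y z m] by linarith+
    then show "ball m (r/2) \<subseteq> ball x r" "ball m (r/2) \<subseteq> ball y r" by auto
  qed
  have "ennreal ((G x - G y)\<^sup>2 * measure lborel (ball m (r/2)))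
     = (\<integral>\<^sup>+z. indicator (ball m (r/2)) z * ennreal ((G x - G y)\<^sup>2) \<partial>lborel)"
  proof -
    have "emeasure lborel (ball m (r/2)) = ennreal (measure lborel (ball m (r/2)))"
      using emeasure_bounded_finite[OF bounded_ball, of m "r/2"] by (simp add: emeasure_eq_ennreal_measure top.not_eq_extremum)
    then show ?thesis
      by (subst nn_integral_multc) (simp_all add: ennreal_mult' mult.commute borel_measurable_indicator)
  qed
  also have "\<dots> \<le> (\<integral>\<^sup>+z. 2 * (indicator (ball x r) z * ennreal ((G z - G x)\<^sup>2)) + 2 * (indicator (ball y r) z * ennreal ((G z - G y)\<^sup>2)) \<partial>lborel)"
  proof (rule nn_integral_mono)
    fix z
    show "indicator (ball m (r/2)) z * ennreal ((G x - G y)\<^sup>2)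
        \<le> 2 * (indicator (ball x r) z * ennreal ((G z - G x)\<^sup>2)) + 2 * (indicator (ball y r) z * ennreal ((G z - G y)\<^sup>2))"
    proof (cases "z \<in> ball m (r/2)")
      case True
      with sub have z: "z \<in> ball x r" "z \<in> ball y r" by auto
      have "(G x - G y)\<^sup>2 \<le> 2 * (G z - G x)\<^sup>2 + 2 * (G z - G y)\<^sup>2"
        using zero_le_power2[of "2 * G z - G x - G y"] by (simp add: power2_eq_square algebra_simps)
      then have "ennreal ((G x - G y)\<^sup>2) \<le> ennreal (2 * (G z - G x)\<^sup>2 + 2 * (G z - G y)\<^sup>2)" by (rule ennreal_leI)
      also have "\<dots> = 2 * ennreal ((G z - G x)\<^sup>2) + 2 * ennreal ((G z - G y)\<^sup>2)"
        by (simp add: ennreal_plus ennreal_mult)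
      finally show ?thesis using True z by simp
    qed simp
  qed
  also have "\<dots> = 2 * (\<integral>\<^sup>+z. indicator (ball x r) z * ennreal ((G z - G x)\<^sup>2) \<partial>lborel) + 2 * (\<integral>\<^sup>+z. indicator (ball y r) z * ennreal ((G z - G y)\<^sup>2) \<partial>lborel)"
  proof -
    have m: "(\<lambda>z. indicator (ball a r) z * ennreal ((G z - G a)\<^sup>2)) \<in> borel_measurable lborel" for a
      by measurable
    show ?thesis
      by (simp only: nn_integral_add[OF borel_measurable_times_ennreal[OF borel_measurable_const m]
            borel_measurable_times_ennreal[OF borel_measurable_const m]] nn_integral_cmult[OF m])
  qed
  also have "\<dots> \<le> 2 * ennreal (r\<^sup>2 * l\<^sup>2 * measure lborel (ball x r)) + 2 * ennreal (r\<^sup>2 * l\<^sup>2 * measure lborel (ball y r))"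
    by (intro add_mono mult_left_mono good_ball_oscillation G x y r) auto
  also have "\<dots> = ennreal (4 * (r\<^sup>2 * l\<^sup>2 * (w * r ^ ?N)))"
  proof -
    have "2 * ennreal a + 2 * ennreal a = ennreal (4 * a)" if "a \<ge> 0" for a
      using that by (simp add: ennreal_mult' distrib_right[symmetric])
    then show ?thesis using r by (simp add: measure_ball_cart w_def)
  qed
  finally have "(G x - G y)\<^sup>2 * (w * (r/2) ^ ?N) \<le> 4 * (r\<^sup>2 * l\<^sup>2 * (w * r ^ ?N))"
    using r w by (subst (asm) ennreal_le_iff) (auto simp: measure_ball_cart w_def)
  then have "(G x - G y)\<^sup>2 * (w * r ^ ?N) \<le> (4 * (r\<^sup>2 * l\<^sup>2) * 2 ^ ?N) * (w * r ^ ?N)"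
    by (simp add: power_divide field_simps)
  then have "(G x - G y)\<^sup>2 \<le> 4 * (r\<^sup>2 * l\<^sup>2) * 2 ^ ?N"
    using w r by (subst (asm) mult_le_cancel_right) auto
  \<comment> \<open>The ratio is enlarged to \<open>4^n\<close> so that the right side becomes a
    perfect square.\<close>
  also have "\<dots> \<le> 4 * (r\<^sup>2 * l\<^sup>2) * (2 ^ ?N * 2 ^ ?N)"
    by (intro mult_left_mono) (auto simp: mult_le_cancel_left1)
  also have "\<dots> = (2 ^ (?N + 1) * l * r)\<^sup>2"
    by (simp add: power_mult_distrib power2_eq_square mult_ac)
  finally have "\<bar>G x - G y\<bar> \<le> 2 ^ (?N + 1) * l * r"
    using l r by (subst (asm) abs_le_square_iff[symmetric]) simp
  then show ?thesis by (simp add: r_def)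
qed simp

text \<open>The weak-type estimate by Vitali covering: disjoint balls carry energy above
  \<open>l^2\<close> times their volume, and their fivefold enlargements cover. The conclusion gives
  a measurable superset, so measurability of \<open>bad G l\<close> itself is not at issue.\<close>

lemma bad_weak_type:
  fixes G :: "real^'n::finite \<Rightarrow> real"
  assumes G: "smooth G" and S: "compact S" "\<And>x. x \<notin> S \<Longrightarrow> G x = 0" and l: "l > 0"
    and D: "(\<integral>x. (norm (grad G x))\<^sup>2 \<partial>lborel) \<le> D"
  obtains M where "M \<in> fmeasurable lborel" "bad G l \<subseteq> M" "measure lborel M \<le> 5 ^ CARD('n) * D / l\<^sup>2"
proof -
  let ?N = "CARD('n)"
  define e where "e = (\<lambda>x. (norm (grad G x))\<^sup>2)"
  have e0: "e x \<ge> 0" for x by (simp add: e_def)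
  have int: "integrable lborel e"
    unfolding e_def
    by (rule integrable_continuous_compact_support[OF _ S(1)])
       (auto simp: grad_zero_outside[OF compact_imp_closed[OF S(1)] S(2)] intro!: continuous_intros continuous_on_grad[OF G])
  have inte: "integrable lborel (\<lambda>y. indicator (ball x r) y * e y)" for x r
    using integrable_mult_indicator[OF _ int, of "ball x r"] by simp
  have E: "energy_on G (ball x r) = ennreal (\<integral>y. indicator (ball x r) y * e y \<partial>lborel)" for x r
  proof -
    have "energy_on G (ball x r) = (\<integral>\<^sup>+y. ennreal (indicator (ball x r) y * e y) \<partial>lborel)"
      unfolding energy_on_def by (rule nn_integral_cong) (simp add: indicator_def e_def)
    also have "\<dots> = ennreal (\<integral>y. indicator (ball x r) y * e y \<partial>lborel)"
      by (rule nn_integral_eq_integral[OF inte]) (simp add: e0)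
    finally show ?thesis .
  qed
  define w where "w = unit_ball_vol (real ?N)"
  have w: "w > 0" by (simp add: w_def)
  have "\<exists>r>0. l\<^sup>2 * measure lborel (ball x r) < (\<integral>y. indicator (ball x r) y * e y \<partial>lborel)" if "x \<in> bad G l" for x
    using that l unfolding bad_def E by (auto simp: ennreal_less_iff)
  then obtain \<rho> where \<rho>: "\<And>x. x \<in> bad G l \<Longrightarrow> \<rho> x > 0"
    "\<And>x. x \<in> bad G l \<Longrightarrow> l\<^sup>2 * measure lborel (ball x (\<rho> x)) < (\<integral>y. indicator (ball x (\<rho> x)) y * e y \<partial>lborel)"
    by metis
  have le: "(\<integral>y. indicator (ball x r) y * e y \<partial>lborel) \<le> D" for x r
    by (rule order_trans[OF integral_mono[OF inte int] D[folded e_def]]) (use e0 in \<open>simp add: indicator_def\<close>)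
  \<comment> \<open>The covering lemma asks for bounded radii. A radius above 1 is at most its n-th
    power, which the total energy \<open>D\<close> controls through the volume.\<close>
  have bdd: "\<rho> x \<le> max 1 (D / (l\<^sup>2 * w))" if x: "x \<in> bad G l" for x
  proof (cases "\<rho> x \<le> 1")
    case False
    then have "\<rho> x \<le> \<rho> x ^ ?N" by (intro self_le_power) auto
    also have "l\<^sup>2 * (w * \<rho> x ^ ?N) < D"
      using \<rho>[OF x] le[of x "\<rho> x"] by (simp add: measure_ball_cart w_def)
    then have "\<rho> x ^ ?N \<le> D / (l\<^sup>2 * w)" using l w by (simp add: field_simps)
    finally show ?thesis by simp
  qed simp
  obtain C where C: "countable C" "C \<subseteq> bad G l"
    "pairwise (\<lambda>i j. disjnt (ball i (\<rho> i)) (ball j (\<rho> j))) C"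
    "bad G l \<subseteq> (\<Union>i\<in>C. ball i (5 * \<rho> i))"
  proof (rule Vitali_covering_lemma_balls[where S="bad G l" and K="bad G l" and a="\<lambda>x. x" and r=\<rho> and B="max 1 (D / (l\<^sup>2 * w))"])
    show "bad G l \<subseteq> (\<Union>i\<in>bad G l. ball i (\<rho> i))" using \<rho>(1) by force
  qed (use \<rho>(1) bdd in auto)
  \<comment> \<open>A bound uniform over finite subfamilies passes to the countable union.\<close>
  have fin: "measure lborel (\<Union>i\<in>I. ball i (5 * \<rho> i)) \<le> 5 ^ ?N * D / l\<^sup>2" if I: "I \<subseteq> C" "finite I" for I
  proof -
    have "measure lborel (\<Union>i\<in>I. ball i (5 * \<rho> i)) \<le> (\<Sum>i\<in>I. measure lborel (ball i (5 * \<rho> i)))"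
      by (rule measure_UNION_le[OF I(2)]) simp
    also have "\<dots> \<le> (\<Sum>i\<in>I. 5 ^ ?N / l\<^sup>2 * (\<integral>y. indicator (ball i (\<rho> i)) y * e y \<partial>lborel))"
    proof (rule sum_mono)
      fix i assume "i \<in> I"
      with I C have i: "i \<in> bad G l" by auto
      have "measure lborel (ball i (5 * \<rho> i)) = 5 ^ ?N / l\<^sup>2 * (l\<^sup>2 * measure lborel (ball i (\<rho> i)))"
        using \<rho>(1)[OF i] l by (simp add: measure_ball_cart power_mult_distrib)
      also have "\<dots> \<le> 5 ^ ?N / l\<^sup>2 * (\<integral>y. indicator (ball i (\<rho> i)) y * e y \<partial>lborel)"
        using \<rho>(2)[OF i] by (intro mult_left_mono) auto
      finally show "measure lborel (ball i (5 * \<rho> i)) \<le> \<dots>" .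
    qed
    also have "\<dots> = 5 ^ ?N / l\<^sup>2 * (\<integral>y. (\<Sum>i\<in>I. indicator (ball i (\<rho> i)) y * e y) \<partial>lborel)"
      by (subst Bochner_Integration.integral_sum) (auto simp: inte sum_distrib_left)
    also have "\<dots> \<le> 5 ^ ?N / l\<^sup>2 * D"
    proof (rule mult_left_mono)
      show "(\<integral>y. (\<Sum>i\<in>I. indicator (ball i (\<rho> i)) y * e y) \<partial>lborel) \<le> D"
      proof (rule order_trans[OF integral_mono[OF _ int] D[folded e_def]])
        show "integrable lborel (\<lambda>y. \<Sum>i\<in>I. indicator (ball i (\<rho> i)) y * e y)"
          by (intro Bochner_Integration.integrable_sum inte)
        fix y
        have "(\<Sum>i\<in>I. indicat_real (ball i (\<rho> i)) y) \<le> 1"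
        proof (cases "\<exists>i\<in>I. y \<in> ball i (\<rho> i)")
          case True
          then obtain i where i: "i \<in> I" "y \<in> ball i (\<rho> i)" by auto
          have "indicat_real (ball j (\<rho> j)) y = 0" if "j \<in> I - {i}" for j
          proof -
            have "disjnt (ball i (\<rho> i)) (ball j (\<rho> j))"
              using pairwiseD[OF C(3), of i j] i(1) that I(1) by auto
            then show ?thesis using i(2) by (auto simp: disjnt_def indicator_def)
          qed
          then have "(\<Sum>j\<in>I - {i}. indicat_real (ball j (\<rho> j)) y) = 0" by (intro sum.neutral) auto
          then show ?thesis using sum.remove[OF I(2) i(1), of "\<lambda>i. indicat_real (ball i (\<rho> i)) y"] by simp
        next
          case False
          then have "(\<Sum>j\<in>I. indicat_real (ball j (\<rho> j)) y) = 0" by (intro sum.neutral) (auto simp: indicator_def)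
          then show ?thesis by simp
        qed
        then show "(\<Sum>i\<in>I. indicator (ball i (\<rho> i)) y * e y) \<le> e y"
          using e0[of y] by (simp add: sum_distrib_right[symmetric] mult_left_le_one_le sum_nonneg)
      qed
    qed simp
    finally show ?thesis by simp
  qed
  have fball: "ball i s \<in> fmeasurable lborel" for i :: "real^'n" and s
    using emeasure_bounded_finite[OF bounded_ball, of i s] by (intro fmeasurableI) auto
  have "(\<Union>i\<in>C. ball i (5 * \<rho> i)) \<in> fmeasurable lborel"
    by (rule fmeasurable_UN_bound[OF C(1) fball fin])
  moreover have "measure lborel (\<Union>i\<in>C. ball i (5 * \<rho> i)) \<le> 5 ^ ?N * D / l\<^sup>2"
    by (rule measure_UN_bound[OF C(1) fball fin])
  ultimately show ?thesis using that C(4) by blast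
qed


text \<open>Mollification disturbs the truncated function also near the bad set. This lemma absorbs
  a neighbourhood of it into the bad set of the lower level \<open>l / 2^n\<close>. A large ball
  witnessing that y is bad serves x after doubling its radius; a small one contains a point where
  the gradient itself exceeds l, and uniform continuity spreads this to a ball about x.\<close>

lemma bad_neighbourhood:
  fixes G :: "real^'n::finite \<Rightarrow> real"
  assumes G: "smooth G" and S: "compact S" "\<And>x. x \<notin> S \<Longrightarrow> G x = 0" and l: "l > 0"
  obtains \<mu>0 where "\<mu>0 > 0" "\<And>\<mu> x y. 0 < \<mu> \<Longrightarrow> \<mu> \<le> \<mu>0 \<Longrightarrow> y \<in> bad G l \<Longrightarrow> dist x y < \<mu> \<Longrightarrow> x \<in> bad G (l / 2 ^ CARD('n))"
proof -
  let ?N = "CARD('n)"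
  define l' where "l' = l / 2 ^ ?N"
  define w where "w = unit_ball_vol (real ?N)"
  have w: "w > 0" by (simp add: w_def)
  have N: "?N \<ge> 1" by (simp add: Suc_leI)
  define e where "e = (\<lambda>x. (norm (grad G x))\<^sup>2)"
  have ce: "continuous_on UNIV e"
    unfolding e_def by (intro continuous_intros continuous_on_grad[OF G])
  have ez: "x \<notin> S \<Longrightarrow> e x = 0" for x
    by (simp add: e_def grad_zero_outside[OF compact_imp_closed[OF S(1)] S(2)])
  \<comment> \<open>The points later compared with a point of \<open>S\<close> may lie outside
    \<open>S\<close>, hence the closed unit neighbourhood.\<close>
  have "uniformly_continuous_on (S \<union> (\<Union>x\<in>S. cball x 1)) e"
  proof -
    have "(\<Union>x\<in>S. cball x 1) = {x + y |x y. x \<in> S \<and> y \<in> cball 0 1}"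
      by (force simp: dist_norm norm_minus_commute intro: exI[of _ "_ - _"])
    then have "compact (\<Union>x\<in>S. cball x 1)"
      using compact_sums[OF S(1) compact_cball[of 0 1]] by simp
    then show ?thesis
      by (intro compact_uniformly_continuous continuous_on_subset[OF ce] compact_Un S(1)) auto
  qed
  then obtain \<delta> where \<delta>: "\<delta> > 0" "\<And>x y. x \<in> S \<Longrightarrow> y \<in> cball x 1 \<Longrightarrow> dist y x < \<delta> \<Longrightarrow> dist (e y) (e x) < l\<^sup>2 / 2"
    unfolding uniformly_continuous_on_def using l by (metis UN_I UnI1 UnI2 half_gt_zero zero_less_power)
  \<comment> \<open>The chain from v over x and y to z has three steps, each shorter than \<mu>;
    their sum must stay within \<delta> and 1.\<close>
  define \<mu>0 where "\<mu>0 = min \<delta> 1 / 3"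
  have l'2: "l'\<^sup>2 \<le> l\<^sup>2 / 4" "l'\<^sup>2 * 2 ^ ?N \<le> l\<^sup>2"
  proof -
    have a: "(2::real) ^ ?N \<ge> 2" using power_increasing[OF N, of "2::real"] by simp
    have b: "(4::real) \<le> 2 ^ ?N * 2 ^ ?N" using mult_mono[OF a a] by simp
    have eq: "l'\<^sup>2 = l\<^sup>2 / (2 ^ ?N * 2 ^ ?N)" by (simp add: l'_def power_divide power2_eq_square)
    show "l'\<^sup>2 \<le> l\<^sup>2 / 4" unfolding eq using b by (intro divide_left_mono) auto
    have "l'\<^sup>2 * 2 ^ ?N = l\<^sup>2 / 2 ^ ?N" unfolding eq by simp
    also have "\<dots> \<le> l\<^sup>2 / 1" using a by (intro divide_left_mono) auto
    finally show "l'\<^sup>2 * 2 ^ ?N \<le> l\<^sup>2" by simp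
  qed
  show ?thesis
  proof (rule that[of \<mu>0])
    show "\<mu>0 > 0" using \<delta> by (simp add: \<mu>0_def)
    fix \<mu> x y assume \<mu>: "0 < \<mu>" "\<mu> \<le> \<mu>0" and y: "y \<in> bad G l" and xy: "dist x y < \<mu>"
    obtain r where r: "r > 0" "ennreal (l\<^sup>2 * measure lborel (ball y r)) < energy_on G (ball y r)"
      using y by (auto simp: bad_def)
    have "x \<in> bad G l'"
    proof (cases "r \<ge> \<mu>")
      case True
      have "ball y r \<subseteq> ball x (2 * r)"
      proof
        fix z assume "z \<in> ball y r"
        then show "z \<in> ball x (2 * r)" using xy True dist_triangle[of x z y] by simp
      qed
      then have "energy_on G (ball y r) \<le> energy_on G (ball x (2 * r))" by (rule energy_on_mono)
      moreover have "l'\<^sup>2 * measure lborel (ball x (2 * r)) \<le> l\<^sup>2 * measure lborel (ball y r)"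
        using mult_right_mono[OF l'2(2), of "w * r ^ ?N"] r w
        by (simp add: measure_ball_cart w_def power_mult_distrib mult_ac)
      ultimately have "ennreal (l'\<^sup>2 * measure lborel (ball x (2 * r))) < energy_on G (ball x (2 * r))"
        using r(2) by (meson ennreal_leI le_less_trans less_le_trans)
      then show ?thesis unfolding bad_def using r(1) by (intro CollectI exI[of _ "2 * r"]) auto
    next
      case False
      have "\<exists>z\<in>ball y r. e z > l\<^sup>2"
      proof (rule ccontr)
        assume "\<not> ?thesis"
        then have "energy_on G (ball y r) \<le> (\<integral>\<^sup>+z. indicator (ball y r) z * ennreal (l\<^sup>2) \<partial>lborel)"
          unfolding energy_on_def by (intro nn_integral_mono) (auto simp: indicator_def e_def not_less intro!: ennreal_leI)
        also have "\<dots> = ennreal (l\<^sup>2 * measure lborel (ball y r))"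
        proof -
          have "emeasure lborel (ball y r) = ennreal (measure lborel (ball y r))"
            using emeasure_bounded_finite[OF bounded_ball, of y r] by (simp add: emeasure_eq_ennreal_measure top.not_eq_extremum)
          then show ?thesis
            by (subst nn_integral_multc) (simp_all add: ennreal_mult' mult.commute)
        qed
        finally show False using r(2) by simp
      qed
      then obtain z where z: "dist y z < r" "e z > l\<^sup>2" by auto
      have zS: "z \<in> S" using ez[of z] z(2) l by (metis not_less zero_le_power2)
      have ew: "e v \<ge> l\<^sup>2 / 2" if "dist x v < \<mu>" for v
      proof -
        have "dist v z \<le> dist v x + dist x y + dist y z"
          using dist_triangle[of v z x] dist_triangle[of x z y] by linarith
        then have "dist v z < 3 * \<mu>" using that xy z(1) False by (simp add: dist_commute)
        then have "dist v z < \<delta>" "v \<in> cball z 1" using \<mu> by (auto simp: \<mu>0_def dist_commute)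
        then have "dist (e v) (e z) < l\<^sup>2 / 2" using \<delta>(2)[OF zS] by blast
        then show ?thesis using z(2) unfolding dist_real_def by linarith
      qed
      have m: "emeasure lborel (ball x \<mu>) = ennreal (measure lborel (ball x \<mu>))"
        using emeasure_bounded_finite[OF bounded_ball, of x \<mu>] by (simp add: emeasure_eq_ennreal_measure top.not_eq_extremum)
      have mp: "measure lborel (ball x \<mu>) > 0" using \<mu> w by (simp add: measure_ball_cart w_def)
      have "ennreal (l'\<^sup>2 * measure lborel (ball x \<mu>)) < ennreal (l\<^sup>2 / 2 * measure lborel (ball x \<mu>))"
      proof (rule ennreal_lessI)
        have "l'\<^sup>2 < l\<^sup>2 / 2" using l'2(1) zero_less_power[OF l, of 2] by linarith
        then show "l'\<^sup>2 * measure lborel (ball x \<mu>) < l\<^sup>2 / 2 * measure lborel (ball x \<mu>)"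
          using mp by (intro mult_strict_right_mono)
      qed (use l mp in auto)
      also have "\<dots> = (\<integral>\<^sup>+v. indicator (ball x \<mu>) v * ennreal (l\<^sup>2 / 2) \<partial>lborel)"
        using m by (subst nn_integral_multc) (simp_all add: ennreal_mult[symmetric] mult.commute)
      also have "\<dots> \<le> energy_on G (ball x \<mu>)"
        unfolding energy_on_def using ew by (intro nn_integral_mono) (auto simp: indicator_def e_def intro!: ennreal_leI)
      finally show ?thesis unfolding bad_def using \<mu>(1) by (intro CollectI exI[of _ \<mu>]) auto
    qed
    then show "x \<in> bad G (l / 2 ^ CARD('n))" by (simp add: l'_def)
  qed
qed

section \<open>Extension and differentiation of Lipschitz functions\<close>

lemma mcshane_extension:
  fixes G :: "'a::metric_space \<Rightarrow> real"
  assumes F: "F \<noteq> {}" and L: "L \<ge> 0" and G: "\<And>x y. x \<in> F \<Longrightarrow> y \<in> F \<Longrightarrow> \<bar>G x - G y\<bar> \<le> L * dist x y"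
  obtains g where "\<And>x. x \<in> F \<Longrightarrow> g x = G x" "\<And>x y. \<bar>g x - g y\<bar> \<le> L * dist x y"
proof -
  define g where "g = (\<lambda>x. INF y\<in>F. G y + L * dist x y)"
  obtain a where a: "a \<in> F" using F by auto
  have bdd: "bdd_below ((\<lambda>y. G y + L * dist x y) ` F)" for x
  proof (rule bdd_belowI2)
    fix y assume y: "y \<in> F"
    have "L * dist a y \<le> L * (dist x a + dist x y)"
      using L dist_triangle3[of a y x] by (intro mult_left_mono) (auto simp: dist_commute)
    then show "G a - L * dist x a \<le> G y + L * dist x y"
      using G[OF a y] by (simp add: algebra_simps abs_le_iff)
  qed
  have "g x \<le> g y + L * dist x y" for x y
  proof -
    have "g x - L * dist x y \<le> G z + L * dist y z" if z: "z \<in> F" for z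
    proof -
      have "g x \<le> G z + L * dist x z" unfolding g_def by (rule cINF_lower[OF bdd z])
      moreover have "L * dist x z \<le> L * (dist x y + dist y z)"
        using L by (intro mult_left_mono dist_triangle)
      ultimately show ?thesis by (simp add: algebra_simps)
    qed
    then have "g x - L * dist x y \<le> g y"
      unfolding g_def[of ] by (intro cINF_greatest[OF F]) (simp add: g_def)
    then show ?thesis by simp
  qed
  then have "\<bar>g x - g y\<bar> \<le> L * dist x y" for x y
    by (simp add: abs_le_iff algebra_simps) (metis add.commute dist_commute)
  moreover have "g x = G x" if x: "x \<in> F" for x
  proof (rule antisym)
    show "g x \<le> G x" unfolding g_def using cINF_lower[OF bdd x, of x] by simp
    show "G x \<le> g x" unfolding g_def
    proof (rule cINF_greatest[OF F])
      fix y assume "y \<in> F"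
      then show "G x \<le> G y + L * dist x y" using G[OF x] by (simp add: abs_le_iff algebra_simps)
    qed
  qed
  ultimately show ?thesis using that by blast
qed

text \<open>The derivative in the direction of the gradient is its squared norm, and the difference
  quotients bound it by L times its norm.\<close>

lemma norm_grad_le_lipschitz:
  fixes f :: "real^'n::finite \<Rightarrow> real"
  assumes f: "f differentiable at x" and L: "\<And>y. \<bar>f y - f x\<bar> \<le> L * norm (y - x)"
  shows "norm (grad f x) \<le> L"
proof (cases "grad f x = 0")
  case True
  have "0 \<le> L * norm (axis undefined 1 :: real^'n)" using L[of "x + axis undefined 1"] by simp
  then show ?thesis using True by simp
next
  case False
  define d where "d = grad f x"
  have "((\<lambda>t. f (x + t *\<^sub>R d)) has_derivative (\<lambda>s. grad f (x + 0 *\<^sub>R d) \<bullet> (s *\<^sub>R d))) (at 0)"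
    by (rule has_derivative_compose[where g=f and f="\<lambda>t. x + t *\<^sub>R d"])
       (use has_derivative_grad[OF f] in \<open>auto intro!: derivative_eq_intros\<close>)
  then have "((\<lambda>t. f (x + t *\<^sub>R d)) has_real_derivative (d \<bullet> d)) (at 0)"
    by (simp add: has_field_derivative_def d_def mult.commute mult_commute_abs)
  then have "(\<lambda>h. (f (x + h *\<^sub>R d) - f x) / h) \<midarrow>0\<rightarrow> d \<bullet> d"
    by (simp add: DERIV_def)
  moreover have "\<forall>\<^sub>F h in at 0. (f (x + h *\<^sub>R d) - f x) / h \<le> L * norm d"
  proof -
    have "(f (x + h *\<^sub>R d) - f x) / h \<le> L * norm d" if "h \<noteq> 0" for h
    proof -
      have "\<bar>(f (x + h *\<^sub>R d) - f x) / h\<bar> = \<bar>f (x + h *\<^sub>R d) - f x\<bar> / \<bar>h\<bar>" by simp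
      also have "\<dots> \<le> (L * norm (h *\<^sub>R d)) / \<bar>h\<bar>"
        using L[of "x + h *\<^sub>R d"] by (intro divide_right_mono) auto
      also have "\<dots> = L * norm d" using that by simp
      finally show ?thesis by linarith
    qed
    then show ?thesis by (simp add: eventually_at_filter)
  qed
  ultimately have "d \<bullet> d \<le> L * norm d"
    by (intro tendsto_upperbound[of _ _ "at 0"]) auto
  then show ?thesis using False by (simp add: d_def power2_norm_eq_inner[symmetric] power2_eq_square)
qed

section \<open>Lipschitz truncation\<close>

lemma smooth_grad_lipschitz:
  fixes f :: "real^'n::finite \<Rightarrow> real"
  assumes f: "smooth f" and S: "compact S" "\<And>x. x \<notin> S \<Longrightarrow> f x = 0"
  obtains b where "b \<ge> 0" "\<And>i x y. \<bar>pd i f x - pd i f y\<bar> \<le> b * norm (x - y)"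
proof -
  have "\<exists>b\<ge>0. \<forall>x y. \<bar>pd i f x - pd i f y\<bar> \<le> b * norm (x - y)" for i
  proof -
    have z: "x \<notin> S \<Longrightarrow> grad (pd i f) x = 0" for x
      by (rule grad_zero_outside[OF compact_imp_closed[OF S(1)] pd_zero_outside[OF compact_imp_closed[OF S(1)] S(2)]])
    obtain b where b: "b > 0" "\<And>x. norm (grad (pd i f) x) \<le> b"
      using bounded_of_compact_support[OF continuous_on_grad[OF smooth_pd[OF f]] S(1) z] by metis
    then show ?thesis using smooth_lipschitz[OF smooth_pd[OF f] b(2)] by (intro exI[of _ b]) auto
  qed
  then obtain b where b: "\<And>i. b i \<ge> 0" "\<And>i x y. \<bar>pd i f x - pd i f y\<bar> \<le> b i * norm (x - y)" by metis
  show ?thesis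
  proof (rule that)
    show "0 \<le> (\<Sum>i\<in>UNIV. b i)" by (intro sum_nonneg b)
    fix i x y
    have "b i \<le> (\<Sum>i\<in>UNIV. b i)" by (rule member_le_sum) (auto intro: b)
    then show "\<bar>pd i f x - pd i f y\<bar> \<le> (\<Sum>i\<in>UNIV. b i) * norm (x - y)"
      by (intro order_trans[OF b(2)] mult_right_mono) auto
  qed
qed

lemma integrable_affine:
  fixes f :: "'a::euclidean_space \<Rightarrow> 'b::{banach,second_countable_topology}"
  assumes f: "integrable lborel f" and c: "c \<noteq> 0"
  shows "integrable lborel (\<lambda>x. f (y + c *\<^sub>R x))"
proof -
  have [measurable]: "f \<in> borel_measurable borel" using f by auto
  have "(\<integral>\<^sup>+x. ennreal (norm (f x)) \<partial>lborel) = ennreal (\<bar>c\<bar> ^ DIM('a)) * (\<integral>\<^sup>+x. ennreal (norm (f (y + c *\<^sub>R x))) \<partial>lborel)"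
    by (rule lborel_nn_integral_affine[OF c]) measurable
  moreover have "(\<integral>\<^sup>+x. ennreal (norm (f x)) \<partial>lborel) < \<infinity>"
    using f by (simp add: integrable_iff_bounded)
  ultimately have "(\<integral>\<^sup>+x. ennreal (norm (f (y + c *\<^sub>R x))) \<partial>lborel) < \<infinity>"
    using c by (auto simp: ennreal_mult_less_top)
  then show ?thesis by (subst integrable_iff_bounded) auto
qed

text \<open>With the factors exchanged, the convolution is an average of translates of
  \<open>g\<close>, all with the same Lipschitz constant.\<close>

lemma conv_mol_lipschitz:
  fixes g :: "real^'n::finite \<Rightarrow> real"
  assumes t: "t > 0" and g: "integrable lborel g" and L: "\<And>x y. \<bar>g x - g y\<bar> \<le> L * norm (x - y)"
  shows "\<bar>conv (mol t) g x - conv (mol t) g y\<bar> \<le> L * norm (x - y)"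
proof -
  have gm: "g \<in> borel_measurable borel" using g by auto
  have mz: "z \<notin> cball 0 t \<Longrightarrow> mol t z = 0" for z :: "real^'n" using t by (simp add: mol_zero)
  have I: "integrable lborel (\<lambda>z. mol t z * g (x - z))" for x
  proof -
    have "integrable lborel (\<lambda>y. g y * mol t (x - y))"
      by (rule conv_integrable[OF smooth_mol compact_cball mz g])
    then have "integrable lborel (\<lambda>z. g (x + (-1) *\<^sub>R z) * mol t (x - (x + (-1) *\<^sub>R z)))"
      by (rule integrable_affine) simp
    then show ?thesis by (simp add: mult.commute)
  qed
  have "conv (mol t) g x - conv (mol t) g y = conv g (mol t) x - conv g (mol t) y"
    using conv_commute[OF measurable_mol gm] by simp
  also have "\<dots> = (\<integral>z. mol t z * g (x - z) - mol t z * g (y - z) \<partial>lborel)"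
    unfolding conv_def by (rule Bochner_Integration.integral_diff[symmetric, OF I I])
  finally have eq: "conv (mol t) g x - conv (mol t) g y = (\<integral>z. mol t z * g (x - z) - mol t z * g (y - z) \<partial>lborel)" .
  have "norm (\<integral>z. mol t z * g (x - z) - mol t z * g (y - z) \<partial>lborel) \<le> (\<integral>z. mol t (z::real^'n) * (L * norm (x - y)) \<partial>lborel)"
  proof (rule norm_integral_le)
    show "integrable lborel (\<lambda>z::real^'n. mol t z * (L * norm (x - y)))"
      by (rule integrable_mult_left[OF integrable_mol[OF t]])
    fix z :: "real^'n"
    have "\<bar>g (x - z) - g (y - z)\<bar> \<le> L * norm (x - y)" using L[of "x - z" "y - z"] by simp
    then show "norm (mol t z * g (x - z) - mol t z * g (y - z)) \<le> mol t z * (L * norm (x - y))"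
      using mol_nonneg[OF t, of z] by (simp add: right_diff_distrib[symmetric] abs_mult mult_left_mono)
  qed
  also have "\<dots> = L * norm (x - y)" using integral_mol[OF t, where 'n='n] by simp
  finally show ?thesis unfolding eq by simp
qed

lemma conv_mol_pd:
  fixes f :: "real^'n::finite \<Rightarrow> real"
  assumes t: "t > 0" and f: "smooth f" and S: "compact S" "\<And>x. x \<notin> S \<Longrightarrow> f x = 0"
  shows "conv (mol t) (pd i f) = conv (pd i (mol t)) f"
proof -
  have m: "g \<in> borel_measurable borel" if "smooth g" for g :: "real^'n \<Rightarrow> real"
    by (rule borel_measurable_continuous_onI[OF smooth_continuous[OF that]])
  have int: "integrable lborel f"
    by (rule integrable_continuous_compact_support[OF smooth_continuous[OF f] S])
  have mz: "x \<notin> cball 0 t \<Longrightarrow> mol t x = 0" for x :: "real^'n" using t by (simp add: mol_zero)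
  have "conv (mol t) (pd i f) = conv (pd i f) (mol t)"
    by (rule ext) (rule conv_commute[OF m[OF smooth_mol] m[OF smooth_pd[OF f]]])
  also have "\<dots> = pd i (conv f (mol t))"
    by (rule conv_pd[symmetric, OF f S integrable_mol[OF t]])
  also have "conv f (mol t) = conv (mol t) f"
    by (rule ext) (rule conv_commute[OF m[OF f] m[OF smooth_mol]])
  also have "pd i (conv (mol t) f) = conv (pd i (mol t)) f"
    by (rule conv_pd[OF smooth_mol compact_cball mz int])
  finally show ?thesis .
qed

lemma grad_cmult: "smooth f \<Longrightarrow> grad (\<lambda>x. c * f x) x = c *\<^sub>R grad f x"
  by (simp add: vec_eq_iff pd_cmult)

lemma compact_neighbourhood:
  fixes S :: "'a::euclidean_space set"
  assumes "compact S" "S \<noteq> {}"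
  shows "compact {x. infdist x S \<le> e}"
proof (cases "e > 0")
  case True
  then show ?thesis by (rule compact_infdist_le[OF assms(2,1)])
next
  case False
  then have "{x. infdist x S \<le> e} = (if e = 0 then S else {})"
    using assms infdist_nonneg[of _ S] in_closed_iff_infdist_zero[OF compact_imp_closed[OF assms(1)] assms(2)]
    by (auto simp: order_antisym_conv) (smt (verit))+
  then show ?thesis using assms by simp
qed

lemma integrable_inner_bounded:
  fixes F H :: "real^'n::finite \<Rightarrow> real^'n"
  assumes F: "F \<in> borel_measurable borel" "\<And>x. norm (F x) \<le> A"
    and H: "continuous_on UNIV H" "compact S" "\<And>x. x \<notin> S \<Longrightarrow> H x = 0"
  shows "integrable lborel (\<lambda>x. F x \<bullet> H x)"
proof -
  obtain b where b: "b > 0" "\<And>x. norm (H x) \<le> b"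
    using bounded_of_compact_support[OF H] by metis
  have A: "A \<ge> 0" using F(2)[of 0] norm_ge_zero order_trans by blast
  note [measurable] = F(1) borel_measurable_continuous_onI[OF H(1)]
  show ?thesis
  proof (rule integrable_compact_support[OF _ H(2)])
    show "norm (F x \<bullet> H x) \<le> A * b" for x
      using Cauchy_Schwarz_ineq2[of "F x" "H x"] mult_mono[OF F(2)[of x] b(2)[of x] A norm_ge_zero] by simp
  qed (auto simp: H(3))
qed

text \<open>Ensures that the set on which the Lipschitz extension is prescribed is nonempty.\<close>

lemma far_point:
  fixes S :: "(real^'n::finite) set"
  assumes "compact S" "S \<noteq> {}"
  obtains x where "infdist x S \<ge> d"
proof -
  obtain R where R: "\<And>y. y \<in> S \<Longrightarrow> norm y \<le> R"
    using compact_imp_bounded[OF assms(1)] unfolding bounded_iff by metis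
  define x where "x = (\<bar>R\<bar> + \<bar>d\<bar>) *\<^sub>R (axis undefined 1 :: real^'n)"
  have "norm x = \<bar>R\<bar> + \<bar>d\<bar>" by (simp add: x_def)
  then have "d \<le> dist x y" if "y \<in> S" for y
    using R[OF that] norm_triangle_ineq2[of x y] by (simp add: dist_norm)
  then have "infdist x S \<ge> d"
    unfolding infdist_notempty[OF assms(2)] by (intro cINF_greatest[OF assms(2)])
  then show ?thesis by (rule that)
qed

text \<open>The hypothesis controls \<open>F\<close> only against functions with bounded gradient, whereas \<open>G\<close> merely has
  finite energy. So \<open>G\<close> is replaced by a mollified Lipschitz extension of its restriction to the
  complement of \<open>bad G l\<close>, and the weak-type bound estimates the error on \<open>bad G l\<close>.\<close>

lemma lipschitz_truncation:
  fixes F :: "real^'n::finite \<Rightarrow> real^'n" and G :: "real^'n \<Rightarrow> real"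
  assumes F: "F \<in> borel_measurable borel" "\<And>x. norm (F x) \<le> A"
    and S: "compact S" "S \<noteq> {}" and d: "d > 0" and U: "{x. infdist x S \<le> 2 * d} \<subseteq> U"
    and G: "smooth G" "\<And>x. x \<notin> S \<Longrightarrow> G x = 0" and D0: "\<And>x. \<bar>G x\<bar> \<le> D0"
    and D: "(\<integral>x. (norm (grad G x))\<^sup>2 \<partial>lborel) \<le> D" and l: "l > 0"
    and test: "\<And>\<psi>. test_fun U \<psi> \<Longrightarrow> (\<And>x. norm (grad \<psi> x) \<le> 1) \<Longrightarrow> \<bar>\<integral>x. F x \<bullet> grad \<psi> x \<partial>lborel\<bar> \<le> \<delta>"
    and L: "L = 2 ^ (CARD('n) + 1) * l + D0 / d"
  shows "\<bar>\<integral>x. F x \<bullet> grad G x \<partial>lborel\<bar>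
     \<le> \<delta> * L + A * ((l + L) * (20 ^ CARD('n) * D / l\<^sup>2) + D / l)"
proof -
  let ?N = "CARD('n)"
  have A0: "A \<ge> 0" using F(2)[of 0] norm_ge_zero order_trans by blast
  have D00: "D0 \<ge> 0" using D0[of 0] by linarith
  have L0: "L > 0" using l D00 d by (auto simp: L intro!: add_pos_nonneg)
  have cl: "closed S" using S(1) by (rule compact_imp_closed)
  have gradz: "x \<notin> S \<Longrightarrow> grad G x = 0" for x by (rule grad_zero_outside[OF cl G(2)])
  define e where "e = (\<lambda>x. (norm (grad G x))\<^sup>2)"
  have inte: "integrable lborel e"
    unfolding e_def
    by (rule integrable_continuous_compact_support[OF continuous_on_power[OF continuous_on_norm[OF continuous_on_grad[OF G(1)]]] S(1)])
       (simp add: gradz)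
  define K where "K = {x. infdist x S \<le> 2 * d}"
  have K: "compact K" unfolding K_def by (rule compact_neighbourhood[OF S])
  have SK: "S \<subseteq> K" using d by (auto simp: K_def)
  \<comment> \<open>Prescribing the value 0 of \<open>G\<close> at distance \<open>d\<close> from
    \<open>S\<close> forces the extension to have compact support. A drop from at most
    \<open>D0\<close> to 0 over the distance \<open>d\<close> accounts for the summand
    \<open>D0 / d\<close> of \<open>L\<close>.\<close>
  define Far where "Far = {x. infdist x S \<ge> d}"
  define Good where "Good = - bad G l \<union> Far"
  have GF: "G x = 0" if "x \<in> Far" for x
    using that d by (intro G(2)) (auto simp: Far_def)
  have far_lip: "\<bar>G x\<bar> \<le> L * dist x y" if "y \<in> Far" for x y
  proof (cases "x \<in> S")
    case True
    have "d \<le> dist x y" using that infdist_le[OF True, of y] by (simp add: Far_def dist_commute)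
    then have "D0 * 1 \<le> D0 * (dist x y / d)" using d D00 by (intro mult_left_mono) auto
    also have "\<dots> \<le> L * dist x y"
      using l mult_right_mono[of "D0 / d" L "dist x y"] by (simp add: L)
    finally show ?thesis using D0[of x] by simp
  next
    case False
    then show ?thesis using G(2) L0 by simp
  qed
  have lip: "\<bar>G x - G y\<bar> \<le> L * dist x y" if xy: "x \<in> Good" "y \<in> Good" for x y
  proof -
    consider "x \<in> Far" | "y \<in> Far" | "x \<notin> bad G l" "y \<notin> bad G l" using xy unfolding Good_def by blast
    then show ?thesis
    proof cases
      case 1
      then show ?thesis using far_lip[OF 1, of y] GF[OF 1] by (simp add: dist_commute)
    next
      case 2
      then show ?thesis using far_lip[OF 2, of x] GF[OF 2] by simp
    next
      case 3
      have "\<bar>G x - G y\<bar> \<le> 2 ^ (?N + 1) * l * dist x y"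
        by (rule good_lipschitz[OF G(1) 3]) (use l in simp)
      also have "\<dots> \<le> L * dist x y" using D00 d by (intro mult_right_mono) (auto simp: L)
      finally show ?thesis .
    qed
  qed
  obtain p where p: "infdist p S \<ge> d" using far_point[OF S] by metis
  then have "Good \<noteq> {}" by (auto simp: Good_def Far_def)
  then obtain g where g: "\<And>x. x \<in> Good \<Longrightarrow> g x = G x" "\<And>x y. \<bar>g x - g y\<bar> \<le> L * dist x y"
    using mcshane_extension[OF _ less_imp_le[OF L0] lip] by metis
  have gz: "g x = 0" if "infdist x S \<ge> d" for x
    using that g(1)[of x] GF[of x] by (auto simp: Good_def Far_def)
  have gc: "continuous_on UNIV g"
    by (rule lipschitz_on_continuous_on[OF lipschitz_onI[of UNIV g L]]) (use g(2) L0 in \<open>auto simp: dist_real_def\<close>)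
  have gint: "integrable lborel g"
    by (rule integrable_continuous_compact_support[OF gc K]) (use d in \<open>auto simp: K_def intro!: gz\<close>)
  obtain b where b: "b \<ge> 0" "\<And>i x y. \<bar>pd i G x - pd i G y\<bar> \<le> b * norm (x - y)"
    using smooth_grad_lipschitz[OF G(1) S(1) G(2)] by metis
  obtain \<mu> where \<mu>: "\<mu> > 0" "\<And>m x y. 0 < m \<Longrightarrow> m \<le> \<mu> \<Longrightarrow> y \<in> bad G l \<Longrightarrow> dist x y < m \<Longrightarrow> x \<in> bad G (l / 2 ^ ?N)"
    using bad_neighbourhood[OF G(1) S(1) G(2) l] by metis
  have l2: "l / 2 ^ ?N > 0" using l by simp
  \<comment> \<open>The weak-type bound is taken at the lowered level; the later constant
    \<open>20^n\<close> is the Vitali factor \<open>5^n\<close> times the \<open>4^n\<close> lost by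
    squaring \<open>2^n\<close>.\<close>
  obtain M where M: "M \<in> fmeasurable lborel" "bad G (l / 2 ^ ?N) \<subseteq> M" "measure lborel M \<le> 5 ^ ?N * D / (l / 2 ^ ?N)\<^sup>2"
    using bad_weak_type[OF G(1) S(1) G(2) l2 D] by metis
  have "5 ^ ?N * D / (l / 2 ^ ?N)\<^sup>2 = 20 ^ ?N * D / l\<^sup>2"
  proof -
    have "(20::real) ^ ?N = 5 ^ ?N * (2 ^ ?N * 2 ^ ?N)" by (simp add: power_mult_distrib[symmetric])
    then show ?thesis by (simp add: power_divide power2_eq_square)
  qed
  with M have Mm: "measure lborel M \<le> 20 ^ ?N * D / l\<^sup>2" by simp
  have Mset: "M \<in> sets lborel" "emeasure lborel M < \<infinity>" using M(1) by (auto simp: fmeasurable_def)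
  let ?C = "\<delta> * L + A * ((l + L) * (20 ^ CARD('n) * D / l\<^sup>2) + D / l)"
  have main: "\<bar>\<integral>x. F x \<bullet> grad G x \<partial>lborel\<bar> \<le> ?C + A * (real ?N * (b * t) * measure lborel K)"
    if t: "0 < t" "t \<le> d" "2 * t \<le> \<mu>" for t
  proof -
    define \<psi> where "\<psi> = conv (mol t) g"
    have mz: "x \<notin> cball 0 t \<Longrightarrow> mol t x = 0" for x :: "real^'n" using t by (simp add: mol_zero)
    have mz1: "norm x > t \<Longrightarrow> pd i (mol t) x = 0" for x :: "real^'n" and i
      using pd_zero_outside[of "cball 0 t" "mol t" x i, OF closed_cball mz] by simp
    have s\<psi>: "smooth \<psi>" unfolding \<psi>_def by (rule conv_smooth[OF smooth_mol compact_cball mz gint])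
    have z\<psi>: "x \<notin> K \<Longrightarrow> \<psi> x = 0" for x
      unfolding \<psi>_def
    proof (rule conv_zero)
      fix y assume x: "x \<notin> K" and "g y \<noteq> 0"
      then have "infdist y S < d" using gz[of y] by force
      then have "dist x y > d" using x infdist_triangle[of x S y] by (simp add: K_def)
      then show "mol t (x - y) = 0" using t by (intro mol_zero) (auto simp: dist_norm)
    qed
    have "test_fun U \<psi>" by (rule test_funI[OF s\<psi> K _ z\<psi>]) (use U in \<open>simp add: K_def\<close>)
    have g\<psi>: "norm (grad \<psi> x) \<le> L" for x
    proof (rule norm_grad_le_lipschitz[OF smooth_differentiable[OF s\<psi>]])
      show "\<bar>\<psi> y - \<psi> x\<bar> \<le> L * norm (y - x)" for y
        unfolding \<psi>_def by (rule conv_mol_lipschitz[OF t(1) gint]) (use g(2) in \<open>simp add: dist_norm\<close>)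
    qed
    have gz\<psi>: "x \<notin> K \<Longrightarrow> grad \<psi> x = 0" for x
      by (rule grad_zero_outside[OF compact_imp_closed[OF K] z\<psi>])
    \<comment> \<open>Off \<open>M\<close> the mollifier sees only points where \<open>g\<close> and
      \<open>G\<close> agree: a bad point within t < 2 t of x would put x into the enlarged bad
      set.\<close>
    have eq: "pd i \<psi> x = conv (mol t) (pd i G) x" if x: "x \<notin> M" for x i
    proof -
      have "pd i \<psi> x = conv (pd i (mol t)) g x"
        unfolding \<psi>_def by (rule fun_cong[OF conv_pd[OF smooth_mol compact_cball mz gint]])
      also have "\<dots> = conv (pd i (mol t)) G x"
        unfolding conv_def
      proof (rule Bochner_Integration.integral_cong)
        fix y
        show "g y * pd i (mol t) (x - y) = G y * pd i (mol t) (x - y)"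
        proof (cases "norm (x - y) \<le> t")
          case True
          have "y \<notin> bad G l"
            using \<mu>(2)[of "2 * t" y x] t True x M(2) by (auto simp: dist_norm)
          then show ?thesis using g(1)[of y] by (simp add: Good_def)
        next
          case False
          then show ?thesis using mz1[of "x - y" i] by simp
        qed
      qed simp
      also have "\<dots> = conv (mol t) (pd i G) x"
        by (rule fun_cong[OF conv_mol_pd[OF t(1) G(1) S(1) G(2), symmetric]])
      finally show ?thesis .
    qed
    have close: "norm (grad G x - grad \<psi> x) \<le> real ?N * (b * t)" if x: "x \<notin> M" for x
    proof (rule norm_le_vec_bound)
      fix i
      have pint: "integrable lborel (pd i G)"
        by (rule integrable_continuous_compact_support[OF smooth_continuous[OF smooth_pd[OF G(1)]] S(1) pd_zero_outside[OF cl G(2)]])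
      have "\<bar>conv (mol t) (pd i G) x - pd i G x\<bar> \<le> b * t"
      proof (rule conv_mol_close[OF t(1) pint])
        fix y assume "dist y x \<le> t"
        then have "b * norm (y - x) \<le> b * t" using b(1) by (intro mult_left_mono) (auto simp: dist_norm)
        then show "\<bar>pd i G y - pd i G x\<bar> \<le> b * t" using b(2)[of i y x] by linarith
      qed
      then show "\<bar>(grad G x - grad \<psi> x) $ i\<bar> \<le> b * t" by (simp add: eq[OF x] abs_minus_commute)
    qed
    \<comment> \<open>Off \<open>M\<close> the two gradients differ by the mollification error, of
      order t. On \<open>M\<close> the gradient of \<psi> is at most \<open>L\<close> and that of
      \<open>G\<close> at most \<open>l + e x / l\<close>, by splitting at the level l; the integral
      of the last term is at most \<open>D / l\<close>.\<close>
    define h where "h = (\<lambda>x. A * (real ?N * (b * t) * indicator K x + ((l + L) * indicator M x + e x / l)))"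
    have iK: "integrable lborel (\<lambda>x. real ?N * (b * t) * indicat_real K x)"
      using K emeasure_compact_finite[OF K] borel_compact[OF K]
      by (intro integrable_mult_right integrable_real_indicator) auto
    have iM: "integrable lborel (\<lambda>x. (l + L) * indicat_real M x)"
      using Mset by (intro integrable_mult_right integrable_real_indicator) auto
    have ie: "integrable lborel (\<lambda>x. e x / l)" using inte by (rule integrable_divide)
    have ih: "integrable lborel h"
      unfolding h_def by (intro integrable_mult_right Bochner_Integration.integrable_add iK iM ie)
    have Ih: "(\<integral>x. h x \<partial>lborel) \<le> A * (real ?N * (b * t) * measure lborel K) + A * ((l + L) * (20 ^ ?N * D / l\<^sup>2) + D / l)"
    proof -
      have "(\<integral>x. h x \<partial>lborel) = A * ((\<integral>x. real ?N * (b * t) * indicat_real K x \<partial>lborel) + ((\<integral>x. (l + L) * indicat_real M x \<partial>lborel) + (\<integral>x. e x / l \<partial>lborel)))"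
        unfolding h_def
        by (simp only: integral_mult_right_zero Bochner_Integration.integral_add[OF iK Bochner_Integration.integrable_add[OF iM ie]]
              Bochner_Integration.integral_add[OF iM ie])
      also have "(\<integral>x. real ?N * (b * t) * indicat_real K x \<partial>lborel) = real ?N * (b * t) * measure lborel K" by simp
      also have "(\<integral>x. (l + L) * indicat_real M x \<partial>lborel) = (l + L) * measure lborel M" by simp
      also have "(\<integral>x. e x / l \<partial>lborel) = (\<integral>x. e x \<partial>lborel) / l" by simp
      also have "A * (real ?N * (b * t) * measure lborel K + ((l + L) * measure lborel M + (\<integral>x. e x \<partial>lborel) / l))
        \<le> A * (real ?N * (b * t) * measure lborel K + ((l + L) * (20 ^ ?N * D / l\<^sup>2) + D / l))"
        using A0 L0 l D Mm by (intro mult_left_mono add_left_mono add_mono divide_right_mono) (auto simp: e_def)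
      finally show ?thesis by (simp add: distrib_left)
    qed
    have bound: "norm (F x \<bullet> (grad G x - grad \<psi> x)) \<le> h x" for x
    proof -
      have "norm (grad G x - grad \<psi> x) \<le> real ?N * (b * t) * indicator K x + ((l + L) * indicator M x + e x / l)"
      proof (cases "x \<in> M")
        case True
        have "norm (grad G x) \<le> l + e x / l"
        proof (cases "norm (grad G x) \<le> l")
          case False
          then have "norm (grad G x) * l \<le> norm (grad G x) * norm (grad G x)" by (intro mult_left_mono) auto
          then have "norm (grad G x) \<le> e x / l" using l by (simp add: e_def power2_eq_square pos_le_divide_eq)
          then show ?thesis using l by simp
        next
          case True
          moreover have "e x / l \<ge> 0" using l by (simp add: e_def)
          ultimately show ?thesis by simp
        qed
        then have "norm (grad G x - grad \<psi> x) \<le> (l + L) * indicator M x + e x / l"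
          using norm_triangle_ineq4[of "grad G x" "grad \<psi> x"] g\<psi>[of x] True by simp
        moreover have "real ?N * (b * t) * indicator K x \<ge> 0" using b t by simp
        ultimately show ?thesis by linarith
      next
        case False
        have e: "e x / l \<ge> 0" using l by (simp add: e_def)
        show ?thesis
        proof (cases "x \<in> K")
          case True
          then show ?thesis using close[OF False] False e by simp
        next
          case nK: False
          then have "grad G x = 0" "grad \<psi> x = 0" using gradz gz\<psi> SK by auto
          then show ?thesis using e nK False by simp
        qed
      qed
      then have "norm (F x) * norm (grad G x - grad \<psi> x) \<le> h x"
        unfolding h_def by (rule mult_mono[OF F(2) _ A0 norm_ge_zero])
      then show ?thesis using Cauchy_Schwarz_ineq2[of "F x" "grad G x - grad \<psi> x"] by simp
    qed
    have i1: "integrable lborel (\<lambda>x. F x \<bullet> grad G x)"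
      by (rule integrable_inner_bounded[OF F continuous_on_grad[OF G(1)] S(1) gradz])
    have i2: "integrable lborel (\<lambda>x. F x \<bullet> grad \<psi> x)"
      by (rule integrable_inner_bounded[OF F continuous_on_grad[OF s\<psi>] K gz\<psi>])
    have "norm (\<integral>x. F x \<bullet> (grad G x - grad \<psi> x) \<partial>lborel) \<le> (\<integral>x. h x \<partial>lborel)"
      by (rule norm_integral_le[OF ih bound])
    moreover have "(\<integral>x. F x \<bullet> (grad G x - grad \<psi> x) \<partial>lborel) = (\<integral>x. F x \<bullet> grad G x \<partial>lborel) - (\<integral>x. F x \<bullet> grad \<psi> x \<partial>lborel)"
      unfolding inner_diff_right by (rule Bochner_Integration.integral_diff[OF i1 i2])
    moreover have "\<bar>\<integral>x. F x \<bullet> grad \<psi> x \<partial>lborel\<bar> \<le> \<delta> * L"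
    proof -
      \<comment> \<open>Division by \<open>L\<close> brings the gradient into the admissible class
        of norm at most 1.\<close>
      define \<psi>' where "\<psi>' = (\<lambda>x. (1 / L) * \<psi> x)"
      have s': "smooth \<psi>'" unfolding \<psi>'_def by (intro smooth_mult smooth_const s\<psi>)
      have g': "grad \<psi>' x = (1 / L) *\<^sub>R grad \<psi> x" for x
        unfolding \<psi>'_def by (rule grad_cmult[OF s\<psi>])
      have "test_fun U \<psi>'"
        by (rule test_funI[OF s' K]) (use U z\<psi> in \<open>simp_all add: K_def \<psi>'_def\<close>)
      moreover have "norm (grad \<psi>' x) \<le> 1" for x
        using g\<psi>[of x] L0 by (simp add: g' divide_le_eq_1)
      ultimately have "\<bar>\<integral>x. F x \<bullet> grad \<psi>' x \<partial>lborel\<bar> \<le> \<delta>" by (rule test)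
      then have "\<bar>\<integral>x. F x \<bullet> grad \<psi> x \<partial>lborel\<bar> / L \<le> \<delta>"
        using L0 by (simp add: g' abs_mult)
      then show ?thesis using L0 by (simp add: pos_divide_le_eq)
    qed
    ultimately show ?thesis using Ih by simp
  qed
  show ?thesis
  proof (rule field_le_epsilon)
    fix \<epsilon> :: real assume \<epsilon>: "\<epsilon> > 0"
    \<comment> \<open>A small mollification scale t removes the only term that depends on the
      smoothness of \<open>G\<close>, through \<open>b\<close>.\<close>
    define Q where "Q = A * (real ?N * b * measure lborel K)"
    have Q: "Q \<ge> 0" using A0 b by (simp add: Q_def)
    define t where "t = min (min d (\<mu> / 2)) (\<epsilon> / (Q + 1))"
    have t: "0 < t" "t \<le> d" "2 * t \<le> \<mu>" "t \<le> \<epsilon> / (Q + 1)" using d \<mu>(1) \<epsilon> Q by (auto simp: t_def)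
    have "Q * t \<le> (Q + 1) * t" using t by simp
    also have "\<dots> \<le> \<epsilon>" using t(4) Q by (simp add: pos_le_divide_eq mult.commute)
    finally have "A * (real ?N * (b * t) * measure lborel K) \<le> \<epsilon>" by (simp add: Q_def mult_ac)
    then show "\<bar>\<integral>x. F x \<bullet> grad G x \<partial>lborel\<bar> \<le> ?C + \<epsilon>" using main[OF t(1-3)] by linarith
  qed
qed

text \<open>Since \<open>L \<le> c * l\<close> for l \<ge> 1, the truncation error is at most
  \<open>Q / l\<close>. So l is chosen large to bring it below \<epsilon> / 2, and only then
  \<delta> is set against \<open>L\<close>. Neither choice depends on \<open>F\<close>,
  \<open>S\<close>, \<open>U\<close> or \<open>G\<close>; that uniformity later allows the kernel
  scale hidden in \<open>G\<close> to shrink.\<close>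

lemma truncation_uniform:
  fixes A D D0 d \<epsilon> :: real
  assumes "A \<ge> 0" "D \<ge> 0" "D0 \<ge> 0" "d > 0" "\<epsilon> > 0"
  obtains \<delta> where "\<delta> > 0"
    "\<And>(F :: real^'n::finite \<Rightarrow> real^'n) S U G. F \<in> borel_measurable borel \<Longrightarrow> (\<And>x. norm (F x) \<le> A) \<Longrightarrow> compact S \<Longrightarrow> S \<noteq> {} \<Longrightarrow>
      {x. infdist x S \<le> 2 * d} \<subseteq> U \<Longrightarrow> smooth G \<Longrightarrow> (\<And>x. x \<notin> S \<Longrightarrow> G x = 0) \<Longrightarrow> (\<And>x. \<bar>G x\<bar> \<le> D0) \<Longrightarrow>
      (\<integral>x. (norm (grad G x))\<^sup>2 \<partial>lborel) \<le> D \<Longrightarrow>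
      (\<And>\<psi>. test_fun U \<psi> \<Longrightarrow> (\<And>x. norm (grad \<psi> x) \<le> 1) \<Longrightarrow> \<bar>\<integral>x. F x \<bullet> grad \<psi> x \<partial>lborel\<bar> \<le> \<delta>) \<Longrightarrow>
      \<bar>\<integral>x. F x \<bullet> grad G x \<partial>lborel\<bar> \<le> \<epsilon>"
proof -
  let ?N = "CARD('n)"
  define c where "c = 2 ^ (?N + 1) + D0 / d"
  define Q where "Q = A * ((1 + c) * (20 ^ ?N * D) + D)"
  have c: "c > 0" using assms by (auto simp: c_def intro!: add_pos_nonneg)
  have Q: "Q \<ge> 0" using assms c by (auto simp: Q_def intro!: mult_nonneg_nonneg add_nonneg_nonneg)
  define l where "l = max 1 (2 * Q / \<epsilon>)"
  define L where "L = 2 ^ (?N + 1) * l + D0 / d"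
  have l: "l \<ge> 1" "2 * Q / \<epsilon> \<le> l" by (auto simp: l_def)
  have L0: "L > 0" using l assms by (auto simp: L_def intro!: add_pos_nonneg)
  have Lc: "L \<le> c * l"
    using l mult_left_mono[of 1 l "D0 / d"] assms by (simp add: L_def c_def distrib_right)
  have "A * ((l + L) * (20 ^ ?N * D / l\<^sup>2) + D / l) \<le> A * ((l + c * l) * (20 ^ ?N * D / l\<^sup>2) + D / l)"
    using assms Lc by (intro mult_left_mono add_right_mono mult_right_mono) auto
  also have "\<dots> = Q / l" using l by (simp add: Q_def field_simps power2_eq_square)
  also have "\<dots> \<le> \<epsilon> / 2" using l assms by (simp add: field_simps)
  finally have small: "A * ((l + L) * (20 ^ ?N * D / l\<^sup>2) + D / l) \<le> \<epsilon> / 2" .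
  show ?thesis
  proof (rule that[of "\<epsilon> / (2 * L)"])
    show "\<epsilon> / (2 * L) > 0" using assms L0 by simp
    fix F :: "real^'n \<Rightarrow> real^'n" and S U :: "(real^'n) set" and G :: "real^'n \<Rightarrow> real"
    assume *: "F \<in> borel_measurable borel" "\<And>x. norm (F x) \<le> A" "compact S" "S \<noteq> {}"
      "{x. infdist x S \<le> 2 * d} \<subseteq> U" "smooth G" "\<And>x. x \<notin> S \<Longrightarrow> G x = 0" "\<And>x. \<bar>G x\<bar> \<le> D0"
      "(\<integral>x. (norm (grad G x))\<^sup>2 \<partial>lborel) \<le> D"
      "\<And>\<psi>. test_fun U \<psi> \<Longrightarrow> (\<And>x. norm (grad \<psi> x) \<le> 1) \<Longrightarrow> \<bar>\<integral>x. F x \<bullet> grad \<psi> x \<partial>lborel\<bar> \<le> \<epsilon> / (2 * L)"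
    have "\<bar>\<integral>x. F x \<bullet> grad G x \<partial>lborel\<bar> \<le> \<epsilon> / (2 * L) * L + A * ((l + L) * (20 ^ ?N * D / l\<^sup>2) + D / l)"
      by (rule lipschitz_truncation[OF *(1-4) assms(4) *(5-9) _ *(10) L_def]) (use l in auto)
    moreover have "\<epsilon> / (2 * L) * L = \<epsilon> / 2" using L0 by simp
    ultimately show "\<bar>\<integral>x. F x \<bullet> grad G x \<partial>lborel\<bar> \<le> \<epsilon>" using small by linarith
  qed
qed

section \<open>Mollification of pairings\<close>

text \<open>An even kernel makes convolution self-adjoint; bounded supports make the double integral
  absolutely convergent.\<close>

lemma conv_pairing:
  fixes K V W :: "real^'n::finite \<Rightarrow> real"
  assumes K: "continuous_on UNIV K" "\<And>x. norm x > T \<Longrightarrow> K x = 0" "\<And>x. K (- x) = K x"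
    and V: "V \<in> borel_measurable borel" "\<And>x. \<bar>V x\<bar> \<le> A" "\<And>x. norm x > R \<Longrightarrow> V x = 0"
    and W: "W \<in> borel_measurable borel" "\<And>x. \<bar>W x\<bar> \<le> B" "\<And>x. norm x > R \<Longrightarrow> W x = 0"
  shows "(\<integral>x. W x * conv K V x \<partial>lborel) = (\<integral>x. V x * conv K W x \<partial>lborel)"
proof -
  note [measurable] = V(1) W(1) borel_measurable_continuous_onI[OF K(1)]
  obtain b where b: "b > 0" "\<And>x. norm (K x) \<le> b"
    using bounded_of_compact_support[OF K(1) compact_cball[of 0 T]] K(2) by (metis mem_cball_0 not_le)
  have A: "A \<ge> 0" "B \<ge> 0" using V(2)[of 0] W(2)[of 0] by linarith+
  let ?f = "\<lambda>(x, y). W x * (V y * K (x - y))"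
  have "integrable lborel ?f"
  proof (rule integrable_compact_support)
    show "?f \<in> borel_measurable borel"
      unfolding borel_prod[symmetric] by measurable
    show "compact (cball (0::real^'n) R \<times> cball (0::real^'n) R)" by (intro compact_Times compact_cball)
    show "?f z = 0" if "z \<notin> cball 0 R \<times> cball 0 R" for z
      using that V(3) W(3) by (cases z) (auto simp: not_le)
    show "norm (?f z) \<le> B * (A * b)" for z
      using A b by (cases z) (auto simp: abs_mult intro!: mult_mono V(2) W(2))
  qed
  then have "integrable (lborel \<Otimes>\<^sub>M lborel) ?f" by (simp add: lborel_prod)
  from lborel_pair.Fubini_integral[OF this]
  have F: "(\<integral>y. \<integral>x. W x * (V y * K (x - y)) \<partial>lborel \<partial>lborel) = (\<integral>x. \<integral>y. W x * (V y * K (x - y)) \<partial>lborel \<partial>lborel)" .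
  have a: "(\<integral>y. W x * (V y * K (x - y)) \<partial>lborel) = W x * conv K V x" for x
    by (simp add: conv_def)
  have b: "(\<integral>x. W x * (V y * K (x - y)) \<partial>lborel) = V y * conv K W y" for y
  proof -
    have eq: "(\<lambda>x. W x * (V y * K (x - y))) = (\<lambda>x. V y * (W x * K (y - x)))"
      using K(3)[of "x - y" for x] by (auto simp: mult_ac)
    show ?thesis unfolding eq conv_def by simp
  qed
  show ?thesis using F unfolding a b by (rule sym)
qed

text \<open>Measurability supplies continuous functions converging to \<open>V\<close> off a null
  set. Clamping them to \<open>[-A, A]\<close> and cutting off between the radii R and R + 1 permits
  dominated convergence, and leaves the limit unchanged because \<open>V\<close> obeys both
  constraints.\<close>

lemma bounded_measurable_approx:
  fixes V :: "real^'n::finite \<Rightarrow> real"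
  assumes V: "V \<in> borel_measurable borel" "\<And>x. \<bar>V x\<bar> \<le> A" "\<And>x. norm x > R \<Longrightarrow> V x = 0" and \<epsilon>: "\<epsilon> > 0"
  shows "\<exists>g. continuous_on UNIV g \<and> (\<forall>x. \<bar>g x\<bar> \<le> A) \<and> (\<forall>x. norm x > R + 1 \<longrightarrow> g x = 0) \<and>
    (\<integral>x. \<bar>V x - g x\<bar> \<partial>lborel) < \<epsilon>"
proof -
  have A: "A \<ge> 0" using V(2)[of 0] by linarith
  have "V \<in> borel_measurable lebesgue" using V(1) by (simp add: measurable_completion)
  then have "V measurable_on UNIV" by (simp add: measurable_on_iff_borel_measurable lebesgue_on_UNIV_eq)
  then obtain N h where N: "negligible N" and h: "\<And>n::nat. continuous_on UNIV (h n)"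
    and lim: "\<And>x. x \<notin> N \<Longrightarrow> (\<lambda>n. h n x) \<longlonglongrightarrow> V x"
    unfolding measurable_on_def by auto
  define c where "c = (\<lambda>x::real^'n. max 0 (min 1 (R + 1 - norm x)))"
  define g where "g = (\<lambda>n x. c x * max (- A) (min A (h n x)))"
  have cg: "continuous_on UNIV (g n)" for n
    unfolding g_def c_def by (intro continuous_intros h)
  have gb: "\<bar>g n x\<bar> \<le> A" for n x
  proof -
    have "\<bar>g n x\<bar> \<le> 1 * A"
      unfolding g_def abs_mult using A by (intro mult_mono) (auto simp: c_def)
    then show ?thesis by simp
  qed
  have gz: "g n x = 0" if "norm x > R + 1" for n x
    using that by (simp add: g_def c_def)
  have glim: "(\<lambda>n. g n x) \<longlonglongrightarrow> V x" if "x \<notin> N" for x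
  proof -
    have "(\<lambda>n. g n x) \<longlonglongrightarrow> c x * max (- A) (min A (V x))"
      unfolding g_def by (intro tendsto_intros lim that)
    also have "c x * max (- A) (min A (V x)) = V x"
    proof (cases "norm x > R")
      case False
      then show ?thesis using V(2)[of x] A by (auto simp: c_def abs_le_iff)
    qed (use V(3) A in simp)
    finally show ?thesis .
  qed
  have "(\<lambda>n. \<integral>x. \<bar>V x - g n x\<bar> \<partial>lborel) \<longlonglongrightarrow> integral\<^sup>L lborel (\<lambda>x::real^'n. 0::real)"
  proof (rule integral_dominated_convergence[where w="\<lambda>x. 2 * A * indicator (cball 0 (R + 1)) x"])
    show "integrable lborel (\<lambda>x::real^'n. 2 * A * indicat_real (cball 0 (R + 1)) x)"
      using emeasure_compact_finite[OF compact_cball, of "0::real^'n" "R + 1"]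
      by (intro integrable_mult_right integrable_real_indicator) auto
    show "AE x in lborel. (\<lambda>n. \<bar>V x - g n x\<bar>) \<longlonglongrightarrow> 0"
    proof -
      have "N \<in> null_sets (completion lborel)" using N by (simp add: negligible_iff_null_sets)
      then have "AE x in completion lborel. x \<notin> N" by (rule AE_not_in)
      then have "AE x in lborel. x \<notin> N" by (simp add: AE_completion_iff)
      then show ?thesis
      proof eventually_elim
        case (elim x)
        then have "(\<lambda>n. \<bar>V x - g n x\<bar>) \<longlonglongrightarrow> \<bar>V x - V x\<bar>"
          by (intro tendsto_intros glim)
        then show ?case by simp
      qed
    qed
    show "AE x in lborel. norm \<bar>V x - g n x\<bar> \<le> 2 * A * indicat_real (cball 0 (R + 1)) x" for n
    proof (rule AE_I2)
      fix x
      show "norm \<bar>V x - g n x\<bar> \<le> 2 * A * indicat_real (cball 0 (R + 1)) x"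
      proof (cases "norm x > R + 1")
        case True
        then show ?thesis using V(3)[of x] gz[of x n] by simp
      next
        case False
        then show ?thesis using V(2)[of x] gb[of n x] by simp
      qed
    qed
    show "(\<lambda>x. \<bar>V x - g n x\<bar>) \<in> borel_measurable lborel" for n
      using V(1) borel_measurable_continuous_onI[OF cg[of n]] by measurable
  qed simp
  then have "\<forall>\<^sub>F n in sequentially. (\<integral>x. \<bar>V x - g n x\<bar> \<partial>lborel) < \<epsilon>"
    using \<epsilon> by (simp add: order_tendstoD)
  then obtain n where "(\<integral>x. \<bar>V x - g n x\<bar> \<partial>lborel) < \<epsilon>"
    by (auto simp: eventually_sequentially)
  then show ?thesis using cg[of n] gb[of n] gz[of _ n] by (intro exI[of _ "g n"]) simp
qed

lemma conv_diff:
  assumes "integrable lborel (\<lambda>y. V y * K (x - y))" "integrable lborel (\<lambda>y. W y * K (x - y))"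
  shows "conv K (\<lambda>y. V y - W y) x = conv K V x - conv K W x"
  using assms by (simp add: conv_def left_diff_distrib)

text \<open>\<open>V\<close> is exchanged for a continuous \<open>g\<close>, whose mollifications
  converge uniformly on the support of \<open>W\<close>. The error \<open>V - g\<close> is small
  only in \<open>L^1\<close>, so its mollification is moved onto the bounded \<open>W\<close> by
  self-adjointness.\<close>

lemma mollified_pairing:
  fixes V W :: "real^'n::finite \<Rightarrow> real"
  assumes V: "V \<in> borel_measurable borel" "\<And>x. \<bar>V x\<bar> \<le> A" "\<And>x. norm x > R \<Longrightarrow> V x = 0"
    and W: "W \<in> borel_measurable borel" "\<And>x. \<bar>W x\<bar> \<le> B" "\<And>x. norm x > R \<Longrightarrow> W x = 0" and \<epsilon>: "\<epsilon> > 0"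
  obtains t0 where "t0 > 0" "\<And>t. 0 < t \<Longrightarrow> t < t0 \<Longrightarrow> \<bar>(\<integral>x. W x * conv (mol t) V x \<partial>lborel) - (\<integral>x. W x * V x \<partial>lborel)\<bar> \<le> \<epsilon>"
proof -
  have B: "B \<ge> 0" using W(2)[of 0] by linarith
  \<comment> \<open>The exchange of \<open>V\<close> for \<open>g\<close> is paid twice, with
    \<epsilon> / 4 each; the uniform convergence for \<open>g\<close> receives \<epsilon> /
    2.\<close>
  define \<epsilon>1 where "\<epsilon>1 = \<epsilon> / (4 * (B + 1))"
  have \<epsilon>1: "\<epsilon>1 > 0" using \<epsilon> B by (simp add: \<epsilon>1_def)
  obtain g where gg: "continuous_on UNIV g \<and> (\<forall>x. \<bar>g x\<bar> \<le> A) \<and> (\<forall>x. norm x > R + 1 \<longrightarrow> g x = 0) \<and>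
    (\<integral>x. \<bar>V x - g x\<bar> \<partial>lborel) < \<epsilon>1"
    using bounded_measurable_approx[OF V \<epsilon>1] ..
  then have g: "continuous_on UNIV g" "\<And>x. \<bar>g x\<bar> \<le> A" "\<And>x. norm x > R + 1 \<Longrightarrow> g x = 0"
    "(\<integral>x. \<bar>V x - g x\<bar> \<partial>lborel) < \<epsilon>1"
    by simp_all
  note [measurable] = V(1) W(1) borel_measurable_continuous_onI[OF g(1)]
  define m where "m = measure lborel (cball (0::real^'n) R)"
  define \<epsilon>2 where "\<epsilon>2 = \<epsilon> / (2 * (B * m + 1))"
  have m: "m \<ge> 0" by (simp add: m_def)
  have \<epsilon>2: "\<epsilon>2 > 0" using \<epsilon> B m by (simp add: \<epsilon>2_def add_nonneg_pos)
  have "uniformly_continuous_on (cball 0 (R + 1)) g"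
    by (rule compact_uniformly_continuous[OF continuous_on_subset[OF g(1)] compact_cball]) simp
  from this[unfolded uniformly_continuous_on_def, rule_format, OF \<epsilon>2]
  obtain t0 where t0: "t0 > 0" "\<forall>x\<in>cball 0 (R + 1). \<forall>y\<in>cball 0 (R + 1). dist y x < t0 \<longrightarrow> dist (g y) (g x) < \<epsilon>2"
    by blast
  have Vi: "integrable lborel V"
    by (rule integrable_compact_support[OF V(1) compact_cball[of 0 R]]) (use V(2,3) in \<open>auto simp: not_le\<close>)
  have gi: "integrable lborel g"
    by (rule integrable_continuous_compact_support[OF g(1) compact_cball[of 0 "R + 1"]]) (simp add: g(3))
  have Wi: "integrable lborel (\<lambda>x. W x * H x)" if "H \<in> borel_measurable borel" "\<And>x. \<bar>H x\<bar> \<le> C" for H C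
  proof (rule integrable_compact_support[of _ "cball 0 R" "B * C"])
    show "norm (W x * H x) \<le> B * C" for x
      unfolding real_norm_def abs_mult using B by (intro mult_mono W(2) that(2)) auto
    show "(\<lambda>x. W x * H x) \<in> borel_measurable borel" using that(1) by measurable
    show "W x * H x = 0" if "x \<notin> cball 0 R" for x using that W(3)[of x] by simp
  qed simp
  show ?thesis
  proof (rule that[of "min t0 1"])
    show "min t0 1 > 0" using t0 by simp
    fix t assume t: "0 < t" "t < min t0 1"
    have mz: "x \<notin> cball 0 t \<Longrightarrow> mol t x = 0" for x :: "real^'n" using t by (simp add: mol_zero)
    have cV: "conv (mol t) (\<lambda>x. V x - g x) x = conv (mol t) V x - conv (mol t) g x" for x
      by (rule conv_diff[OF conv_integrable[OF smooth_mol compact_cball mz Vi] conv_integrable[OF smooth_mol compact_cball mz gi]])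
    have mV: "conv (mol t) V \<in> borel_measurable borel"
      by (rule borel_measurable_continuous_onI[OF smooth_continuous[OF conv_smooth[OF smooth_mol compact_cball mz Vi]]])
    have mg: "conv (mol t) g \<in> borel_measurable borel"
      by (rule borel_measurable_continuous_onI[OF smooth_continuous[OF conv_smooth[OF smooth_mol compact_cball mz gi]]])
    have iWV: "integrable lborel (\<lambda>x. W x * conv (mol t) V x)" by (rule Wi[OF mV conv_mol_abs_le[OF t(1) V(2)]])
    have iWg: "integrable lborel (\<lambda>x. W x * conv (mol t) g x)" by (rule Wi[OF mg conv_mol_abs_le[OF t(1) g(2)]])
    have iV: "integrable lborel (\<lambda>x. W x * V x)" by (rule Wi[OF V(1,2)])
    have ig: "integrable lborel (\<lambda>x. W x * g x)" by (rule Wi[OF _ g(2)]) measurable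
    have iVg: "integrable lborel (\<lambda>x. \<bar>V x - g x\<bar>)" using Vi gi by simp
    have "(\<integral>x. W x * conv (mol t) (\<lambda>x. V x - g x) x \<partial>lborel) = (\<integral>x. (V x - g x) * conv (mol t) W x \<partial>lborel)"
    proof (rule conv_pairing[where T=t and R="R + 1" and A="2 * A" and B=B])
      show "\<bar>V x - g x\<bar> \<le> 2 * A" for x using V(2)[of x] g(2)[of x] by linarith
      show "norm x > R + 1 \<Longrightarrow> V x - g x = 0" for x using V(3)[of x] g(3)[of x] by simp
      show "norm x > R + 1 \<Longrightarrow> W x = 0" for x using W(3)[of x] by simp
      show "norm x > t \<Longrightarrow> mol t x = 0" for x :: "real^'n" by (rule mol_zero[OF t(1)])
      show "(\<lambda>x. V x - g x) \<in> borel_measurable borel" by measurable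
    qed (rule continuous_mol mol_minus W(1) W(2))+
    also have "norm \<dots> \<le> (\<integral>x. B * \<bar>V x - g x\<bar> \<partial>lborel)"
    proof (rule norm_integral_le[OF integrable_mult_right[OF iVg]])
      fix x
      have "\<bar>V x - g x\<bar> * \<bar>conv (mol t) W x\<bar> \<le> \<bar>V x - g x\<bar> * B"
        by (intro mult_left_mono conv_mol_abs_le[OF t(1) W(2)]) simp
      then show "norm ((V x - g x) * conv (mol t) W x) \<le> B * \<bar>V x - g x\<bar>" by (simp add: abs_mult mult.commute)
    qed
    also have "\<dots> \<le> B * \<epsilon>1" using g(4) B by (simp add: mult_left_mono)
    finally have 1: "\<bar>(\<integral>x. W x * conv (mol t) V x \<partial>lborel) - (\<integral>x. W x * conv (mol t) g x \<partial>lborel)\<bar> \<le> B * \<epsilon>1"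
      unfolding cV right_diff_distrib Bochner_Integration.integral_diff[OF iWV iWg] by simp
    have "norm (\<integral>x. W x * conv (mol t) g x - W x * g x \<partial>lborel) \<le> (\<integral>x. B * \<epsilon>2 * indicator (cball (0::real^'n) R) x \<partial>lborel)"
    proof (rule norm_integral_le)
      show "integrable lborel (\<lambda>x::real^'n. B * \<epsilon>2 * indicat_real (cball 0 R) x)"
        using emeasure_compact_finite[OF compact_cball, of "0::real^'n" R]
        by (intro integrable_mult_right integrable_real_indicator) auto
      fix x
      show "norm (W x * conv (mol t) g x - W x * g x) \<le> B * \<epsilon>2 * indicator (cball 0 R) x"
      proof (cases "norm x > R")
        case True
        then show ?thesis using W(3)[of x] by simp
      next
        case False
        have "\<bar>conv (mol t) g x - g x\<bar> \<le> \<epsilon>2"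
        proof (rule conv_mol_close[OF t(1) gi])
          fix y assume y: "dist y x \<le> t"
          have "norm y \<le> norm x + dist y x" using norm_triangle_sub[of y x] by (simp add: dist_norm)
          then have "norm y \<le> R + 1" using y t False by simp
          then show "\<bar>g y - g x\<bar> \<le> \<epsilon>2"
            using t0(2)[THEN bspec[of _ _ x], THEN bspec[of _ _ y]] y t False by (simp add: dist_real_def)
        qed
        then have "\<bar>W x\<bar> * \<bar>conv (mol t) g x - g x\<bar> \<le> B * \<epsilon>2"
          by (intro mult_mono W(2) B) auto
        then show ?thesis using False by (simp add: right_diff_distrib[symmetric] abs_mult)
      qed
    qed
    then have 2: "\<bar>(\<integral>x. W x * conv (mol t) g x \<partial>lborel) - (\<integral>x. W x * g x \<partial>lborel)\<bar> \<le> B * \<epsilon>2 * m"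
      unfolding Bochner_Integration.integral_diff[OF iWg ig] by (simp add: m_def)
    have "norm (\<integral>x. W x * g x - W x * V x \<partial>lborel) \<le> (\<integral>x. B * \<bar>V x - g x\<bar> \<partial>lborel)"
    proof (rule norm_integral_le[OF integrable_mult_right[OF iVg]])
      fix x
      have "\<bar>W x\<bar> * \<bar>g x - V x\<bar> \<le> B * \<bar>g x - V x\<bar>" by (intro mult_right_mono W(2)) simp
      then show "norm (W x * g x - W x * V x) \<le> B * \<bar>V x - g x\<bar>"
        by (simp add: right_diff_distrib[symmetric] abs_mult abs_minus_commute)
    qed
    also have "\<dots> \<le> B * \<epsilon>1" using g(4) B by (simp add: mult_left_mono)
    finally have 3: "\<bar>(\<integral>x. W x * g x \<partial>lborel) - (\<integral>x. W x * V x \<partial>lborel)\<bar> \<le> B * \<epsilon>1"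
      unfolding Bochner_Integration.integral_diff[OF ig iV] by simp
    have "B * \<epsilon>1 \<le> \<epsilon> / 4" using \<epsilon> B by (simp add: \<epsilon>1_def field_simps)
    moreover have "B * \<epsilon>2 * m \<le> \<epsilon> / 2"
    proof -
      have "B * \<epsilon>2 * m = (\<epsilon> / 2) * ((B * m) / (B * m + 1))" by (simp add: \<epsilon>2_def)
      also have "\<dots> \<le> (\<epsilon> / 2) * 1" using \<epsilon> B m by (intro mult_left_mono) (auto simp: divide_le_eq_1 add_nonneg_pos)
      finally show ?thesis by simp
    qed
    ultimately show "\<bar>(\<integral>x. W x * conv (mol t) V x \<partial>lborel) - (\<integral>x. W x * V x \<partial>lborel)\<bar> \<le> \<epsilon>"
      using 1 2 3 by linarith
  qed
qed

section \<open>The truncated div-curl identity\<close>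

text \<open>The constant of \<open>integral_pd_ker_le\<close>; the type of the index also fixes the
  dimension.\<close>

definition bump_const :: "'n::finite \<Rightarrow> real" where
  "bump_const j = (\<integral>x. \<bar>pd j (bump 0) (x::real^'n)\<bar> \<partial>lborel) / (2 * bump_mass TYPE('n))"

lemma bump_const_nonneg: "bump_const j \<ge> 0"
  unfolding bump_const_def using bump_mass_pos[where 'n='a] by (intro divide_nonneg_pos) auto

lemma integral_bounded_support_le:
  fixes f :: "real^'n::finite \<Rightarrow> real"
  assumes "\<And>x. \<bar>f x\<bar> \<le> b" "\<And>x. norm x > R \<Longrightarrow> f x = 0"
  shows "\<bar>\<integral>x. f x \<partial>lborel\<bar> \<le> b * measure lborel (cball (0::real^'n) R)"
proof -
  have "norm (\<integral>x. f x \<partial>lborel) \<le> (\<integral>x. b * indicator (cball (0::real^'n) R) x \<partial>lborel)"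
  proof (rule norm_integral_le)
    show "integrable lborel (\<lambda>x::real^'n. b * indicat_real (cball 0 R) x)"
      using emeasure_compact_finite[OF compact_cball, of "0::real^'n" R]
      by (intro integrable_mult_right integrable_real_indicator) auto
    show "norm (f x) \<le> b * indicat_real (cball 0 R) x" for x
      using assms(1)[of x] assms(2)[of x] by (cases "norm x > R") auto
  qed
  then show ?thesis by simp
qed

lemma pd_neg_arg:
  fixes f :: "real^'n::finite \<Rightarrow> real"
  assumes "smooth f" "\<And>x. f (- x) = c * f x"
  shows "pd i f (- x) = - c * pd i f x"
proof -
  have "pd i (\<lambda>x. f ((-1) *\<^sub>R x + 0)) x = -1 * pd i f ((-1) *\<^sub>R x + 0)"
    by (rule pd_affine[OF smooth_differentiable[OF assms(1)]])
  moreover have "(\<lambda>x. f ((-1) *\<^sub>R x + 0)) = (\<lambda>x. c * f x)" using assms(2) by auto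
  ultimately have "pd i (\<lambda>x. c * f x) x = - pd i f (- x)" by simp
  then show ?thesis by (simp add: pd_cmult[OF assms(1)])
qed

section \<open>The common setting: a cutoff, two bounded fields and their truncated
  potentials\<close>

context
  fixes \<eta> T R A P0 P1 d :: real and \<phi> :: "real^'n::finite \<Rightarrow> real" and S U :: "(real^'n) set"
    and v w :: "real^'n \<Rightarrow> real^'n"
  assumes \<eta>: "0 < \<eta>" "\<eta> < T" and T: "T \<le> 1" "T \<le> d"
    and \<phi>: "smooth \<phi>" "compact S" "\<And>x. x \<notin> S \<Longrightarrow> \<phi> x = 0" "\<And>x. \<bar>\<phi> x\<bar> \<le> P0" "\<And>x. norm (grad \<phi> x) \<le> P1"
    and U: "S \<subseteq> U" "U \<subseteq> cball 0 R"
    and v: "v \<in> borel_measurable borel" "\<And>x. norm (v x) \<le> A" "\<And>x. x \<notin> U \<Longrightarrow> v x = 0"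
    and w: "w \<in> borel_measurable borel" "\<And>x. norm (w x) \<le> A" "\<And>x. x \<notin> U \<Longrightarrow> w x = 0"
begin

text \<open>\<open>H\<close> and \<open>Q\<close> are the truncated potentials of v and of \<phi> w,
  and \<open>\<Psi>\<close> is the divergence of \<open>H\<close>. The cutoff sits on w so that
  \<open>Q\<close> is supported near \<open>S\<close>; \<open>\<Psi>\<close> is not localised and is
  multiplied by \<phi> where it serves as a test function.\<close>

abbreviation (input) V :: "'n \<Rightarrow> real^'n \<Rightarrow> real" where "V i \<equiv> (\<lambda>x. v x $ i)"
abbreviation (input) W :: "'n \<Rightarrow> real^'n \<Rightarrow> real" where "W i \<equiv> (\<lambda>x. \<phi> x * w x $ i)"
abbreviation (input) H :: "'n \<Rightarrow> real^'n \<Rightarrow> real" where "H i \<equiv> conv (ker \<eta> T) (V i)"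
abbreviation (input) Q :: "'n \<Rightarrow> real^'n \<Rightarrow> real" where "Q i \<equiv> conv (ker \<eta> T) (W i)"
abbreviation (input) \<Psi> :: "real^'n \<Rightarrow> real" where "\<Psi> \<equiv> (\<lambda>x. \<Sum>j\<in>UNIV. pd j (H j) x)"

lemma A_nonneg: "A \<ge> 0" using v(2)[of 0] norm_ge_zero order_trans by blast
lemma P0_nonneg: "P0 \<ge> 0" using \<phi>(4)[of 0] by linarith

lemma component_measurable [measurable]: "V i \<in> borel_measurable borel" "W i \<in> borel_measurable borel"
proof -
  note [measurable] = v(1) w(1) borel_measurable_continuous_onI[OF smooth_continuous[OF \<phi>(1)]]
  have [measurable]: "(\<lambda>x::real^'n. x $ i) \<in> borel_measurable borel"
    by (intro borel_measurable_continuous_onI continuous_on_component continuous_on_id)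
  show "V i \<in> borel_measurable borel" "W i \<in> borel_measurable borel" by measurable
qed

lemma V_bound: "\<bar>V i x\<bar> \<le> A"
  using component_le_norm_cart[of "v x" i] v(2)[of x] by linarith

lemma W_bound: "\<bar>W i x\<bar> \<le> P0 * A"
  unfolding abs_mult using component_le_norm_cart[of "w x" i] w(2)[of x] P0_nonneg
  by (intro mult_mono \<phi>(4)) auto

lemma V_zero: "norm x > R \<Longrightarrow> V i x = 0"
  using v(3)[of x] U(2) by (cases "x \<in> U") (auto simp: subset_iff)

lemma W_zero: "norm x > R \<Longrightarrow> W i x = 0"
  using w(3)[of x] U(2) by (cases "x \<in> U") (auto simp: subset_iff)

lemmas HV = \<eta> component_measurable(1) V_bound V_zero
lemmas QW = \<eta> component_measurable(2) W_bound W_zero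

lemma smooth_H: "smooth (H i)" by (rule conv_ker_smooth[OF HV])

lemma smooth_Q: "smooth (Q i)" by (rule conv_ker_smooth[OF QW])

lemma H_pd: "pd j (H i) = conv (pd j (ker \<eta> T)) (V i)" by (rule conv_ker_pd[OF HV])

lemma Q_pd: "pd j (Q i) = conv (pd j (ker \<eta> T)) (W i)" by (rule conv_ker_pd[OF QW])

lemma H_pd_pd: "pd k (pd j (H i)) = conv (pd k (pd j (ker \<eta> T))) (V i)" by (rule conv_ker_pd_pd[OF HV])

lemma Q_pd_pd: "pd k (pd j (Q i)) = conv (pd k (pd j (ker \<eta> T))) (W i)" by (rule conv_ker_pd_pd[OF QW])

lemma H_laplace: "(\<Sum>j\<in>UNIV. pd j (pd j (H i)) x) = conv (mol T) (V i) x - conv (mol \<eta>) (V i) x"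
  by (rule conv_ker_laplace[OF HV])

lemma H_zero: "norm x > R + T \<Longrightarrow> H i x = 0" by (rule conv_ker_zero[OF HV])

lemma H_energy: "(\<integral>x. (norm (grad (pd j (H i)) x))\<^sup>2 \<partial>lborel) \<le> 4 * A\<^sup>2 * measure lborel (cball (0::real^'n) (R + T))"
  unfolding H_pd by (rule conv_ker_L2[OF HV])

lemma Q_energy: "(\<integral>x. (norm (grad (pd j (Q i)) x))\<^sup>2 \<partial>lborel) \<le> 4 * (P0 * A)\<^sup>2 * measure lborel (cball (0::real^'n) (R + T))"
  unfolding Q_pd by (rule conv_ker_L2[OF QW])

lemma smooth_Psi: "smooth \<Psi>"
  by (intro smooth_sum smooth_pd smooth_H)

text \<open>The factor T comes from the \<open>L^1\<close> norm of the kernel gradient;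
  \<open>X\<close> contributes only its sup norm.\<close>

lemma ker_conv_bound:
  assumes "\<And>x. \<bar>X x\<bar> \<le> B"
  shows "\<bar>conv (pd j (ker \<eta> T)) X x\<bar> \<le> B * (T * bump_const j)"
proof -
  have "B \<ge> 0" using assms[of 0] by linarith
  then show ?thesis
    using order_trans[OF conv_abs_le[where V=X, OF integrable_pd_ker[OF \<eta>] assms]
      mult_left_mono[OF integral_pd_ker_le[OF \<eta>]]] unfolding bump_const_def by blast
qed

lemma Psi_bound: "\<bar>\<Psi> x\<bar> \<le> A * (T * (\<Sum>j\<in>UNIV. bump_const (j::'n)))"
proof -
  have "\<bar>\<Psi> x\<bar> \<le> (\<Sum>j\<in>UNIV. \<bar>pd j (H j) x\<bar>)" by (rule sum_abs)
  also have "\<dots> \<le> (\<Sum>j\<in>(UNIV::'n set). A * (T * bump_const j))"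
    unfolding H_pd by (intro sum_mono ker_conv_bound V_bound)
  finally show ?thesis by (simp add: sum_distrib_left)
qed

lemma measure_cball_le: "measure lborel (cball (0::real^'n) (R + T)) \<le> measure lborel (cball (0::real^'n) (R + 1))"
  using T by (intro measure_mono_fmeasurable subset_cball fmeasurableI)
    (auto simp: emeasure_compact_finite[OF compact_cball, simplified])

lemma Psi_energy:
  "integrable lborel (\<lambda>x. (norm (grad \<Psi> x))\<^sup>2)"
  "(\<integral>x. (norm (grad \<Psi> x))\<^sup>2 \<partial>lborel) \<le> real CARD('n) * (real CARD('n) * (4 * A\<^sup>2 * measure lborel (cball (0::real^'n) (R + 1))))"
proof -
  have z: "x \<notin> cball 0 (R + T) \<Longrightarrow> pd j (H i) x = 0" for x i j
    by (rule pd_zero_outside[OF closed_cball[of 0 "R + T"]]) (simp_all add: H_zero)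
  have gz: "x \<notin> cball 0 (R + T) \<Longrightarrow> grad (pd j (H i)) x = 0" for x i j
    by (rule grad_zero_outside[OF closed_cball z])
  have Iint: "integrable lborel (\<lambda>x. (norm (grad (pd j (H i)) x))\<^sup>2)" for i j
    by (rule integrable_continuous_compact_support[OF continuous_on_power[OF continuous_on_norm[OF continuous_on_grad[OF smooth_pd[OF smooth_H]]]] compact_cball[of 0 "R + T"]])
       (subst gz, assumption, simp)
  have g: "grad \<Psi> x = (\<Sum>j\<in>UNIV. grad (pd j (H j)) x)" for x
    by (simp add: vec_eq_iff pd_sum smooth_pd smooth_H)
  have pt: "(norm (grad \<Psi> x))\<^sup>2 \<le> (\<Sum>j\<in>UNIV. real CARD('n) * (norm (grad (pd j (H j)) x))\<^sup>2)" for x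
  proof -
    have "(norm (grad \<Psi> x))\<^sup>2 \<le> (\<Sum>j\<in>UNIV. norm (grad (pd j (H j)) x))\<^sup>2"
      unfolding g by (intro power_mono norm_sum) auto
    also have "\<dots> \<le> (\<Sum>j\<in>UNIV. (norm (grad (pd j (H j)) x))\<^sup>2) * real CARD('n)"
      by (rule sum_squared_le_sum_of_squares)
    finally show ?thesis by (simp add: sum_distrib_left mult.commute)
  qed
  have "x \<notin> cball 0 (R + T) \<Longrightarrow> grad \<Psi> x = 0" for x unfolding g using gz by (intro sum.neutral) auto
  then show int: "integrable lborel (\<lambda>x. (norm (grad \<Psi> x))\<^sup>2)"
    by (intro integrable_continuous_compact_support[OF continuous_on_power[OF continuous_on_norm[OF continuous_on_grad[OF smooth_Psi]]] compact_cball[of 0 "R + T"]]) simp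
  have "(\<integral>x. (norm (grad \<Psi> x))\<^sup>2 \<partial>lborel) \<le> (\<integral>x. (\<Sum>j\<in>UNIV. real CARD('n) * (norm (grad (pd j (H j)) x))\<^sup>2) \<partial>lborel)"
    by (intro integral_mono[OF int] Bochner_Integration.integrable_sum integrable_mult_right Iint pt)
  also have "\<dots> = (\<Sum>j\<in>UNIV. real CARD('n) * (\<integral>x. (norm (grad (pd j (H j)) x))\<^sup>2 \<partial>lborel))"
    by (subst Bochner_Integration.integral_sum) (auto intro: Iint)
  also have "\<dots> \<le> (\<Sum>j\<in>(UNIV::'n set). real CARD('n) * (4 * A\<^sup>2 * measure lborel (cball (0::real^'n) (R + 1))))"
  proof (intro sum_mono mult_left_mono)
    fix j
    have "(\<integral>x. (norm (grad (pd j (H j)) x))\<^sup>2 \<partial>lborel) \<le> 4 * A\<^sup>2 * measure lborel (cball (0::real^'n) (R + T))"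
      by (rule H_energy)
    also have "\<dots> \<le> 4 * A\<^sup>2 * measure lborel (cball (0::real^'n) (R + 1))" by (intro mult_left_mono measure_cball_le) simp
    finally show "(\<integral>x. (norm (grad (pd j (H j)) x))\<^sup>2 \<partial>lborel) \<le> 4 * A\<^sup>2 * measure lborel (cball (0::real^'n) (R + 1))" .
  qed simp
  finally show "(\<integral>x. (norm (grad \<Psi> x))\<^sup>2 \<partial>lborel) \<le> real CARD('n) * (real CARD('n) * (4 * A\<^sup>2 * measure lborel (cball (0::real^'n) (R + 1))))" by simp
qed

lemma grad_phi_Psi: "grad (\<lambda>x. \<phi> x * \<Psi> x) x = \<phi> x *\<^sub>R grad \<Psi> x + \<Psi> x *\<^sub>R grad \<phi> x"
  by (simp add: vec_eq_iff pd_mult smooth_differentiable[OF \<phi>(1)] smooth_differentiable[OF smooth_Psi] mult.commute)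

text \<open>Both parts of the product rule are bounded without \<eta>: the gradient of
  \<open>\<Psi>\<close> by the Hessian estimate, \<open>\<Psi>\<close> itself in sup norm, where T
  \<le> 1 is absorbed.\<close>

lemma phi_Psi_energy:
  "(\<integral>x. (norm (grad (\<lambda>x. \<phi> x * \<Psi> x) x))\<^sup>2 \<partial>lborel)
    \<le> 2 * P0\<^sup>2 * (real CARD('n) * (real CARD('n) * (4 * A\<^sup>2 * measure lborel (cball (0::real^'n) (R + 1))))) + 2 * (A * (\<Sum>j\<in>UNIV. bump_const (j::'n)))\<^sup>2 * P1\<^sup>2 * measure lborel (cball (0::real^'n) (R + 1))"
proof -
  have C1: "(\<Sum>j\<in>UNIV. bump_const (j::'n)) \<ge> 0" by (intro sum_nonneg bump_const_nonneg)
  have T0: "T > 0" using \<eta> by linarith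
  have iI: "integrable lborel (\<lambda>x. 2 * (A * (\<Sum>j\<in>UNIV. bump_const (j::'n)))\<^sup>2 * P1\<^sup>2 * indicat_real (cball 0 (R + 1)) (x::real^'n))"
    using emeasure_compact_finite[OF compact_cball, of "0::real^'n" "R + 1"]
    by (intro integrable_mult_right integrable_real_indicator) auto
  have "norm (\<integral>x. (norm (grad (\<lambda>x. \<phi> x * \<Psi> x) x))\<^sup>2 \<partial>lborel)
     \<le> (\<integral>x. 2 * P0\<^sup>2 * (norm (grad \<Psi> x))\<^sup>2 + 2 * (A * (\<Sum>j\<in>UNIV. bump_const (j::'n)))\<^sup>2 * P1\<^sup>2 * indicat_real (cball 0 (R + 1)) x \<partial>lborel)"
  proof (rule norm_integral_le[OF Bochner_Integration.integrable_add[OF integrable_mult_right[OF Psi_energy(1)] iI]])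
    fix x
    have ab: "(a + b)\<^sup>2 \<le> 2 * a\<^sup>2 + 2 * b\<^sup>2" for a b :: real
      using zero_le_power2[of "a - b"] by (simp add: power2_eq_square algebra_simps)
    have "(norm (grad (\<lambda>x. \<phi> x * \<Psi> x) x))\<^sup>2 \<le> (norm (\<phi> x *\<^sub>R grad \<Psi> x) + norm (\<Psi> x *\<^sub>R grad \<phi> x))\<^sup>2"
      unfolding grad_phi_Psi by (intro power_mono norm_triangle_ineq) simp
    also have "\<dots> \<le> 2 * (norm (\<phi> x *\<^sub>R grad \<Psi> x))\<^sup>2 + 2 * (norm (\<Psi> x *\<^sub>R grad \<phi> x))\<^sup>2" by (rule ab)
    also have "\<dots> \<le> 2 * P0\<^sup>2 * (norm (grad \<Psi> x))\<^sup>2 + 2 * (A * (\<Sum>j\<in>UNIV. bump_const (j::'n)))\<^sup>2 * P1\<^sup>2 * indicat_real (cball 0 (R + 1)) x"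
    proof (rule add_mono)
      have "(norm (\<phi> x *\<^sub>R grad \<Psi> x))\<^sup>2 \<le> (P0 * norm (grad \<Psi> x))\<^sup>2"
        unfolding norm_scaleR by (intro power_mono mult_right_mono) (use \<phi>(4) in auto)
      then show "2 * (norm (\<phi> x *\<^sub>R grad \<Psi> x))\<^sup>2 \<le> 2 * P0\<^sup>2 * (norm (grad \<Psi> x))\<^sup>2"
        by (simp add: power_mult_distrib)
      show "2 * (norm (\<Psi> x *\<^sub>R grad \<phi> x))\<^sup>2 \<le> 2 * (A * (\<Sum>j\<in>UNIV. bump_const (j::'n)))\<^sup>2 * P1\<^sup>2 * indicat_real (cball 0 (R + 1)) x"
      proof (cases "x \<in> S")
        case True
        then have "x \<in> cball 0 (R + 1)" using U by fastforce
        moreover have "(norm (\<Psi> x *\<^sub>R grad \<phi> x))\<^sup>2 \<le> (A * (\<Sum>j\<in>UNIV. bump_const (j::'n)) * P1)\<^sup>2"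
        proof -
          have "\<bar>\<Psi> x\<bar> \<le> A * (\<Sum>j\<in>UNIV. bump_const (j::'n))"
            using Psi_bound[of x] mult_left_mono[of "T * (\<Sum>j\<in>UNIV. bump_const (j::'n))" "\<Sum>j\<in>UNIV. bump_const (j::'n)" A] T(1) T0 C1 A_nonneg mult_left_le_one_le[of "\<Sum>j\<in>UNIV. bump_const (j::'n)" T] by linarith
          then show ?thesis
            unfolding norm_scaleR using A_nonneg C1 by (intro power_mono mult_mono \<phi>(5)) auto
        qed
        ultimately show ?thesis by (simp add: power_mult_distrib)
      next
        case False
        then show ?thesis using grad_zero_outside[OF compact_imp_closed[OF \<phi>(2)] \<phi>(3)] by simp
      qed
    qed
    finally show "norm ((norm (grad (\<lambda>x. \<phi> x * \<Psi> x) x))\<^sup>2)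
       \<le> 2 * P0\<^sup>2 * (norm (grad \<Psi> x))\<^sup>2 + 2 * (A * (\<Sum>j\<in>UNIV. bump_const (j::'n)))\<^sup>2 * P1\<^sup>2 * indicat_real (cball 0 (R + 1)) x"
      by simp
  qed
  also have "\<dots> = 2 * P0\<^sup>2 * (\<integral>x. (norm (grad \<Psi> x))\<^sup>2 \<partial>lborel) + 2 * (A * (\<Sum>j\<in>UNIV. bump_const (j::'n)))\<^sup>2 * P1\<^sup>2 * measure lborel (cball (0::real^'n) (R + 1))"
    by (subst Bochner_Integration.integral_add[OF integrable_mult_right[OF Psi_energy(1)] iI]) simp
  also have "\<dots> \<le> 2 * P0\<^sup>2 * (real CARD('n) * (real CARD('n) * (4 * A\<^sup>2 * measure lborel (cball (0::real^'n) (R + 1))))) + 2 * (A * (\<Sum>j\<in>UNIV. bump_const (j::'n)))\<^sup>2 * P1\<^sup>2 * measure lborel (cball (0::real^'n) (R + 1))"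
    by (intro add_right_mono mult_left_mono Psi_energy(2)) simp
  finally show ?thesis by simp
qed

lemma Q_pd_bound: "\<bar>pd j (Q i) x\<bar> \<le> P0 * (A * (\<Sum>j\<in>UNIV. bump_const (j::'n)))"
proof -
  have "\<bar>pd j (Q i) x\<bar> \<le> (P0 * A) * (T * bump_const j)"
    unfolding Q_pd by (rule ker_conv_bound[OF W_bound])
  also have "\<dots> \<le> (P0 * A) * (1 * (\<Sum>j\<in>UNIV. bump_const (j::'n)))"
    using A_nonneg P0_nonneg T \<eta> member_le_sum[of j UNIV bump_const]
    by (intro mult_left_mono mult_mono) (auto simp: bump_const_nonneg)
  finally show ?thesis by simp
qed

lemma Q_pd_energy: "(\<integral>x. (norm (grad (pd j (Q i)) x))\<^sup>2 \<partial>lborel) \<le> 4 * (P0 * A)\<^sup>2 * measure lborel (cball (0::real^'n) (R + 1))"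
proof -
  have "(\<integral>x. (norm (grad (pd j (Q i)) x))\<^sup>2 \<partial>lborel) \<le> 4 * (P0 * A)\<^sup>2 * measure lborel (cball (0::real^'n) (R + T))"
    by (rule Q_energy)
  also have "\<dots> \<le> 4 * (P0 * A)\<^sup>2 * measure lborel (cball (0::real^'n) (R + 1))" by (intro mult_left_mono measure_cball_le) simp
  finally show ?thesis .
qed

text \<open>\<open>W i\<close> lives on \<open>S\<close> and the kernel has range T \<le> d, so
  these functions stay close to \<open>S\<close> and leave room for truncation inside
  \<open>U\<close>.\<close>

lemma Q_pd_zero: "x \<notin> {x. infdist x S \<le> d} \<Longrightarrow> pd j (Q i) x = 0"
proof -
  have cl: "closed {x. infdist x S \<le> d}"
    by (intro closed_Collect_le continuous_intros)
  have "Q i x = 0" if "x \<notin> {x. infdist x S \<le> d}" for x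
  proof (rule conv_zero)
    fix y assume "W i y \<noteq> 0"
    then have "y \<in> S" using \<phi>(3) by fastforce
    then have "norm (x - y) > T"
      using that infdist_le[of y S x] T by (simp add: dist_norm)
    then show "ker \<eta> T (x - y) = 0" by (rule ker_zero[OF \<eta>])
  qed
  then show "x \<notin> {x. infdist x S \<le> d} \<Longrightarrow> pd j (Q i) x = 0"
    by (rule pd_zero_outside[OF cl])
qed

lemma pd_pd_ker_even: "pd i (pd j (ker \<eta> T)) (- x) = pd i (pd j (ker \<eta> T)) (x::real^'n)"
  using pd_neg_arg[OF smooth_pd[OF smooth_ker[OF \<eta>]], of j "-1" i x] pd_neg_arg[OF smooth_ker[OF \<eta>], of 1 j]
  by (simp add: ker_minus[OF \<eta>])

text \<open>The Hessian of the even kernel is again even and can be moved from v onto \<phi> w.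
  Derivatives of \<open>H\<close> thereby become derivatives of \<open>Q\<close>, against which v
  can be tested.\<close>

lemma hessian_pairing: "(\<integral>x. W i x * pd k (pd j (H l)) x \<partial>lborel) = (\<integral>x. v x $ l * pd k (pd j (Q i)) x \<partial>lborel)"
  unfolding H_pd_pd Q_pd_pd
proof (rule conv_pairing[where T=T and R=R and A=A and B="P0 * A"])
  show "continuous_on UNIV (pd k (pd j (ker \<eta> T)))"
    by (rule smooth_continuous[OF smooth_pd[OF smooth_pd[OF smooth_ker[OF \<eta>]]]])
  have 1: "x \<notin> cball 0 T \<Longrightarrow> ker \<eta> T x = 0" for x :: "real^'n" by (simp add: ker_zero[OF \<eta>])
  have 2: "x \<notin> cball 0 T \<Longrightarrow> pd j (ker \<eta> T) x = 0" for x by (rule pd_zero_outside[OF closed_cball 1])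
  show "pd k (pd j (ker \<eta> T)) x = 0" if "norm x > T" for x
    using pd_zero_outside[of "cball 0 T" "pd j (ker \<eta> T)" x k, OF closed_cball 2] that by simp
qed (rule pd_pd_ker_even component_measurable V_bound W_bound V_zero W_zero; assumption?)+

lemma integrable_W:
  assumes "continuous_on UNIV X"
  shows "integrable lborel (\<lambda>x. W i x * X x)"
proof -
  have z: "x \<notin> cball 0 R \<Longrightarrow> W i x = 0" for x using W_zero[of x i] by simp
  have "bounded (X ` cball 0 R)"
    by (rule compact_imp_bounded[OF compact_continuous_image[OF continuous_on_subset[OF assms] compact_cball]]) simp
  then obtain b where "\<forall>y\<in>X ` cball 0 R. norm y \<le> b" unfolding bounded_iff by blast
  then have b: "\<And>x. x \<in> cball 0 R \<Longrightarrow> norm (X x) \<le> b" by blast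
  have [measurable]: "X \<in> borel_measurable borel" by (rule borel_measurable_continuous_onI[OF assms])
  show ?thesis
  proof (rule integrable_compact_support[OF _ compact_cball[of 0 R]])
    show "norm (W i x * X x) \<le> P0 * A * \<bar>b\<bar>" for x
    proof (cases "x \<in> cball 0 R")
      case True
      have "\<bar>W i x\<bar> * \<bar>X x\<bar> \<le> (P0 * A) * \<bar>b\<bar>"
        using P0_nonneg A_nonneg b[OF True] by (intro mult_mono W_bound) auto
      then show ?thesis by (simp only: real_norm_def abs_mult)
    next
      case False
      have W0: "W i x = 0" by (rule z[OF False])
      show ?thesis unfolding W0 using P0_nonneg A_nonneg by simp
    qed
  qed (use z in auto)
qed

lemma integrable_V:
  assumes "continuous_on UNIV X"
  shows "integrable lborel (\<lambda>x. v x $ i * X x)"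
proof -
  have z: "x \<notin> cball 0 R \<Longrightarrow> v x $ i = 0" for x using V_zero[of x i] by simp
  have "bounded (X ` cball 0 R)"
    by (rule compact_imp_bounded[OF compact_continuous_image[OF continuous_on_subset[OF assms] compact_cball]]) simp
  then obtain b where "\<forall>y\<in>X ` cball 0 R. norm y \<le> b" unfolding bounded_iff by blast
  then have b: "\<And>x. x \<in> cball 0 R \<Longrightarrow> norm (X x) \<le> b" by blast
  have [measurable]: "X \<in> borel_measurable borel" by (rule borel_measurable_continuous_onI[OF assms])
  show ?thesis
  proof (rule integrable_compact_support[OF _ compact_cball[of 0 R]])
    show "norm (v x $ i * X x) \<le> A * \<bar>b\<bar>" for x
    proof (cases "x \<in> cball 0 R")
      case True
      have "\<bar>v x $ i\<bar> * \<bar>X x\<bar> \<le> A * \<bar>b\<bar>"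
        using A_nonneg b[OF True] by (intro mult_mono V_bound) auto
      then show ?thesis by (simp only: real_norm_def abs_mult)
    next
      case False
      then show ?thesis using z[OF False] A_nonneg by simp
    qed
  qed (use z in auto)
qed

text \<open>The identity behind the div-curl lemma: \<open>\<Delta> V = grad (div V) - curl* (curl V)\<close>,
  with the derivatives distributed over the kernel and the test fields.\<close>

lemma div_curl_identity:
  "(\<Sum>i\<in>UNIV. \<integral>x. W i x * conv (mol T) (V i) x \<partial>lborel) - (\<Sum>i\<in>UNIV. \<integral>x. W i x * conv (mol \<eta>) (V i) x \<partial>lborel)
   = (\<Sum>i\<in>UNIV. \<Sum>j\<in>UNIV. \<integral>x. v x $ i * pd j (pd j (Q i)) x - v x $ j * pd i (pd j (Q i)) x \<partial>lborel)
    + ((\<integral>x. w x \<bullet> grad (\<lambda>x. \<phi> x * \<Psi> x) x \<partial>lborel) - (\<integral>x. \<Psi> x * (w x \<bullet> grad \<phi> x) \<partial>lborel))"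
proof -
  have cm: "continuous_on UNIV (conv (mol t) (V i))" if "t > 0" for t i
  proof -
    have "x \<notin> cball 0 t \<Longrightarrow> mol t x = 0" for x :: "real^'n" using that by (simp add: mol_zero)
    then show ?thesis
      by (rule smooth_continuous[OF conv_smooth[OF smooth_mol compact_cball _ W_integrable[OF HV]]])
  qed
  have T0: "T > 0" using \<eta> by linarith
  have cH: "continuous_on UNIV (pd k (pd j (H l)))" for k j l
    by (rule smooth_continuous[OF smooth_pd[OF smooth_pd[OF smooth_H]]])
  have cQ: "continuous_on UNIV (pd k (pd j (Q l)))" for k j l
    by (rule smooth_continuous[OF smooth_pd[OF smooth_pd[OF smooth_Q]]])
  have "(\<Sum>i\<in>UNIV. \<integral>x. W i x * conv (mol T) (V i) x \<partial>lborel) - (\<Sum>i\<in>UNIV. \<integral>x. W i x * conv (mol \<eta>) (V i) x \<partial>lborel)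
    = (\<Sum>i\<in>UNIV. \<integral>x. W i x * conv (mol T) (V i) x - W i x * conv (mol \<eta>) (V i) x \<partial>lborel)"
    unfolding sum_subtractf[symmetric]
    by (intro sum.cong refl Bochner_Integration.integral_diff[symmetric] integrable_W cm T0 \<eta>)
  also have "\<dots> = (\<Sum>i\<in>UNIV. \<integral>x. (\<Sum>j\<in>UNIV. W i x * pd j (pd j (H i)) x) \<partial>lborel)"
    unfolding sum_distrib_left[symmetric] H_laplace right_diff_distrib ..
  also have "\<dots> = (\<Sum>i\<in>UNIV. \<Sum>j\<in>UNIV. \<integral>x. W i x * pd j (pd j (H i)) x \<partial>lborel)"
    by (intro sum.cong refl Bochner_Integration.integral_sum integrable_W cH)
  \<comment> \<open>The mixed term with \<open>pd i (pd j (H j))\<close>, which equals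
    \<open>v x $ j\<close> tested with \<open>pd i (pd j (Q i))\<close>, is subtracted to form the
    curl and added back, where it sums to the gradient of \<open>\<Psi>\<close>.\<close>
  also have "\<dots> = (\<Sum>i\<in>UNIV. \<Sum>j\<in>UNIV. (\<integral>x. v x $ i * pd j (pd j (Q i)) x \<partial>lborel) - (\<integral>x. v x $ j * pd i (pd j (Q i)) x \<partial>lborel))
      + (\<Sum>i\<in>UNIV. \<Sum>j\<in>UNIV. \<integral>x. W i x * pd i (pd j (H j)) x \<partial>lborel)"
    unfolding hessian_pairing sum_subtractf by simp
  also have "(\<Sum>i\<in>UNIV. \<Sum>j\<in>UNIV. \<integral>x. W i x * pd i (pd j (H j)) x \<partial>lborel) = (\<integral>x. (\<Sum>i\<in>UNIV. \<Sum>j\<in>UNIV. W i x * pd i (pd j (H j)) x) \<partial>lborel)"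
    by (subst Bochner_Integration.integral_sum, intro Bochner_Integration.integrable_sum integrable_W cH,
        intro sum.cong refl Bochner_Integration.integral_sum[symmetric] integrable_W cH)
  \<comment> \<open>By the product rule \<phi> times the gradient of \<open>\<Psi>\<close> is the
    gradient of their product, a compactly supported test function for the divergence of w, minus
    the commutator with \<phi>.\<close>
  also have "(\<lambda>x. \<Sum>i\<in>UNIV. \<Sum>j\<in>UNIV. W i x * pd i (pd j (H j)) x) = (\<lambda>x. w x \<bullet> grad (\<lambda>x. \<phi> x * \<Psi> x) x - \<Psi> x * (w x \<bullet> grad \<phi> x))"
  proof
    fix x
    have "(\<Sum>i\<in>UNIV. \<Sum>j\<in>UNIV. W i x * pd i (pd j (H j)) x) = (\<Sum>i\<in>UNIV. \<phi> x * w x $ i * pd i \<Psi> x)"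
      by (simp add: sum_distrib_left[symmetric] pd_sum smooth_pd smooth_H)
    also have "\<dots> = \<phi> x * (w x \<bullet> grad \<Psi> x)" by (simp add: inner_vec_def sum_distrib_left mult.assoc)
    finally show "(\<Sum>i\<in>UNIV. \<Sum>j\<in>UNIV. W i x * pd i (pd j (H j)) x) = w x \<bullet> grad (\<lambda>x. \<phi> x * \<Psi> x) x - \<Psi> x * (w x \<bullet> grad \<phi> x)"
      unfolding grad_phi_Psi by (simp add: inner_add_right)
  qed
  also have "(\<integral>x. w x \<bullet> grad (\<lambda>x. \<phi> x * \<Psi> x) x - \<Psi> x * (w x \<bullet> grad \<phi> x) \<partial>lborel)
     = (\<integral>x. w x \<bullet> grad (\<lambda>x. \<phi> x * \<Psi> x) x \<partial>lborel) - (\<integral>x. \<Psi> x * (w x \<bullet> grad \<phi> x) \<partial>lborel)"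
  proof (rule Bochner_Integration.integral_diff)
    have s: "smooth (\<lambda>x. \<phi> x * \<Psi> x)" by (rule smooth_mult[OF \<phi>(1) smooth_Psi])
    have z: "x \<notin> S \<Longrightarrow> \<phi> x * \<Psi> x = 0" for x by (simp add: \<phi>(3))
    show "integrable lborel (\<lambda>x. w x \<bullet> grad (\<lambda>x. \<phi> x * \<Psi> x) x)"
      by (rule integrable_inner_bounded[OF w(1,2) continuous_on_grad[OF s] \<phi>(2) grad_zero_outside[OF compact_imp_closed[OF \<phi>(2)] z]])
    have "integrable lborel (\<lambda>x. w x \<bullet> (\<Psi> x *\<^sub>R grad \<phi> x))"
      by (rule integrable_inner_bounded[OF w(1,2) continuous_on_scaleR[OF smooth_continuous[OF smooth_Psi] continuous_on_grad[OF \<phi>(1)]] \<phi>(2)])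
         (simp add: grad_zero_outside[OF compact_imp_closed[OF \<phi>(2)] \<phi>(3)])
    then show "integrable lborel (\<lambda>x. \<Psi> x * (w x \<bullet> grad \<phi> x))" by simp
  qed
  also have "(\<Sum>i\<in>UNIV. \<Sum>j\<in>UNIV. (\<integral>x. v x $ i * pd j (pd j (Q i)) x \<partial>lborel) - (\<integral>x. v x $ j * pd i (pd j (Q i)) x \<partial>lborel))
     = (\<Sum>i\<in>UNIV. \<Sum>j\<in>UNIV. \<integral>x. v x $ i * pd j (pd j (Q i)) x - v x $ j * pd i (pd j (Q i)) x \<partial>lborel)"
    by (intro sum.cong refl Bochner_Integration.integral_diff[symmetric] integrable_V cQ)
  finally show ?thesis .
qed

text \<open>No derivative falls on \<open>\<Psi>\<close> in the commutator, so its sup bound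
  supplies the factor T.\<close>

lemma Psi_remainder: "\<bar>\<integral>x. \<Psi> x * (w x \<bullet> grad \<phi> x) \<partial>lborel\<bar> \<le> A * (T * (\<Sum>j\<in>UNIV. bump_const (j::'n))) * (A * P1) * measure lborel (cball (0::real^'n) (R + 1))"
proof (rule integral_bounded_support_le)
  fix x
  have C1: "(\<Sum>j\<in>UNIV. bump_const (j::'n)) \<ge> 0" by (intro sum_nonneg bump_const_nonneg)
  have "\<bar>w x \<bullet> grad \<phi> x\<bar> \<le> A * P1"
    by (rule order_trans[OF Cauchy_Schwarz_ineq2]) (intro mult_mono w(2) \<phi>(5) A_nonneg norm_ge_zero)
  then show "\<bar>\<Psi> x * (w x \<bullet> grad \<phi> x)\<bar> \<le> A * (T * (\<Sum>j\<in>UNIV. bump_const (j::'n))) * (A * P1)"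
    unfolding abs_mult using A_nonneg C1 \<eta> by (intro mult_mono Psi_bound) auto
next
  fix x :: "real^'n" assume "norm x > R + 1"
  then have "x \<notin> S" using U by fastforce
  then show "\<Psi> x * (w x \<bullet> grad \<phi> x) = 0"
    using grad_zero_outside[OF compact_imp_closed[OF \<phi>(2)] \<phi>(3)] by simp
qed

end

section \<open>The quantitative div-curl lemma\<close>

definition bounded_field :: "(real^'n::finite) set \<Rightarrow> real \<Rightarrow> (real^'n \<Rightarrow> real^'n) \<Rightarrow> bool" where
  "bounded_field U A v \<longleftrightarrow> v \<in> borel_measurable borel \<and> (\<forall>x. norm (v x) \<le> A) \<and> (\<forall>x. x \<notin> U \<longrightarrow> v x = 0)"

text \<open>Only functions of gradient at most 1 are used: after Lipschitz truncation no others are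
  needed, and on a bounded set the negative Sobolev norms control the pairing with them.\<close>

definition small_curl_div :: "(real^'n::finite) set \<Rightarrow> real \<Rightarrow> (real^'n \<Rightarrow> real^'n) \<Rightarrow> (real^'n \<Rightarrow> real^'n) \<Rightarrow> bool" where
  "small_curl_div U \<delta> v w \<longleftrightarrow> (\<forall>\<psi>. test_fun U \<psi> \<longrightarrow> (\<forall>x. norm (grad \<psi> x) \<le> 1) \<longrightarrow>
     \<bar>\<integral>x. w x \<bullet> grad \<psi> x \<partial>lborel\<bar> \<le> \<delta> \<and>
     (\<forall>i j. \<bar>\<integral>x. v x $ i * pd j \<psi> x - v x $ j * pd i \<psi> x \<partial>lborel\<bar> \<le> \<delta>))"

text \<open>The Laplacian is inverted only between the scales \<open>\<eta>\<close> and \<open>T\<close>. The commutator term is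
  \<open>O(T)\<close>, which fixes \<open>T\<close>; all other bounds are uniform in \<open>\<eta>\<close>, which tends to 0.\<close>

theorem div_curl_quantitative:
  fixes \<phi> :: "real^'n::finite \<Rightarrow> real"
  assumes \<phi>: "smooth \<phi>" "compact S" "S \<noteq> {}" "\<And>x. x \<notin> S \<Longrightarrow> \<phi> x = 0"
    and U: "open U" "S \<subseteq> U" "bounded U" and A: "A \<ge> 0" and \<epsilon>: "\<epsilon> > 0"
  shows "\<exists>T>0. \<exists>\<delta>>0. \<forall>v w. bounded_field U A v \<and> bounded_field U A w \<and> small_curl_div U \<delta> v w \<longrightarrow>
     \<bar>\<integral>x. \<phi> x * (v x \<bullet> w x) \<partial>lborel\<bar>
       \<le> \<epsilon> + \<bar>\<Sum>i\<in>UNIV. \<integral>x. \<phi> x * w x $ i * conv (mol T) (\<lambda>y. v y $ i) x \<partial>lborel\<bar>"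
proof -
  let ?N = "real CARD('n)"
  have N: "?N > 0" by simp
  obtain e0 where e0: "e0 > 0" "(\<Union>x\<in>S. cball x e0) \<subseteq> U"
    using compact_subset_open_imp_cball_epsilon_subset[OF \<phi>(2) U(1,2)] by blast
  \<comment> \<open>The potentials reach \<open>d\<close> beyond \<open>S\<close> and the truncation
    another \<open>2 * d\<close>, within the distance \<open>4 * d\<close> that fits into
    \<open>U\<close>. The bound 1 on \<open>d\<close> gives T \<le> 1.\<close>
  define d where "d = min 1 (e0 / 4)"
  have d: "d > 0" "d \<le> 1" "4 * d \<le> e0" using e0 by (auto simp: d_def)
  have nb: "{x. infdist x S \<le> r} \<subseteq> U" if "r \<le> 4 * d" for r
  proof
    fix x assume "x \<in> {x. infdist x S \<le> r}"
    obtain y where "y \<in> S" "infdist x S = dist x y"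
      using infdist_attains_inf[OF compact_imp_closed[OF \<phi>(2)] \<phi>(3)] by metis
    then have "x \<in> cball y e0" using \<open>x \<in> _\<close> that d by (simp add: dist_commute)
    then show "x \<in> U" using e0(2) \<open>y \<in> S\<close> by blast
  qed
  define S1 where "S1 = {x. infdist x S \<le> d}"
  have S1: "compact S1" unfolding S1_def by (rule compact_neighbourhood[OF \<phi>(2,3)])
  have "S \<subseteq> S1" using d by (auto simp: S1_def)
  with \<phi>(3) S1 have S1: "compact S1" "S1 \<noteq> {}" by auto
  have nb1: "{x. infdist x S1 \<le> 2 * d} \<subseteq> U"
  proof
    fix x assume x: "x \<in> {x. infdist x S1 \<le> 2 * d}"
    obtain y where y: "y \<in> S1" "infdist x S1 = dist x y"
      using infdist_attains_inf[OF compact_imp_closed[OF S1(1)] S1(2)] by metis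
    have "infdist x S \<le> infdist y S + dist x y" by (rule infdist_triangle)
    then show "x \<in> U" using nb[of "3 * d"] x y d by (auto simp: S1_def)
  qed
  obtain R where R: "U \<subseteq> cball 0 R" using U(3) unfolding bounded_iff by (auto simp: subset_iff)
  obtain P0 where P0: "\<And>x. norm (\<phi> x) \<le> P0"
    using bounded_of_compact_support[OF smooth_continuous[OF \<phi>(1)] \<phi>(2,4)] by metis
  have gz: "x \<notin> S \<Longrightarrow> grad \<phi> x = 0" for x by (rule grad_zero_outside[OF compact_imp_closed[OF \<phi>(2)] \<phi>(4)])
  obtain P1 where P1: "\<And>x. norm (grad \<phi> x) \<le> P1"
    using bounded_of_compact_support[OF continuous_on_grad[OF \<phi>(1)] \<phi>(2) gz] by metis
  have P00: "P0 \<ge> 0" "P1 \<ge> 0" using P0[of 0] P1[of 0] norm_ge_zero order_trans by blast+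
  define c1 where "c1 = (\<Sum>j\<in>UNIV. bump_const (j::'n))"
  have c1: "c1 \<ge> 0" unfolding c1_def by (intro sum_nonneg bump_const_nonneg)
  define m where "m = measure lborel (cball (0::real^'n) (R + 1))"
  have m: "m \<ge> 0" by (simp add: m_def)
  define Da where "Da = 2 * P0\<^sup>2 * (?N * (?N * (4 * A\<^sup>2 * m))) + 2 * (A * c1)\<^sup>2 * P1\<^sup>2 * m"
  define Db where "Db = 4 * (P0 * A)\<^sup>2 * m"
  have D: "Da \<ge> 0" "Db \<ge> 0" using m by (simp_all add: Da_def Db_def)
  define D0 where "D0 = P0 * (A * c1)"
  have D0: "D0 \<ge> 0" using P00 A c1 by (simp add: D0_def)
  \<comment> \<open>The \<open>n^2\<close> curl pairings and the divergence pairing share \<epsilon>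
    / 3; the commutator and the mollification at scale \<eta> receive the other two thirds.\<close>
  define \<epsilon>1 where "\<epsilon>1 = \<epsilon> / (3 * (1 + ?N * ?N))"
  have \<epsilon>1: "\<epsilon>1 > 0" using \<epsilon> by (simp add: \<epsilon>1_def add_pos_nonneg)
  define Z where "Z = A * c1 * (A * P1) * m"
  have Z: "Z \<ge> 0" using A c1 P00 m by (simp add: Z_def)
  \<comment> \<open>The commutator is at most \<open>T * Z\<close>; the added 1 avoids a division by
    zero when \<open>Z = 0\<close>.\<close>
  define T where "T = min d (\<epsilon> / (3 * (Z + 1)))"
  have T: "T > 0" "T \<le> 1" "T \<le> d" using d \<epsilon> Z by (auto simp: T_def)
  have TZ: "T * Z \<le> \<epsilon> / 3"
  proof -
    have "T * Z \<le> \<epsilon> / (3 * (Z + 1)) * (Z + 1)" using Z T \<epsilon> by (intro mult_mono) (auto simp: T_def)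
    also have "\<dots> = \<epsilon> / 3"
    proof -
      have "Z + 1 \<noteq> 0" using Z by linarith
      from mult_divide_mult_cancel_right[OF this, of \<epsilon> 3] show ?thesis by (simp only: times_divide_eq_left)
    qed
    finally show ?thesis .
  qed
  have A2: "2 * A \<ge> 0" and DD: "Da + Db \<ge> 0" using A D by auto
  show ?thesis
  proof (rule truncation_uniform[OF A2 DD D0 d(1) \<epsilon>1, where 'n='n])
    fix \<delta> assume \<delta>: "0 < \<delta>" and trunc: "\<And>(F :: real^'n \<Rightarrow> real^'n) S U G. F \<in> borel_measurable borel \<Longrightarrow> (\<And>x. norm (F x) \<le> 2 * A) \<Longrightarrow> compact S \<Longrightarrow> S \<noteq> {} \<Longrightarrow>
      {x. infdist x S \<le> 2 * d} \<subseteq> U \<Longrightarrow> smooth G \<Longrightarrow> (\<And>x. x \<notin> S \<Longrightarrow> G x = 0) \<Longrightarrow> (\<And>x. \<bar>G x\<bar> \<le> D0) \<Longrightarrow>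
      (\<integral>x. (norm (grad G x))\<^sup>2 \<partial>lborel) \<le> Da + Db \<Longrightarrow>
      (\<And>\<psi>. test_fun U \<psi> \<Longrightarrow> (\<And>x. norm (grad \<psi> x) \<le> 1) \<Longrightarrow> \<bar>\<integral>x. F x \<bullet> grad \<psi> x \<partial>lborel\<bar> \<le> \<delta>) \<Longrightarrow>
      \<bar>\<integral>x. F x \<bullet> grad G x \<partial>lborel\<bar> \<le> \<epsilon>1"
    have "\<bar>\<integral>x. \<phi> x * (v x \<bullet> w x) \<partial>lborel\<bar>
       \<le> \<epsilon> + \<bar>\<Sum>i\<in>UNIV. \<integral>x. \<phi> x * w x $ i * conv (mol T) (\<lambda>y. v y $ i) x \<partial>lborel\<bar>"
      if vw: "bounded_field U A v" "bounded_field U A w" "small_curl_div U \<delta> v w" for v w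
    proof -
      have v: "v \<in> borel_measurable borel" "\<And>x. norm (v x) \<le> A" "\<And>x. x \<notin> U \<Longrightarrow> v x = 0"
        and w: "w \<in> borel_measurable borel" "\<And>x. norm (w x) \<le> A" "\<And>x. x \<notin> U \<Longrightarrow> w x = 0"
        using vw by (auto simp: bounded_field_def)
      have small: "\<bar>\<integral>x. w x \<bullet> grad \<psi> x \<partial>lborel\<bar> \<le> \<delta>"
        "\<bar>\<integral>x. v x $ i * pd j \<psi> x - v x $ j * pd i \<psi> x \<partial>lborel\<bar> \<le> \<delta>"
        if "test_fun U \<psi>" "\<And>x. norm (grad \<psi> x) \<le> 1" for \<psi> i j
        using vw(3) that unfolding small_curl_div_def by blast+
      note ctx = T(2,3) \<phi>(1,2,4) P0[unfolded real_norm_def] P1 U(2) R v w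
      have nth: "(\<lambda>x::real^'n. x $ i) \<in> borel_measurable borel" for i
        by (intro borel_measurable_continuous_onI continuous_on_component continuous_on_id)
      note [measurable] = nth v(1) w(1) borel_measurable_continuous_onI[OF smooth_continuous[OF \<phi>(1)]]
      have V1: "(\<lambda>x. v x $ i) \<in> borel_measurable borel" for i by measurable
      have V2: "(\<lambda>x. \<phi> x * w x $ i) \<in> borel_measurable borel" for i by measurable
      have V3: "\<bar>v x $ i\<bar> \<le> A" for x i
        by (rule order_trans[OF component_le_norm_cart v(2)])
      have V4: "\<bar>\<phi> x * w x $ i\<bar> \<le> P0 * A" for x i
        unfolding abs_mult
        by (rule mult_mono[OF P0[unfolded real_norm_def] order_trans[OF component_le_norm_cart w(2)] P00(1) abs_ge_zero])
      have V5: "v x $ i = 0" if "norm x > R" for x i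
      proof -
        have "x \<notin> U" using R that by auto
        then show ?thesis using v(3) by simp
      qed
      have V6: "\<phi> x * w x $ i = 0" if "norm x > R" for x i
      proof -
        have "x \<notin> U" using R that by auto
        then show ?thesis using w(3) by simp
      qed
      note V = V1 V2 V3 V4 V5 V6
      define \<epsilon>2 where "\<epsilon>2 = \<epsilon> / (3 * ?N)"
      have \<epsilon>2: "\<epsilon>2 > 0" using \<epsilon> by (simp add: \<epsilon>2_def)
      let ?I = "\<lambda>t i. \<integral>x. \<phi> x * w x $ i * conv (mol t) (\<lambda>y. v y $ i) x \<partial>lborel"
      let ?J = "\<lambda>i. \<integral>x. \<phi> x * w x $ i * v x $ i \<partial>lborel"
      have "\<exists>t0>0. \<forall>t. 0 < t \<and> t < t0 \<longrightarrow> \<bar>?I t i - ?J i\<bar> \<le> \<epsilon>2" for i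
      proof (rule mollified_pairing[OF V1[of i] V3 V5 V2[of i] V4 V6 \<epsilon>2])
        fix t0 assume "t0 > 0" "\<And>t. 0 < t \<Longrightarrow> t < t0 \<Longrightarrow> \<bar>?I t i - ?J i\<bar> \<le> \<epsilon>2"
        then show ?thesis by blast
      qed
      then have "\<exists>t0. \<forall>i. t0 i > 0 \<and> (\<forall>t. 0 < t \<and> t < t0 i \<longrightarrow> \<bar>?I t i - ?J i\<bar> \<le> \<epsilon>2)" by (intro choice) blast
      then obtain t0 where "\<forall>i. t0 i > 0 \<and> (\<forall>t. 0 < t \<and> t < t0 i \<longrightarrow> \<bar>?I t i - ?J i\<bar> \<le> \<epsilon>2)" ..
      then have t0: "\<And>i. t0 i > 0" "\<And>i t. 0 < t \<Longrightarrow> t < t0 i \<Longrightarrow> \<bar>?I t i - ?J i\<bar> \<le> \<epsilon>2" by simp_all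
      \<comment> \<open>Through \<open>t0\<close> the scale \<eta> depends on v and w. This is
        harmless, since \<delta> was fixed by bounds in which \<eta> does not occur.\<close>
      define \<eta> where "\<eta> = min T (Min (range t0)) / 2"
      have Mp: "Min (range t0) > 0" using t0(1) by (subst Min_gr_iff) auto
      have \<eta>: "0 < \<eta>" "\<eta> < T" using T Mp by (auto simp: \<eta>_def)
      have \<eta>t: "\<eta> < t0 i" for i
      proof -
        have "Min (range t0) \<le> t0 i" by simp
        then show ?thesis using Mp min.cobounded2[of T "Min (range t0)"] unfolding \<eta>_def by linarith
      qed
      let ?G = "\<lambda>i j. pd j (conv (ker \<eta> T) (\<lambda>x. \<phi> x * w x $ i))"
      let ?P = "\<lambda>x. \<phi> x * (\<Sum>j\<in>UNIV. pd j (conv (ker \<eta> T) (\<lambda>x. v x $ j)) x)"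
      let ?r = "\<integral>x. (\<Sum>j\<in>UNIV. pd j (conv (ker \<eta> T) (\<lambda>x. v x $ j)) x) * (w x \<bullet> grad \<phi> x) \<partial>lborel"
      have c: "\<bar>\<integral>x. v x $ i * pd j (?G i j) x - v x $ j * pd i (?G i j) x \<partial>lborel\<bar> \<le> \<epsilon>1" for i j
      proof -
        \<comment> \<open>A curl component is the pairing of this field with a gradient, so the
          truncation result covers curl and divergence alike; the field has norm at most
          \<open>2 * A\<close>, which explains the bound chosen there.\<close>
        define F where "F = (\<lambda>x. (v x $ i) *\<^sub>R (axis j 1 :: real^'n) - (v x $ j) *\<^sub>R axis i 1)"
        have F: "F x \<bullet> grad \<psi> x = v x $ i * pd j \<psi> x - v x $ j * pd i \<psi> x" for x \<psi>
          by (simp add: F_def inner_diff_left inner_axis')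
        have "\<bar>\<integral>x. F x \<bullet> grad (?G i j) x \<partial>lborel\<bar> \<le> \<epsilon>1"
        proof (rule trunc[OF _ _ S1 nb1])
          show "F \<in> borel_measurable borel" unfolding F_def by measurable
          show "norm (F x) \<le> 2 * A" for x
          proof -
            have "norm (F x) \<le> norm ((v x $ i) *\<^sub>R (axis j 1 :: real^'n)) + norm ((v x $ j) *\<^sub>R (axis i 1 :: real^'n))"
              unfolding F_def by (rule norm_triangle_ineq4)
            also have "\<dots> = \<bar>v x $ i\<bar> + \<bar>v x $ j\<bar>" by simp
            also have "\<dots> \<le> 2 * A" using V(3)[of x i] V(3)[of x j] by simp
            finally show ?thesis .
          qed
          show "smooth (?G i j)" by (rule smooth_pd[OF smooth_Q[OF \<eta> ctx]])
          show "?G i j x = 0" if "x \<notin> S1" for x using Q_pd_zero[OF \<eta> ctx] that unfolding S1_def by blast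
          show "\<bar>?G i j x\<bar> \<le> D0" for x using Q_pd_bound[OF \<eta> ctx] unfolding D0_def c1_def by blast
          have "(\<integral>x. (norm (grad (?G i j) x))\<^sup>2 \<partial>lborel) \<le> Db"
            using Q_pd_energy[OF \<eta> ctx] unfolding Db_def m_def by blast
          then show "(\<integral>x. (norm (grad (?G i j) x))\<^sup>2 \<partial>lborel) \<le> Da + Db" using D by linarith
          show "\<bar>\<integral>x. F x \<bullet> grad \<psi> x \<partial>lborel\<bar> \<le> \<delta>" if "test_fun U \<psi>" "\<And>x. norm (grad \<psi> x) \<le> 1" for \<psi>
            unfolding F by (rule small(2)[OF that])
        qed
        then show ?thesis unfolding F .
      qed
      have p: "\<bar>\<integral>x. w x \<bullet> grad ?P x \<partial>lborel\<bar> \<le> \<epsilon>1"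
      proof (rule trunc[OF w(1) _ \<phi>(2,3)])
        show "norm (w x) \<le> 2 * A" for x using w(2)[of x] A by linarith
        show "{x. infdist x S \<le> 2 * d} \<subseteq> U" using nb d by simp
        show "smooth ?P" by (rule smooth_mult[OF \<phi>(1) smooth_Psi[OF \<eta> ctx]])
        show "?P x = 0" if "x \<notin> S" for x using \<phi>(4)[OF that] by simp
        show "\<bar>?P x\<bar> \<le> D0" for x
        proof -
          have "\<bar>?P x\<bar> \<le> P0 * (A * (T * c1))"
            unfolding abs_mult c1_def by (rule mult_mono[OF _ Psi_bound[OF \<eta> ctx]]) (use P0 P00 in auto)
          also have "\<dots> \<le> D0"
            unfolding D0_def using T c1 P00 A by (intro mult_left_mono) (auto simp: mult_left_le_one_le)
          finally show ?thesis .
        qed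
        have "(\<integral>x. (norm (grad ?P x))\<^sup>2 \<partial>lborel) \<le> Da"
          using phi_Psi_energy[OF \<eta> ctx] unfolding Da_def m_def c1_def .
        then show "(\<integral>x. (norm (grad ?P x))\<^sup>2 \<partial>lborel) \<le> Da + Db" using D by linarith
        show "\<bar>\<integral>x. w x \<bullet> grad \<psi> x \<partial>lborel\<bar> \<le> \<delta>" if "test_fun U \<psi>" "\<And>x. norm (grad \<psi> x) \<le> 1" for \<psi>
          by (rule small(1)[OF that])
      qed
      have r: "\<bar>?r\<bar> \<le> \<epsilon> / 3"
      proof -
        have "\<bar>?r\<bar> \<le> A * (T * c1) * (A * P1) * m"
          using Psi_remainder[OF \<eta> ctx] unfolding m_def c1_def .
        also have "\<dots> = T * Z" by (simp add: Z_def mult_ac)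
        finally show ?thesis using TZ by linarith
      qed
      have "\<bar>\<Sum>i\<in>UNIV. \<Sum>j\<in>UNIV. \<integral>x. v x $ i * pd j (?G i j) x - v x $ j * pd i (?G i j) x \<partial>lborel\<bar> \<le> (\<Sum>i\<in>(UNIV::'n set). \<Sum>j\<in>(UNIV::'n set). \<epsilon>1)"
        by (intro order_trans[OF sum_abs] sum_mono c)
      then have cc: "\<bar>\<Sum>i\<in>UNIV. \<Sum>j\<in>UNIV. \<integral>x. v x $ i * pd j (?G i j) x - v x $ j * pd i (?G i j) x \<partial>lborel\<bar> \<le> ?N * ?N * \<epsilon>1"
        by simp
      have id: "(\<Sum>i\<in>UNIV. ?I T i) - (\<Sum>i\<in>UNIV. ?I \<eta> i)
         = (\<Sum>i\<in>UNIV. \<Sum>j\<in>UNIV. \<integral>x. v x $ i * pd j (?G i j) x - v x $ j * pd i (?G i j) x \<partial>lborel)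
         + ((\<integral>x. w x \<bullet> grad ?P x \<partial>lborel) - ?r)"
        by (rule div_curl_identity[OF \<eta> ctx])
      have "?N * ?N * \<epsilon>1 + \<epsilon>1 = (1 + ?N * ?N) * \<epsilon>1" by (simp add: algebra_simps)
      also have "\<dots> = \<epsilon> / 3"
      proof -
        have "1 + ?N * ?N \<noteq> 0" by (smt (verit) N mult_pos_pos)
        from mult_divide_mult_cancel_left[OF this, of \<epsilon> 3] show ?thesis
          by (simp only: \<epsilon>1_def times_divide_eq_right mult.commute[of 3])
      qed
      finally have e3: "?N * ?N * \<epsilon>1 + \<epsilon>1 = \<epsilon> / 3" .
      have "\<bar>(\<Sum>i\<in>UNIV. ?I \<eta> i) - (\<Sum>i\<in>UNIV. ?J i)\<bar> \<le> (\<Sum>i\<in>(UNIV::'n set). \<epsilon>2)"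
        unfolding sum_subtractf[symmetric] by (intro order_trans[OF sum_abs] sum_mono t0(2) \<eta>(1) \<eta>t)
      also have "\<dots> = \<epsilon> / 3" by (simp add: \<epsilon>2_def)
      finally have j: "\<bar>(\<Sum>i\<in>UNIV. ?I \<eta> i) - (\<Sum>i\<in>UNIV. ?J i)\<bar> \<le> \<epsilon> / 3" .
      have "(\<Sum>i\<in>UNIV. ?J i) = (\<integral>x. (\<Sum>i\<in>UNIV. \<phi> x * w x $ i * v x $ i) \<partial>lborel)"
      proof (rule Bochner_Integration.integral_sum[symmetric])
        fix i
        show "integrable lborel (\<lambda>x. \<phi> x * w x $ i * v x $ i)"
        proof (rule integrable_compact_support[OF _ compact_cball[of 0 R]])
          show "norm (\<phi> x * w x $ i * v x $ i) \<le> P0 * A * A" for x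
            unfolding real_norm_def abs_mult[of "\<phi> x * w x $ i"] using P00 A by (intro mult_mono V) auto
          show "\<phi> x * w x $ i * v x $ i = 0" if "x \<notin> cball 0 R" for x using V(5)[of x i] that by simp
        qed measurable
      qed
      also have "(\<lambda>x. \<Sum>i\<in>UNIV. \<phi> x * w x $ i * v x $ i) = (\<lambda>x. \<phi> x * (v x \<bullet> w x))"
        by (auto simp: inner_vec_def sum_distrib_left mult_ac)
      finally have J: "(\<Sum>i\<in>UNIV. ?J i) = (\<integral>x. \<phi> x * (v x \<bullet> w x) \<partial>lborel)" .
      show ?thesis using cc p r id e3 j unfolding J by linarith
    qed
    then show ?thesis using T(1) \<delta> by blast
  qed
qed

section \<open>Negative Sobolev norms and Lipschitz test functions\<close>

lemma powr_le_self: "0 \<le> x \<Longrightarrow> x \<le> 1 \<Longrightarrow> 1 \<le> q \<Longrightarrow> x powr q \<le> (x::real)"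
  using powr_mono'[of 1 q x] by (cases "x = 0") auto

text \<open>A function supported in \<open>U\<close> with gradient at most 1 is bounded by its
  distance from a zero beyond \<open>U\<close>. After division by \<open>c\<close> function and
  gradient are at most 1, where a q-th power only decreases them, so the two integrals are estimated
  linearly.\<close>

lemma W1_norm_normalize:
  fixes U :: "(real^'n::finite) set"
  assumes U: "bounded U" and q: "q > 1"
  shows "\<exists>c>0. \<forall>\<psi>. test_fun U \<psi> \<and> (\<forall>x. norm (grad \<psi> x) \<le> 1) \<longrightarrow>
     test_fun U (\<lambda>x. (1 / c) * \<psi> x) \<and> W1_norm q (\<lambda>x. (1 / c) * \<psi> x) \<le> 1"
proof -
  obtain R0 where R0: "\<And>x. x \<in> U \<Longrightarrow> norm x \<le> R0" using U unfolding bounded_iff by blast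
  define R where "R = max R0 0"
  have R: "R \<ge> 0" "\<And>x. x \<in> U \<Longrightarrow> norm x \<le> R" using R0 by (auto simp: R_def le_max_iff_disj)
  define m where "m = measure lborel (cball (0::real^'n) R)"
  have m: "m \<ge> 0" by (simp add: m_def)
  \<comment> \<open>The first entry makes all values at most 1; the second bounds the sum of the
    integrals, at most \<open>(2 * R + 1) / c * m\<close> and \<open>1 / c * m\<close>, by
    1.\<close>
  define c where "c = max (2 * R + 1) (m * (2 * R + 2))"
  have c: "c \<ge> 1" "2 * R + 1 \<le> c" "m * (2 * R + 2) \<le> c" using R by (auto simp: c_def)
  have "test_fun U (\<lambda>x. (1 / c) * \<psi> x) \<and> W1_norm q (\<lambda>x. (1 / c) * \<psi> x) \<le> 1"
    if \<psi>: "test_fun U \<psi>" "\<And>x. norm (grad \<psi> x) \<le> 1" for \<psi>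
  proof -
    obtain S where S: "smooth \<psi>" "compact S" "S \<subseteq> U" "\<And>x. x \<notin> S \<Longrightarrow> \<psi> x = 0"
      using test_funE[OF \<psi>(1)] by metis
    define \<psi>' where "\<psi>' = (\<lambda>x. (1 / c) * \<psi> x)"
    have s': "smooth \<psi>'" unfolding \<psi>'_def by (intro smooth_mult smooth_const S)
    have t: "test_fun U \<psi>'" by (rule test_funI[OF s' S(2,3)]) (simp add: \<psi>'_def S(4))
    have zS: "x \<notin> S" if "norm x > R" for x using R(2) S(3) that by fastforce
    have b: "\<bar>\<psi> x\<bar> \<le> 2 * R + 1" for x
    proof (cases "x \<in> S")
      case True
      define p where "p = (R + 1) *\<^sub>R (axis undefined 1 :: real^'n)"
      have np: "norm p = R + 1" using R by (simp add: p_def)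
      then have "\<psi> p = 0" by (intro S(4) zS) simp
      then have "\<bar>\<psi> x\<bar> \<le> 1 * norm (x - p)" using smooth_lipschitz[OF S(1) \<psi>(2), of x p] by simp
      also have "\<dots> \<le> norm x + norm p" by (simp add: norm_triangle_ineq4)
      finally show ?thesis using R(2) S(3) True np by fastforce
    qed (use S(4) R in simp)
    have g': "grad \<psi>' x = (1 / c) *\<^sub>R grad \<psi> x" for x unfolding \<psi>'_def by (rule grad_cmult[OF S(1)])
    have I1: "(\<integral>x. \<bar>\<psi>' x\<bar> powr q \<partial>lebesgue) \<le> (2 * R + 1) / c * m"
    proof -
      have "(\<integral>x. \<bar>\<psi>' x\<bar> powr q \<partial>lebesgue) = (\<integral>x. \<bar>\<psi>' x\<bar> powr q \<partial>lborel)"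
        using borel_measurable_continuous_onI[OF smooth_continuous[OF s']] by (intro integral_completion) measurable
      also have "\<dots> \<le> (2 * R + 1) / c * m"
        unfolding m_def
      proof (rule order_trans[OF abs_ge_self integral_bounded_support_le])
        fix x
        have "\<bar>\<psi>' x\<bar> \<le> (2 * R + 1) / c"
          using b[of x] c by (simp add: \<psi>'_def abs_mult divide_right_mono)
        moreover have "\<bar>\<psi>' x\<bar> powr q \<le> \<bar>\<psi>' x\<bar>"
        proof (rule powr_le_self)
          have "(2 * R + 1) / c \<le> 1" using c by simp
          then show "\<bar>\<psi>' x\<bar> \<le> 1" using calculation by linarith
        qed (use q in auto)
        ultimately show "\<bar>\<bar>\<psi>' x\<bar> powr q\<bar> \<le> (2 * R + 1) / c" by simp
      next
        fix x :: "real^'n" assume "norm x > R"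
        then show "\<bar>\<psi>' x\<bar> powr q = 0" using S(4)[OF zS] by (simp add: \<psi>'_def)
      qed
      finally show ?thesis .
    qed
    have I2: "(\<integral>x. norm (grad \<psi>' x) powr q \<partial>lebesgue) \<le> 1 / c * m"
    proof -
      have "(\<integral>x. norm (grad \<psi>' x) powr q \<partial>lebesgue) = (\<integral>x. norm (grad \<psi>' x) powr q \<partial>lborel)"
        using measurable_grad[OF s'] by (intro integral_completion) measurable
      also have "\<dots> \<le> 1 / c * m"
        unfolding m_def
      proof (rule order_trans[OF abs_ge_self integral_bounded_support_le])
        fix x
        have "norm (grad \<psi>' x) \<le> 1 / c"
          using \<psi>(2)[of x] c by (simp add: g' divide_right_mono)
        moreover have "norm (grad \<psi>' x) powr q \<le> norm (grad \<psi>' x)"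
        proof (rule powr_le_self)
          have "1 / c \<le> 1" using c by simp
          then show "norm (grad \<psi>' x) \<le> 1" using calculation by linarith
        qed (use q in auto)
        ultimately show "\<bar>norm (grad \<psi>' x) powr q\<bar> \<le> 1 / c" by simp
      next
        fix x :: "real^'n" assume nx: "norm x > R"
        have "grad \<psi> x = 0" by (rule grad_zero_outside[OF compact_imp_closed[OF S(2)] S(4) zS[OF nx]])
        then show "norm (grad \<psi>' x) powr q = 0" by (simp add: g')
      qed
      finally show ?thesis .
    qed
    have "(2 * R + 1) / c * m + 1 / c * m = m * (2 * R + 2) / c"
      by (simp add: add_divide_distrib[symmetric] algebra_simps)
    also have "\<dots> \<le> 1" using c by simp
    finally have le: "(\<integral>x. \<bar>\<psi>' x\<bar> powr q \<partial>lebesgue) + (\<integral>x. norm (grad \<psi>' x) powr q \<partial>lebesgue) \<le> 1"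
      using I1 I2 by linarith
    have "(\<integral>x. \<bar>\<psi>' x\<bar> powr q \<partial>lebesgue) \<ge> 0" "(\<integral>x. norm (grad \<psi>' x) powr q \<partial>lebesgue) \<ge> 0"
      by (intro Bochner_Integration.integral_nonneg, simp)+
    then have "W1_norm q \<psi>' \<le> 1 powr (1 / q)"
      unfolding W1_norm_def using le q by (intro powr_mono2) auto
    then show ?thesis using t by (simp add: \<psi>'_def)
  qed
  then show ?thesis using c(1) by (intro exI[of _ c]) auto
qed

text \<open>The constant precedes the quantifier over \<open>T\<close>, because it will serve all
  differences of distributions along a sequence. Homogeneity on test functions undoes the
  normalisation.\<close>

lemma Wneg_norm_bound:
  fixes U :: "(real^'n::finite) set"
  assumes U: "bounded U" and s: "s > 1"
  shows "\<exists>c>0. \<forall>T \<psi> e. (\<forall>a \<psi>. T (\<lambda>x. a * \<psi> x) = a * T \<psi> \<or> \<not> test_fun U \<psi>) \<and> test_fun U \<psi> \<and> (\<forall>x. norm (grad \<psi> x) \<le> 1) \<and>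
     Wneg_norm s U T < ereal e \<longrightarrow> \<bar>T \<psi>\<bar> \<le> c * e"
proof -
  have q: "s / (s - 1) > 1" using s by (simp add: less_divide_eq)
  obtain c where c: "c > 0" "\<And>\<psi>. test_fun U \<psi> \<Longrightarrow> (\<forall>x. norm (grad \<psi> x) \<le> 1) \<Longrightarrow>
     test_fun U (\<lambda>x. (1 / c) * \<psi> x) \<and> W1_norm (s / (s - 1)) (\<lambda>x. (1 / c) * \<psi> x) \<le> 1"
    using W1_norm_normalize[OF U q] by blast
  have "\<bar>T \<psi>\<bar> \<le> c * e"
    if T: "\<forall>a \<psi>. T (\<lambda>x. a * \<psi> x) = a * T \<psi> \<or> \<not> test_fun U \<psi>" and \<psi>: "test_fun U \<psi>" "\<forall>x. norm (grad \<psi> x) \<le> 1"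
      and e: "Wneg_norm s U T < ereal e" for T \<psi> e
  proof -
    have "ereal \<bar>T (\<lambda>x. (1 / c) * \<psi> x)\<bar> \<le> Wneg_norm s U T"
      unfolding Wneg_norm_def by (rule SUP_upper) (use c(2)[OF \<psi>] in simp)
    then have "ereal \<bar>T (\<lambda>x. (1 / c) * \<psi> x)\<bar> < ereal e" using e by (rule le_less_trans)
    then have "\<bar>T (\<lambda>x. (1 / c) * \<psi> x)\<bar> < e" by simp
    moreover have "T (\<lambda>x. (1 / c) * \<psi> x) = (1 / c) * T \<psi>" using T \<psi> by blast
    ultimately have "\<bar>T \<psi>\<bar> / c < e" using c(1) by (simp add: abs_mult)
    then show ?thesis using c(1) by (simp add: pos_divide_less_eq mult.commute)
  qed
  then show ?thesis using c(1) by (intro exI[of _ c]) blast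
qed

section \<open>From negative Sobolev norms to small curl and divergence\<close>

lemma integral_lebesgue_eq_lborel:
  fixes f f' :: "'a::euclidean_space \<Rightarrow> 'b::{banach,second_countable_topology}"
  assumes "f \<in> borel_measurable lebesgue" "f' \<in> borel_measurable borel" "AE x in lebesgue. f x = f' x"
  shows "(\<integral>x. f x \<partial>lebesgue) = (\<integral>x. f' x \<partial>lborel)"
proof -
  have "f' \<in> borel_measurable lborel" using assms(2) by simp
  then have "f' \<in> borel_measurable lebesgue" by (rule measurable_completion)
  then have "(\<integral>x. f x \<partial>lebesgue) = (\<integral>x. f' x \<partial>lebesgue)"
    by (rule integral_cong_AE[OF assms(1) _ assms(3)])
  also have "\<dots> = (\<integral>x. f' x \<partial>lborel)"
    using assms(2) by (intro integral_completion) simp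
  finally show ?thesis .
qed

text \<open>A Borel version is taken componentwise and set to 0 outside \<open>U\<close> and where
  its norm exceeds \<open>A\<close>. This affects a null set only and makes the bounds hold
  everywhere.\<close>

lemma bounded_field_version:
  fixes v :: "real^'n::finite \<Rightarrow> real^'n"
  assumes v: "(\<lambda>x. if x \<in> U then v x else 0) \<in> borel_measurable lebesgue" and U: "open U"
    and A: "A \<ge> 0" "\<And>x. x \<in> U \<Longrightarrow> norm (v x) \<le> A"
  shows "\<exists>v'. bounded_field U A v' \<and> (AE x in lebesgue. (if x \<in> U then v x else 0) = v' x)"
proof -
  define vU where "vU = (\<lambda>x. if x \<in> U then v x else 0)"
  have nth: "(\<lambda>x::real^'n. x $ i) \<in> borel_measurable borel" for i
    by (intro borel_measurable_continuous_onI continuous_on_component continuous_on_id)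
  have "(\<lambda>x. vU x $ i) \<in> borel_measurable lebesgue" for i
    using measurable_compose[OF v nth] by (simp add: vU_def)
  then have "\<exists>g. g \<in> borel_measurable lborel \<and> (AE x in lborel. vU x $ i = g x)" for i
    using completion_ex_borel_measurable_real[of "\<lambda>x. vU x $ i" lborel] by blast
  then obtain g where g: "\<And>i. g i \<in> borel_measurable lborel" "\<And>i. AE x in lborel. vU x $ i = g i x" by metis
  define v1 where "v1 = (\<lambda>x. \<Sum>i\<in>UNIV. g i x *\<^sub>R (axis i 1 :: real^'n))"
  define v' where "v' = (\<lambda>x. if x \<in> U \<and> norm (v1 x) \<le> A then v1 x else 0)"
  have [measurable]: "g i \<in> borel_measurable borel" for i using g(1)[of i] by simp
  have v1m [measurable]: "v1 \<in> borel_measurable borel" unfolding v1_def by measurable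
  have [measurable]: "U \<in> sets borel" using U by simp
  have "v' \<in> borel_measurable borel" unfolding v'_def by measurable
  then have "bounded_field U A v'" using A by (auto simp: bounded_field_def v'_def)
  moreover have "AE x in lborel. \<forall>i. vU x $ i = g i x" using g(2) by (simp add: AE_all_countable)
  then have "AE x in lborel. vU x = v' x"
  proof eventually_elim
    case (elim x)
    have "vU x = (\<Sum>i\<in>UNIV. vU x $ i *\<^sub>R axis i 1)"
      by (simp add: basis_expansion scalar_mult_eq_scaleR [symmetric])
    then have "v1 x = vU x" using elim by (simp add: v1_def)
    then show ?case using A by (auto simp: v'_def vU_def)
  qed
  then have "AE x in lebesgue. vU x = v' x" by (rule AE_completion)
  ultimately show ?thesis unfolding vU_def by blast
qed

text \<open>Bolzano-Weierstrass for countably many sequences at once, by Cantor's diagonal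
  argument.\<close>

lemma bounded_sequences_common_subseq:
  fixes a :: "nat \<Rightarrow> nat \<Rightarrow> 'a::heine_borel"
  assumes "\<And>n. bounded (range (a n))"
  obtains r :: "nat \<Rightarrow> nat" where "strict_mono r" "\<And>n. convergent (\<lambda>k. a n (r k))"
proof -
  interpret subseqs "\<lambda>n s. convergent (\<lambda>k. a n (s k))"
  proof
    fix n and s :: "nat \<Rightarrow> nat" assume "strict_mono s"
    have "bounded (range (\<lambda>k. a n (s k)))" by (rule bounded_subset[OF assms[of n]]) auto
    from bounded_imp_convergent_subsequence[OF this]
    show "\<exists>r'. strict_mono r' \<and> convergent (\<lambda>k. a n ((s \<circ> r') k))"
      by (auto simp: o_def convergent_def)
  qed
  show ?thesis
  proof (rule that[OF subseq_diagseq])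
    fix n
    \<comment> \<open>The diagonal sequence is a subsequence of the n-th extraction only after an
      initial segment is dropped, which does not affect convergence.\<close>
    have "convergent (\<lambda>k. a n ((diagseq \<circ> ((+) (Suc n))) k))"
    proof (rule diagseq_holds)
      fix r s :: "nat \<Rightarrow> nat" and n
      assume "strict_mono r" "convergent (\<lambda>k. a n (s k))"
      then show "convergent (\<lambda>k. a n ((s \<circ> r) k))"
        using convergent_subseq_convergent[of "\<lambda>k. a n (s k)" r] by (simp add: o_def)
    qed
    then have "convergent (\<lambda>k. a n (diagseq (k + Suc n)))" by (simp add: o_def add.commute)
    then show "convergent (\<lambda>k. a n (diagseq k))"
      using convergent_ignore_initial_segment[of "\<lambda>k. a n (diagseq k)" "Suc n"] by blast
  qed
qed

definition Wneg_Cauchy :: "real \<Rightarrow> (real^'n::finite) set \<Rightarrow> (nat \<Rightarrow> 'n distr) \<Rightarrow> bool" where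
  "Wneg_Cauchy s \<Omega> T \<longleftrightarrow> (\<forall>U. cc_open U \<Omega> \<longrightarrow> (\<forall>e>0. \<exists>N. \<forall>m\<ge>N. \<forall>k\<ge>N.
            Wneg_norm s U (\<lambda>\<phi>. T m \<phi> - T k \<phi>) < ereal e))"

lemma Wneg_Cauchy_subseq:
  fixes r :: "nat \<Rightarrow> nat"
  assumes "Wneg_Cauchy s \<Omega> T" "strict_mono r"
  shows "Wneg_Cauchy s \<Omega> (\<lambda>k. T (r k))"
  unfolding Wneg_Cauchy_def
proof (intro allI impI)
  fix U :: "(real^'a) set" and e :: real assume "cc_open U \<Omega>" "0 < e"
  then obtain N where N: "\<forall>m\<ge>N. \<forall>k\<ge>N. Wneg_norm s U (\<lambda>\<phi>. T m \<phi> - T k \<phi>) < ereal e"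
    using assms(1) unfolding Wneg_Cauchy_def by blast
  have "r k \<ge> N" if "k \<ge> N" for k using seq_suble[OF assms(2), of k] that by linarith
  then show "\<exists>N. \<forall>m\<ge>N. \<forall>k\<ge>N. Wneg_norm s U (\<lambda>\<phi>. T (r m) \<phi> - T (r k) \<phi>) < ereal e"
    using N by (intro exI[of _ N]) blast
qed

text \<open>Finitely many distributions allow successive extraction. The parameter \<open>r0\<close>
  carries a subsequence already chosen for another purpose, here the mollified velocities.\<close>

lemma Wneg_common_subseq:
  assumes "finite J" "\<And>j. j \<in> J \<Longrightarrow> Wneg_loc_precompact s \<Omega> (T j)" "strict_mono (r0 :: nat \<Rightarrow> nat)"
  shows "\<exists>r::nat\<Rightarrow>nat. strict_mono r \<and> (\<forall>j\<in>J. Wneg_Cauchy s \<Omega> (\<lambda>k. T j (r0 (r k))))"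
  using assms
proof (induction J rule: finite_induct)
  case empty
  then show ?case by (intro exI[of _ id]) (auto simp: strict_mono_def)
next
  case (insert j J)
  then obtain r :: "nat \<Rightarrow> nat" where r: "strict_mono r" "\<forall>j\<in>J. Wneg_Cauchy s \<Omega> (\<lambda>k. T j (r0 (r k)))" by auto
  have rr: "strict_mono (\<lambda>k. r0 (r k))"
    using strict_mono_o[OF insert.prems(2) r(1)] by (simp add: o_def)
  have "Wneg_loc_precompact s \<Omega> (T j)" using insert.prems by simp
  then have "\<forall>r::nat\<Rightarrow>nat. strict_mono r \<longrightarrow> (\<exists>r'::nat\<Rightarrow>nat. strict_mono r' \<and> Wneg_Cauchy s \<Omega> (\<lambda>k. T j (r (r' k))))"
    unfolding Wneg_loc_precompact_def Wneg_Cauchy_def by (rule conjunct2)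
  then obtain r' :: "nat \<Rightarrow> nat" where r': "strict_mono r'" "Wneg_Cauchy s \<Omega> (\<lambda>k. T j (r0 (r (r' k))))"
    using rr by blast
  have "Wneg_Cauchy s \<Omega> (\<lambda>k. T i (r0 (r (r' k))))" if "i \<in> J" for i
    using Wneg_Cauchy_subseq[OF _ r'(1)] r(2) that by blast
  then show ?case
    using r' strict_mono_o[OF r(1) r'(1)] by (intro exI[of _ "\<lambda>k. r (r' k)"]) (auto simp: o_def)
qed

lemma cc_open_neighbourhood:
  fixes S :: "(real^'n::finite) set"
  assumes "compact S" "S \<noteq> {}" "S \<subseteq> \<Omega>" "open \<Omega>"
  obtains U where "cc_open U \<Omega>" "S \<subseteq> U"
proof -
  obtain e where e: "e > 0" "(\<Union>x\<in>S. cball x e) \<subseteq> \<Omega>"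
    using compact_subset_open_imp_cball_epsilon_subset[OF assms(1,4,3)] by blast
  have nb: "{x. infdist x S \<le> e} \<subseteq> \<Omega>"
  proof
    fix x assume x: "x \<in> {x. infdist x S \<le> e}"
    obtain y where "y \<in> S" "infdist x S = dist x y"
      using infdist_attains_inf[OF compact_imp_closed[OF assms(1)] assms(2)] by metis
    then have "x \<in> cball y e" using x by (simp add: dist_commute)
    then show "x \<in> \<Omega>" using e(2) \<open>y \<in> S\<close> by blast
  qed
  define U where "U = {x. infdist x S < e}"
  have cp: "compact {x. infdist x S \<le> e}" by (rule compact_neighbourhood[OF assms(1,2)])
  have "open U" unfolding U_def by (intro open_Collect_less continuous_intros)
  moreover have cl: "closure U \<subseteq> {x. infdist x S \<le> e}"
    by (rule closure_minimal[OF _ compact_imp_closed[OF cp]]) (auto simp: U_def)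
  moreover have "compact (closure U)"
    using closed_Int_compact[OF closed_closure[of U] cp] cl by (simp add: Int_absorb2)
  ultimately have "cc_open U \<Omega>" using nb by (auto simp: cc_open_def)
  moreover have "S \<subseteq> U" using e by (auto simp: U_def)
  ultimately show ?thesis by (rule that)
qed

text \<open>The derivative falls on the mollifier, so \<open>L\<close> depends on t alone: at a
  fixed scale, bounded functions have equicontinuous mollifications.\<close>

lemma conv_mol_equilipschitz:
  fixes V :: "real^'n::finite \<Rightarrow> real"
  assumes t: "t > 0"
  obtains L where "L \<ge> 0" "\<And>V A x y. A \<ge> 0 \<Longrightarrow> integrable lborel V \<Longrightarrow> (\<And>x. \<bar>V x\<bar> \<le> A) \<Longrightarrow>
     \<bar>conv (mol t) V x - conv (mol t) V (y::real^'n)\<bar> \<le> A * L * norm (x - y)"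
proof -
  define B where "B = (\<Sum>i\<in>UNIV. \<integral>x. \<bar>pd i (mol t) (x::real^'n)\<bar> \<partial>lborel)"
  have B: "B \<ge> 0" unfolding B_def by (intro sum_nonneg) simp
  have mz: "x \<notin> cball 0 t \<Longrightarrow> mol t x = 0" for x :: "real^'n" using t by (simp add: mol_zero)
  have int: "integrable lborel (pd i (mol t) :: real^'n \<Rightarrow> real)" for i
    by (rule integrable_continuous_compact_support[OF smooth_continuous[OF smooth_pd[OF smooth_mol]] compact_cball pd_zero_outside[OF closed_cball mz]])
  show ?thesis
  proof (rule that[of "real CARD('n) * B"])
    show "real CARD('n) * B \<ge> 0" using B by simp
    fix V :: "real^'n \<Rightarrow> real" and A x y
    assume A: "A \<ge> 0" and V: "integrable lborel V" and VA: "\<And>x. \<bar>V x\<bar> \<le> A"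
    have sm: "smooth (conv (mol t) V)" by (rule conv_smooth[OF smooth_mol compact_cball mz V])
    have "norm (grad (conv (mol t) V) x) \<le> real CARD('n) * (A * B)" for x
    proof (rule norm_le_vec_bound)
      fix i
      have "pd i (conv (mol t) V) = conv (pd i (mol t)) V" by (rule conv_pd[OF smooth_mol compact_cball mz V])
      then have "\<bar>grad (conv (mol t) V) x $ i\<bar> \<le> A * (\<integral>x. \<bar>pd i (mol t) (x::real^'n)\<bar> \<partial>lborel)"
        using conv_abs_le[where K="pd i (mol t)" and V=V, OF int VA] by simp
      also have "\<dots> \<le> A * B"
        unfolding B_def by (intro mult_left_mono A member_le_sum) auto
      finally show "\<bar>grad (conv (mol t) V) x $ i\<bar> \<le> A * B" .
    qed
    from smooth_lipschitz[OF sm this] show "\<bar>conv (mol t) V x - conv (mol t) V y\<bar> \<le> A * (real CARD('n) * B) * norm (x - y)"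
      by (simp add: mult_ac)
  qed
qed

lemma bounded_field_integrable:
  assumes "bounded_field U A v" "bounded U"
  shows "integrable lborel (\<lambda>x. v x $ i)"
proof -
  have nth: "(\<lambda>x::real^'a. x $ i) \<in> borel_measurable borel" for i
    by (intro borel_measurable_continuous_onI continuous_on_component continuous_on_id)
  have v: "v \<in> borel_measurable borel" "\<And>x. norm (v x) \<le> A" "\<And>x. x \<notin> U \<Longrightarrow> v x = 0"
    using assms(1) by (auto simp: bounded_field_def)
  obtain R where R: "\<And>x. x \<in> U \<Longrightarrow> norm x \<le> R" using assms(2) unfolding bounded_iff by blast
  show ?thesis
  proof (rule integrable_compact_support[OF measurable_compose[OF v(1) nth] compact_cball[of 0 R]])
    show "norm (v x $ i) \<le> A" for x using component_le_norm_cart[of "v x" i] v(2)[of x] by simp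
    show "v x $ i = 0" if "x \<notin> cball 0 R" for x
    proof -
      have "x \<notin> U" using R that by auto
      then show ?thesis using v(3) by simp
    qed
  qed
qed

text \<open>Convergence on a dense set suffices, by equicontinuity.\<close>

lemma conv_mol_convergent:
  fixes v :: "nat \<Rightarrow> real^'n::finite \<Rightarrow> real^'n"
  assumes t: "t > 0" and v: "\<And>k. bounded_field U A (v k)" "bounded U" and A: "A \<ge> 0"
    and D: "\<And>x e. e > 0 \<Longrightarrow> \<exists>y\<in>D. norm (x - y) < e" and conv: "\<And>y. y \<in> D \<Longrightarrow> convergent (\<lambda>k. conv (mol t) (\<lambda>z. v k z $ i) y)"
  shows "convergent (\<lambda>k. conv (mol t) (\<lambda>z. v k z $ i) x)"
proof -
  obtain L where L: "L \<ge> 0" and lip: "\<And>V A x y. A \<ge> 0 \<Longrightarrow> integrable lborel V \<Longrightarrow> (\<And>x. \<bar>V x\<bar> \<le> A) \<Longrightarrow>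
     \<bar>conv (mol t) V x - conv (mol t) V (y::real^'n)\<bar> \<le> A * L * norm (x - y)"
    using conv_mol_equilipschitz[OF t, where 'n='n] by blast
  let ?g = "\<lambda>k x. conv (mol t) (\<lambda>z. v k z $ i) x"
  have g: "\<bar>?g k x - ?g k y\<bar> \<le> A * L * norm (x - y)" for k x y
  proof (rule lip[OF A bounded_field_integrable[OF v(1,2)]])
    show "\<bar>v k z $ i\<bar> \<le> A" for z
      using component_le_norm_cart[of "v k z" i] v(1)[of k] unfolding bounded_field_def by (meson order_trans)
  qed
  have "Cauchy (\<lambda>k. ?g k x)"
  proof (rule metric_CauchyI)
    fix e :: real assume e: "e > 0"
    have "e / (3 * (A * L + 1)) > 0" using e A L by (simp add: add_nonneg_pos)
    then obtain y where y: "y \<in> D" "norm (x - y) < e / (3 * (A * L + 1))" using D by blast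
    have "A * L * norm (x - y) \<le> (A * L + 1) * norm (x - y)" by (intro mult_right_mono) auto
    also have "\<dots> < e / 3"
    proof -
      have "A * L + 1 > 0" using A L by (simp add: add_nonneg_pos)
      then show ?thesis using y(2) by (simp add: pos_less_divide_eq algebra_simps)
    qed
    finally have s: "A * L * norm (x - y) < e / 3" .
    have "Cauchy (\<lambda>k. ?g k y)" by (rule convergent_Cauchy[OF conv[OF y(1)]])
    then obtain N where N: "\<And>m k. m \<ge> N \<Longrightarrow> k \<ge> N \<Longrightarrow> dist (?g m y) (?g k y) < e / 3"
      using e unfolding Cauchy_def by (meson divide_pos_pos zero_less_numeral)
    have "dist (?g m x) (?g k x) < e" if "m \<ge> N" "k \<ge> N" for m k
      using N[OF that] g[of m x y] g[of k x y] s unfolding dist_real_def by linarith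
    then show "\<exists>N. \<forall>m\<ge>N. \<forall>k\<ge>N. dist (?g m x) (?g k x) < e" by blast
  qed
  then show ?thesis by (rule Cauchy_convergent)
qed


text \<open>Carries the hypothesis from distributions of Lebesgue measurable fields to Borel
  versions on \<open>U\<close>; each pair couples a field with its version. The threshold is chosen
  ahead of the fields, so one threshold serves all differences along the sequence.\<close>

lemma small_curl_div_of_Wneg:
  fixes U :: "(real^'n::finite) set"
  assumes s: "s > 1" and U: "open U" "bounded U" and \<delta>: "\<delta> > 0" and A: "A \<ge> 0"
  shows "\<exists>e>0. \<forall>u1 u2 w1 w2 v1 v2 z1 z2 :: real^'n \<Rightarrow> real^'n.
     (\<forall>(f, f') \<in> {(u1, v1), (u2, v2), (w1, z1), (w2, z2)}. (\<lambda>x. if x \<in> U then f x else 0) \<in> borel_measurable lebesgue \<and>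
        bounded_field U A f' \<and> (AE x in lebesgue. (if x \<in> U then f x else 0) = f' x)) \<longrightarrow>
     (\<forall>i j. Wneg_norm s U (\<lambda>\<psi>. curl_distr u1 i j \<psi> - curl_distr u2 i j \<psi>) < ereal e) \<longrightarrow>
     Wneg_norm s U (\<lambda>\<psi>. div_distr w1 \<psi> - div_distr w2 \<psi>) < ereal e \<longrightarrow>
     small_curl_div U \<delta> (\<lambda>x. v1 x - v2 x) (\<lambda>x. z1 x - z2 x)"
proof -
  obtain c where c0: "c > 0 \<and> (\<forall>T \<psi> e. (\<forall>a \<psi>. T (\<lambda>x. a * \<psi> x) = a * T \<psi> \<or> \<not> test_fun U \<psi>) \<and> test_fun U \<psi> \<and>
      (\<forall>x. norm (grad \<psi> x) \<le> 1) \<and> Wneg_norm s U T < ereal e \<longrightarrow> \<bar>T \<psi>\<bar> \<le> c * e)"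
    using Wneg_norm_bound[OF U(2) s] ..
  note c = conjunct1[OF c0]
  have Wb: "\<bar>T \<psi>\<bar> \<le> c * e" if "\<forall>a \<psi>. T (\<lambda>x. a * \<psi> x) = a * T \<psi> \<or> \<not> test_fun U \<psi>" "test_fun U \<psi>"
      "\<forall>x. norm (grad \<psi> x) \<le> 1" "Wneg_norm s U T < ereal e" for T \<psi> e
    by (rule conjunct2[OF c0, THEN spec, THEN spec, THEN spec, THEN mp, OF conjI[OF that(1) conjI[OF that(2) conjI[OF that(3) that(4)]]]])
  have nth: "(\<lambda>x::real^'n. x $ i) \<in> borel_measurable borel" for i
    by (intro borel_measurable_continuous_onI continuous_on_component continuous_on_id)
  let ?ok = "\<lambda>f f'. (\<lambda>x. if x \<in> U then f x else 0) \<in> borel_measurable lebesgue \<and>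
        bounded_field U A f' \<and> (AE x in lebesgue. (if x \<in> U then f x else 0) = (f' x :: real^'n))"
  \<comment> \<open>Derivatives of test functions vanish off \<open>U\<close>, so a field may be
    altered there without changing a pairing.\<close>
  have gz: "grad \<psi> x = 0" "pd i \<psi> x = 0" if tf: "test_fun U \<psi>" "x \<notin> U" for \<psi> x i
  proof -
    obtain S where S: "smooth \<psi>" "compact S" "S \<subseteq> U" "\<And>x. x \<notin> S \<Longrightarrow> \<psi> x = 0" using test_funE[OF tf(1)] by metis
    have xS: "x \<notin> S" using tf(2) S(3) by auto
    show "grad \<psi> x = 0" by (rule grad_zero_outside[OF compact_imp_closed[OF S(2)] S(4) xS])
    show "pd i \<psi> x = 0" by (rule pd_zero_outside[OF compact_imp_closed[OF S(2)] S(4) xS])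
  qed
  have lebm: "g \<in> borel_measurable lebesgue" if "g \<in> borel_measurable borel" for g :: "real^'n \<Rightarrow> real"
    using that by (intro measurable_completion) simp
  have lebmv: "g \<in> borel_measurable lebesgue" if "g \<in> borel_measurable borel" for g :: "real^'n \<Rightarrow> real^'n"
    using that by (intro measurable_completion) simp
  have divE: "(\<integral>x. f x \<bullet> grad \<psi> x \<partial>lebesgue) = (\<integral>x. f' x \<bullet> grad \<psi> x \<partial>lborel)"
    and divI: "integrable lborel (\<lambda>x. f' x \<bullet> grad \<psi> x)" if ok: "?ok f f'" and \<psi>: "test_fun U \<psi>" for f f' \<psi>
  proof -
    obtain S where S: "smooth \<psi>" "compact S" "S \<subseteq> U" "\<And>x. x \<notin> S \<Longrightarrow> \<psi> x = 0" using test_funE[OF \<psi>] by metis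
    have m: "grad \<psi> \<in> borel_measurable borel" by (rule measurable_grad[OF S(1)])
    have f': "f' \<in> borel_measurable borel" "\<And>x. norm (f' x) \<le> A" using ok by (auto simp: bounded_field_def)
    have eq: "f x \<bullet> grad \<psi> x = (if x \<in> U then f x else 0) \<bullet> grad \<psi> x" for x using gz(1)[OF \<psi>, of x] by auto
    show "(\<integral>x. f x \<bullet> grad \<psi> x \<partial>lebesgue) = (\<integral>x. f' x \<bullet> grad \<psi> x \<partial>lborel)"
      unfolding eq
    proof (rule integral_lebesgue_eq_lborel)
      show "(\<lambda>x. (if x \<in> U then f x else 0) \<bullet> grad \<psi> x) \<in> borel_measurable lebesgue"
        by (rule borel_measurable_inner[OF _ lebmv[OF m]]) (use ok in blast)
      show "(\<lambda>x. f' x \<bullet> grad \<psi> x) \<in> borel_measurable borel" by (rule borel_measurable_inner[OF f'(1) m])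
      have "AE x in lebesgue. (if x \<in> U then f x else 0) = f' x" using ok by blast
      then show "AE x in lebesgue. (if x \<in> U then f x else 0) \<bullet> grad \<psi> x = f' x \<bullet> grad \<psi> x" by eventually_elim simp
    qed
    show "integrable lborel (\<lambda>x. f' x \<bullet> grad \<psi> x)"
      by (rule integrable_inner_bounded[OF f' continuous_on_grad[OF S(1)] S(2) grad_zero_outside[OF compact_imp_closed[OF S(2)] S(4)]])
  qed
  have curlE: "(\<integral>x. f x $ i * pd j \<psi> x - f x $ j * pd i \<psi> x \<partial>lebesgue) = (\<integral>x. f' x $ i * pd j \<psi> x - f' x $ j * pd i \<psi> x \<partial>lborel)"
    and curlI: "integrable lborel (\<lambda>x. f' x $ i * pd j \<psi> x - f' x $ j * pd i \<psi> x)"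
    if ok: "?ok f f'" and \<psi>: "test_fun U \<psi>" for f f' \<psi> i j
  proof -
    obtain S where S: "smooth \<psi>" "compact S" "S \<subseteq> U" "\<And>x. x \<notin> S \<Longrightarrow> \<psi> x = 0" using test_funE[OF \<psi>] by metis
    have m: "pd k \<psi> \<in> borel_measurable borel" for k
      by (rule borel_measurable_continuous_onI[OF smooth_continuous[OF smooth_pd[OF S(1)]]])
    have f': "f' \<in> borel_measurable borel" "\<And>x. norm (f' x) \<le> A" using ok by (auto simp: bounded_field_def)
    have eq: "f x $ i * pd j \<psi> x - f x $ j * pd i \<psi> x
       = (if x \<in> U then f x else 0) $ i * pd j \<psi> x - (if x \<in> U then f x else 0) $ j * pd i \<psi> x" for x
      using gz(2)[OF \<psi>, of x] by auto
    show "(\<integral>x. f x $ i * pd j \<psi> x - f x $ j * pd i \<psi> x \<partial>lebesgue) = (\<integral>x. f' x $ i * pd j \<psi> x - f' x $ j * pd i \<psi> x \<partial>lborel)"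
      unfolding eq
    proof (rule integral_lebesgue_eq_lborel)
      have "(\<lambda>x. if x \<in> U then f x else 0) \<in> borel_measurable lebesgue" using ok by blast
      note mm = measurable_compose[OF this nth]
      show "(\<lambda>x. (if x \<in> U then f x else 0) $ i * pd j \<psi> x - (if x \<in> U then f x else 0) $ j * pd i \<psi> x) \<in> borel_measurable lebesgue"
        by (rule borel_measurable_diff[OF borel_measurable_times[OF mm lebm[OF m]] borel_measurable_times[OF mm lebm[OF m]]])
      show "(\<lambda>x. f' x $ i * pd j \<psi> x - f' x $ j * pd i \<psi> x) \<in> borel_measurable borel"
        by (intro borel_measurable_diff borel_measurable_times m measurable_compose[OF f'(1) nth])
      have "AE x in lebesgue. (if x \<in> U then f x else 0) = f' x" using ok by blast
      then show "AE x in lebesgue. (if x \<in> U then f x else 0) $ i * pd j \<psi> x - (if x \<in> U then f x else 0) $ j * pd i \<psi> x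
         = f' x $ i * pd j \<psi> x - f' x $ j * pd i \<psi> x" by eventually_elim simp
    qed
    have "integrable lborel (\<lambda>x. f' x \<bullet> (pd j \<psi> x *\<^sub>R axis i 1 - pd i \<psi> x *\<^sub>R axis j 1))"
    proof (rule integrable_inner_bounded[OF f' _ S(2)])
      show "continuous_on UNIV (\<lambda>x. pd j \<psi> x *\<^sub>R axis i 1 - pd i \<psi> x *\<^sub>R axis j 1 :: real^'n)"
        by (intro continuous_intros smooth_continuous smooth_pd S(1))
      show "pd j \<psi> x *\<^sub>R axis i 1 - pd i \<psi> x *\<^sub>R axis j 1 = (0 :: real^'n)" if "x \<notin> S" for x
        by (simp add: pd_zero_outside[OF compact_imp_closed[OF S(2)] S(4) that])
    qed
    then show "integrable lborel (\<lambda>x. f' x $ i * pd j \<psi> x - f' x $ j * pd i \<psi> x)"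
      by (simp add: inner_diff_right inner_axis mult.commute)
  qed
  have sc: "grad (\<lambda>x. a * \<psi> x) x = a *\<^sub>R grad \<psi> x" "pd i (\<lambda>x. a * \<psi> x) x = a * pd i \<psi> x" if "test_fun U \<psi>" for a \<psi> x i
    using that by (auto simp: test_fun_def grad_cmult pd_cmult)
  have homd: "div_distr f (\<lambda>x. a * \<psi> x) = a * div_distr f \<psi>" if "test_fun U \<psi>" for f :: "real^'n \<Rightarrow> real^'n" and a \<psi>
    by (simp add: div_distr_def sc[OF that])
  have homc: "curl_distr f i j (\<lambda>x. a * \<psi> x) = a * curl_distr f i j \<psi>" if "test_fun U \<psi>" for f :: "real^'n \<Rightarrow> real^'n" and a \<psi> i j
  proof -
    have "f x $ i * (a * pd j \<psi> x) - f x $ j * (a * pd i \<psi> x) = a * (f x $ i * pd j \<psi> x - f x $ j * pd i \<psi> x)" for x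
      by (simp add: algebra_simps)
    then show ?thesis by (simp add: curl_distr_def sc[OF that])
  qed
  have "small_curl_div U \<delta> (\<lambda>x. v1 x - v2 x) (\<lambda>x. z1 x - z2 x)"
    if ok: "?ok u1 v1" "?ok u2 v2" "?ok w1 z1" "?ok w2 z2"
      and C: "\<forall>i j. Wneg_norm s U (\<lambda>\<psi>. curl_distr u1 i j \<psi> - curl_distr u2 i j \<psi>) < ereal (\<delta> / c)"
      and D: "Wneg_norm s U (\<lambda>\<psi>. div_distr w1 \<psi> - div_distr w2 \<psi>) < ereal (\<delta> / c)"
    for u1 u2 w1 w2 v1 v2 z1 z2
    unfolding small_curl_div_def
  proof (intro allI impI conjI)
    fix \<psi> :: "real^'n \<Rightarrow> real" assume \<psi>: "test_fun U \<psi>" "\<forall>x. norm (grad \<psi> x) \<le> 1"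
    have hd: "\<forall>a \<psi>. div_distr w1 (\<lambda>x. a * \<psi> x) - div_distr w2 (\<lambda>x. a * \<psi> x) = a * (div_distr w1 \<psi> - div_distr w2 \<psi>) \<or> \<not> test_fun U \<psi>"
    proof (intro allI)
      fix a and \<xi> :: "real^'n \<Rightarrow> real"
      show "div_distr w1 (\<lambda>x. a * \<xi> x) - div_distr w2 (\<lambda>x. a * \<xi> x) = a * (div_distr w1 \<xi> - div_distr w2 \<xi>) \<or> \<not> test_fun U \<xi>"
        by (cases "test_fun U \<xi>") (simp_all only: homd right_diff_distrib simp_thms)
    qed
    have "\<bar>div_distr w1 \<psi> - div_distr w2 \<psi>\<bar> \<le> c * (\<delta> / c)"
      by (rule Wb[where T="\<lambda>\<psi>. div_distr w1 \<psi> - div_distr w2 \<psi>", OF hd \<psi> D])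
    moreover have "(\<integral>x. (z1 x - z2 x) \<bullet> grad \<psi> x \<partial>lborel) = - (div_distr w1 \<psi> - div_distr w2 \<psi>)"
      unfolding div_distr_def divE[OF ok(3) \<psi>(1)] divE[OF ok(4) \<psi>(1)] inner_diff_left
      by (subst Bochner_Integration.integral_diff[OF divI[OF ok(3) \<psi>(1)] divI[OF ok(4) \<psi>(1)]]) simp
    ultimately show "\<bar>\<integral>x. (z1 x - z2 x) \<bullet> grad \<psi> x \<partial>lborel\<bar> \<le> \<delta>" using c by simp
    fix i j
    have hc: "\<forall>a \<psi>. curl_distr u1 i j (\<lambda>x. a * \<psi> x) - curl_distr u2 i j (\<lambda>x. a * \<psi> x) = a * (curl_distr u1 i j \<psi> - curl_distr u2 i j \<psi>) \<or> \<not> test_fun U \<psi>"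
    proof (intro allI)
      fix a and \<xi> :: "real^'n \<Rightarrow> real"
      show "curl_distr u1 i j (\<lambda>x. a * \<xi> x) - curl_distr u2 i j (\<lambda>x. a * \<xi> x) = a * (curl_distr u1 i j \<xi> - curl_distr u2 i j \<xi>) \<or> \<not> test_fun U \<xi>"
        by (cases "test_fun U \<xi>") (simp_all only: homc right_diff_distrib simp_thms)
    qed
    have "\<bar>curl_distr u1 i j \<psi> - curl_distr u2 i j \<psi>\<bar> \<le> c * (\<delta> / c)"
      by (rule Wb[where T="\<lambda>\<psi>. curl_distr u1 i j \<psi> - curl_distr u2 i j \<psi>", OF hc \<psi> C[THEN spec, THEN spec]])
    moreover have "(\<integral>x. (v1 x - v2 x) $ i * pd j \<psi> x - (v1 x - v2 x) $ j * pd i \<psi> x \<partial>lborel) = curl_distr u1 i j \<psi> - curl_distr u2 i j \<psi>"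
    proof -
      have "(v1 x - v2 x) $ i * pd j \<psi> x - (v1 x - v2 x) $ j * pd i \<psi> x
        = (v1 x $ i * pd j \<psi> x - v1 x $ j * pd i \<psi> x) - (v2 x $ i * pd j \<psi> x - v2 x $ j * pd i \<psi> x)" for x
        by (simp add: algebra_simps)
      then show ?thesis
        unfolding curl_distr_def curlE[OF ok(1) \<psi>(1)] curlE[OF ok(2) \<psi>(1)]
        by (simp only: Bochner_Integration.integral_diff[OF curlI[OF ok(1) \<psi>(1)] curlI[OF ok(2) \<psi>(1)]])
    qed
    ultimately show "\<bar>\<integral>x. (v1 x - v2 x) $ i * pd j \<psi> x - (v1 x - v2 x) $ j * pd i \<psi> x \<partial>lborel\<bar> \<le> \<delta>" using c by simp
  qed
  note main = this
  show ?thesis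
  proof (intro exI[of _ "\<delta> / c"] conjI allI impI)
    show "\<delta> / c > 0" using \<delta> c by simp
    fix u1 u2 w1 w2 v1 v2 z1 z2 :: "real^'n \<Rightarrow> real^'n"
    assume h: "\<forall>(f, f') \<in> {(u1, v1), (u2, v2), (w1, z1), (w2, z2)}. ?ok f f'"
      and C: "\<forall>i j. Wneg_norm s U (\<lambda>\<psi>. curl_distr u1 i j \<psi> - curl_distr u2 i j \<psi>) < ereal (\<delta> / c)"
      and D: "Wneg_norm s U (\<lambda>\<psi>. div_distr w1 \<psi> - div_distr w2 \<psi>) < ereal (\<delta> / c)"
    have "?ok u1 v1" "?ok u2 v2" "?ok w1 z1" "?ok w2 z2"
      using bspec[OF h, of "(u1, v1)"] bspec[OF h, of "(u2, v2)"] bspec[OF h, of "(w1, z1)"] bspec[OF h, of "(w2, z2)"]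
      by (simp_all only: insert_iff simp_thms prod.case)
    then show "small_curl_div U \<delta> (\<lambda>x. v1 x - v2 x) (\<lambda>x. z1 x - z2 x)" by (rule main[OF _ _ _ _ C D])
  qed
qed

section \<open>The div-curl lemma for differences\<close>

lemma bounded_field_diff:
  assumes "bounded_field U A v" "bounded_field U A w"
  shows "bounded_field U (2 * A) (\<lambda>x. v x - w x)"
  unfolding bounded_field_def
proof (intro conjI allI impI)
  show "(\<lambda>x. v x - w x) \<in> borel_measurable borel"
    using assms by (intro borel_measurable_diff) (auto simp: bounded_field_def)
  show "norm (v x - w x) \<le> 2 * A" for x
  proof -
    have "norm (v x) \<le> A" "norm (w x) \<le> A" using assms by (auto simp: bounded_field_def)
    then show ?thesis using norm_triangle_ineq4[of "v x" "w x"] by linarith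
  qed
  show "v x - w x = 0" if "x \<notin> U" for x using assms that by (auto simp: bounded_field_def)
qed

text \<open>At a fixed scale the mollifications converge pointwise and boundedly, hence in the
  weighted \<open>L^1\<close> sense, while the differences of w stay bounded. This disposes of the
  one term that the quantitative div-curl lemma leaves.\<close>

lemma mollified_term_vanishes:
  fixes \<phi> :: "real^'n::finite \<Rightarrow> real" and v w :: "nat \<Rightarrow> real^'n \<Rightarrow> real^'n"
  assumes \<phi>: "smooth \<phi>" "compact S" "\<And>x. x \<notin> S \<Longrightarrow> \<phi> x = 0"
    and v: "\<And>k. bounded_field U A (v k)" and w: "\<And>k. bounded_field U A (w k)" and U: "bounded U" and A: "A \<ge> 0"
    and t: "t > 0" and conv: "\<And>x i. convergent (\<lambda>k. conv (mol t) (\<lambda>z. v k z $ i) x)" and \<epsilon>: "\<epsilon> > 0"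
  shows "\<exists>N. \<forall>m\<ge>N. \<forall>k\<ge>N. \<bar>\<Sum>i\<in>UNIV. \<integral>x. \<phi> x * (w m x - w k x) $ i * conv (mol t) (\<lambda>z. (v m z - v k z) $ i) x \<partial>lborel\<bar> < \<epsilon>"
proof -
  let ?g = "\<lambda>k i x. conv (mol t) (\<lambda>z. v k z $ i) x"
  define g where "g = (\<lambda>i x. lim (\<lambda>k. ?g k i x))"
  have gl: "(\<lambda>k. ?g k i x) \<longlonglongrightarrow> g i x" for i x
    using conv unfolding g_def by (simp add: convergent_LIMSEQ_iff)
  have vb: "\<bar>v k z $ i\<bar> \<le> A" for k z i
    using component_le_norm_cart[of "v k z" i] v[of k] unfolding bounded_field_def by (meson order_trans)
  have gb: "\<bar>?g k i x\<bar> \<le> A" for k i x by (rule conv_mol_abs_le[OF t vb])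
  have glb: "\<bar>g i x\<bar> \<le> A" for i x
    by (rule Lim_bounded[OF tendsto_rabs[OF gl], of 0]) (use gb in auto)
  have mz: "x \<notin> cball 0 t \<Longrightarrow> mol t x = 0" for x :: "real^'n" using t by (simp add: mol_zero)
  have vint: "integrable lborel (\<lambda>z. v k z $ i)" for k i by (rule bounded_field_integrable[OF v U])
  have gm: "?g k i \<in> borel_measurable borel" for k i
    by (rule borel_measurable_continuous_onI[OF smooth_continuous[OF conv_smooth[OF smooth_mol compact_cball mz vint]]])
  have glm: "g i \<in> borel_measurable borel" for i
    by (rule borel_measurable_LIMSEQ_real[OF gl gm])
  have \<phi>i: "integrable lborel \<phi>" by (rule integrable_continuous_compact_support[OF smooth_continuous[OF \<phi>(1)] \<phi>(2,3)])
  have \<phi>m: "\<phi> \<in> borel_measurable borel" by (rule borel_measurable_continuous_onI[OF smooth_continuous[OF \<phi>(1)]])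
  have J: "(\<lambda>k. \<integral>x. \<bar>\<phi> x\<bar> * \<bar>?g k i x - g i x\<bar> \<partial>lborel) \<longlonglongrightarrow> 0" for i
  proof -
    have "(\<lambda>k. \<integral>x. \<bar>\<phi> x\<bar> * \<bar>?g k i x - g i x\<bar> \<partial>lborel) \<longlonglongrightarrow> (\<integral>x. 0 \<partial>(lborel :: (real^'n) measure))"
    proof (rule integral_dominated_convergence[where w="\<lambda>x. 2 * A * \<bar>\<phi> x\<bar>"])
      show "(\<lambda>x. \<bar>\<phi> x\<bar> * \<bar>?g k i x - g i x\<bar>) \<in> borel_measurable lborel" for k
        using \<phi>m gm[of k i] glm[of i] by measurable
      show "AE x in lborel. (\<lambda>k. \<bar>\<phi> x\<bar> * \<bar>?g k i x - g i x\<bar>) \<longlonglongrightarrow> 0"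
      proof (rule AE_I2)
        fix x
        have "(\<lambda>k. \<bar>\<phi> x\<bar> * \<bar>?g k i x - g i x\<bar>) \<longlonglongrightarrow> \<bar>\<phi> x\<bar> * \<bar>g i x - g i x\<bar>"
          by (intro tendsto_intros gl)
        then show "(\<lambda>k. \<bar>\<phi> x\<bar> * \<bar>?g k i x - g i x\<bar>) \<longlonglongrightarrow> 0" by simp
      qed
      show "AE x in lborel. norm (\<bar>\<phi> x\<bar> * \<bar>?g k i x - g i x\<bar>) \<le> 2 * A * \<bar>\<phi> x\<bar>" for k
      proof (rule AE_I2)
        fix x
        have "\<bar>?g k i x - g i x\<bar> \<le> 2 * A" using gb[of k i x] glb[of i x] by linarith
        then have "\<bar>\<phi> x\<bar> * \<bar>?g k i x - g i x\<bar> \<le> \<bar>\<phi> x\<bar> * (2 * A)" by (intro mult_left_mono) auto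
        then show "norm (\<bar>\<phi> x\<bar> * \<bar>?g k i x - g i x\<bar>) \<le> 2 * A * \<bar>\<phi> x\<bar>" by (simp add: abs_mult mult.commute)
      qed
      show "integrable lborel (\<lambda>x. 2 * A * \<bar>\<phi> x\<bar>)" using \<phi>i by simp
    qed simp
    then show ?thesis by simp
  qed
  let ?J = "\<lambda>k i. \<integral>x. \<bar>\<phi> x\<bar> * \<bar>?g k i x - g i x\<bar> \<partial>lborel"
  have "(\<lambda>k. \<Sum>i\<in>UNIV. 2 * A * ?J k i) \<longlonglongrightarrow> (\<Sum>i\<in>(UNIV::'n set). 2 * A * 0)"
    by (intro tendsto_intros J)
  then have "(\<lambda>k. \<Sum>i\<in>UNIV. 2 * A * ?J k i) \<longlonglongrightarrow> 0" by simp
  from order_tendstoD(2)[OF this half_gt_zero[OF \<epsilon>]]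
  obtain N where N: "\<And>k. k \<ge> N \<Longrightarrow> (\<Sum>i\<in>UNIV. 2 * A * ?J k i) < \<epsilon> / 2"
    by (auto simp: eventually_sequentially)
  have Ji: "integrable lborel (\<lambda>x. \<bar>\<phi> x\<bar> * \<bar>?g k i x - g i x\<bar>)" for k i
  proof (rule Bochner_Integration.integrable_bound[where f="\<lambda>x. 2 * A * \<bar>\<phi> x\<bar>"])
    show "integrable lborel (\<lambda>x. 2 * A * \<bar>\<phi> x\<bar>)" using \<phi>i by simp
    show "(\<lambda>x. \<bar>\<phi> x\<bar> * \<bar>?g k i x - g i x\<bar>) \<in> borel_measurable lborel"
      using \<phi>m gm[of k i] glm[of i] by measurable
    show "AE x in lborel. norm (\<bar>\<phi> x\<bar> * \<bar>?g k i x - g i x\<bar>) \<le> norm (2 * A * \<bar>\<phi> x\<bar>)"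
    proof (rule AE_I2)
      fix x
      have "\<bar>?g k i x - g i x\<bar> \<le> 2 * A" using gb[of k i x] glb[of i x] by linarith
      then have "\<bar>\<phi> x\<bar> * \<bar>?g k i x - g i x\<bar> \<le> \<bar>\<phi> x\<bar> * (2 * A)" by (intro mult_left_mono) auto
      then show "norm (\<bar>\<phi> x\<bar> * \<bar>?g k i x - g i x\<bar>) \<le> norm (2 * A * \<bar>\<phi> x\<bar>)" using A by (simp add: abs_mult mult.commute)
    qed
  qed
  have "\<bar>\<Sum>i\<in>UNIV. \<integral>x. \<phi> x * (w m x - w k x) $ i * conv (mol t) (\<lambda>z. (v m z - v k z) $ i) x \<partial>lborel\<bar> < \<epsilon>"
    if mk: "m \<ge> N" "k \<ge> N" for m k
  proof -
    have tm: "\<bar>\<integral>x. \<phi> x * (w m x - w k x) $ i * conv (mol t) (\<lambda>z. (v m z - v k z) $ i) x \<partial>lborel\<bar> \<le> 2 * A * ?J m i + 2 * A * ?J k i" for i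
    proof -
      have "norm (\<integral>x. \<phi> x * (w m x - w k x) $ i * conv (mol t) (\<lambda>z. (v m z - v k z) $ i) x \<partial>lborel)
        \<le> (\<integral>x. 2 * A * (\<bar>\<phi> x\<bar> * \<bar>?g m i x - g i x\<bar>) + 2 * A * (\<bar>\<phi> x\<bar> * \<bar>?g k i x - g i x\<bar>) \<partial>lborel)"
      proof (rule norm_integral_le[OF Bochner_Integration.integrable_add[OF integrable_mult_right[OF Ji] integrable_mult_right[OF Ji]]])
        fix x
        have wd: "\<bar>(w m x - w k x) $ i\<bar> \<le> 2 * A"
          using component_le_norm_cart[of "w m x - w k x" i] bounded_field_diff[OF w[of m] w[of k]]
          unfolding bounded_field_def by (meson order_trans)
        have "conv (mol t) (\<lambda>z. (v m z - v k z) $ i) x = ?g m i x - ?g k i x"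
          unfolding vector_minus_component
          by (rule conv_diff[OF conv_integrable[OF smooth_mol compact_cball mz vint] conv_integrable[OF smooth_mol compact_cball mz vint]])
        then have "\<bar>conv (mol t) (\<lambda>z. (v m z - v k z) $ i) x\<bar> \<le> \<bar>?g m i x - g i x\<bar> + \<bar>?g k i x - g i x\<bar>" by linarith
        then have "\<bar>\<phi> x\<bar> * \<bar>(w m x - w k x) $ i\<bar> * \<bar>conv (mol t) (\<lambda>z. (v m z - v k z) $ i) x\<bar>
           \<le> \<bar>\<phi> x\<bar> * (2 * A) * (\<bar>?g m i x - g i x\<bar> + \<bar>?g k i x - g i x\<bar>)"
          using A wd by (intro mult_mono) auto
        then show "norm (\<phi> x * (w m x - w k x) $ i * conv (mol t) (\<lambda>z. (v m z - v k z) $ i) x)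
          \<le> 2 * A * (\<bar>\<phi> x\<bar> * \<bar>?g m i x - g i x\<bar>) + 2 * A * (\<bar>\<phi> x\<bar> * \<bar>?g k i x - g i x\<bar>)"
          unfolding real_norm_def abs_mult by (simp only: distrib_left mult_ac)
      qed
      then show ?thesis
        by (simp only: Bochner_Integration.integral_add[OF integrable_mult_right[OF Ji] integrable_mult_right[OF Ji]] integral_mult_right_zero real_norm_def)
    qed
    have "\<bar>\<Sum>i\<in>UNIV. \<integral>x. \<phi> x * (w m x - w k x) $ i * conv (mol t) (\<lambda>z. (v m z - v k z) $ i) x \<partial>lborel\<bar>
       \<le> (\<Sum>i\<in>UNIV. 2 * A * ?J m i + 2 * A * ?J k i)"
      by (intro order_trans[OF sum_abs] sum_mono tm)
    also have "\<dots> < \<epsilon>" unfolding sum.distrib using N[OF mk(1)] N[OF mk(2)] by linarith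
    finally show ?thesis .
  qed
  then show ?thesis by blast
qed

text \<open>For each test function j and accuracy \<open>1 / (l + 1)\<close> the quantitative lemma
  fixes a scale \<open>T j l\<close> and a threshold \<open>\<delta> j l\<close> before the indices
  m and k. One subsequence then has to make the mollifications at these countably many scales
  converge, and the curls and divergences Cauchy.\<close>

theorem div_curl_Cauchy:
  fixes \<phi> :: "nat \<Rightarrow> real^'n::finite \<Rightarrow> real" and u w :: "nat \<Rightarrow> real^'n \<Rightarrow> real^'n"
  assumes \<Omega>: "open \<Omega>" and \<phi>: "\<And>j. test_fun \<Omega> (\<phi> j)"
    and u: "\<And>k. u k \<in> borel_measurable (lebesgue_on \<Omega>)" and w: "\<And>k. w k \<in> borel_measurable (lebesgue_on \<Omega>)"
    and bdd: "\<And>K. compact K \<Longrightarrow> K \<subseteq> \<Omega> \<Longrightarrow> \<exists>A. \<forall>k. \<forall>x\<in>K. norm (u k x) \<le> A \<and> norm (w k x) \<le> A"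
    and s: "s > 1" and curl: "\<And>i j. Wneg_loc_precompact s \<Omega> (\<lambda>k. curl_distr (u k) i j)"
    and div: "Wneg_loc_precompact s \<Omega> (\<lambda>k. div_distr (w k))"
  shows "\<exists>r::nat\<Rightarrow>nat. strict_mono r \<and> (\<forall>j. \<forall>\<epsilon>>0. \<exists>N. \<forall>m\<ge>N. \<forall>k\<ge>N.
     \<bar>\<integral>x. \<phi> j x * ((u (r m) x - u (r k) x) \<bullet> (w (r m) x - w (r k) x)) \<partial>lebesgue\<bar> < \<epsilon>)"
proof -
  define ok where "ok = (\<lambda>U A f f'. (\<lambda>x. if x \<in> U then f x else 0) \<in> borel_measurable lebesgue \<and>
        bounded_field U A f' \<and> (AE x in lebesgue. (if x \<in> U then f x else 0) = (f' x :: real^'n)))"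
  define Pd where "Pd = (\<lambda>j S U A. smooth (\<phi> j) \<and> compact S \<and> S \<noteq> {} \<and> (\<forall>x. x \<notin> S \<longrightarrow> \<phi> j x = 0) \<and> cc_open U \<Omega> \<and> S \<subseteq> U \<and> A \<ge> 0 \<and>
      (\<forall>k. \<forall>x\<in>U. norm (u k x) \<le> A \<and> norm (w k x) \<le> A))"
  have "\<exists>S U A. Pd j S U A" if ne: "\<exists>x. \<phi> j x \<noteq> 0" for j
  proof -
    obtain S where S: "smooth (\<phi> j)" "compact S" "S \<subseteq> \<Omega>" "\<And>x. x \<notin> S \<Longrightarrow> \<phi> j x = 0" using test_funE[OF \<phi>[of j]] by metis
    have "S \<noteq> {}" using ne S(4) by blast
    then obtain U where U: "cc_open U \<Omega>" "S \<subseteq> U" using cc_open_neighbourhood[OF S(2) _ S(3) \<Omega>] by metis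
    then obtain A where A: "\<forall>k. \<forall>x\<in>closure U. norm (u k x) \<le> A \<and> norm (w k x) \<le> A"
      using bdd[of "closure U"] by (auto simp: cc_open_def)
    have "\<forall>k. \<forall>x\<in>U. norm (u k x) \<le> max A 0 \<and> norm (w k x) \<le> max A 0"
      using A closure_subset[of U] by (auto simp: le_max_iff_disj)
    then have "Pd j S U (max A 0)" unfolding Pd_def using S U \<open>S \<noteq> {}\<close> by simp
    then show ?thesis by blast
  qed
  then have "\<forall>j. \<exists>S U A. (\<exists>x. \<phi> j x \<noteq> 0) \<longrightarrow> Pd j S U A" by blast
  then obtain S U A where SUA0: "\<And>j. (\<exists>x. \<phi> j x \<noteq> 0) \<Longrightarrow> Pd j (S j) (U j) (A j)" by metis
  \<comment> \<open>Test functions that vanish identically are set aside, since the supporting set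
    \<open>S\<close> must be nonempty in the truncation argument.\<close>
  define nz where "nz = {j. \<exists>x. \<phi> j x \<noteq> 0}"
  have SUA: "smooth (\<phi> j)" "compact (S j)" "S j \<noteq> {}" "\<And>x. x \<notin> S j \<Longrightarrow> \<phi> j x = 0" "cc_open (U j) \<Omega>" "S j \<subseteq> U j" "A j \<ge> 0"
      "\<And>k x. x \<in> U j \<Longrightarrow> norm (u k x) \<le> A j" "\<And>k x. x \<in> U j \<Longrightarrow> norm (w k x) \<le> A j" if "j \<in> nz" for j
    using SUA0[of j] that by (auto simp: nz_def Pd_def)
  have Uo: "open (U j)" "bounded (U j)" "U j \<subseteq> \<Omega>" if "j \<in> nz" for j
    using SUA(5)[OF that] closure_subset[of "U j"] bounded_subset[OF compact_imp_bounded, of "closure (U j)" "U j"]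
    by (auto simp: cc_open_def)
  have meas: "(\<lambda>x. if x \<in> U j then f x else 0) \<in> borel_measurable lebesgue" if "f \<in> borel_measurable (lebesgue_on \<Omega>)" "j \<in> nz" for f :: "real^'n \<Rightarrow> real^'n" and j
  proof -
    have "(\<lambda>x. if x \<in> \<Omega> then f x else 0) \<in> borel_measurable lebesgue"
      using that(1) \<Omega> by (simp add: borel_measurable_if)
    then have "(\<lambda>x. indicat_real (U j) x *\<^sub>R (if x \<in> \<Omega> then f x else 0)) \<in> borel_measurable lebesgue"
      using Uo(1)[OF that(2)] by (intro borel_measurable_scaleR borel_measurable_indicator) auto
    moreover have "(\<lambda>x. indicat_real (U j) x *\<^sub>R (if x \<in> \<Omega> then f x else 0)) = (\<lambda>x. if x \<in> U j then f x else 0)"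
      using Uo(3)[OF that(2)] by (intro ext) (auto simp: indicator_def)
    ultimately show ?thesis by simp
  qed
  have ex: "\<exists>v'. ok (U j) (A j) f v'" if "j \<in> nz" "f \<in> borel_measurable (lebesgue_on \<Omega>)" "\<And>x. x \<in> U j \<Longrightarrow> norm (f x) \<le> A j" for j f
  proof -
    from bounded_field_version[OF meas[OF that(2,1)] Uo(1)[OF that(1)] SUA(7)[OF that(1)] that(3)]
    obtain v' where "bounded_field (U j) (A j) v' \<and> (AE x in lebesgue. (if x \<in> U j then f x else 0) = v' x)" by blast
    then have "ok (U j) (A j) f v'" unfolding ok_def using meas[OF that(2,1)] by simp
    then show ?thesis by (rule exI[where x=v'])
  qed
  have "\<exists>v'. j \<in> nz \<longrightarrow> ok (U j) (A j) (u k) v'" for j k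
    using ex[of j "u k"] u[of k] SUA(8)[of j] by (cases "j \<in> nz") auto
  then obtain ub where ub: "\<And>j k. j \<in> nz \<Longrightarrow> ok (U j) (A j) (u k) (ub j k)" by metis
  have "\<exists>v'. j \<in> nz \<longrightarrow> ok (U j) (A j) (w k) v'" for j k
    using ex[of j "w k"] w[of k] SUA(9)[of j] by (cases "j \<in> nz") auto
  then obtain wb where wb: "\<And>j k. j \<in> nz \<Longrightarrow> ok (U j) (A j) (w k) (wb j k)" by metis
  define Q where "Q = (\<lambda>j l T \<delta>. \<forall>v w. bounded_field (U j) (2 * A j) v \<and> bounded_field (U j) (2 * A j) w \<and> small_curl_div (U j) \<delta> v w \<longrightarrow>
     \<bar>\<integral>x. \<phi> j x * (v x \<bullet> w x) \<partial>lborel\<bar>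
       \<le> inverse (real (Suc l)) + \<bar>\<Sum>i\<in>UNIV. \<integral>x. \<phi> j x * w x $ i * conv (mol T) (\<lambda>y. v y $ i) x \<partial>lborel\<bar>)"
  have Qex: "\<exists>T>0. \<exists>\<delta>>0. Q j l T \<delta>" if "j \<in> nz" for j l
  proof -
    have "2 * A j \<ge> 0" "inverse (real (Suc l)) > 0" using SUA(7)[OF that] by simp_all
    from div_curl_quantitative[OF SUA(1-4)[OF that] Uo(1)[OF that] SUA(6)[OF that] Uo(2)[OF that] this]
    show ?thesis unfolding Q_def .
  qed
  have "\<exists>T \<delta>. j \<in> nz \<longrightarrow> T > 0 \<and> \<delta> > 0 \<and> Q j l T \<delta>" for j l
    using Qex[of j l] by blast
  then obtain T \<delta> where T\<delta>: "\<And>j l. j \<in> nz \<Longrightarrow> T j l > 0 \<and> \<delta> j l > 0 \<and> Q j l (T j l) (\<delta> j l)" by metis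
  have T0: "T j l > 0" and \<delta>0: "\<delta> j l > 0" if "j \<in> nz" for j l using T\<delta>[OF that, of l] by simp_all
  obtain D :: "(real^'n) set" where D: "countable D" "\<And>X. open X \<Longrightarrow> X \<noteq> {} \<Longrightarrow> \<exists>d\<in>D. d \<in> X"
    by (rule countable_dense_setE[where 'a="real^'n"]) blast
  have Dd: "\<exists>y\<in>D. norm (x - y) < e" if "e > 0" for x e
    using D(2)[of "ball x e"] that by (auto simp: dist_norm)
  \<comment> \<open>One index codes a test function, an accuracy level and a point of a countable
    dense set; the vector value treats all components at once.\<close>
  define a where "a = (\<lambda>n k. case prod_decode n of (j, n') \<Rightarrow> case prod_decode n' of (l, q) \<Rightarrow>
     if j \<in> nz then (\<chi> i. conv (mol (T j l)) (\<lambda>z. ub j k z $ i) (from_nat_into D q)) else 0)"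
  have ubf: "bounded_field (U j) (A j) (ub j k)" if "j \<in> nz" for j k using ub[OF that, of k] by (simp add: ok_def)
  have wbf: "bounded_field (U j) (A j) (wb j k)" if "j \<in> nz" for j k using wb[OF that, of k] by (simp add: ok_def)
  have "bounded (range (a n))" for n
  proof -
    obtain j n' l q where n: "prod_decode n = (j, n')" "prod_decode n' = (l, q)" by (metis surj_pair)
    show ?thesis
    proof (cases "j \<in> nz")
      case True
      have "norm (a n k) \<le> real CARD('n) * A j" for k
      proof (rule norm_le_vec_bound)
        fix i
        have "\<bar>ub j k z $ i\<bar> \<le> A j" for z
          using component_le_norm_cart[of "ub j k z" i] ubf[OF True, of k] unfolding bounded_field_def by (meson order_trans)
        from conv_mol_abs_le[OF T0[OF True] this]
        show "\<bar>a n k $ i\<bar> \<le> A j" using True by (simp add: a_def n)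
      qed
      then show ?thesis unfolding bounded_iff by blast
    next
      case False
      then show ?thesis unfolding bounded_iff by (auto simp: a_def n)
    qed
  qed
  then obtain r0 :: "nat \<Rightarrow> nat" where r0: "strict_mono r0" "\<And>n. convergent (\<lambda>k. a n (r0 k))"
    using bounded_sequences_common_subseq[of a] by blast
  have conv0: "convergent (\<lambda>k. conv (mol (T j l)) (\<lambda>z. ub j (r0 k) z $ i) x)" if j: "j \<in> nz" for j l i x
  proof (rule conv_mol_convergent[where v="\<lambda>k. ub j (r0 k)", OF T0[OF j] ubf[OF j] Uo(2)[OF j] SUA(7)[OF j] Dd])
    fix y assume "y \<in> D"
    then obtain q where q: "from_nat_into D q = y" using from_nat_into_surj[OF D(1)] by blast
    have "convergent (\<lambda>k. a (prod_encode (j, prod_encode (l, q))) (r0 k))" by (rule r0)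
    then obtain c where "(\<lambda>k. a (prod_encode (j, prod_encode (l, q))) (r0 k)) \<longlonglongrightarrow> c" by (auto simp: convergent_def)
    from tendsto_vec_nth[OF this, of i]
    have "(\<lambda>k. conv (mol (T j l)) (\<lambda>z. ub j (r0 k) z $ i) y) \<longlonglongrightarrow> c $ i" using j by (simp add: a_def q)
    then show "convergent (\<lambda>k. conv (mol (T j l)) (\<lambda>z. ub j (r0 k) z $ i) y)" by (rule convergentI)
  qed
  \<comment> \<open>The divergence and the curl components are gathered under one finite index type,
    for a single common extraction.\<close>
  define TT where "TT = (\<lambda>q. case q of None \<Rightarrow> (\<lambda>k. div_distr (w k)) | Some (i, j) \<Rightarrow> (\<lambda>k. curl_distr (u k) i j))"
  have "\<exists>r::nat\<Rightarrow>nat. strict_mono r \<and> (\<forall>q\<in>UNIV. Wneg_Cauchy s \<Omega> (\<lambda>k. TT q (r0 (r k))))"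
    by (rule Wneg_common_subseq[OF _ _ r0(1)]) (auto simp: TT_def curl div split: option.split)
  then obtain r1 :: "nat \<Rightarrow> nat" where r1: "strict_mono r1" "\<And>q. Wneg_Cauchy s \<Omega> (\<lambda>k. TT q (r0 (r1 k)))" by blast
  define r where "r = r0 \<circ> r1"
  have r: "strict_mono r" unfolding r_def by (rule strict_mono_o[OF r0(1) r1(1)])
  have Cd: "Wneg_Cauchy s \<Omega> (\<lambda>k. div_distr (w (r k)))" using r1(2)[of None] by (simp add: TT_def r_def)
  have Cc: "Wneg_Cauchy s \<Omega> (\<lambda>k. curl_distr (u (r k)) i j)" for i j using r1(2)[of "Some (i, j)"] by (simp add: TT_def r_def)
  have conv1: "convergent (\<lambda>k. conv (mol (T j l)) (\<lambda>z. ub j (r k) z $ i) x)" if j: "j \<in> nz" for j l i x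
    using convergent_subseq_convergent[OF conv0[OF j] r1(1)] by (simp add: r_def o_def)
  have "\<exists>N. \<forall>m\<ge>N. \<forall>k\<ge>N. \<bar>\<integral>x. \<phi> j x * ((u (r m) x - u (r k) x) \<bullet> (w (r m) x - w (r k) x)) \<partial>lebesgue\<bar> < \<epsilon>"
    if \<epsilon>: "\<epsilon> > 0" for j \<epsilon>
  proof (cases "j \<in> nz")
    case False
    then have "\<phi> j x = 0" for x by (simp add: nz_def)
    then show ?thesis using \<epsilon> by simp
  next
    case j: True
    obtain l where l: "inverse (real (Suc l)) < \<epsilon> / 2" using reals_Archimedean[OF half_gt_zero[OF \<epsilon>]] by blast
    obtain e where e0: "e > 0 \<and> (\<forall>u1 u2 w1 w2 v1 v2 z1 z2 :: real^'n \<Rightarrow> real^'n.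
     (\<forall>(f, f') \<in> {(u1, v1), (u2, v2), (w1, z1), (w2, z2)}. (\<lambda>x. if x \<in> U j then f x else 0) \<in> borel_measurable lebesgue \<and>
        bounded_field (U j) (A j) f' \<and> (AE x in lebesgue. (if x \<in> U j then f x else 0) = f' x)) \<longrightarrow>
     (\<forall>i i'. Wneg_norm s (U j) (\<lambda>\<psi>. curl_distr u1 i i' \<psi> - curl_distr u2 i i' \<psi>) < ereal e) \<longrightarrow>
     Wneg_norm s (U j) (\<lambda>\<psi>. div_distr w1 \<psi> - div_distr w2 \<psi>) < ereal e \<longrightarrow>
     small_curl_div (U j) (\<delta> j l) (\<lambda>x. v1 x - v2 x) (\<lambda>x. z1 x - z2 x))"
      using small_curl_div_of_Wneg[OF s Uo(1)[OF j] Uo(2)[OF j] \<delta>0[OF j, of l] SUA(7)[OF j]] ..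
    note e = conjunct1[OF e0]
    obtain N1 where N1: "\<forall>m\<ge>N1. \<forall>k\<ge>N1. Wneg_norm s (U j) (\<lambda>\<psi>. div_distr (w (r m)) \<psi> - div_distr (w (r k)) \<psi>) < ereal e"
      using Cd e SUA(5)[OF j] unfolding Wneg_Cauchy_def by blast
    have "\<forall>ii. \<exists>N. \<forall>m\<ge>N. \<forall>k\<ge>N. Wneg_norm s (U j) (\<lambda>\<psi>. curl_distr (u (r m)) (fst ii) (snd ii) \<psi> - curl_distr (u (r k)) (fst ii) (snd ii) \<psi>) < ereal e"
      using Cc e SUA(5)[OF j] unfolding Wneg_Cauchy_def by blast
    then obtain N2 where N2: "\<And>ii m k. m \<ge> N2 ii \<Longrightarrow> k \<ge> N2 ii \<Longrightarrow>
       Wneg_norm s (U j) (\<lambda>\<psi>. curl_distr (u (r m)) (fst ii) (snd ii) \<psi> - curl_distr (u (r k)) (fst ii) (snd ii) \<psi>) < ereal e" by metis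
    have "\<exists>N. \<forall>m\<ge>N. \<forall>k\<ge>N. \<bar>\<Sum>i\<in>UNIV. \<integral>x. \<phi> j x * (wb j (r m) x - wb j (r k) x) $ i * conv (mol (T j l)) (\<lambda>z. (ub j (r m) z - ub j (r k) z) $ i) x \<partial>lborel\<bar> < \<epsilon> / 2"
      by (rule mollified_term_vanishes[where v="\<lambda>k. ub j (r k)" and w="\<lambda>k. wb j (r k)",
          OF SUA(1,2,4)[OF j] ubf[OF j] wbf[OF j] Uo(2)[OF j] SUA(7)[OF j] T0[OF j] conv1[OF j] half_gt_zero[OF \<epsilon>]])
    then obtain N3 where N3: "\<forall>m\<ge>N3. \<forall>k\<ge>N3. \<bar>\<Sum>i\<in>UNIV. \<integral>x. \<phi> j x * (wb j (r m) x - wb j (r k) x) $ i * conv (mol (T j l)) (\<lambda>z. (ub j (r m) z - ub j (r k) z) $ i) x \<partial>lborel\<bar> < \<epsilon> / 2" ..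
    define N where "N = max N1 (max N3 (Max (range N2)))"
    have NN: "N1 \<le> N" "N3 \<le> N" "N2 ii \<le> N" for ii
      by (auto simp: N_def intro!: max.coboundedI2)
    have "\<bar>\<integral>x. \<phi> j x * ((u (r m) x - u (r k) x) \<bullet> (w (r m) x - w (r k) x)) \<partial>lebesgue\<bar> < \<epsilon>" if mk: "m \<ge> N" "k \<ge> N" for m k
    proof -
      have cN: "Wneg_norm s (U j) (\<lambda>\<psi>. curl_distr (u (r m)) i i' \<psi> - curl_distr (u (r k)) i i' \<psi>) < ereal e" for i i'
        using N2[of "(i, i')" m k] NN(3)[of "(i, i')"] mk by simp
      have dN: "Wneg_norm s (U j) (\<lambda>\<psi>. div_distr (w (r m)) \<psi> - div_distr (w (r k)) \<psi>) < ereal e"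
        using N1 NN(1) mk by simp
      have okk: "\<forall>(f, f') \<in> {(u (r m), ub j (r m)), (u (r k), ub j (r k)), (w (r m), wb j (r m)), (w (r k), wb j (r k))}.
         (\<lambda>x. if x \<in> U j then f x else 0) \<in> borel_measurable lebesgue \<and>
        bounded_field (U j) (A j) f' \<and> (AE x in lebesgue. (if x \<in> U j then f x else 0) = f' x)"
        using ub[OF j] wb[OF j] unfolding ok_def by (simp only: ball_simps prod.case simp_thms)
      have smol: "small_curl_div (U j) (\<delta> j l) (\<lambda>x. ub j (r m) x - ub j (r k) x) (\<lambda>x. wb j (r m) x - wb j (r k) x)"
        by (rule conjunct2[OF e0, THEN spec, THEN spec, THEN spec, THEN spec, THEN spec, THEN spec, THEN spec, THEN spec,
            THEN mp, THEN mp, THEN mp, OF okk]) (use cN dN in blast)+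
      have "\<bar>\<integral>x. \<phi> j x * ((ub j (r m) x - ub j (r k) x) \<bullet> (wb j (r m) x - wb j (r k) x)) \<partial>lborel\<bar>
         \<le> inverse (real (Suc l)) + \<bar>\<Sum>i\<in>UNIV. \<integral>x. \<phi> j x * (wb j (r m) x - wb j (r k) x) $ i * conv (mol (T j l)) (\<lambda>y. (ub j (r m) y - ub j (r k) y) $ i) x \<partial>lborel\<bar>"
        by (rule T\<delta>[OF j, of l, THEN conjunct2, THEN conjunct2, unfolded Q_def, THEN spec, THEN spec, THEN mp])
           (intro conjI bounded_field_diff ubf[OF j] wbf[OF j] smol)
      also have "\<dots> < \<epsilon> / 2 + \<epsilon> / 2"
        using l N3 NN(2) mk by (intro add_strict_mono) auto
      finally have fin: "\<bar>\<integral>x. \<phi> j x * ((ub j (r m) x - ub j (r k) x) \<bullet> (wb j (r m) x - wb j (r k) x)) \<partial>lborel\<bar> < \<epsilon>" by simp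
      have m\<phi>: "\<phi> j \<in> borel_measurable borel" by (rule borel_measurable_continuous_onI[OF smooth_continuous[OF SUA(1)[OF j]]])
      have m\<phi>': "\<phi> j \<in> borel_measurable lebesgue" using m\<phi> by (intro measurable_completion) simp
      let ?i = "\<lambda>f x. if x \<in> U j then f x else (0 :: real^'n)"
      have "\<phi> j x * ((u (r m) x - u (r k) x) \<bullet> (w (r m) x - w (r k) x))
        = \<phi> j x * ((?i (u (r m)) x - ?i (u (r k)) x) \<bullet> (?i (w (r m)) x - ?i (w (r k)) x))" for x
        using SUA(4)[OF j, of x] SUA(6)[OF j] by auto
      then have "(\<integral>x. \<phi> j x * ((u (r m) x - u (r k) x) \<bullet> (w (r m) x - w (r k) x)) \<partial>lebesgue)
        = (\<integral>x. \<phi> j x * ((?i (u (r m)) x - ?i (u (r k)) x) \<bullet> (?i (w (r m)) x - ?i (w (r k)) x)) \<partial>lebesgue)" by (intro Bochner_Integration.integral_cong refl)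
      also have "\<dots> = (\<integral>x. \<phi> j x * ((ub j (r m) x - ub j (r k) x) \<bullet> (wb j (r m) x - wb j (r k) x)) \<partial>lborel)"
      proof (rule integral_lebesgue_eq_lborel)
        show "(\<lambda>x. \<phi> j x * ((?i (u (r m)) x - ?i (u (r k)) x) \<bullet> (?i (w (r m)) x - ?i (w (r k)) x))) \<in> borel_measurable lebesgue"
          by (rule borel_measurable_times[OF m\<phi>' borel_measurable_inner[OF borel_measurable_diff[OF meas[OF u j] meas[OF u j]]
                borel_measurable_diff[OF meas[OF w j] meas[OF w j]]]])
        have mb: "ub j k \<in> borel_measurable borel" "wb j k \<in> borel_measurable borel" for k
          using ubf[OF j, of k] wbf[OF j, of k] by (auto simp: bounded_field_def)
        show "(\<lambda>x. \<phi> j x * ((ub j (r m) x - ub j (r k) x) \<bullet> (wb j (r m) x - wb j (r k) x))) \<in> borel_measurable borel"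
          by (rule borel_measurable_times[OF m\<phi> borel_measurable_inner[OF borel_measurable_diff[OF mb(1) mb(1)] borel_measurable_diff[OF mb(2) mb(2)]]])
        have "AE x in lebesgue. ?i (u (r m)) x = ub j (r m) x" "AE x in lebesgue. ?i (u (r k)) x = ub j (r k) x"
          "AE x in lebesgue. ?i (w (r m)) x = wb j (r m) x" "AE x in lebesgue. ?i (w (r k)) x = wb j (r k) x"
          using ub[OF j] wb[OF j] unfolding ok_def by simp_all
        then show "AE x in lebesgue. \<phi> j x * ((?i (u (r m)) x - ?i (u (r k)) x) \<bullet> (?i (w (r m)) x - ?i (w (r k)) x))
          = \<phi> j x * ((ub j (r m) x - ub j (r k) x) \<bullet> (wb j (r m) x - wb j (r k) x))"
          by eventually_elim (simp only:)
      qed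
      finally show ?thesis using fin by simp
    qed
    then show ?thesis by blast
  qed
  then show ?thesis using r by blast
qed

section \<open>Monotonicity of the mass flux\<close>

lemma tendsto_by_subsequences:
  fixes x :: "nat \<Rightarrow> 'a::metric_space"
  assumes "\<And>q::nat\<Rightarrow>nat. strict_mono q \<Longrightarrow> \<exists>q'::nat\<Rightarrow>nat. strict_mono q' \<and> (\<lambda>i. x (q (q' i))) \<longlonglongrightarrow> l"
  shows "x \<longlonglongrightarrow> l"
proof (rule ccontr)
  assume "\<not> x \<longlonglongrightarrow> l"
  then obtain e where e: "e > 0" "\<forall>N. \<exists>n\<ge>N. dist (x n) l \<ge> e"
    unfolding lim_sequentially by (auto simp: not_less)
  have "infinite {n. dist (x n) l \<ge> e}"
    using e(2) by (simp add: infinite_nat_iff_unbounded_le)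
  from infinite_enumerate[OF this]
  obtain q :: "nat \<Rightarrow> nat" where q: "strict_mono q" "\<forall>n. dist (x (q n)) l \<ge> e" by auto
  obtain q' :: "nat \<Rightarrow> nat" where "(\<lambda>i. x (q (q' i))) \<longlonglongrightarrow> l" using assms[OF q(1)] by blast
  then have "eventually (\<lambda>i. dist (x (q (q' i))) l < e) sequentially" using e(1) by (rule tendstoD)
  then obtain i where "dist (x (q (q' i))) l < e" by (auto simp: eventually_sequentially)
  with q(2) show False by (meson not_le)
qed

text \<open>The density \<rho> solving Bernoulli's law
  \<open>b = (norm a)^2 / 2 + \<sigma> * \<rho> powr (\<gamma> - 1)\<close>, with \<sigma> the
  entropy function.\<close>

definition dens :: "real \<Rightarrow> real \<Rightarrow> real \<Rightarrow> real^'n::finite \<Rightarrow> real" where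
  "dens \<gamma> b \<sigma> a = ((b - (norm a)\<^sup>2 / 2) / \<sigma>) powr (1 / (\<gamma> - 1))"

text \<open>The squared sound speed is \<gamma> - 1 times the enthalpy
  \<open>b - (norm a)^2 / 2\<close>, so this is M \<le> 1 without a quotient: a closed condition,
  meaningful also at vacuum.\<close>

definition subsonic :: "real \<Rightarrow> real \<Rightarrow> real^'n::finite \<Rightarrow> bool" where
  "subsonic \<gamma> b a \<longleftrightarrow> (norm a)\<^sup>2 \<le> (\<gamma> - 1) * (b - (norm a)\<^sup>2 / 2)"

lemma dens_nonneg: "dens \<gamma> b \<sigma> a \<ge> 0"
  by (simp add: dens_def)

lemma subsonic_enthalpy_nonneg: "\<gamma> > 1 \<Longrightarrow> subsonic \<gamma> b a \<Longrightarrow> b - (norm a)\<^sup>2 / 2 \<ge> 0"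
  unfolding subsonic_def by (smt (verit) mult_pos_neg zero_le_power2)

text \<open>The derivative of the flux at speed t has the sign of c^2 - t^2, with c the sound speed
  belonging to t. Only the right endpoint can be sonic, and positivity on the open interval
  suffices.\<close>

lemma scalar_mass_flux_strict_mono:
  fixes q q' b \<sigma> \<gamma> :: real
  assumes \<gamma>: "\<gamma> > 1" and \<sigma>: "\<sigma> > 0" and q: "0 \<le> q" "q < q'" and sub: "q'\<^sup>2 \<le> (\<gamma> - 1) * (b - q'\<^sup>2 / 2)"
  shows "((b - q\<^sup>2 / 2) / \<sigma>) powr (1 / (\<gamma> - 1)) * q < ((b - q'\<^sup>2 / 2) / \<sigma>) powr (1 / (\<gamma> - 1)) * q'"
proof -
  define p where "p = 1 / (\<gamma> - 1)"
  have p: "p > 0" "p * (\<gamma> - 1) = 1" using \<gamma> by (simp_all add: p_def)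
  have "q'\<^sup>2 > 0" using q by simp
  then have "(\<gamma> - 1) * (b - q'\<^sup>2 / 2) > 0" using sub by linarith
  then have h': "b - q'\<^sup>2 / 2 > 0" using \<gamma> by (simp add: zero_less_mult_iff)
  have h: "b - t\<^sup>2 / 2 \<ge> b - q'\<^sup>2 / 2" "b - t\<^sup>2 / 2 > 0" if "q \<le> t" "t \<le> q'" for t
  proof -
    have "t\<^sup>2 \<le> q'\<^sup>2" using that q by (intro power_mono) auto
    then show "b - t\<^sup>2 / 2 \<ge> b - q'\<^sup>2 / 2" "b - t\<^sup>2 / 2 > 0" using h' by linarith+
  qed
  let ?f = "\<lambda>t. ((b - t\<^sup>2 / 2) / \<sigma>) powr p * t"
  have "?f q < ?f q'"
  proof (rule DERIV_pos_imp_increasing_open[OF q(2)])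
    fix t assume t: "q < t" "t < q'"
    define h where "h = b - t\<^sup>2 / 2"
    have hp: "h > 0" "h \<ge> b - q'\<^sup>2 / 2" using h(1,2)[of t] t by (simp_all add: h_def)
    have t2: "t\<^sup>2 < q'\<^sup>2" using t q by (intro power_strict_mono) auto
    have "t\<^sup>2 < (\<gamma> - 1) * h"
      using t2 sub mult_left_mono[OF hp(2), of "\<gamma> - 1"] \<gamma> by linarith
    then have "p * t\<^sup>2 < p * ((\<gamma> - 1) * h)" using p(1) by (rule mult_strict_left_mono)
    then have pos: "h - p * t\<^sup>2 > 0" using p(2) by (simp add: mult.assoc[symmetric])
    have inner: "((\<lambda>t. (b - t\<^sup>2 / 2) / \<sigma>) has_real_derivative - t / \<sigma>) (at t)"
      using \<sigma> by (auto intro!: derivative_eq_intros simp: field_simps)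
    have hs: "h / \<sigma> > 0" using hp(1) \<sigma> by simp
    have "((\<lambda>z. z powr p) has_real_derivative p * (h / \<sigma>) powr (p - 1)) (at ((b - t\<^sup>2 / 2) / \<sigma>))"
      using has_real_derivative_powr[OF hs, of p] by (simp add: h_def)
    from DERIV_chain2[OF this inner]
    have "((\<lambda>t. ((b - t\<^sup>2 / 2) / \<sigma>) powr p) has_real_derivative p * (h / \<sigma>) powr (p - 1) * (- t / \<sigma>)) (at t)" .
    from DERIV_mult[OF this DERIV_ident]
    have "(?f has_real_derivative (p * (h / \<sigma>) powr (p - 1) * (- t / \<sigma>)) * t + 1 * ((b - t\<^sup>2 / 2) / \<sigma>) powr p) (at t)" .
    also have "(p * (h / \<sigma>) powr (p - 1) * (- t / \<sigma>)) * t + 1 * ((b - t\<^sup>2 / 2) / \<sigma>) powr p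
        = (h / \<sigma>) powr (p - 1) * ((h - p * t\<^sup>2) / \<sigma>)"
    proof -
      have "(h / \<sigma>) powr p = (h / \<sigma>) powr (p - 1) * (h / \<sigma>)"
        using hs powr_mult_base[of "h / \<sigma>" "p - 1"] by (simp add: mult.commute)
      then show ?thesis unfolding h_def[symmetric]
        by (simp add: power2_eq_square diff_divide_distrib algebra_simps)
    qed
    finally have D: "(?f has_real_derivative (h / \<sigma>) powr (p - 1) * ((h - p * t\<^sup>2) / \<sigma>)) (at t)" .
    have "(h / \<sigma>) powr (p - 1) * ((h - p * t\<^sup>2) / \<sigma>) > 0" using hs pos \<sigma> by (intro mult_pos_pos) auto
    with D show "\<exists>y. (?f has_real_derivative y) (at t) \<and> 0 < y" by blast
  next
    have "continuous_on {q..q'} (\<lambda>t. (b - t\<^sup>2 / 2) / \<sigma>)" using \<sigma> by (intro continuous_intros) auto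
    moreover have "(b - t\<^sup>2 / 2) / \<sigma> \<noteq> 0" if "t \<in> {q..q'}" for t using h(2)[of t] that \<sigma> by simp
    ultimately show "continuous_on {q..q'} ?f" by (intro continuous_on_mult continuous_on_powr continuous_intros) auto
  qed
  then show ?thesis by (simp add: p_def)
qed

text \<open>For different norms Cauchy-Schwarz reduces the claim to the scalar flux. For equal norms
  the densities agree and the product is the density times \<open>(norm (a - a'))^2\<close>; the
  density is positive because distinct vectors of equal norm are nonzero, and a nonzero subsonic
  velocity has positive enthalpy.\<close>

lemma mass_flux_strictly_monotone:
  fixes a a' :: "real^'n::finite"
  assumes \<gamma>: "\<gamma> > 1" and \<sigma>: "\<sigma> > 0" and sub: "subsonic \<gamma> b a" "subsonic \<gamma> b a'" and ne: "a \<noteq> a'"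
  shows "(dens \<gamma> b \<sigma> a *\<^sub>R a - dens \<gamma> b \<sigma> a' *\<^sub>R a') \<bullet> (a - a') > 0"
proof -
  have main: "(dens \<gamma> b \<sigma> a *\<^sub>R a - dens \<gamma> b \<sigma> a' *\<^sub>R a') \<bullet> (a - a') > 0"
    if sub: "subsonic \<gamma> b a" "subsonic \<gamma> b a'" and ne: "a \<noteq> a'" and le: "norm a \<le> norm a'" for a a' :: "real^'n"
  proof -
    define R where "R = dens \<gamma> b \<sigma> a"
    define R' where "R' = dens \<gamma> b \<sigma> a'"
    have R: "R \<ge> 0" "R' \<ge> 0" by (simp_all add: R_def R'_def dens_nonneg)
    have ex: "(R *\<^sub>R a - R' *\<^sub>R a') \<bullet> (a - a') = R * (norm a)\<^sup>2 + R' * (norm a')\<^sup>2 - (R + R') * (a \<bullet> a')"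
      by (simp add: inner_diff_left inner_diff_right power2_norm_eq_inner inner_commute algebra_simps)
    show ?thesis
    proof (cases "norm a < norm a'")
      case True
      have "R * norm a < R' * norm a'"
        unfolding R_def R'_def dens_def
        by (rule scalar_mass_flux_strict_mono[OF \<gamma> \<sigma> norm_ge_zero True]) (use sub(2) in \<open>simp add: subsonic_def\<close>)
      then have "0 < (R * norm a - R' * norm a') * (norm a - norm a')" using True by (intro mult_neg_neg) auto
      also have "\<dots> = R * (norm a)\<^sup>2 + R' * (norm a')\<^sup>2 - (R + R') * (norm a * norm a')"
        by (simp add: power2_eq_square algebra_simps)
      also have "\<dots> \<le> R * (norm a)\<^sup>2 + R' * (norm a')\<^sup>2 - (R + R') * (a \<bullet> a')"
        using mult_left_mono[OF norm_cauchy_schwarz[of a a'], of "R + R'"] R by linarith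
      finally show ?thesis unfolding R_def[symmetric] R'_def[symmetric] ex .
    next
      case False
      then have eq: "norm a = norm a'" using le by simp
      then have RR: "R' = R" by (simp add: R_def R'_def dens_def)
      have "norm a \<noteq> 0" using ne eq by auto
      then have "(norm a)\<^sup>2 > 0" by simp
      then have "(\<gamma> - 1) * (b - (norm a)\<^sup>2 / 2) > 0" using sub(1) unfolding subsonic_def by linarith
      then have "b - (norm a)\<^sup>2 / 2 > 0" using \<gamma> by (simp add: zero_less_mult_iff)
      then have "R > 0" using \<sigma> by (simp add: R_def dens_def)
      moreover have "(a - a') \<bullet> (a - a') > 0" using ne by simp
      ultimately have "R * ((a - a') \<bullet> (a - a')) > 0" by simp
      then show ?thesis unfolding R_def[symmetric] R'_def[symmetric] RR by (simp add: scaleR_diff_right[symmetric])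
    qed
  qed
  show ?thesis
  proof (cases "norm a \<le> norm a'")
    case True
    then show ?thesis by (rule main[OF sub ne])
  next
    case False
    then have "(dens \<gamma> b \<sigma> a' *\<^sub>R a' - dens \<gamma> b \<sigma> a *\<^sub>R a) \<bullet> (a' - a) > 0" using main[OF sub(2,1)] ne by auto
    then show ?thesis by (simp add: inner_diff_left inner_diff_right algebra_simps)
  qed
qed

text \<open>The limit may be vacuum, where the base of the power is 0. Continuity persists there
  because the exponent is positive and the bases along the sequence are nonnegative.\<close>

lemma tendsto_dens:
  fixes a :: "nat \<Rightarrow> real^'n::finite"
  assumes \<gamma>: "\<gamma> > 1" and lim: "b \<longlonglongrightarrow> b0" "\<sigma> \<longlonglongrightarrow> \<sigma>0" "a \<longlonglongrightarrow> a0" and \<sigma>0: "\<sigma>0 > 0" "\<And>i. \<sigma> i > 0"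
    and h: "\<And>i. b i - (norm (a i))\<^sup>2 / 2 \<ge> 0"
  shows "(\<lambda>i. dens \<gamma> (b i) (\<sigma> i) (a i)) \<longlonglongrightarrow> dens \<gamma> b0 \<sigma>0 a0"
  unfolding dens_def
proof (rule tendsto_powr')
  show "(\<lambda>i. (b i - (norm (a i))\<^sup>2 / 2) / \<sigma> i) \<longlonglongrightarrow> (b0 - (norm a0)\<^sup>2 / 2) / \<sigma>0"
    using \<sigma>0(1) by (intro tendsto_intros lim) auto
  show "(b0 - (norm a0)\<^sup>2 / 2) / \<sigma>0 \<noteq> 0 \<or> 1 / (\<gamma> - 1) > 0 \<and> (\<forall>\<^sub>F i in sequentially. 0 \<le> (b i - (norm (a i))\<^sup>2 / 2) / \<sigma> i)"
    using \<gamma> h \<sigma>0(2) by (auto intro!: always_eventually divide_nonneg_pos)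
qed simp

lemma subsonic_limit:
  fixes a :: "nat \<Rightarrow> real^'n::finite"
  assumes "b \<longlonglongrightarrow> b0" "a \<longlonglongrightarrow> a0" "\<And>i. subsonic \<gamma> (b i) (a i)"
  shows "subsonic \<gamma> b0 a0"
  unfolding subsonic_def
proof (rule LIMSEQ_le)
  show "(\<lambda>i. (norm (a i))\<^sup>2) \<longlonglongrightarrow> (norm a0)\<^sup>2" by (intro tendsto_intros assms)
  show "(\<lambda>i. (\<gamma> - 1) * (b i - (norm (a i))\<^sup>2 / 2)) \<longlonglongrightarrow> (\<gamma> - 1) * (b0 - (norm a0)\<^sup>2 / 2)"
    by (intro tendsto_intros assms) auto
  show "\<exists>N. \<forall>n\<ge>N. (norm (a n))\<^sup>2 \<le> (\<gamma> - 1) * (b n - (norm (a n))\<^sup>2 / 2)"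
    using assms(3) by (auto simp: subsonic_def)
qed

text \<open>\<open>E i\<close> itself may be negative, since b and \<sigma> differ between the two
  states. Along a subsequence both velocities converge to subsonic ones with the common
  \<open>b0\<close> and \<open>\<sigma>0\<close>, where strict monotonicity applies: the limit of
  \<open>E\<close> is nonnegative, and zero only if the two limit velocities coincide.\<close>

lemma monotone_pairing_limits:
  fixes a a' :: "nat \<Rightarrow> real^'n::finite"
  assumes \<gamma>: "\<gamma> > 1" and lim: "b \<longlonglongrightarrow> b0" "b' \<longlonglongrightarrow> b0" "\<sigma> \<longlonglongrightarrow> \<sigma>0" "\<sigma>' \<longlonglongrightarrow> \<sigma>0"
    and \<sigma>: "\<sigma>0 > 0" "\<And>i. \<sigma> i > 0" "\<And>i. \<sigma>' i > 0"
    and sub: "\<And>i. subsonic \<gamma> (b i) (a i)" "\<And>i. subsonic \<gamma> (b' i) (a' i)"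
    and C: "\<And>i. norm (a i) \<le> C" "\<And>i. norm (a' i) \<le> C"
  defines "E \<equiv> \<lambda>i. (a i - a' i) \<bullet> (dens \<gamma> (b i) (\<sigma> i) (a i) *\<^sub>R a i - dens \<gamma> (b' i) (\<sigma>' i) (a' i) *\<^sub>R a' i)"
  shows "(\<lambda>i. max 0 (- E i)) \<longlonglongrightarrow> 0" and "E \<longlonglongrightarrow> 0 \<Longrightarrow> (\<lambda>i. a i - a' i) \<longlonglongrightarrow> 0"
proof -
  have key: "\<exists>q'::nat\<Rightarrow>nat. strict_mono q' \<and> (\<exists>\<alpha> \<alpha>'. (\<lambda>i. a (q (q' i))) \<longlonglongrightarrow> \<alpha> \<and> (\<lambda>i. a' (q (q' i))) \<longlonglongrightarrow> \<alpha>' \<and>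
     (\<lambda>i. E (q (q' i))) \<longlonglongrightarrow> (\<alpha> - \<alpha>') \<bullet> (dens \<gamma> b0 \<sigma>0 \<alpha> *\<^sub>R \<alpha> - dens \<gamma> b0 \<sigma>0 \<alpha>' *\<^sub>R \<alpha>') \<and> subsonic \<gamma> b0 \<alpha> \<and> subsonic \<gamma> b0 \<alpha>')"
    if q: "strict_mono q" for q :: "nat \<Rightarrow> nat"
  proof -
    have "norm (a i, a' i) \<le> C + C" for i
      using norm_Pair_le[of "a i" "a' i"] C(1)[of i] C(2)[of i] by linarith
    then have "bounded (range (\<lambda>i. (a (q i), a' (q i))))" unfolding bounded_iff by blast
    from bounded_imp_convergent_subsequence[OF this]
    obtain l and q' :: "nat \<Rightarrow> nat" where q': "strict_mono q'" "((\<lambda>i. (a (q i), a' (q i))) \<circ> q') \<longlonglongrightarrow> l" by blast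
    have s: "strict_mono (\<lambda>i. q (q' i))" using strict_mono_o[OF q q'(1)] by (simp add: o_def)
    define \<alpha> where "\<alpha> = fst l"
    define \<alpha>' where "\<alpha>' = snd l"
    have la: "(\<lambda>i. a (q (q' i))) \<longlonglongrightarrow> \<alpha>" using tendsto_fst[OF q'(2)] by (simp add: o_def \<alpha>_def)
    have la': "(\<lambda>i. a' (q (q' i))) \<longlonglongrightarrow> \<alpha>'" using tendsto_snd[OF q'(2)] by (simp add: o_def \<alpha>'_def)
    have lb: "(\<lambda>i. b (q (q' i))) \<longlonglongrightarrow> b0" "(\<lambda>i. b' (q (q' i))) \<longlonglongrightarrow> b0" "(\<lambda>i. \<sigma> (q (q' i))) \<longlonglongrightarrow> \<sigma>0" "(\<lambda>i. \<sigma>' (q (q' i))) \<longlonglongrightarrow> \<sigma>0"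
      using LIMSEQ_subseq_LIMSEQ[OF lim(1) s] LIMSEQ_subseq_LIMSEQ[OF lim(2) s] LIMSEQ_subseq_LIMSEQ[OF lim(3) s] LIMSEQ_subseq_LIMSEQ[OF lim(4) s]
      by (simp_all add: o_def)
    have d1: "(\<lambda>i. dens \<gamma> (b (q (q' i))) (\<sigma> (q (q' i))) (a (q (q' i)))) \<longlonglongrightarrow> dens \<gamma> b0 \<sigma>0 \<alpha>"
      by (rule tendsto_dens[OF \<gamma> lb(1,3) la \<sigma>(1,2) subsonic_enthalpy_nonneg[OF \<gamma> sub(1)]])
    have d2: "(\<lambda>i. dens \<gamma> (b' (q (q' i))) (\<sigma>' (q (q' i))) (a' (q (q' i)))) \<longlonglongrightarrow> dens \<gamma> b0 \<sigma>0 \<alpha>'"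
      by (rule tendsto_dens[OF \<gamma> lb(2,4) la' \<sigma>(1,3) subsonic_enthalpy_nonneg[OF \<gamma> sub(2)]])
    have "(\<lambda>i. E (q (q' i))) \<longlonglongrightarrow> (\<alpha> - \<alpha>') \<bullet> (dens \<gamma> b0 \<sigma>0 \<alpha> *\<^sub>R \<alpha> - dens \<gamma> b0 \<sigma>0 \<alpha>' *\<^sub>R \<alpha>')"
      unfolding E_def by (intro tendsto_inner tendsto_diff tendsto_scaleR la la' d1 d2)
    moreover have "subsonic \<gamma> b0 \<alpha>" by (rule subsonic_limit[OF lb(1) la sub(1)])
    moreover have "subsonic \<gamma> b0 \<alpha>'" by (rule subsonic_limit[OF lb(2) la' sub(2)])
    ultimately show ?thesis using q'(1) la la' by blast
  qed
  show "(\<lambda>i. max 0 (- E i)) \<longlonglongrightarrow> 0"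
  proof (rule tendsto_by_subsequences)
    fix q :: "nat \<Rightarrow> nat" assume q: "strict_mono q"
    obtain q' :: "nat \<Rightarrow> nat" and \<alpha> \<alpha>' :: "real^'n" where q': "strict_mono q'"
      "(\<lambda>i. E (q (q' i))) \<longlonglongrightarrow> (\<alpha> - \<alpha>') \<bullet> (dens \<gamma> b0 \<sigma>0 \<alpha> *\<^sub>R \<alpha> - dens \<gamma> b0 \<sigma>0 \<alpha>' *\<^sub>R \<alpha>')" "subsonic \<gamma> b0 \<alpha>" "subsonic \<gamma> b0 \<alpha>'"
      using key[OF q] by blast
    have "(\<alpha> - \<alpha>') \<bullet> (dens \<gamma> b0 \<sigma>0 \<alpha> *\<^sub>R \<alpha> - dens \<gamma> b0 \<sigma>0 \<alpha>' *\<^sub>R \<alpha>') \<ge> 0"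
      using mass_flux_strictly_monotone[OF \<gamma> \<sigma>(1) q'(3,4)] by (cases "\<alpha> = \<alpha>'") (auto simp: inner_commute)
    moreover have "(\<lambda>i. max 0 (- E (q (q' i)))) \<longlonglongrightarrow> max 0 (- ((\<alpha> - \<alpha>') \<bullet> (dens \<gamma> b0 \<sigma>0 \<alpha> *\<^sub>R \<alpha> - dens \<gamma> b0 \<sigma>0 \<alpha>' *\<^sub>R \<alpha>')))"
      by (intro tendsto_max tendsto_const tendsto_minus q'(2))
    ultimately have "(\<lambda>i. max 0 (- E (q (q' i)))) \<longlonglongrightarrow> 0" by simp
    then show "\<exists>q'::nat\<Rightarrow>nat. strict_mono q' \<and> (\<lambda>i. max 0 (- E (q (q' i)))) \<longlonglongrightarrow> 0" using q'(1) by blast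
  qed
  show "(\<lambda>i. a i - a' i) \<longlonglongrightarrow> 0" if E0: "E \<longlonglongrightarrow> 0"
  proof (rule tendsto_by_subsequences)
    fix q :: "nat \<Rightarrow> nat" assume q: "strict_mono q"
    obtain q' :: "nat \<Rightarrow> nat" and \<alpha> \<alpha>' :: "real^'n" where q': "strict_mono q'" "(\<lambda>i. a (q (q' i))) \<longlonglongrightarrow> \<alpha>" "(\<lambda>i. a' (q (q' i))) \<longlonglongrightarrow> \<alpha>'"
      "(\<lambda>i. E (q (q' i))) \<longlonglongrightarrow> (\<alpha> - \<alpha>') \<bullet> (dens \<gamma> b0 \<sigma>0 \<alpha> *\<^sub>R \<alpha> - dens \<gamma> b0 \<sigma>0 \<alpha>' *\<^sub>R \<alpha>')" "subsonic \<gamma> b0 \<alpha>" "subsonic \<gamma> b0 \<alpha>'"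
      using key[OF q] by blast
    have "(\<lambda>i. E (q (q' i))) \<longlonglongrightarrow> 0"
      using LIMSEQ_subseq_LIMSEQ[OF E0 strict_mono_o[OF q q'(1)]] by (simp add: o_def)
    from LIMSEQ_unique[OF q'(4) this]
    have "\<alpha> = \<alpha>'" using mass_flux_strictly_monotone[OF \<gamma> \<sigma>(1) q'(5,6)] by (auto simp: inner_commute)
    then have "(\<lambda>i. a (q (q' i)) - a' (q (q' i))) \<longlonglongrightarrow> 0" using tendsto_diff[OF q'(2,3)] by simp
    then show "\<exists>q'::nat\<Rightarrow>nat. strict_mono q' \<and> (\<lambda>i. a (q (q' i)) - a' (q (q' i))) \<longlonglongrightarrow> 0" using q'(1) by blast
  qed
qed

text \<open>A Lindelof cover of \<Omega> by balls, each carrying a bump. Being countable, the family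
  lets statements almost everywhere on \<Omega> be proved separately on the sets where one weight is
  positive.\<close>

lemma exhausting_test_functions:
  fixes \<Omega> :: "(real^'n::finite) set"
  assumes "open \<Omega>"
  obtains \<phi> :: "nat \<Rightarrow> real^'n \<Rightarrow> real" where "\<And>j. test_fun \<Omega> (\<phi> j)" "\<And>j x. \<phi> j x \<ge> 0" "\<And>x. x \<in> \<Omega> \<Longrightarrow> \<exists>j. \<phi> j x > 0"
proof -
  define F where "F = {ball c r |c r. r > 0 \<and> cball c r \<subseteq> \<Omega>}"
  have Fo: "\<And>S. S \<in> F \<Longrightarrow> open S" by (auto simp: F_def)
  obtain F' where F': "F' \<subseteq> F" "countable F'" "\<Union>F' = \<Union>F" using Lindelof[of F] Fo by metis
  have F\<Omega>: "\<exists>B\<in>F. x \<in> B" if x: "x \<in> \<Omega>" for x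
  proof -
    obtain r where "r > 0" "cball x r \<subseteq> \<Omega>" using assms x unfolding open_contains_cball by blast
    then have "ball x r \<in> F" by (auto simp: F_def)
    then show ?thesis using \<open>r > 0\<close> by (intro bexI[of _ "ball x r"]) auto
  qed
  have t0: "test_fun \<Omega> (\<lambda>x. 0)" by (rule test_funI[of _ "{}"]) auto
  show ?thesis
  proof (cases "F' = {}")
    case True
    then have "\<Omega> = {}" using F\<Omega> F'(3) by auto
    then show ?thesis using that[of "\<lambda>_ _. 0"] t0 by simp
  next
    case False
    have "\<forall>j. \<exists>c r. from_nat_into F' j = ball c r \<and> r > 0 \<and> cball c r \<subseteq> \<Omega>"
      using from_nat_into[OF False] F'(1) unfolding F_def by blast
    then obtain c r where cr: "\<And>j. from_nat_into F' j = ball (c j) (r j)" "\<And>j. r j > 0" "\<And>j. cball (c j) (r j) \<subseteq> \<Omega>" by metis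
    define \<phi> where "\<phi> = (\<lambda>j x. bump 0 ((1 / r j) *\<^sub>R x + (- 1 / r j) *\<^sub>R c j))"
    have eq: "(1 / r j) *\<^sub>R x + (- 1 / r j) *\<^sub>R c j = (1 / r j) *\<^sub>R (x - c j)" for j x by (simp add: scaleR_diff_right)
    have nn: "norm ((1 / r j) *\<^sub>R x + (- 1 / r j) *\<^sub>R c j) = dist (c j) x / r j" for j x
      unfolding eq using cr(2)[of j] by (simp add: dist_norm norm_minus_commute)
    show ?thesis
    proof (rule that[of \<phi>])
      fix j
      show "test_fun \<Omega> (\<phi> j)"
      proof (rule test_funI[OF _ compact_cball cr(3)])
        show "smooth (\<phi> j)" unfolding \<phi>_def by (rule smooth_affine[OF smooth_bump])
        show "\<phi> j x = 0" if "x \<notin> cball (c j) (r j)" for x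
          unfolding \<phi>_def
        proof (rule bump_zero)
          show "(1 / r j) *\<^sub>R x + (- 1 / r j) *\<^sub>R c j \<notin> cball 0 1"
            unfolding mem_cball_0 nn using that cr(2)[of j] by (simp add: divide_le_eq_1)
        qed
      qed
      show "\<phi> j x \<ge> 0" for x by (simp add: \<phi>_def bump_nonneg)
    next
      fix x assume "x \<in> \<Omega>"
      then obtain B where "B \<in> F'" "x \<in> B" using F\<Omega> F'(3) by blast
      then obtain j where "from_nat_into F' j = B" using from_nat_into_surj[OF F'(2)] by blast
      then have "dist (c j) x < r j" using \<open>x \<in> B\<close> cr(1)[of j] by auto
      then have "\<phi> j x > 0" unfolding \<phi>_def by (intro bump_pos) (use nn cr(2)[of j] in simp)
      then show "\<exists>j. \<phi> j x > 0" ..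
    qed
  qed
qed

section \<open>Strong convergence and passage to the limit\<close>

text \<open>The usual fast subsequence with summable increments, chosen so that step i controls all
  weights of index at most i; one subsequence thus serves every weight.\<close>

lemma Cauchy_L1_imp_AE_convergent_subseq:
  fixes u :: "nat \<Rightarrow> 'a \<Rightarrow> real^'n::finite" and \<phi> :: "nat \<Rightarrow> 'a \<Rightarrow> real"
  assumes u[measurable]: "\<And>k. u k \<in> borel_measurable M" and \<phi>[measurable]: "\<And>j. \<phi> j \<in> borel_measurable M"
    and nn: "\<And>j x. \<phi> j x \<ge> 0" and int: "\<And>j m k. integrable M (\<lambda>x. \<phi> j x * norm (u m x - u k x))"
    and C: "\<And>j \<epsilon>. \<epsilon> > 0 \<Longrightarrow> \<exists>N. \<forall>m\<ge>N. \<forall>k\<ge>N. (\<integral>x. \<phi> j x * norm (u m x - u k x) \<partial>M) < \<epsilon>"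
  shows "\<exists>r::nat\<Rightarrow>nat. strict_mono r \<and> (\<forall>j. AE x in M. \<phi> j x > 0 \<longrightarrow> convergent (\<lambda>k. u (r k) x))"
proof -
  have "\<exists>N. \<forall>j\<le>i. \<forall>m\<ge>N. \<forall>k\<ge>N. (\<integral>x. \<phi> j x * norm (u m x - u k x) \<partial>M) < (1/2) ^ i" for i :: nat
  proof -
    have "\<forall>j. \<exists>N. \<forall>m\<ge>N. \<forall>k\<ge>N. (\<integral>x. \<phi> j x * norm (u m x - u k x) \<partial>M) < (1/2) ^ i"
      using C[of "(1/2) ^ i"] by simp
    then obtain N where N: "\<And>j m k. m \<ge> N j \<Longrightarrow> k \<ge> N j \<Longrightarrow> (\<integral>x. \<phi> j x * norm (u m x - u k x) \<partial>M) < (1/2) ^ i" by metis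
    have "N j \<le> Max (N ` {..i})" if "j \<le> i" for j using that by simp
    then show ?thesis using N by (intro exI[of _ "Max (N ` {..i})"]) (meson order_trans)
  qed
  then obtain N where N: "\<And>i j m k. j \<le> i \<Longrightarrow> m \<ge> N i \<Longrightarrow> k \<ge> N i \<Longrightarrow> (\<integral>x. \<phi> j x * norm (u m x - u k x) \<partial>M) < (1/2) ^ i"
    by metis
  \<comment> \<open>The entry \<open>Suc p\<close> makes the sequence strictly increasing even where
    the thresholds \<open>N\<close> are not.\<close>
  define r where "r = rec_nat (N 0) (\<lambda>i p. max (N (Suc i)) (Suc p))"
  have r0: "r 0 = N 0" and rS: "\<And>i. r (Suc i) = max (N (Suc i)) (Suc (r i))" by (simp_all add: r_def)
  have r: "strict_mono r" unfolding strict_mono_Suc_iff by (simp add: rS less_max_iff_disj)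
  have rN: "r i \<ge> N i" for i by (cases i) (simp_all add: r0 rS)
  have "AE x in M. \<phi> j x > 0 \<longrightarrow> convergent (\<lambda>k. u (r k) x)" for j
  proof -
    \<comment> \<open>The shift by j skips the steps at which weight j is not yet
      controlled.\<close>
    let ?d = "\<lambda>i x. \<phi> j x * norm (u (r (Suc (i + j))) x - u (r (i + j)) x)"
    have dn: "?d i x \<ge> 0" for i x using nn by simp
    have di: "(\<integral>\<^sup>+x. ennreal (?d i x) \<partial>M) \<le> ennreal ((1/2) ^ i)" for i
    proof -
      have "(\<integral>\<^sup>+x. ennreal (?d i x) \<partial>M) = ennreal (\<integral>x. ?d i x \<partial>M)"
        by (rule nn_integral_eq_integral[OF int]) (simp add: dn)
      also have "\<dots> \<le> ennreal ((1/2) ^ (i + j))"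
        using N[of j "i + j" "r (Suc (i + j))" "r (i + j)"] rN[of "i + j"] strict_monoD[OF r, of "i + j" "Suc (i + j)"]
        by (intro ennreal_leI) simp
      also have "\<dots> \<le> ennreal ((1/2) ^ i)" by (intro ennreal_leI power_decreasing) auto
      finally show ?thesis .
    qed
    have "(\<integral>\<^sup>+x. (\<Sum>i. ennreal (?d i x)) \<partial>M) = (\<Sum>i. \<integral>\<^sup>+x. ennreal (?d i x) \<partial>M)"
      by (rule nn_integral_suminf) measurable
    also have "\<dots> \<le> (\<Sum>i. ennreal ((1/2) ^ i))" by (intro suminf_le di) auto
    also have "\<dots> = ennreal (\<Sum>i. (1/2) ^ i)" by (rule suminf_ennreal2) (auto intro: summable_geometric)
    also have "\<dots> < \<infinity>" by simp
    finally have "(\<integral>\<^sup>+x. (\<Sum>i. ennreal (?d i x)) \<partial>M) \<noteq> \<infinity>" by simp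
    then have "AE x in M. (\<Sum>i. ennreal (?d i x)) \<noteq> \<infinity>" by (intro nn_integral_noteq_infinite) measurable
    then show ?thesis
    proof eventually_elim
      case (elim x)
      show ?case
      proof
        assume p: "\<phi> j x > 0"
        have "summable (\<lambda>i. ?d i x)" using elim dn by (intro summable_suminf_not_top) auto
        then have "summable (\<lambda>i. norm (u (r (Suc (i + j))) x - u (r (i + j)) x))"
          using p by (simp add: summable_cmult_iff)
        then have "summable (\<lambda>i. u (r (Suc (i + j))) x - u (r (i + j)) x)" by (rule summable_norm_cancel)
        then have "convergent (\<lambda>n. \<Sum>i<n. u (r (Suc (i + j))) x - u (r (i + j)) x)" by (simp add: summable_iff_convergent)
        moreover have "(\<Sum>i<n. u (r (Suc (i + j))) x - u (r (i + j)) x) = u (r (n + j)) x - u (r j) x" for n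
          using sum_lessThan_telescope[of "\<lambda>i. u (r (i + j)) x" n] by simp
        ultimately have "convergent (\<lambda>n. u (r (n + j)) x - u (r j) x)" by simp
        then have "convergent (\<lambda>n. (u (r (n + j)) x - u (r j) x) + u (r j) x)" by (rule convergent_add[OF _ convergent_const])
        then have "convergent (\<lambda>n. u (r (n + j)) x)" by simp
        then show "convergent (\<lambda>k. u (r k) x)" using convergent_ignore_initial_segment[of "\<lambda>k. u (r k) x" j] by simp
      qed
    qed
  qed
  then show ?thesis using r by blast
qed

text \<open>The pairing is nonnegative up to an error that tends to 0, so the decay of its integral is
  decay in \<open>L\<^sup>1\<close>; strict monotonicity turns this into convergence of the velocities.\<close>

lemma velocity_L1_Cauchy:
  fixes u w :: "nat \<Rightarrow> 'a \<Rightarrow> real^'n::finite" and \<phi> Bb Sb :: "'a \<Rightarrow> real" and B Sg :: "nat \<Rightarrow> 'a \<Rightarrow> real"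
  assumes \<gamma>: "\<gamma> > 1" and u[measurable]: "\<And>k. u k \<in> borel_measurable M" and w[measurable]: "\<And>k. w k \<in> borel_measurable M"
    and \<phi>: "integrable M \<phi>" "\<And>x. \<phi> x \<ge> 0"
    and weq: "\<And>k x. x \<in> space M \<Longrightarrow> w k x = dens \<gamma> (B k x) (Sg k x) (u k x) *\<^sub>R u k x"
    and good: "AE x in M. (\<forall>k. subsonic \<gamma> (B k x) (u k x)) \<and> (\<lambda>k. B k x) \<longlonglongrightarrow> Bb x \<and> (\<lambda>k. Sg k x) \<longlonglongrightarrow> Sb x \<and> Sb x > 0 \<and> (\<forall>k. Sg k x > 0)"
    and bd: "\<And>k x. x \<in> space M \<Longrightarrow> \<phi> x \<noteq> 0 \<Longrightarrow> norm (u k x) \<le> A \<and> norm (w k x) \<le> A" and A: "A \<ge> 0"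
    and dc: "\<And>\<epsilon>. \<epsilon> > 0 \<Longrightarrow> \<exists>N. \<forall>m\<ge>N. \<forall>k\<ge>N. \<bar>\<integral>x. \<phi> x * ((u m x - u k x) \<bullet> (w m x - w k x)) \<partial>M\<bar> < \<epsilon>"
    and \<epsilon>: "\<epsilon> > 0"
  shows "\<exists>N. \<forall>m\<ge>N. \<forall>k\<ge>N. (\<integral>x. \<phi> x * norm (u m x - u k x) \<partial>M) < \<epsilon>"
proof (rule ccontr)
  assume "\<not> ?thesis"
  then have "\<forall>N. \<exists>m k. m \<ge> N \<and> k \<ge> N \<and> (\<integral>x. \<phi> x * norm (u m x - u k x) \<partial>M) \<ge> \<epsilon>" by (auto simp: not_less) 
  \<comment> \<open>These index sequences tend to infinity but need not be monotone, hence limits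
    through \<open>filterlim\<close> instead of subsequences.\<close>
  then obtain m k where mk: "\<And>N::nat. m N \<ge> N" "\<And>N. k N \<ge> N" "\<And>N. (\<integral>x. \<phi> x * norm (u (m N) x - u (k N) x) \<partial>M) \<ge> \<epsilon>" by metis
  have [measurable]: "\<phi> \<in> borel_measurable M" using \<phi>(1) by auto
  have "filterlim m at_top sequentially"
    by (rule filterlim_at_top_mono[OF filterlim_ident always_eventually]) (use mk(1) in blast)
  moreover have "filterlim k at_top sequentially"
    by (rule filterlim_at_top_mono[OF filterlim_ident always_eventually]) (use mk(2) in blast)
  ultimately have ml: "filterlim m at_top sequentially" "filterlim k at_top sequentially" .
  define E where "E = (\<lambda>N x. (u (m N) x - u (k N) x) \<bullet> (w (m N) x - w (k N) x))"
  have Em[measurable]: "E N \<in> borel_measurable M" for N unfolding E_def by measurable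
  have Eb: "\<phi> x * \<bar>E N x\<bar> \<le> \<phi> x * (4 * A\<^sup>2)" if "x \<in> space M" for N x
  proof (cases "\<phi> x = 0")
    case False
    have "norm (u (m N) x - u (k N) x) \<le> 2 * A" "norm (w (m N) x - w (k N) x) \<le> 2 * A"
      using bd[OF that False, of "m N"] bd[OF that False, of "k N"]
        norm_triangle_ineq4[of "u (m N) x" "u (k N) x"] norm_triangle_ineq4[of "w (m N) x" "w (k N) x"] by linarith+
    then have "norm (u (m N) x - u (k N) x) * norm (w (m N) x - w (k N) x) \<le> (2 * A) * (2 * A)"
      using A by (intro mult_mono) auto
    then have "\<bar>E N x\<bar> \<le> 4 * A\<^sup>2"
      using Cauchy_Schwarz_ineq2[of "u (m N) x - u (k N) x" "w (m N) x - w (k N) x"] by (simp add: E_def power2_eq_square)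
    then show ?thesis using \<phi>(2) by (intro mult_left_mono)
  qed simp
  have dom: "integrable M (\<lambda>x. \<phi> x * (4 * A\<^sup>2))" using \<phi>(1) by simp
  have iE: "integrable M (\<lambda>x. \<phi> x * E N x)" for N
    by (rule Bochner_Integration.integrable_bound[OF dom])
       (use Eb \<phi>(2) in \<open>auto simp: abs_mult intro!: AE_I2\<close>)
  have iN: "integrable M (\<lambda>x. \<phi> x * max 0 (- E N x))" for N
  proof (rule Bochner_Integration.integrable_bound[OF iE[of N]])
    show "AE x in M. norm (\<phi> x * max 0 (- E N x)) \<le> norm (\<phi> x * E N x)"
      using \<phi>(2) by (intro AE_I2) (auto simp: abs_mult intro!: mult_left_mono)
  qed measurable
  have lims: "AE x in M. (\<lambda>N. max 0 (- E N x)) \<longlonglongrightarrow> 0 \<or> \<phi> x = 0"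
    and lims2: "AE x in M. \<forall>q::nat\<Rightarrow>nat. strict_mono q \<longrightarrow> (\<lambda>N. E (q N) x) \<longlonglongrightarrow> 0 \<longrightarrow> \<phi> x \<noteq> 0 \<longrightarrow> (\<lambda>N. u (m (q N)) x - u (k (q N)) x) \<longlonglongrightarrow> 0"
  proof -
    have both: "AE x in M. \<phi> x \<noteq> 0 \<longrightarrow> (\<lambda>N. max 0 (- E N x)) \<longlonglongrightarrow> 0 \<and>
       (\<forall>q::nat\<Rightarrow>nat. strict_mono q \<longrightarrow> (\<lambda>N. E (q N) x) \<longlonglongrightarrow> 0 \<longrightarrow> (\<lambda>N. u (m (q N)) x - u (k (q N)) x) \<longlonglongrightarrow> 0)"
      using good AE_space
    proof eventually_elim
      case (elim x)
      then have g: "\<And>k. subsonic \<gamma> (B k x) (u k x)" "(\<lambda>k. B k x) \<longlonglongrightarrow> Bb x" "(\<lambda>k. Sg k x) \<longlonglongrightarrow> Sb x" "Sb x > 0" "\<And>k. Sg k x > 0" and sp: "x \<in> space M"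
        by blast+
      show ?case
      proof (intro impI conjI allI)
        assume p: "\<phi> x \<noteq> 0"
        have L: "(\<lambda>N. B (m N) x) \<longlonglongrightarrow> Bb x" "(\<lambda>N. B (k N) x) \<longlonglongrightarrow> Bb x" "(\<lambda>N. Sg (m N) x) \<longlonglongrightarrow> Sb x" "(\<lambda>N. Sg (k N) x) \<longlonglongrightarrow> Sb x"
          using filterlim_compose[OF g(2) ml(1)] filterlim_compose[OF g(2) ml(2)] filterlim_compose[OF g(3) ml(1)] filterlim_compose[OF g(3) ml(2)]
          by simp_all
        have bu: "norm (u (f N) x) \<le> A" for f :: "nat \<Rightarrow> nat" and N using bd[OF sp p] by blast
        show "(\<lambda>N. max 0 (- E N x)) \<longlonglongrightarrow> 0"
          using monotone_pairing_limits(1)[where a = "\<lambda>N. u (m N) x" and a' = "\<lambda>N. u (k N) x" and \<sigma> = "\<lambda>N. Sg (m N) x" and \<sigma>' = "\<lambda>N. Sg (k N) x", OF \<gamma> L g(4) g(5) g(5) g(1) g(1) bu[of m] bu[of k]] unfolding E_def weq[OF sp] .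
        fix q :: "nat \<Rightarrow> nat" assume q: "strict_mono q" and E0: "(\<lambda>N. E (q N) x) \<longlonglongrightarrow> 0"
        have Lq: "(\<lambda>N. B (m (q N)) x) \<longlonglongrightarrow> Bb x" "(\<lambda>N. B (k (q N)) x) \<longlonglongrightarrow> Bb x" "(\<lambda>N. Sg (m (q N)) x) \<longlonglongrightarrow> Sb x" "(\<lambda>N. Sg (k (q N)) x) \<longlonglongrightarrow> Sb x"
          using LIMSEQ_subseq_LIMSEQ[OF L(1) q] LIMSEQ_subseq_LIMSEQ[OF L(2) q] LIMSEQ_subseq_LIMSEQ[OF L(3) q] LIMSEQ_subseq_LIMSEQ[OF L(4) q]
          by (simp_all add: o_def)
        show "(\<lambda>N. u (m (q N)) x - u (k (q N)) x) \<longlonglongrightarrow> 0"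
          by (rule monotone_pairing_limits(2)[where a = "\<lambda>N. u (m (q N)) x" and a' = "\<lambda>N. u (k (q N)) x" and \<sigma> = "\<lambda>N. Sg (m (q N)) x" and \<sigma>' = "\<lambda>N. Sg (k (q N)) x", OF \<gamma> Lq g(4) g(5) g(5) g(1) g(1) bu[of "\<lambda>N. m (q N)"] bu[of "\<lambda>N. k (q N)"]])
             (use E0 in \<open>simp add: E_def weq[OF sp]\<close>)
      qed
    qed
    from both show "AE x in M. (\<lambda>N. max 0 (- E N x)) \<longlonglongrightarrow> 0 \<or> \<phi> x = 0" by eventually_elim blast
    from both show "AE x in M. \<forall>q::nat\<Rightarrow>nat. strict_mono q \<longrightarrow> (\<lambda>N. E (q N) x) \<longlonglongrightarrow> 0 \<longrightarrow> \<phi> x \<noteq> 0 \<longrightarrow> (\<lambda>N. u (m (q N)) x - u (k (q N)) x) \<longlonglongrightarrow> 0"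
      by eventually_elim blast
  qed
  have neg: "(\<lambda>N. \<integral>x. \<phi> x * max 0 (- E N x) \<partial>M) \<longlonglongrightarrow> 0"
  proof -
    have "(\<lambda>N. \<integral>x. \<phi> x * max 0 (- E N x) \<partial>M) \<longlonglongrightarrow> (\<integral>x. 0 \<partial>M)"
    proof (rule integral_dominated_convergence[OF _ _ dom])
      show "AE x in M. (\<lambda>N. \<phi> x * max 0 (- E N x)) \<longlonglongrightarrow> 0"
        using lims
      proof eventually_elim
        case (elim x)
        then show ?case using tendsto_mult_left[of "\<lambda>N. max 0 (- E N x)" 0 sequentially "\<phi> x"] by auto
      qed
      show "AE x in M. norm (\<phi> x * max 0 (- E N x)) \<le> \<phi> x * (4 * A\<^sup>2)" for N
      proof (rule AE_I2)
        fix x assume "x \<in> space M"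
        have "\<phi> x * max 0 (- E N x) \<le> \<phi> x * \<bar>E N x\<bar>" using \<phi>(2) by (intro mult_left_mono) auto
        then show "norm (\<phi> x * max 0 (- E N x)) \<le> \<phi> x * (4 * A\<^sup>2)"
          using Eb[OF \<open>x \<in> space M\<close>, of N] \<phi>(2)[of x] by (simp add: abs_mult)
      qed
    qed measurable
    then show ?thesis by simp
  qed
  have I0: "(\<lambda>N. \<integral>x. \<phi> x * E N x \<partial>M) \<longlonglongrightarrow> 0"
    unfolding lim_sequentially
  proof (intro allI impI)
    fix e :: real assume "e > 0"
    then obtain N0 where "\<forall>m\<ge>N0. \<forall>k\<ge>N0. \<bar>\<integral>x. \<phi> x * ((u m x - u k x) \<bullet> (w m x - w k x)) \<partial>M\<bar> < e" using dc by blast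
    moreover have "m N \<ge> N0" "k N \<ge> N0" if "N \<ge> N0" for N using mk(1)[of N] mk(2)[of N] that by linarith+
    ultimately have "\<forall>N\<ge>N0. \<bar>\<integral>x. \<phi> x * E N x \<partial>M\<bar> < e" unfolding E_def by blast
    then show "\<exists>N0. \<forall>N\<ge>N0. dist (\<integral>x. \<phi> x * E N x \<partial>M) 0 < e" by auto
  qed
  \<comment> \<open>The identity |y| = y + 2 max 0 (-y) combines the decay of the integral with that
    of the negative part into decay in \<open>L^1\<close>.\<close>
  have "(\<lambda>N. (\<integral>x. \<phi> x * E N x \<partial>M) + 2 * (\<integral>x. \<phi> x * max 0 (- E N x) \<partial>M)) \<longlonglongrightarrow> 0 + 2 * 0"
    by (intro tendsto_intros I0 neg)
  moreover have "(\<integral>x. \<phi> x * E N x \<partial>M) + 2 * (\<integral>x. \<phi> x * max 0 (- E N x) \<partial>M) = (\<integral>x. norm (\<phi> x * E N x) \<partial>M)" for N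
  proof -
    have "(\<integral>x. \<phi> x * E N x \<partial>M) + 2 * (\<integral>x. \<phi> x * max 0 (- E N x) \<partial>M) = (\<integral>x. \<phi> x * E N x + 2 * (\<phi> x * max 0 (- E N x)) \<partial>M)"
      using iE[of N] iN[of N] by simp
    also have "\<dots> = (\<integral>x. norm (\<phi> x * E N x) \<partial>M)"
    proof (intro Bochner_Integration.integral_cong refl)
      fix x
      have m: "max 0 (- E N x) = (\<bar>E N x\<bar> - E N x) / 2" by simp
      show "\<phi> x * E N x + 2 * (\<phi> x * max 0 (- E N x)) = norm (\<phi> x * E N x)"
        unfolding m using \<phi>(2)[of x] by (simp add: abs_mult field_simps)
    qed
    finally show ?thesis .
  qed
  ultimately have "(\<lambda>N. \<integral>x. norm (\<phi> x * E N x) \<partial>M) \<longlonglongrightarrow> 0" by simp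
  \<comment> \<open>Along a subsequence \<open>E\<close> then decays pointwise, so the velocities
    approach each other there, and dominated convergence contradicts the lower bound
    \<epsilon>.\<close>
  from tendsto_L1_AE_subseq[OF iE this]
  obtain q :: "nat \<Rightarrow> nat" where q: "strict_mono q" "AE x in M. (\<lambda>n. \<phi> x * E (q n) x) \<longlonglongrightarrow> 0" by blast
  have "(\<lambda>N. \<integral>x. \<phi> x * norm (u (m (q N)) x - u (k (q N)) x) \<partial>M) \<longlonglongrightarrow> (\<integral>x. 0 \<partial>M)"
  proof (rule integral_dominated_convergence[where w="\<lambda>x. \<phi> x * (2 * A)"])
    show "AE x in M. (\<lambda>N. \<phi> x * norm (u (m (q N)) x - u (k (q N)) x)) \<longlonglongrightarrow> 0"
      using lims2 q(2)
    proof eventually_elim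
      case (elim x)
      show ?case
      proof (cases "\<phi> x = 0")
        case False
        have "(\<lambda>n. inverse (\<phi> x) * (\<phi> x * E (q n) x)) \<longlonglongrightarrow> inverse (\<phi> x) * 0" by (intro tendsto_intros elim(2))
        then have "(\<lambda>n. E (q n) x) \<longlonglongrightarrow> 0" using False by (simp add: mult.assoc[symmetric])
        then have "(\<lambda>N. u (m (q N)) x - u (k (q N)) x) \<longlonglongrightarrow> 0" using elim(1) q(1) False by blast
        then have "(\<lambda>N. \<phi> x * norm (u (m (q N)) x - u (k (q N)) x)) \<longlonglongrightarrow> \<phi> x * norm (0 :: real^'n)" by (intro tendsto_intros)
        then show ?thesis by simp
      qed simp
    qed
    show "AE x in M. norm (\<phi> x * norm (u (m (q N)) x - u (k (q N)) x)) \<le> \<phi> x * (2 * A)" for N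
    proof (rule AE_I2)
      fix x assume sp: "x \<in> space M"
      show "norm (\<phi> x * norm (u (m (q N)) x - u (k (q N)) x)) \<le> \<phi> x * (2 * A)"
      proof (cases "\<phi> x = 0")
        case False
        have "norm (u (m (q N)) x - u (k (q N)) x) \<le> 2 * A"
          using bd[OF sp False, of "m (q N)"] bd[OF sp False, of "k (q N)"] norm_triangle_ineq4[of "u (m (q N)) x" "u (k (q N)) x"] by linarith
        then show ?thesis using \<phi>(2)[of x] by (simp add: abs_mult mult_left_mono)
      qed simp
    qed
    show "integrable M (\<lambda>x. \<phi> x * (2 * A))" using \<phi>(1) by simp
  qed measurable
  then have "(\<lambda>N. \<integral>x. \<phi> x * norm (u (m (q N)) x - u (k (q N)) x) \<partial>M) \<longlonglongrightarrow> 0" by simp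
  then have "\<epsilon> \<le> 0" by (rule LIMSEQ_le_const) (use mk(3) in blast)
  with \<epsilon> show False by simp
qed

text \<open>The bounds on compact sets pass to \<open>F0\<close> almost everywhere, giving local
  integrability, and they furnish the majorant for dominated convergence on the support of a test
  function.\<close>

lemma weak_div_free_limit:
  fixes F :: "nat \<Rightarrow> real^'n::finite \<Rightarrow> real^'n"
  assumes \<Omega>: "open \<Omega>" and F: "\<And>k. F k \<in> borel_measurable (lebesgue_on \<Omega>)" and F0: "F0 \<in> borel_measurable (lebesgue_on \<Omega>)"
    and bd: "\<And>K. compact K \<Longrightarrow> K \<subseteq> \<Omega> \<Longrightarrow> \<exists>A. \<forall>k. \<forall>x\<in>K. norm (F k x) \<le> A"
    and lim: "AE x in lebesgue. x \<in> \<Omega> \<longrightarrow> (\<lambda>k. F k x) \<longlonglongrightarrow> F0 x"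
    and dv: "\<And>\<phi>. test_fun \<Omega> \<phi> \<Longrightarrow> (\<lambda>k. div_distr (F k) \<phi>) \<longlonglongrightarrow> 0"
  shows "weak_div_free \<Omega> F0"
proof -
  have meas: "(\<lambda>x. if x \<in> \<Omega> then f x else 0) \<in> borel_measurable lebesgue" if "f \<in> borel_measurable (lebesgue_on \<Omega>)" for f :: "real^'n \<Rightarrow> real^'n"
    using that \<Omega> by (simp add: borel_measurable_if)
  have F0b: "AE x in lebesgue. x \<in> K \<longrightarrow> norm (F0 x) \<le> A" if K: "K \<subseteq> \<Omega>" and A: "\<forall>k. \<forall>x\<in>K. norm (F k x) \<le> A" for K A
    using lim
  proof eventually_elim
    case (elim x)
    show ?case
    proof
      assume x: "x \<in> K"
      then have "(\<lambda>k. norm (F k x)) \<longlonglongrightarrow> norm (F0 x)" using elim K by (intro tendsto_norm) blast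
      then show "norm (F0 x) \<le> A" by (rule Lim_bounded[of _ _ 0]) (use A x in blast)
    qed
  qed
  have Kfin: "integrable lebesgue (\<lambda>x. A * indicat_real K x)" if "compact K" for A and K :: "(real^'n) set"
    using lmeasurable_compact[OF that] by (intro integrable_mult_right integrable_real_indicator) (auto simp: fmeasurable_def)
  have "set_integrable lebesgue K F0" if K: "compact K" "K \<subseteq> \<Omega>" for K
  proof -
    obtain A where A: "\<forall>k. \<forall>x\<in>K. norm (F k x) \<le> A" using bd[OF K] by blast
    have eq: "(\<lambda>x. indicat_real K x *\<^sub>R F0 x) = (\<lambda>x. indicat_real K x *\<^sub>R (if x \<in> \<Omega> then F0 x else 0))"
      using K(2) by (intro ext) (auto simp: indicator_def)
    have Ks: "K \<in> sets lebesgue" using lmeasurable_compact[OF K(1)] by (auto simp: fmeasurable_def)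
    show ?thesis
      unfolding set_integrable_def
    proof (rule Bochner_Integration.integrable_bound[OF Kfin[OF K(1)]])
      show "(\<lambda>x. indicat_real K x *\<^sub>R F0 x) \<in> borel_measurable lebesgue"
        unfolding eq by (intro borel_measurable_scaleR borel_measurable_indicator Ks meas F0)
      show "AE x in lebesgue. norm (indicat_real K x *\<^sub>R F0 x) \<le> norm (A * indicat_real K x)"
        using F0b[OF K(2) A]
      proof eventually_elim
        case (elim x)
        then show ?case by (cases "x \<in> K") auto
      qed
    qed
  qed
  then have li: "locally_integrable \<Omega> F0" by (auto simp: locally_integrable_def)
  have "div_distr F0 \<phi> = 0" if \<phi>: "test_fun \<Omega> \<phi>" for \<phi>
  proof -
    obtain S where S: "smooth \<phi>" "compact S" "S \<subseteq> \<Omega>" "\<And>x. x \<notin> S \<Longrightarrow> \<phi> x = 0" using test_funE[OF \<phi>] by metis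
    have gz: "x \<notin> S \<Longrightarrow> grad \<phi> x = 0" for x by (rule grad_zero_outside[OF compact_imp_closed[OF S(2)] S(4)])
    obtain P where P: "P > 0" "\<And>x. norm (grad \<phi> x) \<le> P"
      using bounded_of_compact_support[OF continuous_on_grad[OF S(1)] S(2) gz] by metis
    obtain A where A: "\<forall>k. \<forall>x\<in>S. norm (F k x) \<le> A" using bd[OF S(2,3)] by blast
    have gm: "grad \<phi> \<in> borel_measurable lebesgue"
      using measurable_grad[OF S(1)] by (intro measurable_completion) simp
    have mm: "(\<lambda>x. f x \<bullet> grad \<phi> x) \<in> borel_measurable lebesgue" if "f \<in> borel_measurable (lebesgue_on \<Omega>)" for f :: "real^'n \<Rightarrow> real^'n"
    proof -
      have "(\<lambda>x. f x \<bullet> grad \<phi> x) = (\<lambda>x. (if x \<in> \<Omega> then f x else 0) \<bullet> grad \<phi> x)"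
      proof
        fix x
        show "f x \<bullet> grad \<phi> x = (if x \<in> \<Omega> then f x else 0) \<bullet> grad \<phi> x"
        proof (cases "x \<in> \<Omega>")
          case False
          then have "x \<notin> S" using S(3) by blast
          then show ?thesis using gz by simp
        qed simp
      qed
      then show ?thesis using borel_measurable_inner[OF meas[OF that] gm] by simp
    qed
    have "(\<lambda>k. \<integral>x. F k x \<bullet> grad \<phi> x \<partial>lebesgue) \<longlonglongrightarrow> (\<integral>x. F0 x \<bullet> grad \<phi> x \<partial>lebesgue)"
    proof (rule integral_dominated_convergence[OF mm[OF F0] mm[OF F] Kfin[OF S(2), of "A * P"]])
      show "AE x in lebesgue. (\<lambda>k. F k x \<bullet> grad \<phi> x) \<longlonglongrightarrow> F0 x \<bullet> grad \<phi> x"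
        using lim
      proof eventually_elim
        case (elim x)
        show ?case
        proof (cases "x \<in> S")
          case True
          then show ?thesis using elim S(3) by (intro tendsto_inner tendsto_const) blast
        qed (simp add: gz)
      qed
      show "AE x in lebesgue. norm (F k x \<bullet> grad \<phi> x) \<le> A * P * indicat_real S x" for k
      proof (rule AE_I2)
        fix x
        show "norm (F k x \<bullet> grad \<phi> x) \<le> A * P * indicat_real S x"
        proof (cases "x \<in> S")
          case True
          have "norm (F k x) \<le> A" using A True by blast
          moreover have "A \<ge> 0" using calculation norm_ge_zero order_trans by blast
          ultimately have "norm (F k x) * norm (grad \<phi> x) \<le> A * P" using P by (intro mult_mono) auto
          then show ?thesis using True Cauchy_Schwarz_ineq2[of "F k x" "grad \<phi> x"] by simp
        qed (simp add: gz)
      qed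
    qed
    then have "(\<lambda>k. div_distr (F k) \<phi>) \<longlonglongrightarrow> div_distr F0 \<phi>" unfolding div_distr_def by (rule tendsto_minus)
    from LIMSEQ_unique[OF this dv[OF \<phi>]] show ?thesis .
  qed
  with li show ?thesis by (simp add: weak_div_free_def)
qed

text \<open>Expresses density and pressure through Bernoulli function, entropy and velocity, so that
  their convergence reduces to that of these three.\<close>

lemma state_relations:
  fixes u :: "real^'n::finite"
  assumes \<gamma>: "\<gamma> > 1" and pos: "rho > 0" "P > 0"
  defines "h \<equiv> bernoulli \<gamma> rho u P - (norm u)\<^sup>2 / 2"
  shows "h = \<gamma> * P / ((\<gamma> - 1) * rho)" "h > 0" "entropy \<gamma> rho P > 0"
    and "rho = dens \<gamma> (bernoulli \<gamma> rho u P) (entropy \<gamma> rho P) u" "P = (\<gamma> - 1) / \<gamma> * h * rho"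
    and "mach \<gamma> rho u P \<le> 1 \<Longrightarrow> subsonic \<gamma> (bernoulli \<gamma> rho u P) u"
proof -
  show h: "h = \<gamma> * P / ((\<gamma> - 1) * rho)" by (simp add: h_def bernoulli_def)
  then show hp: "h > 0" using \<gamma> pos by simp
  show "entropy \<gamma> rho P > 0" using \<gamma> pos by (simp add: entropy_def)
  have "h / entropy \<gamma> rho P = rho powr \<gamma> / rho"
    using \<gamma> pos by (simp add: h entropy_def)
  also have "\<dots> = rho powr (\<gamma> - 1)" using pos by (simp add: powr_diff)
  finally show "rho = dens \<gamma> (bernoulli \<gamma> rho u P) (entropy \<gamma> rho P) u"
    using \<gamma> pos by (simp add: dens_def h_def[symmetric] powr_powr)
  show "P = (\<gamma> - 1) / \<gamma> * h * rho" using \<gamma> pos by (simp add: h)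
  assume "mach \<gamma> rho u P \<le> 1"
  then have "norm u \<le> sqrt (\<gamma> * P / rho)"
    using \<gamma> pos by (simp add: mach_def sound_speed_def divide_le_eq)
  then have "(norm u)\<^sup>2 \<le> (sqrt (\<gamma> * P / rho))\<^sup>2" by (intro power_mono) auto
  also have "\<dots> = \<gamma> * P / rho" using \<gamma> pos by simp
  also have "\<dots> = (\<gamma> - 1) * h" using \<gamma> pos by (simp add: h)
  finally show "subsonic \<gamma> (bernoulli \<gamma> rho u P) u" by (simp add: subsonic_def h_def)
qed

text \<open>At vacuum the convention for division by 0 gives Mach number 0; otherwise the pressure
  relation identifies the squared sound speed with \<gamma> - 1 times the enthalpy.\<close>

lemma mach_le_1:
  assumes \<gamma>: "\<gamma> > 1" and "subsonic \<gamma> b a" and P: "P = (\<gamma> - 1) / \<gamma> * (b - (norm a)\<^sup>2 / 2) * rho"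
  shows "mach \<gamma> rho a P \<le> 1"
proof (cases "rho = 0")
  case False
  have "sound_speed \<gamma> rho P = sqrt ((\<gamma> - 1) * (b - (norm a)\<^sup>2 / 2))"
    using \<gamma> False by (simp add: sound_speed_def P)
  moreover have "norm a \<le> sqrt ((\<gamma> - 1) * (b - (norm a)\<^sup>2 / 2))"
    using assms(2) by (intro real_le_rsqrt) (simp add: subsonic_def)
  ultimately have "norm a \<le> sound_speed \<gamma> rho P" by simp
  then show ?thesis by (cases "sound_speed \<gamma> rho P = 0") (auto simp: mach_def divide_le_eq_1 dest: order_trans[OF norm_ge_zero])
qed (simp add: mach_def sound_speed_def)

text \<open>Removes the quotient of pressure by density. The right side is continuous in the state,
  including vacuum, where density and pressure vanish together.\<close>

lemma energy_flux_eq: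
  assumes "rho \<noteq> 0 \<or> P = 0" "\<gamma> > 1"
  shows "energy_flux \<gamma> rho u P = (rho * (norm u)\<^sup>2 / 2 + \<gamma> / (\<gamma> - 1) * P) *\<^sub>R u"
proof -
  have "rho * energy \<gamma> rho u P + P = rho * (norm u)\<^sup>2 / 2 + \<gamma> / (\<gamma> - 1) * P"
  proof (cases "rho = 0")
    case True
    then show ?thesis using assms by simp
  next
    case False
    then have "rho * energy \<gamma> rho u P = rho * (norm u)\<^sup>2 / 2 + P / (\<gamma> - 1)"
      using assms(2) by (simp add: energy_def distrib_left)
    moreover have "P / (\<gamma> - 1) + P = \<gamma> / (\<gamma> - 1) * P" using assms(2) by (simp add: field_simps)
    ultimately show ?thesis by simp
  qed
  then show ?thesis by (simp add: energy_flux_def scaleR_add_left[symmetric])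
qed

lemma flux_bounds:
  assumes u: "norm u \<le> U" and rho: "0 < rho" "rho \<le> R" and P: "0 \<le> P" "P \<le> Pm" and \<gamma>: "\<gamma> > 1"
  shows "norm (mass_flux rho u) \<le> R * U"
    and "norm (mom_flux j rho u P) \<le> R * U * U + Pm"
    and "norm (energy_flux \<gamma> rho u P) \<le> (R * U\<^sup>2 / 2 + \<gamma> / (\<gamma> - 1) * Pm) * U"
proof -
  have U: "0 \<le> U" using u norm_ge_zero order_trans by blast
  show "norm (mass_flux rho u) \<le> R * U"
    using u rho U by (auto simp: mass_flux_def intro!: mult_mono)
  have "norm ((rho * u $ j) *\<^sub>R u) \<le> R * U * U"
    using u rho U order_trans[OF component_le_norm_cart[of u j] u] by (auto simp: abs_mult intro!: mult_mono)
  then show "norm (mom_flux j rho u P) \<le> R * U * U + Pm"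
    unfolding mom_flux_def using P by (intro norm_triangle_le add_mono) auto
  have "rho * (norm u)\<^sup>2 \<le> R * U\<^sup>2" using u rho by (intro mult_mono power_mono) auto
  moreover have "\<gamma> / (\<gamma> - 1) * P \<le> \<gamma> / (\<gamma> - 1) * Pm" using P \<gamma> by (intro mult_left_mono) auto
  moreover have "\<gamma> / (\<gamma> - 1) * P \<ge> 0" "rho * (norm u)\<^sup>2 \<ge> 0" using P \<gamma> rho by auto
  ultimately have "\<bar>rho * (norm u)\<^sup>2 / 2 + \<gamma> / (\<gamma> - 1) * P\<bar> \<le> R * U\<^sup>2 / 2 + \<gamma> / (\<gamma> - 1) * Pm" by linarith
  then show "norm (energy_flux \<gamma> rho u P) \<le> (R * U\<^sup>2 / 2 + \<gamma> / (\<gamma> - 1) * Pm) * U"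
    unfolding energy_flux_eq[OF disjI1[OF less_imp_neq[OF rho(1), symmetric]] \<gamma>] norm_scaleR
    using u by (intro mult_mono) auto
qed

theorem theorem2p3:
  fixes \<gamma> s :: real and \<Omega> :: "(real^'n::finite) set"
    and rho P :: "nat \<Rightarrow> real^'n \<Rightarrow> real" and u :: "nat \<Rightarrow> real^'n \<Rightarrow> real^'n"
    and Sbar Bbar :: "real^'n \<Rightarrow> real"
  assumes dim: "CARD('n) \<ge> 2"
    and gam: "\<gamma> > 1"
    and open_\<Omega>: "open \<Omega>"
    and meas: "\<And>k. rho k \<in> borel_measurable (lebesgue_on \<Omega>)"
              "\<And>k. u k \<in> borel_measurable (lebesgue_on \<Omega>)"
              "\<And>k. P k \<in> borel_measurable (lebesgue_on \<Omega>)"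
    and pos: "\<And>k x. x \<in> \<Omega> \<Longrightarrow> rho k x > 0 \<and> P k x > 0"
    and A1: "\<And>k. AE x in lebesgue. x \<in> \<Omega> \<longrightarrow> mach \<gamma> (rho k x) (u k x) (P k x) \<le> 1"
    and A2_bdd: "\<exists>C. \<forall>k. \<forall>x\<in>\<Omega>. \<bar>entropy \<gamma> (rho k x) (P k x)\<bar> \<le> C
                              \<and> \<bar>bernoulli \<gamma> (rho k x) (u k x) (P k x)\<bar> \<le> C"
    and A2_inf: "\<And>K. compact K \<Longrightarrow> K \<subseteq> \<Omega> \<Longrightarrow>
                   \<exists>c>0. \<forall>k. \<forall>x\<in>K. entropy \<gamma> (rho k x) (P k x) \<ge> c"
    and A2_conv: "AE x in lebesgue. x \<in> \<Omega> \<longrightarrow>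
                    (\<lambda>k. entropy \<gamma> (rho k x) (P k x)) \<longlonglongrightarrow> Sbar x \<and>
                    (\<lambda>k. bernoulli \<gamma> (rho k x) (u k x) (P k x)) \<longlonglongrightarrow> Bbar x"
    and s: "1 < s" "s \<le> 2"
    and A3_curl: "\<And>i j. Wneg_loc_precompact s \<Omega> (\<lambda>k. curl_distr (u k) i j)"
    and A3_e1: "Wneg_loc_precompact s \<Omega> (\<lambda>k. div_distr (\<lambda>x. mass_flux (rho k x) (u k x)))"
    and e1: "\<And>\<phi>. test_fun \<Omega> \<phi> \<Longrightarrow>
               (\<lambda>k. div_distr (\<lambda>x. mass_flux (rho k x) (u k x)) \<phi>) \<longlonglongrightarrow> 0"
    and e2: "\<And>\<phi> j. test_fun \<Omega> \<phi> \<Longrightarrow>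
               (\<lambda>k. div_distr (\<lambda>x. mom_flux j (rho k x) (u k x) (P k x)) \<phi>) \<longlonglongrightarrow> 0"
    and e3: "\<And>\<phi>. test_fun \<Omega> \<phi> \<Longrightarrow>
               (\<lambda>k. div_distr (\<lambda>x. energy_flux \<gamma> (rho k x) (u k x) (P k x)) \<phi>) \<longlonglongrightarrow> 0"
  shows "\<exists>(r::nat\<Rightarrow>nat) rho0 u0 P0. strict_mono r \<and>
           (AE x in lebesgue. x \<in> \<Omega> \<longrightarrow>
              (\<lambda>k. rho (r k) x) \<longlonglongrightarrow> rho0 x \<and>
              (\<lambda>k. u (r k) x) \<longlonglongrightarrow> u0 x \<and>
              (\<lambda>k. P (r k) x) \<longlonglongrightarrow> P0 x) \<and>
           weak_full_euler \<gamma> \<Omega> rho0 u0 P0 \<and>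
           (AE x in lebesgue. x \<in> \<Omega> \<longrightarrow> mach \<gamma> (rho0 x) (u0 x) (P0 x) \<le> 1)"
proof -
  define B where "B = (\<lambda>k x. bernoulli \<gamma> (rho k x) (u k x) (P k x))"
  define Sg where "Sg = (\<lambda>k x. entropy \<gamma> (rho k x) (P k x))"
  define w where "w = (\<lambda>k x. mass_flux (rho k x) (u k x))"
  define M where "M = lebesgue_on \<Omega>"
  have \<Omega>M: "\<Omega> \<inter> space lebesgue \<in> sets (lebesgue :: (real^'n) measure)" using open_\<Omega> by auto
  have AE_M: "(AE x in M. R x) \<longleftrightarrow> (AE x in lebesgue. x \<in> \<Omega> \<longrightarrow> R x)" for R
    unfolding M_def by (rule AE_restrict_space_iff[OF \<Omega>M])
  have spM: "space M = \<Omega>" by (simp add: M_def space_restrict_space)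
  note um[measurable] = meas(1)[folded M_def] meas(2)[folded M_def] meas(3)[folded M_def]
  have wm[measurable]: "w k \<in> borel_measurable M" for k unfolding w_def mass_flux_def by measurable
  obtain C where C: "\<And>k x. x \<in> \<Omega> \<Longrightarrow> \<bar>B k x\<bar> \<le> C" using A2_bdd unfolding B_def by blast
  have st: "B k x - (norm (u k x))\<^sup>2 / 2 > 0" "Sg k x > 0" "rho k x = dens \<gamma> (B k x) (Sg k x) (u k x)"
    "P k x = (\<gamma> - 1) / \<gamma> * (B k x - (norm (u k x))\<^sup>2 / 2) * rho k x"
    "mach \<gamma> (rho k x) (u k x) (P k x) \<le> 1 \<Longrightarrow> subsonic \<gamma> (B k x) (u k x)" if "x \<in> \<Omega>" for k x
    using state_relations(1,2,4-6)[OF gam, of "rho k x" "P k x" "u k x"] state_relations(3)[OF gam, of "rho k x" "P k x"] pos[OF that, of k] by (simp_all add: B_def Sg_def)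
  \<comment> \<open>Positive enthalpy means that half the squared speed lies below the Bernoulli
    function, hence below \<open>C\<close>.\<close>
  define U where "U = sqrt (2 * \<bar>C\<bar>)"
  have U: "norm (u k x) \<le> U" if "x \<in> \<Omega>" for k x
    unfolding U_def using st(1)[OF that, of k] C[OF that, of k] by (intro real_le_rsqrt) linarith
  have U0: "U \<ge> 0" by (simp add: U_def)
  \<comment> \<open>The density to the power \<gamma> - 1 is enthalpy over entropy, so its upper
    bound rests on the lower bound of the entropy and is only local. The pressure is at most
    enthalpy times density.\<close>
  have bdK: "\<exists>R\<ge>0. \<forall>k. \<forall>x\<in>K. rho k x \<le> R \<and> P k x \<le> C * R" if K: "compact K" "K \<subseteq> \<Omega>" for K
  proof -
    obtain c where c: "c > 0" "\<And>k x. x \<in> K \<Longrightarrow> Sg k x \<ge> c" using A2_inf[OF K] unfolding Sg_def by blast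
    have "rho k x \<le> (C / c) powr (1 / (\<gamma> - 1)) \<and> P k x \<le> C * (C / c) powr (1 / (\<gamma> - 1))" if "x \<in> K" for k x
    proof -
      have x: "x \<in> \<Omega>" using that K(2) by blast
      have h: "0 < B k x - (norm (u k x))\<^sup>2 / 2" "B k x - (norm (u k x))\<^sup>2 / 2 \<le> C"
        using st(1)[OF x, of k] C[OF x, of k] zero_le_power2[of "norm (u k x)"] by linarith+
      then have "(B k x - (norm (u k x))\<^sup>2 / 2) / Sg k x \<le> C / c"
        using c(1) c(2)[OF that] by (intro frac_le) auto
      then have r: "rho k x \<le> (C / c) powr (1 / (\<gamma> - 1))"
        unfolding st(3)[OF x] dens_def using gam h(1) st(2)[OF x, of k] by (intro powr_mono2) auto
      have "(\<gamma> - 1) / \<gamma> * (B k x - (norm (u k x))\<^sup>2 / 2) \<le> 1 * C"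
        using gam h by (intro mult_mono) auto
      then have "P k x \<le> C * (C / c) powr (1 / (\<gamma> - 1))"
        unfolding st(4)[OF x] using r h pos[OF x, of k] by (intro mult_mono) auto
      with r show ?thesis ..
    qed
    then show ?thesis by (intro exI[of _ "(C / c) powr (1 / (\<gamma> - 1))"]) auto
  qed
  have bdd: "\<exists>A. \<forall>k. \<forall>x\<in>K. norm (u k x) \<le> A \<and> norm (w k x) \<le> A" if K: "compact K" "K \<subseteq> \<Omega>" for K
  proof -
    obtain R where R: "R \<ge> 0" "\<And>k x. x \<in> K \<Longrightarrow> rho k x \<le> R" using bdK[OF K] by blast
    have "norm (u k x) \<le> U + R * U \<and> norm (w k x) \<le> U + R * U" if "x \<in> K" for k x
    proof -
      have x: "x \<in> \<Omega>" using that K(2) by blast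
      have "norm (w k x) \<le> R * U"
        unfolding w_def by (rule flux_bounds(1)[OF U[OF x] _ R(2)[OF that] order_refl order_refl gam]) (use pos[OF x] in auto)
      moreover have "R * U \<ge> 0" using R(1) U0 by simp
      ultimately show ?thesis using U[OF x, of k] U0 by linarith
    qed
    then show ?thesis by blast
  qed
  obtain \<phi> :: "nat \<Rightarrow> real^'n \<Rightarrow> real" where \<phi>: "\<And>j. test_fun \<Omega> (\<phi> j)" "\<And>j x. \<phi> j x \<ge> 0" "\<And>x. x \<in> \<Omega> \<Longrightarrow> \<exists>j. \<phi> j x > 0"
    using exhausting_test_functions[OF open_\<Omega>] by metis
  have supp: "\<exists>S. compact S \<and> S \<subseteq> \<Omega> \<and> (\<forall>x. x \<notin> S \<longrightarrow> \<phi> j x = 0) \<and> integrable lebesgue (\<phi> j)" for j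
  proof -
    obtain S where S: "smooth (\<phi> j)" "compact S" "S \<subseteq> \<Omega>" "\<And>x. x \<notin> S \<Longrightarrow> \<phi> j x = 0" using test_funE[OF \<phi>(1)] by metis
    obtain b where b: "b > 0" "\<And>x. norm (\<phi> j x) \<le> b"
      using bounded_of_compact_support[OF smooth_continuous[OF S(1)] S(2,4)] by metis
    have m: "\<phi> j \<in> borel_measurable borel" by (rule borel_measurable_continuous_onI[OF smooth_continuous[OF S(1)]])
    have "integrable lborel (\<phi> j)" by (rule integrable_compact_support[OF m S(2,4) b(2)])
    then have "integrable lebesgue (\<phi> j)" using m by (simp add: integrable_completion)
    with S show ?thesis by blast
  qed
  have \<phi>0: "\<phi> j x = 0" if "x \<notin> \<Omega>" for j x using supp[of j] that by blast
  \<comment> \<open>The weights vanish off \<Omega>, so integrals over \<open>M\<close> and over the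
    whole space agree.\<close>
  have intM: "(\<integral>x. \<phi> j x * g x \<partial>M) = (\<integral>x. \<phi> j x * g x \<partial>lebesgue)" for j and g :: "real^'n \<Rightarrow> real"
    unfolding M_def integral_restrict_space[OF \<Omega>M]
    by (rule Bochner_Integration.integral_cong[OF refl]) (use \<phi>0 in \<open>auto simp: indicator_def\<close>)
  have \<phi>i: "integrable M (\<phi> j)" for j
  proof -
    have "(\<lambda>x. indicator \<Omega> x *\<^sub>R \<phi> j x) = \<phi> j" using \<phi>0 by (intro ext) (auto simp: indicator_def)
    then show ?thesis unfolding M_def integrable_restrict_space[OF \<Omega>M] using supp[of j] by metis
  qed
  have \<phi>m[measurable]: "\<phi> j \<in> borel_measurable M" for j using \<phi>i[of j] by auto
  have A: "\<exists>A\<ge>0. \<forall>k x. \<phi> j x \<noteq> 0 \<longrightarrow> norm (u k x) \<le> A \<and> norm (w k x) \<le> A" for j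
  proof -
    obtain S where S: "compact S" "S \<subseteq> \<Omega>" "\<And>x. x \<notin> S \<Longrightarrow> \<phi> j x = 0" using supp[of j] by blast
    obtain A where "\<forall>k. \<forall>x\<in>S. norm (u k x) \<le> A \<and> norm (w k x) \<le> A" using bdd[OF S(1,2)] by blast
    then have "\<forall>k x. \<phi> j x \<noteq> 0 \<longrightarrow> norm (u k x) \<le> \<bar>A\<bar> \<and> norm (w k x) \<le> \<bar>A\<bar>"
      using S(3) by (meson abs_ge_self order_trans)
    then show ?thesis by (intro exI[of _ "\<bar>A\<bar>"]) simp
  qed
  have good: "AE x in M. (\<forall>k. subsonic \<gamma> (B k x) (u k x)) \<and> (\<lambda>k. B k x) \<longlonglongrightarrow> Bbar x \<and> (\<lambda>k. Sg k x) \<longlonglongrightarrow> Sbar x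
      \<and> Sbar x > 0 \<and> (\<forall>k. Sg k x > 0)"
  proof -
    have "AE x in lebesgue. \<forall>k. x \<in> \<Omega> \<longrightarrow> mach \<gamma> (rho k x) (u k x) (P k x) \<le> 1"
      unfolding AE_all_countable using A1 by blast
    then show ?thesis
      unfolding AE_M using A2_conv
    proof eventually_elim
      case (elim x)
      show ?case
      proof (intro impI)
        assume x: "x \<in> \<Omega>"
        have L: "(\<lambda>k. Sg k x) \<longlonglongrightarrow> Sbar x" "(\<lambda>k. B k x) \<longlonglongrightarrow> Bbar x" using elim(2) x by (simp_all add: Sg_def B_def)
        \<comment> \<open>The uniform lower bound, taken on the compact set \<open>{x}\<close>,
          keeps the limit of the entropy positive.\<close>
        obtain c where c: "c > 0" "\<And>k. Sg k x \<ge> c" using A2_inf[of "{x}"] x by (auto simp: Sg_def)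
        have "c \<le> Sbar x" by (rule LIMSEQ_le_const[OF L(1)]) (use c(2) in blast)
        then show "(\<forall>k. subsonic \<gamma> (B k x) (u k x)) \<and> (\<lambda>k. B k x) \<longlonglongrightarrow> Bbar x \<and> (\<lambda>k. Sg k x) \<longlonglongrightarrow> Sbar x
            \<and> Sbar x > 0 \<and> (\<forall>k. Sg k x > 0)"
          using L c(1) st(2)[OF x] st(5)[OF x] elim(1) x by auto
      qed
    qed
  qed
  have wp: "Wneg_loc_precompact s \<Omega> (\<lambda>k. div_distr (w k))" using A3_e1 by (simp add: w_def)
  have "\<exists>r::nat\<Rightarrow>nat. strict_mono r \<and> (\<forall>j. \<forall>\<epsilon>>0. \<exists>N. \<forall>m\<ge>N. \<forall>k\<ge>N.
      \<bar>\<integral>x. \<phi> j x * ((u (r m) x - u (r k) x) \<bullet> (w (r m) x - w (r k) x)) \<partial>lebesgue\<bar> < \<epsilon>)"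
    by (rule div_curl_Cauchy[OF open_\<Omega> \<phi>(1) meas(2) wm[unfolded M_def] bdd s(1) A3_curl wp])
  then obtain r :: "nat \<Rightarrow> nat" where r: "strict_mono r" and dc: "\<forall>j. \<forall>\<epsilon>>0. \<exists>N. \<forall>m\<ge>N. \<forall>k\<ge>N.
      \<bar>\<integral>x. \<phi> j x * ((u (r m) x - u (r k) x) \<bullet> (w (r m) x - w (r k) x)) \<partial>M\<bar> < \<epsilon>"
    unfolding intM by blast
  have Cau: "\<exists>N. \<forall>m\<ge>N. \<forall>k\<ge>N. (\<integral>x. \<phi> j x * norm (u (r m) x - u (r k) x) \<partial>M) < \<epsilon>" if "\<epsilon> > 0" for j \<epsilon>
  proof -
    obtain A where A: "A \<ge> 0" "\<And>k x. \<phi> j x \<noteq> 0 \<Longrightarrow> norm (u k x) \<le> A \<and> norm (w k x) \<le> A" using A[of j] by blast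
    show ?thesis
    proof (rule velocity_L1_Cauchy[where w = "\<lambda>k. w (r k)" and B = "\<lambda>k. B (r k)" and Sg = "\<lambda>k. Sg (r k)", OF gam um(2) wm \<phi>i \<phi>(2) _ _ _ A(1) _ that])
      show "w (r k) x = dens \<gamma> (B (r k) x) (Sg (r k) x) (u (r k) x) *\<^sub>R u (r k) x" if "x \<in> space M" for k x
        using st(3)[of x "r k"] that by (simp add: w_def mass_flux_def spM)
      show "AE x in M. (\<forall>k. subsonic \<gamma> (B (r k) x) (u (r k) x)) \<and> (\<lambda>k. B (r k) x) \<longlonglongrightarrow> Bbar x \<and> (\<lambda>k. Sg (r k) x) \<longlonglongrightarrow> Sbar x
          \<and> Sbar x > 0 \<and> (\<forall>k. Sg (r k) x > 0)"
        using good
      proof eventually_elim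
        case (elim x)
        then show ?case
          using LIMSEQ_subseq_LIMSEQ[of "\<lambda>k. B k x" "Bbar x" r] LIMSEQ_subseq_LIMSEQ[of "\<lambda>k. Sg k x" "Sbar x" r] r by (simp add: o_def)
      qed
      show "norm (u (r k) x) \<le> A \<and> norm (w (r k) x) \<le> A" if "\<phi> j x \<noteq> 0" for k x using A(2)[OF that] .
      show "\<exists>N. \<forall>m\<ge>N. \<forall>k\<ge>N. \<bar>\<integral>x. \<phi> j x * ((u (r m) x - u (r k) x) \<bullet> (w (r m) x - w (r k) x)) \<partial>M\<bar> < \<epsilon>'" if "\<epsilon>' > 0" for \<epsilon>'
        using dc that by blast
    qed
  qed
  have int: "integrable M (\<lambda>x. \<phi> j x * norm (u (r m) x - u (r k) x))" for j m k
  proof -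
    obtain A where A: "A \<ge> 0" "\<And>k x. \<phi> j x \<noteq> 0 \<Longrightarrow> norm (u k x) \<le> A \<and> norm (w k x) \<le> A" using A[of j] by blast
    have dom: "integrable M (\<lambda>x. \<phi> j x * (2 * A))" using \<phi>i[of j] by simp
    show ?thesis
    proof (rule Bochner_Integration.integrable_bound[OF dom])
      show "AE x in M. norm (\<phi> j x * norm (u (r m) x - u (r k) x)) \<le> norm (\<phi> j x * (2 * A))"
      proof (rule AE_I2)
        fix x
        show "norm (\<phi> j x * norm (u (r m) x - u (r k) x)) \<le> norm (\<phi> j x * (2 * A))"
        proof (cases "\<phi> j x = 0")
          case False
          have "norm (u (r m) x - u (r k) x) \<le> 2 * A"
            using A(2)[OF False, of "r m"] A(2)[OF False, of "r k"] norm_triangle_ineq4[of "u (r m) x" "u (r k) x"] by linarith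
          then show ?thesis using \<phi>(2)[of j x] A(1) by (simp add: abs_mult mult_left_mono)
        qed simp
      qed
    qed measurable
  qed
  have "\<exists>r1::nat\<Rightarrow>nat. strict_mono r1 \<and> (\<forall>j. AE x in M. \<phi> j x > 0 \<longrightarrow> convergent (\<lambda>k. u (r (r1 k)) x))"
    by (rule Cauchy_L1_imp_AE_convergent_subseq[of "\<lambda>k. u (r k)" M \<phi>, OF um(2) \<phi>m \<phi>(2) int Cau])
  then obtain r1 :: "nat \<Rightarrow> nat" where r1: "strict_mono r1" "\<forall>j. AE x in M. \<phi> j x > 0 \<longrightarrow> convergent (\<lambda>k. u (r (r1 k)) x)" by blast
  define q where "q = (\<lambda>k. r (r1 k))"
  have q: "strict_mono q" unfolding q_def using strict_mono_o[OF r r1(1)] by (simp add: o_def)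
  \<comment> \<open>Defining the limits by \<open>lim\<close> makes them measurable on all of
    \<Omega>, whatever value \<open>lim\<close> takes where the sequence does not converge.\<close>
  define u0 where "u0 = (\<lambda>x. lim (\<lambda>k. u (q k) x))"
  define rho0 where "rho0 = (\<lambda>x. lim (\<lambda>k. rho (q k) x))"
  define P0 where "P0 = (\<lambda>x. lim (\<lambda>k. P (q k) x))"
  have m0[measurable]: "u0 \<in> borel_measurable M" "rho0 \<in> borel_measurable M" "P0 \<in> borel_measurable M"
    unfolding u0_def rho0_def P0_def by measurable
  have "AE x in M. \<forall>j. \<phi> j x > 0 \<longrightarrow> convergent (\<lambda>k. u (q k) x)" unfolding AE_all_countable q_def using r1(2) by blast
  then have main: "AE x in lebesgue. x \<in> \<Omega> \<longrightarrow> (\<lambda>k. rho (q k) x) \<longlonglongrightarrow> rho0 x \<and> (\<lambda>k. u (q k) x) \<longlonglongrightarrow> u0 x \<and> (\<lambda>k. P (q k) x) \<longlonglongrightarrow> P0 x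
      \<and> subsonic \<gamma> (Bbar x) (u0 x) \<and> P0 x = (\<gamma> - 1) / \<gamma> * (Bbar x - (norm (u0 x))\<^sup>2 / 2) * rho0 x"
    using good unfolding AE_M
  proof eventually_elim
    case (elim x)
    show ?case
    proof
      assume x: "x \<in> \<Omega>"
      have "convergent (\<lambda>k. u (q k) x)" using elim(1) \<phi>(3)[OF x] x by blast
      then have Lu: "(\<lambda>k. u (q k) x) \<longlonglongrightarrow> u0 x" by (simp add: u0_def convergent_LIMSEQ_iff)
      have g: "\<And>k. subsonic \<gamma> (B k x) (u k x)" "(\<lambda>k. B k x) \<longlonglongrightarrow> Bbar x" "(\<lambda>k. Sg k x) \<longlonglongrightarrow> Sbar x" "Sbar x > 0"
        using elim(2) x by blast+
      have LB: "(\<lambda>k. B (q k) x) \<longlonglongrightarrow> Bbar x" and LS: "(\<lambda>k. Sg (q k) x) \<longlonglongrightarrow> Sbar x"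
        using LIMSEQ_subseq_LIMSEQ[OF g(2) q] LIMSEQ_subseq_LIMSEQ[OF g(3) q] by (simp_all add: o_def)
      have "(\<lambda>k. dens \<gamma> (B (q k) x) (Sg (q k) x) (u (q k) x)) \<longlonglongrightarrow> dens \<gamma> (Bbar x) (Sbar x) (u0 x)"
        by (rule tendsto_dens[OF gam LB LS Lu g(4) st(2)[OF x] less_imp_le[OF st(1)[OF x]]])
      then have "convergent (\<lambda>k. rho (q k) x)" by (simp add: st(3)[OF x, symmetric] convergentI)
      then have Lr: "(\<lambda>k. rho (q k) x) \<longlonglongrightarrow> rho0 x" by (simp add: rho0_def convergent_LIMSEQ_iff)
      have LP: "(\<lambda>k. P (q k) x) \<longlonglongrightarrow> (\<gamma> - 1) / \<gamma> * (Bbar x - (norm (u0 x))\<^sup>2 / 2) * rho0 x"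
        unfolding st(4)[OF x] by (intro tendsto_intros LB Lu Lr) auto
      then have P0: "P0 x = (\<gamma> - 1) / \<gamma> * (Bbar x - (norm (u0 x))\<^sup>2 / 2) * rho0 x" unfolding P0_def by (rule limI)
      have sub: "subsonic \<gamma> (Bbar x) (u0 x)" by (rule subsonic_limit[OF LB Lu g(1)])
      show "(\<lambda>k. rho (q k) x) \<longlonglongrightarrow> rho0 x \<and> (\<lambda>k. u (q k) x) \<longlonglongrightarrow> u0 x \<and> (\<lambda>k. P (q k) x) \<longlonglongrightarrow> P0 x
          \<and> subsonic \<gamma> (Bbar x) (u0 x) \<and> P0 x = (\<gamma> - 1) / \<gamma> * (Bbar x - (norm (u0 x))\<^sup>2 / 2) * rho0 x"
        using Lr Lu LP P0 sub by simp
    qed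
  qed
  have flux: "\<exists>A. \<forall>k. \<forall>x\<in>K. norm (mass_flux (rho (q k) x) (u (q k) x)) \<le> A \<and> norm (mom_flux j (rho (q k) x) (u (q k) x) (P (q k) x)) \<le> A
      \<and> norm (energy_flux \<gamma> (rho (q k) x) (u (q k) x) (P (q k) x)) \<le> A" if K: "compact K" "K \<subseteq> \<Omega>" for K j
  proof -
    obtain R where R: "R \<ge> 0" "\<And>k x. x \<in> K \<Longrightarrow> rho k x \<le> R \<and> P k x \<le> C * R" using bdK[OF K] by blast
    define A1 where "A1 = R * U"
    define A2 where "A2 = R * U * U + C * R"
    define A3 where "A3 = (R * U\<^sup>2 / 2 + \<gamma> / (\<gamma> - 1) * (C * R)) * U"
    have "norm (mass_flux (rho k x) (u k x)) \<le> A1 \<and> norm (mom_flux j (rho k x) (u k x) (P k x)) \<le> A2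
        \<and> norm (energy_flux \<gamma> (rho k x) (u k x) (P k x)) \<le> A3" if "x \<in> K" for k x
    proof -
      have x: "x \<in> \<Omega>" using that K(2) by blast
      have p: "0 < rho k x" "0 \<le> P k x" "rho k x \<le> R" "P k x \<le> C * R" using pos[OF x, of k] R(2)[OF that, of k] by auto
      show ?thesis
        unfolding A1_def A2_def A3_def using flux_bounds[OF U[OF x] p(1,3,2,4) gam] by blast
    qed
    then show ?thesis by (intro exI[of _ "max A1 (max A2 A3)"]) (simp add: le_max_iff_disj)
  qed
  have "weak_div_free \<Omega> (\<lambda>x. mass_flux (rho0 x) (u0 x))"
  proof (rule weak_div_free_limit[OF open_\<Omega>, where F = "\<lambda>k x. mass_flux (rho (q k) x) (u (q k) x)", folded M_def])
    show "(\<lambda>x. mass_flux (rho (q k) x) (u (q k) x)) \<in> borel_measurable M" for k unfolding mass_flux_def by measurable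
    show "(\<lambda>x. mass_flux (rho0 x) (u0 x)) \<in> borel_measurable M" unfolding mass_flux_def by measurable
    show "\<exists>A. \<forall>k. \<forall>x\<in>K. norm (mass_flux (rho (q k) x) (u (q k) x)) \<le> A" if "compact K" "K \<subseteq> \<Omega>" for K
      using flux[OF that] by blast
    show "AE x in lebesgue. x \<in> \<Omega> \<longrightarrow> (\<lambda>k. mass_flux (rho (q k) x) (u (q k) x)) \<longlonglongrightarrow> mass_flux (rho0 x) (u0 x)"
      using main by eventually_elim (auto simp: mass_flux_def intro!: tendsto_scaleR)
    show "(\<lambda>k. div_distr (\<lambda>x. mass_flux (rho (q k) x) (u (q k) x)) \<psi>) \<longlonglongrightarrow> 0" if "test_fun \<Omega> \<psi>" for \<psi>
      using LIMSEQ_subseq_LIMSEQ[OF e1[OF that] q] by (simp add: o_def)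
  qed
  moreover have "weak_div_free \<Omega> (\<lambda>x. mom_flux j (rho0 x) (u0 x) (P0 x))" for j
  proof (rule weak_div_free_limit[OF open_\<Omega>, where F = "\<lambda>k x. mom_flux j (rho (q k) x) (u (q k) x) (P (q k) x)", folded M_def])
    show "(\<lambda>x. mom_flux j (rho (q k) x) (u (q k) x) (P (q k) x)) \<in> borel_measurable M" for k unfolding mom_flux_def cart_eq_inner_axis by measurable
    show "(\<lambda>x. mom_flux j (rho0 x) (u0 x) (P0 x)) \<in> borel_measurable M" unfolding mom_flux_def cart_eq_inner_axis by measurable
    show "\<exists>A. \<forall>k. \<forall>x\<in>K. norm (mom_flux j (rho (q k) x) (u (q k) x) (P (q k) x)) \<le> A" if "compact K" "K \<subseteq> \<Omega>" for K
      using flux[OF that, of j] by blast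
    show "AE x in lebesgue. x \<in> \<Omega> \<longrightarrow> (\<lambda>k. mom_flux j (rho (q k) x) (u (q k) x) (P (q k) x)) \<longlonglongrightarrow> mom_flux j (rho0 x) (u0 x) (P0 x)"
      using main by eventually_elim (auto simp: mom_flux_def intro!: tendsto_intros)
    show "(\<lambda>k. div_distr (\<lambda>x. mom_flux j (rho (q k) x) (u (q k) x) (P (q k) x)) \<psi>) \<longlonglongrightarrow> 0" if "test_fun \<Omega> \<psi>" for \<psi>
      using LIMSEQ_subseq_LIMSEQ[OF e2[OF that] q] by (simp add: o_def)
  qed
  moreover have "weak_div_free \<Omega> (\<lambda>x. energy_flux \<gamma> (rho0 x) (u0 x) (P0 x))"
  proof (rule weak_div_free_limit[OF open_\<Omega>, where F = "\<lambda>k x. energy_flux \<gamma> (rho (q k) x) (u (q k) x) (P (q k) x)", folded M_def])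
    show "(\<lambda>x. energy_flux \<gamma> (rho (q k) x) (u (q k) x) (P (q k) x)) \<in> borel_measurable M" for k unfolding energy_flux_def energy_def by measurable
    show "(\<lambda>x. energy_flux \<gamma> (rho0 x) (u0 x) (P0 x)) \<in> borel_measurable M" unfolding energy_flux_def energy_def by measurable
    show "\<exists>A. \<forall>k. \<forall>x\<in>K. norm (energy_flux \<gamma> (rho (q k) x) (u (q k) x) (P (q k) x)) \<le> A" if "compact K" "K \<subseteq> \<Omega>" for K
      using flux[OF that] by blast
    show "AE x in lebesgue. x \<in> \<Omega> \<longrightarrow> (\<lambda>k. energy_flux \<gamma> (rho (q k) x) (u (q k) x) (P (q k) x)) \<longlonglongrightarrow> energy_flux \<gamma> (rho0 x) (u0 x) (P0 x)"
      using main
    proof eventually_elim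
      case (elim x)
      show ?case
      proof
        assume x: "x \<in> \<Omega>"
        have "rho (q k) x \<noteq> 0" for k using pos[OF x, of "q k"] by simp
        then have eq: "energy_flux \<gamma> (rho (q k) x) (u (q k) x) (P (q k) x) = (rho (q k) x * (norm (u (q k) x))\<^sup>2 / 2 + \<gamma> / (\<gamma> - 1) * P (q k) x) *\<^sub>R u (q k) x" for k
          using gam by (intro energy_flux_eq) auto
        \<comment> \<open>Where \<open>rho0\<close> vanishes so does \<open>P0\<close>, being a
          multiple of it; this covers vacuum points of the limit.\<close>
        have eq0: "energy_flux \<gamma> (rho0 x) (u0 x) (P0 x) = (rho0 x * (norm (u0 x))\<^sup>2 / 2 + \<gamma> / (\<gamma> - 1) * P0 x) *\<^sub>R u0 x"
          using elim x gam by (intro energy_flux_eq) auto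
        show "(\<lambda>k. energy_flux \<gamma> (rho (q k) x) (u (q k) x) (P (q k) x)) \<longlonglongrightarrow> energy_flux \<gamma> (rho0 x) (u0 x) (P0 x)"
          unfolding eq eq0 using elim x by (intro tendsto_intros) auto
      qed
    qed
    show "(\<lambda>k. div_distr (\<lambda>x. energy_flux \<gamma> (rho (q k) x) (u (q k) x) (P (q k) x)) \<psi>) \<longlonglongrightarrow> 0" if "test_fun \<Omega> \<psi>" for \<psi>
      using LIMSEQ_subseq_LIMSEQ[OF e3[OF that] q] by (simp add: o_def)
  qed
  ultimately have "weak_full_euler \<gamma> \<Omega> rho0 u0 P0" by (simp add: weak_full_euler_def)
  moreover have "AE x in lebesgue. x \<in> \<Omega> \<longrightarrow> mach \<gamma> (rho0 x) (u0 x) (P0 x) \<le> 1"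
    using main by eventually_elim (use mach_le_1[OF gam] in blast)
  moreover have "AE x in lebesgue. x \<in> \<Omega> \<longrightarrow> (\<lambda>k. rho (q k) x) \<longlonglongrightarrow> rho0 x \<and> (\<lambda>k. u (q k) x) \<longlonglongrightarrow> u0 x \<and> (\<lambda>k. P (q k) x) \<longlonglongrightarrow> P0 x"
    using main by eventually_elim blast
  ultimately show ?thesis using q by blast
qed

end
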